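(* Let $K$ be a local field of residue characteristic $2$, let $L/K$ be a separable ramified quadratic extension with parameter $i_0$, let $t$ be a uniformiser of $L$ and let $\beta=t\bar t$. Let $\underline{\mathrm{SU}}_3^{L/K}$ be the schematic adherence of $\varphi_{i_0}(\mathrm{SU}_3^{L/K})$ in $\mathcal{R}^{\mathcal{O}_L}_{\mathcal{O}_K}\mathrm{SL}_3$. Then for any $\mathcal{O}_K$-algebra $R$, $$\underline{\mathrm{SU}}_3^{L/K}(R) = \Big\{ g\in \mathcal{R}^{\mathcal{O}_L}_{\mathcal{O}_K}\mathrm{SL}_3(R)\ \Big|\ {}^S\bar{g}\begin{pmatrix} 1 & 0 & 0 \\ 0 & \beta^{i_0} & 0 \\ 0 & 0 & 1 \end{pmatrix}g=\begin{pmatrix} 1 & 0 & 0 \\ 0 & \beta^{i_0} & 0 \\ 0 & 0 & 1 \end{pmatrix},\ \tfrac{Tr}{\beta^{i_0}}(\bar{g}_{31}g_{11}) = -N(g_{21}),\ \tfrac{Tr}{\beta^{i_0}}(\bar{g}_{33}g_{13}) = -N(g_{23})\Big\}.$$ Furthermore, $\underline{\mathrm{SU}}_3^{L/K}$ is smooth over $\mathcal{O}_K$.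
   Context: $K$ is a non-archimedean local field of residue characteristic $2$ with valuation $\omega$ (extended to $L$), $L/K$ a separable quadratic ramified extension, $x\mapsto\bar x$ its non-trivial Galois automorphism, $\mathcal{O}_K,\mathcal{O}_L$ the rings of integers, $\pi_K$ a uniformiser of $K$. $\mathrm{SU}_3^{L/K}$ is the algebraic group over $K$ with $\mathrm{SU}_3^{L/K}(R)=\{g\in\mathrm{SL}_3(R\otimes_KL)\mid{}^S\bar gg=\mathrm{Id}\}$, where ${}^Sg$ is the transpose along the anti-diagonal: $({}^Sg)_{ij}=g_{4-j,4-i}$. Parameter $i_0$. There are $t_0\in L$, $\alpha,\beta_0\in K$ with $L=K[t_0]$, $t_0^2-\alpha t_0+\beta_0=0$, $\beta_0$ a uniformiser of $K$, and either $\alpha=0$ or $0<\omega(\beta_0)\le\omega(\alpha)\le\omega(2)$. The integer $i_0$ is determined by $\omega(\pi_K^{i_0})=\omega(2)$ if $\alpha=0$, and $\omega(\pi_K^{i_0})=\omega(\alpha)$ if $\alpha\ne0$; it depends only on $L/K$. One has $x+\bar x\in\pi_K^{i_0}\mathcal{O}_K$ for all $x\in\mathcal{O}_L$. $\mathcal{R}^{\mathcal{O}_L}_{\mathcal{O}_K}\mathrm{SL}_3$ is the Weil restriction, so $\mathcal{R}^{\mathcal{O}_L}_{\mathcal{O}_K}\mathrm{SL}_3(R)=\mathrm{SL}_3(R\otimes_{\mathcal{O}_K}\mathcal{O}_L)$; conjugation acts on $R\otimes_{\mathcal{O}_K}\mathcal{O}_L$ through the second factor. $\frac{Tr}{\beta^{i_0}}\colon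 R\otimes_{\mathcal{O}_K}\mathcal{O}_L\to R$ is the $R$-linear extension of $\mathcal{O}_L\to\mathcal{O}_K$, $x\mapsto\frac{x+\bar x}{\beta^{i_0}}$, and $N\colon R\otimes_{\mathcal{O}_K}\mathcal{O}_L\to R$, $N(x)=x\bar x$, is the norm. $\varphi_{i_0}\colon\mathrm{SU}_3^{L/K}\to[\mathcal{R}^{\mathcal{O}_L}_{\mathcal{O}_K}\mathrm{SL}_3]_K$ is the homomorphism of $K$-group schemes $g\mapsto\begin{pmatrix} g_{11} & t^{i_0}g_{12} & g_{13} \\ t^{-i_0}g_{21} & g_{22} & t^{-i_0}g_{23} \\ g_{31} & t^{i_0}g_{32} & g_{33} \end{pmatrix}$. For an affine $\mathcal{O}_K$-scheme $Z$ and a closed subscheme $Y$ of $Z_K$ defined by an ideal $I(Y)\subset K[Z]$, the schematic adherence of $Y$ in $Z$ is the closed subscheme of $Z$ defined by the ideal $j^{-1}(I(Y))$, where $j\colon\mathcal{O}_K[Z]\to K[Z]$ is the canonical map. *)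

theory Defs
  imports
    "HOL-Algebra.Embedded_Algebras"
    "HOL-Algebra.QuotRing"
    "HOL-Library.Poly_Mapping"
    "HOL-Library.Numeral_Type"
    "HOL-Library.Extended_Real"
    "HOL-Combinatorics.Permutations"
    "HOL-Computational_Algebra.Polynomial"
begin

section \<open>Algebras over subrings of a commutative ring\<close>

definition ring_of :: "'a::comm_ring_1 set \<Rightarrow> 'a ring" where
  "ring_of S = \<lparr>carrier = S, monoid.mult = (*), one = 1, zero = 0, add = (+)\<rparr>"

text \<open>An algebra over a subring \<open>S\<close> of an ambient ring type is a pair of a commutative ring
  \<open>R\<close> (possibly the zero ring) and a structure homomorphism \<open>s\<close> from \<open>S\<close> to \<open>R\<close>.\<close>

definition algebra_over :: "'a::comm_ring_1 set \<Rightarrow> ('a \<Rightarrow> 'r) \<Rightarrow> 'r ring \<Rightarrow> bool" where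
  "algebra_over S s R \<longleftrightarrow> cring R \<and> s \<in> ring_hom (ring_of S) R"

definition alg_hom ::
  "'a::comm_ring_1 set \<Rightarrow> ('a \<Rightarrow> 'p) \<Rightarrow> 'p ring \<Rightarrow> ('a \<Rightarrow> 'q) \<Rightarrow> 'q ring \<Rightarrow> ('p \<Rightarrow> 'q) set" where
  "alg_hom S a A b B = {h \<in> ring_hom A B. \<forall>c\<in>S. h (a c) = b c}"

definition quot_struct :: "'p ring \<Rightarrow> 'p set \<Rightarrow> ('a \<Rightarrow> 'p) \<Rightarrow> 'a \<Rightarrow> 'p set" where
  "quot_struct A I a c = I +>\<^bsub>A\<^esub> a c"


section \<open>Multivariate polynomials\<close>

type_synonym ('v, 'a) mpoly = "('v \<Rightarrow>\<^sub>0 nat) \<Rightarrow>\<^sub>0 'a"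

definition mpoly_ring :: "'a::comm_ring_1 set \<Rightarrow> 'v set \<Rightarrow> ('v, 'a) mpoly ring" where
  "mpoly_ring S V =
     ring_of {p. (\<forall>m. Poly_Mapping.lookup p m \<in> S) \<and>
       (\<forall>m\<in>Poly_Mapping.keys p. Poly_Mapping.keys m \<subseteq> V)}"

definition mp_var :: "'v \<Rightarrow> ('v, 'a::comm_ring_1) mpoly" where
  "mp_var v = Poly_Mapping.single (Poly_Mapping.single v 1) 1"

definition mp_const :: "'a::comm_ring_1 \<Rightarrow> ('v, 'a) mpoly" where
  "mp_const c = Poly_Mapping.single 0 c"


section \<open>Smooth algebras\<close>

definition finitely_presented :: "'a::comm_ring_1 set \<Rightarrow> ('a \<Rightarrow> 'p) \<Rightarrow> 'p ring \<Rightarrow> bool" where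
  "finitely_presented S a A \<longleftrightarrow>
     (\<exists>(n::nat) h F. h \<in> alg_hom S mp_const (mpoly_ring S {..<n}) a A
        \<and> h ` carrier (mpoly_ring S {..<n}) = carrier A
        \<and> finite F \<and> F \<subseteq> carrier (mpoly_ring S {..<n})
        \<and> a_kernel (mpoly_ring S {..<n}) A h = genideal (mpoly_ring S {..<n}) F)"

text \<open>Infinitesimal lifting property. The test algebras \<open>C\<close> range over all algebras whose
  elements have type \<open>'c\<close>; a result that is polymorphic in \<open>'c\<close> covers all test algebras.\<close>

definition formally_smooth ::
  "'c itself \<Rightarrow> 'a::comm_ring_1 set \<Rightarrow> ('a \<Rightarrow> 'p) \<Rightarrow> 'p ring \<Rightarrow> bool" where
  "formally_smooth (_::'c itself) S a A \<longleftrightarrow>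
     (\<forall>(C::'c ring) c J. algebra_over S c C \<longrightarrow> ideal J C \<longrightarrow>
        (\<forall>x\<in>J. \<forall>y\<in>J. x \<otimes>\<^bsub>C\<^esub> y = \<zero>\<^bsub>C\<^esub>) \<longrightarrow>
        (\<forall>h \<in> alg_hom S a A (quot_struct C J c) (C Quot J).
           \<exists>h' \<in> alg_hom S a A c C. \<forall>x\<in>carrier A. J +>\<^bsub>C\<^esub> h' x = h x))"

definition smooth_algebra ::
  "'c itself \<Rightarrow> 'a::comm_ring_1 set \<Rightarrow> ('a \<Rightarrow> 'p) \<Rightarrow> 'p ring \<Rightarrow> bool" where
  "smooth_algebra X S a A \<longleftrightarrow>
     algebra_over S a A \<and> finitely_presented S a A \<and> formally_smooth X S a A"


section \<open>Tensor products\<close>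

text \<open>\<open>R\<close> is an algebra over \<open>S\<close> with structure map \<open>s\<close>, and \<open>B\<close> is a ring containing \<open>S\<close>.
  Elements of the tensor product of \<open>R\<close> and \<open>B\<close> over \<open>S\<close> are classes of formal finite sums
  of pairs \<open>(r, b)\<close>, encoded as lists, modulo the additive congruence generated by
  commutativity and the bilinear relations. Negatives exist because
  \<open>(r, b) + (- r, b)\<close> is congruent to \<open>(0, b)\<close>, hence to the empty sum.\<close>

inductive_set tensor_rel ::
  "'a::comm_ring_1 set \<Rightarrow> ('a \<Rightarrow> 'r) \<Rightarrow> 'r ring \<Rightarrow> 'a set \<Rightarrow> (('r \<times> 'a) list \<times> ('r \<times> 'a) list) set"
  for S s R B where
  refl: "xs \<in> lists (carrier R \<times> B) \<Longrightarrow> (xs, xs) \<in> tensor_rel S s R B"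
| sym: "(xs, ys) \<in> tensor_rel S s R B \<Longrightarrow> (ys, xs) \<in> tensor_rel S s R B"
| trans: "(xs, ys) \<in> tensor_rel S s R B \<Longrightarrow> (ys, zs) \<in> tensor_rel S s R B \<Longrightarrow>
    (xs, zs) \<in> tensor_rel S s R B"
| append: "(xs, xs') \<in> tensor_rel S s R B \<Longrightarrow> (ys, ys') \<in> tensor_rel S s R B \<Longrightarrow>
    (xs @ ys, xs' @ ys') \<in> tensor_rel S s R B"
| commute: "xs \<in> lists (carrier R \<times> B) \<Longrightarrow> ys \<in> lists (carrier R \<times> B) \<Longrightarrow>
    (xs @ ys, ys @ xs) \<in> tensor_rel S s R B"
| add_left: "r \<in> carrier R \<Longrightarrow> r' \<in> carrier R \<Longrightarrow> b \<in> B \<Longrightarrow>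
    ([(r \<oplus>\<^bsub>R\<^esub> r', b)], [(r, b), (r', b)]) \<in> tensor_rel S s R B"
| add_right: "r \<in> carrier R \<Longrightarrow> b \<in> B \<Longrightarrow> b' \<in> B \<Longrightarrow>
    ([(r, b + b')], [(r, b), (r, b')]) \<in> tensor_rel S s R B"
| zero: "b \<in> B \<Longrightarrow> ([(\<zero>\<^bsub>R\<^esub>, b)], []) \<in> tensor_rel S s R B"
| balanced: "r \<in> carrier R \<Longrightarrow> c \<in> S \<Longrightarrow> b \<in> B \<Longrightarrow>
    ([(r \<otimes>\<^bsub>R\<^esub> s c, b)], [(r, c * b)]) \<in> tensor_rel S s R B"

definition tensor_class ::
  "'a::comm_ring_1 set \<Rightarrow> ('a \<Rightarrow> 'r) \<Rightarrow> 'r ring \<Rightarrow> 'a set \<Rightarrow> ('r \<times> 'a) list \<Rightarrow> ('r \<times> 'a) list set"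
  where "tensor_class S s R B xs = tensor_rel S s R B `` {xs}"

definition tens ::
  "'a::comm_ring_1 set \<Rightarrow> ('a \<Rightarrow> 'r) \<Rightarrow> 'r ring \<Rightarrow> 'a set \<Rightarrow> 'r \<Rightarrow> 'a \<Rightarrow> ('r \<times> 'a) list set"
  where "tens S s R B r b = tensor_class S s R B [(r, b)]"

definition tensor ::
  "'a::comm_ring_1 set \<Rightarrow> ('a \<Rightarrow> 'r) \<Rightarrow> 'r ring \<Rightarrow> 'a set \<Rightarrow> ('r \<times> 'a) list set ring" where
  "tensor S s R B =
     \<lparr>carrier = lists (carrier R \<times> B) // tensor_rel S s R B,
      monoid.mult = (\<lambda>X Y. \<Union>xs\<in>X. \<Union>ys\<in>Y. tensor_class S s R B
                [(fst p \<otimes>\<^bsub>R\<^esub> fst q, snd p * snd q). p \<leftarrow> xs, q \<leftarrow> ys]),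
      one = tens S s R B \<one>\<^bsub>R\<^esub> 1,
      zero = tensor_class S s R B [],
      add = (\<lambda>X Y. \<Union>xs\<in>X. \<Union>ys\<in>Y. tensor_class S s R B (xs @ ys))\<rparr>"

text \<open>The map \<open>id \<otimes> f\<close> for an \<open>S\<close>-linear endomorphism \<open>f\<close> of \<open>B\<close>.\<close>

definition tensor_map ::
  "'a::comm_ring_1 set \<Rightarrow> ('a \<Rightarrow> 'r) \<Rightarrow> 'r ring \<Rightarrow> 'a set \<Rightarrow> ('a \<Rightarrow> 'a)
     \<Rightarrow> ('r \<times> 'a) list set \<Rightarrow> ('r \<times> 'a) list set" where
  "tensor_map S s R B f X = (\<Union>xs\<in>X. tensor_class S s R B (map (apsnd f) xs))"

text \<open>The \<open>R\<close>-linear extension \<open>r \<otimes> b \<mapsto> r f(b)\<close> of an \<open>S\<close>-linear map \<open>f\<close> from \<open>B\<close> to \<open>S\<close>.\<close>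

definition tensor_linear_ext ::
  "('a::comm_ring_1 \<Rightarrow> 'r) \<Rightarrow> 'r ring \<Rightarrow> ('a \<Rightarrow> 'a) \<Rightarrow> ('r \<times> 'a) list set \<Rightarrow> 'r" where
  "tensor_linear_ext s R f X =
     the_elem ((\<lambda>xs. foldr (\<lambda>(r, b) y. r \<otimes>\<^bsub>R\<^esub> s (f b) \<oplus>\<^bsub>R\<^esub> y) xs \<zero>\<^bsub>R\<^esub>) ` X)"

text \<open>The norm \<open>x \<mapsto> x \<cdot> x\<^sup>\<sigma>\<close>, viewed in \<open>R\<close> through \<open>r \<mapsto> r \<otimes> 1\<close>.\<close>

definition tensor_norm ::
  "'a::comm_ring_1 set \<Rightarrow> ('a \<Rightarrow> 'r) \<Rightarrow> 'r ring \<Rightarrow> 'a set \<Rightarrow> ('a \<Rightarrow> 'a) \<Rightarrow> ('r \<times> 'a) list set \<Rightarrow> 'r"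
  where
  "tensor_norm S s R B \<sigma> X =
     (THE r. r \<in> carrier R \<and>
        tens S s R B r 1 = X \<otimes>\<^bsub>tensor S s R B\<^esub> tensor_map S s R B \<sigma> X)"


section \<open>Three by three matrices\<close>

text \<open>Indices live in the three-element type \<open>3\<close>, with elements \<open>1, 2, 3\<close> and arithmetic
  modulo three (so \<open>3 = 0\<close>); \<open>j \<mapsto> 4 - j\<close> exchanges \<open>1\<close> and \<open>3\<close> and fixes \<open>2\<close>.\<close>

type_synonym 'a mat3 = "3 \<Rightarrow> 3 \<Rightarrow> 'a"

definition mat_mul :: "'a ring \<Rightarrow> 'a mat3 \<Rightarrow> 'a mat3 \<Rightarrow> 'a mat3" where
  "mat_mul T g h = (\<lambda>i j. \<Oplus>\<^bsub>T\<^esub>k\<in>UNIV. g i k \<otimes>\<^bsub>T\<^esub> h k j)"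

definition mat_diag :: "'a ring \<Rightarrow> (3 \<Rightarrow> 'a) \<Rightarrow> 'a mat3" where
  "mat_diag T d = (\<lambda>i j. if i = j then d i else \<zero>\<^bsub>T\<^esub>)"

definition mat_det :: "'a ring \<Rightarrow> 'a mat3 \<Rightarrow> 'a" where
  "mat_det T g = (\<Oplus>\<^bsub>T\<^esub>p\<in>{p. p permutes UNIV}.
     if evenperm p then \<Otimes>\<^bsub>T\<^esub>i\<in>UNIV. g i (p i) else \<ominus>\<^bsub>T\<^esub> (\<Otimes>\<^bsub>T\<^esub>i\<in>UNIV. g i (p i)))"

definition SL3 :: "'a ring \<Rightarrow> 'a mat3 set" where
  "SL3 T = {g. (\<forall>i j. g i j \<in> carrier T) \<and> mat_det T g = \<one>\<^bsub>T\<^esub>}"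

definition anti_transpose :: "'a mat3 \<Rightarrow> 'a mat3" where
  "anti_transpose g = (\<lambda>i j. g (4 - j) (4 - i))"

definition mat_conj ::
  "'a::comm_ring_1 set \<Rightarrow> ('a \<Rightarrow> 'r) \<Rightarrow> 'r ring \<Rightarrow> 'a set \<Rightarrow> ('a \<Rightarrow> 'a)
     \<Rightarrow> ('r \<times> 'a) list set mat3 \<Rightarrow> ('r \<times> 'a) list set mat3" where
  "mat_conj S s R B \<sigma> g = (\<lambda>i j. tensor_map S s R B \<sigma> (g i j))"


section \<open>Ramified quadratic extensions of local fields\<close>

text \<open>The field \<open>L\<close> is the whole type \<open>'l\<close>, and \<open>K\<close> is a subset of it. The valuation is
  not assumed normalised.\<close>

definition valuation_on :: "'l::field set \<Rightarrow> ('l \<Rightarrow> ereal) \<Rightarrow> bool" where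
  "valuation_on F \<omega> \<longleftrightarrow>
     (\<forall>x\<in>F. \<omega> x \<noteq> -\<infinity> \<and> (\<omega> x = \<infinity> \<longleftrightarrow> x = 0)) \<and>
     (\<forall>x\<in>F. \<forall>y\<in>F. \<omega> (x * y) = \<omega> x + \<omega> y \<and> min (\<omega> x) (\<omega> y) \<le> \<omega> (x + y))"

definition integers :: "('l \<Rightarrow> ereal) \<Rightarrow> 'l::field set \<Rightarrow> 'l set" where
  "integers \<omega> F = {x \<in> F. 0 \<le> \<omega> x}"

definition max_ideal :: "('l \<Rightarrow> ereal) \<Rightarrow> 'l::field set \<Rightarrow> 'l set" where
  "max_ideal \<omega> F = {x \<in> F. 0 < \<omega> x}"

definition uniformiser :: "('l \<Rightarrow> ereal) \<Rightarrow> 'l::field set \<Rightarrow> 'l \<Rightarrow> bool" where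
  "uniformiser \<omega> F p \<longleftrightarrow> p \<in> max_ideal \<omega> F \<and> p \<noteq> 0 \<and> (\<forall>x\<in>max_ideal \<omega> F. \<omega> p \<le> \<omega> x)"

definition complete_on :: "('l \<Rightarrow> ereal) \<Rightarrow> 'l::field set \<Rightarrow> bool" where
  "complete_on \<omega> F \<longleftrightarrow>
     (\<forall>f::nat \<Rightarrow> 'l. range f \<subseteq> F \<longrightarrow>
        (\<forall>M::real. \<exists>N. \<forall>m\<ge>N. \<forall>n\<ge>N. ereal M \<le> \<omega> (f m - f n)) \<longrightarrow>
        (\<exists>x\<in>F. \<forall>M::real. \<exists>N. \<forall>n\<ge>N. ereal M \<le> \<omega> (f n - x)))"

text \<open>A uniformiser exists exactly when the value group, a subgroup of the reals, is discrete
  and non-trivial.\<close>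

definition local_field :: "('l \<Rightarrow> ereal) \<Rightarrow> 'l::field set \<Rightarrow> bool" where
  "local_field \<omega> K \<longleftrightarrow>
     subfield K (ring_of UNIV) \<and> valuation_on K \<omega> \<and> (\<exists>p. uniformiser \<omega> K p) \<and>
     complete_on \<omega> K \<and> finite (carrier (ring_of (integers \<omega> K) Quot max_ideal \<omega> K))"

definition residue_char_two :: "('l \<Rightarrow> ereal) \<Rightarrow> 'l::field set \<Rightarrow> bool" where
  "residue_char_two \<omega> K \<longleftrightarrow> (2::'l) \<in> max_ideal \<omega> K"

definition separable_over :: "'l::field set \<Rightarrow> bool" where
  "separable_over K \<longleftrightarrow>
     (\<forall>x::'l. \<exists>p. set (coeffs p) \<subseteq> K \<and> poly p x = 0 \<and> coprime p (pderiv p))"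

definition conjugation :: "'l::field set \<Rightarrow> ('l \<Rightarrow> 'l) \<Rightarrow> bool" where
  "conjugation K \<sigma> \<longleftrightarrow>
     \<sigma> \<in> ring_iso (ring_of UNIV) (ring_of UNIV) \<and> (\<forall>x\<in>K. \<sigma> x = x) \<and> \<sigma> \<noteq> id"

definition ramified :: "('l \<Rightarrow> ereal) \<Rightarrow> 'l::field set \<Rightarrow> bool" where
  "ramified \<omega> K \<longleftrightarrow> \<omega> ` (UNIV - {0}) \<noteq> \<omega> ` (K - {0})"

definition ramified_separable_quadratic ::
  "('l \<Rightarrow> ereal) \<Rightarrow> 'l::field set \<Rightarrow> ('l \<Rightarrow> 'l) \<Rightarrow> bool" where
  "ramified_separable_quadratic \<omega> K \<sigma> \<longleftrightarrow>
     valuation_on UNIV \<omega> \<and> ring.dimension (ring_of (UNIV::'l set)) 2 K UNIV \<and>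
     separable_over K \<and> conjugation K \<sigma> \<and> ramified \<omega> K"

definition ramification_parameter :: "('l \<Rightarrow> ereal) \<Rightarrow> 'l::field set \<Rightarrow> nat \<Rightarrow> bool" where
  "ramification_parameter \<omega> K i0 \<longleftrightarrow>
     (\<exists>t0 \<alpha> \<beta>0 p. \<alpha> \<in> K \<and> \<beta>0 \<in> K \<and>
        (\<forall>x. \<exists>f. set (coeffs f) \<subseteq> K \<and> poly f t0 = x) \<and>
        t0\<^sup>2 - \<alpha> * t0 + \<beta>0 = 0 \<and> uniformiser \<omega> K \<beta>0 \<and>
        (\<alpha> = 0 \<or> 0 < \<omega> \<beta>0 \<and> \<omega> \<beta>0 \<le> \<omega> \<alpha> \<and> \<omega> \<alpha> \<le> \<omega> 2) \<and>
        uniformiser \<omega> K p \<and> \<omega> (p ^ i0) = (if \<alpha> = 0 then \<omega> 2 else \<omega> \<alpha>))"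


section \<open>Weil restriction of the special linear group\<close>

text \<open>Let \<open>S \<subseteq> B\<close> be such that \<open>B\<close> is free over \<open>S\<close> with basis \<open>1, t\<close>. This applies to
  the rings of integers (\<open>t\<close> a uniformiser of \<open>L\<close>, totally ramified over \<open>K\<close>) and to
  \<open>K \<subseteq> L\<close>. An element of the tensor product of \<open>R\<close> and \<open>B\<close> then has two coordinates in \<open>R\<close>,
  and a matrix over it is given by a family \<open>x\<close> of elements of \<open>R\<close> indexed by \<open>3 \<times> 3 \<times> 2\<close>,
  the last index \<open>0\<close> (resp. \<open>1\<close>) belonging to the basis element \<open>1\<close> (resp. \<open>t\<close>).\<close>

type_synonym weil_index = "3 \<times> 3 \<times> 2"

definition weil_matrix ::
  "'a::comm_ring_1 set \<Rightarrow> ('a \<Rightarrow> 'r) \<Rightarrow> 'r ring \<Rightarrow> 'a set \<Rightarrow> 'a \<Rightarrow> (weil_index \<Rightarrow> 'r)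
     \<Rightarrow> ('r \<times> 'a) list set mat3" where
  "weil_matrix S s R B t x =
     (\<lambda>i j. tens S s R B (x (i, j, 0)) 1 \<oplus>\<^bsub>tensor S s R B\<^esub> tens S s R B (x (i, j, 1)) t)"

definition weil_coords ::
  "'a::comm_ring_1 set \<Rightarrow> ('a \<Rightarrow> 'r) \<Rightarrow> 'r ring \<Rightarrow> 'a set \<Rightarrow> 'a \<Rightarrow> ('r \<times> 'a) list set \<Rightarrow> 'r set"
  where
  "weil_coords S s R B t z =
     \<Union> {{p, q} | p q. p \<in> carrier R \<and> q \<in> carrier R \<and>
          z = tens S s R B p 1 \<oplus>\<^bsub>tensor S s R B\<^esub> tens S s R B q t}"

abbreviation weil_polys :: "'a::comm_ring_1 set \<Rightarrow> (weil_index, 'a) mpoly ring" where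
  "weil_polys S \<equiv> mpoly_ring S UNIV"

abbreviation generic_matrix ::
  "'a::comm_ring_1 set \<Rightarrow> 'a set \<Rightarrow> 'a \<Rightarrow> ((weil_index, 'a) mpoly \<times> 'a) list set mat3" where
  "generic_matrix S B t \<equiv> weil_matrix S mp_const (weil_polys S) B t mp_var"

text \<open>The Weil restriction of \<open>SL\<^sub>3\<close> is the spectrum of \<open>weil_SL3 S B t\<close>: the polynomial ring
  in the coordinates of a generic matrix, modulo the two coordinates of
  ``determinant minus one''. Its points in \<open>R\<close> are identified with \<open>SL3 (tensor S s R B)\<close> by
  sending \<open>h\<close> to the matrix with coordinates \<open>h \<circ> coord_fun\<close>.\<close>

definition weil_SL3_ideal :: "'a::comm_ring_1 set \<Rightarrow> 'a set \<Rightarrow> 'a \<Rightarrow> (weil_index, 'a) mpoly set" where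
  "weil_SL3_ideal S B t =
     (let P = weil_polys S; T = tensor S mp_const P B
      in genideal P (weil_coords S mp_const P B t
           (mat_det T (generic_matrix S B t) \<ominus>\<^bsub>T\<^esub> \<one>\<^bsub>T\<^esub>)))"

definition weil_SL3 ::
  "'a::comm_ring_1 set \<Rightarrow> 'a set \<Rightarrow> 'a \<Rightarrow> (weil_index, 'a) mpoly set ring" where
  "weil_SL3 S B t = weil_polys S Quot weil_SL3_ideal S B t"

definition weil_SL3_struct ::
  "'a::comm_ring_1 set \<Rightarrow> 'a set \<Rightarrow> 'a \<Rightarrow> 'a \<Rightarrow> (weil_index, 'a) mpoly set" where
  "weil_SL3_struct S B t = quot_struct (weil_polys S) (weil_SL3_ideal S B t) mp_const"

definition coord_fun ::
  "'a::comm_ring_1 set \<Rightarrow> (weil_index, 'a) mpoly set \<Rightarrow> weil_index \<Rightarrow> (weil_index, 'a) mpoly set"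
  where "coord_fun S I v = I +>\<^bsub>weil_polys S\<^esub> mp_var v"


section \<open>The special unitary group\<close>

text \<open>Coordinate ring of \<open>SU\<^sub>3\<close> over \<open>K\<close>: same construction for \<open>K \<subseteq> L\<close>, with the coordinates
  of the entries of \<open>\<^sup>S(g\<^sup>\<sigma>) g - Id\<close> as additional equations.\<close>

definition SU3_ideal :: "'l::field set \<Rightarrow> ('l \<Rightarrow> 'l) \<Rightarrow> 'l \<Rightarrow> (weil_index, 'l) mpoly set" where
  "SU3_ideal K \<sigma> t =
     (let P = weil_polys K; T = tensor K mp_const P UNIV; g = generic_matrix K UNIV t;
          h = mat_mul T (anti_transpose (mat_conj K mp_const P UNIV \<sigma> g)) g
      in genideal P
           (weil_coords K mp_const P UNIV t (mat_det T g \<ominus>\<^bsub>T\<^esub> \<one>\<^bsub>T\<^esub>) \<union>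
            (\<Union>i j. weil_coords K mp_const P UNIV t
                     (h i j \<ominus>\<^bsub>T\<^esub> mat_diag T (\<lambda>_. \<one>\<^bsub>T\<^esub>) i j))))"

definition SU3 :: "'l::field set \<Rightarrow> ('l \<Rightarrow> 'l) \<Rightarrow> 'l \<Rightarrow> (weil_index, 'l) mpoly set ring" where
  "SU3 K \<sigma> t = weil_polys K Quot SU3_ideal K \<sigma> t"

definition SU3_struct :: "'l::field set \<Rightarrow> ('l \<Rightarrow> 'l) \<Rightarrow> 'l \<Rightarrow> 'l \<Rightarrow> (weil_index, 'l) mpoly set" where
  "SU3_struct K \<sigma> t = quot_struct (weil_polys K) (SU3_ideal K \<sigma> t) mp_const"

definition phi_matrix ::
  "'l::field set \<Rightarrow> ('l \<Rightarrow> 'r) \<Rightarrow> 'r ring \<Rightarrow> 'l \<Rightarrow> nat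
     \<Rightarrow> ('r \<times> 'l) list set mat3 \<Rightarrow> ('r \<times> 'l) list set mat3" where
  "phi_matrix K s R t i0 g =
     (\<lambda>i j. if i \<noteq> 2 \<and> j = 2 then tens K s R UNIV \<one>\<^bsub>R\<^esub> (t ^ i0) \<otimes>\<^bsub>tensor K s R UNIV\<^esub> g i j
            else if i = 2 \<and> j \<noteq> 2
              then tens K s R UNIV \<one>\<^bsub>R\<^esub> (inverse t ^ i0) \<otimes>\<^bsub>tensor K s R UNIV\<^esub> g i j
            else g i j)"


section \<open>Schematic adherence\<close>

text \<open>For an algebra \<open>A\<close> over \<open>S \<subseteq> K\<close> and an ideal \<open>I\<close> of the base change of \<open>A\<close> to \<open>K\<close>.\<close>

definition adherence_ideal ::
  "'a::comm_ring_1 set \<Rightarrow> ('a \<Rightarrow> 'p) \<Rightarrow> 'p ring \<Rightarrow> 'a set \<Rightarrow> ('p \<times> 'a) list set set \<Rightarrow> 'p set" where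
  "adherence_ideal S a A K I = {f \<in> carrier A. tens S a A K f 1 \<in> I}"

abbreviation OK_weil_SL3 ::
  "('l \<Rightarrow> ereal) \<Rightarrow> 'l::field set \<Rightarrow> 'l \<Rightarrow> (weil_index, 'l) mpoly set ring" where
  "OK_weil_SL3 \<omega> K t \<equiv> weil_SL3 (integers \<omega> K) (integers \<omega> UNIV) t"

abbreviation OK_weil_SL3_struct ::
  "('l \<Rightarrow> ereal) \<Rightarrow> 'l::field set \<Rightarrow> 'l \<Rightarrow> 'l \<Rightarrow> (weil_index, 'l) mpoly set" where
  "OK_weil_SL3_struct \<omega> K t \<equiv> weil_SL3_struct (integers \<omega> K) (integers \<omega> UNIV) t"

abbreviation OK_coord_fun ::
  "('l \<Rightarrow> ereal) \<Rightarrow> 'l::field set \<Rightarrow> 'l \<Rightarrow> weil_index \<Rightarrow> (weil_index, 'l) mpoly set" where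
  "OK_coord_fun \<omega> K t \<equiv>
     coord_fun (integers \<omega> K) (weil_SL3_ideal (integers \<omega> K) (integers \<omega> UNIV) t)"

text \<open>A homomorphism of \<open>K\<close>-algebras from the coordinate ring of the generic fibre of the Weil
  restriction to that of \<open>SU\<^sub>3\<close> is the comorphism of \<open>\<phi>\<close> iff it sends the universal matrix
  to the image under \<open>\<phi>\<close> of the universal point of \<open>SU\<^sub>3\<close>. This determines it uniquely on the
  carrier.\<close>

definition phi_comorphism ::
  "('l \<Rightarrow> ereal) \<Rightarrow> 'l::field set \<Rightarrow> ('l \<Rightarrow> 'l) \<Rightarrow> 'l \<Rightarrow> nat
     \<Rightarrow> (((weil_index, 'l) mpoly set \<times> 'l) list set \<Rightarrow> (weil_index, 'l) mpoly set) \<Rightarrow> bool" where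
  "phi_comorphism \<omega> K \<sigma> t i0 h \<longleftrightarrow>
     (let O' = integers \<omega> K; A = OK_weil_SL3 \<omega> K t; a = OK_weil_SL3_struct \<omega> K t;
          U = SU3 K \<sigma> t; u = SU3_struct K \<sigma> t
      in h \<in> alg_hom K (\<lambda>c. tens O' a A K \<one>\<^bsub>A\<^esub> c) (tensor O' a A K) u U \<and>
         weil_matrix K u U UNIV t (\<lambda>v. h (tens O' a A K (OK_coord_fun \<omega> K t v) 1)) =
         phi_matrix K u U t i0
           (weil_matrix K u U UNIV t (coord_fun K (SU3_ideal K \<sigma> t))))"

text \<open>The ideal of the closed subscheme \<open>\<phi>(SU\<^sub>3)\<close> of the generic fibre.\<close>

definition phi_image_ideal ::
  "('l \<Rightarrow> ereal) \<Rightarrow> 'l::field set \<Rightarrow> ('l \<Rightarrow> 'l) \<Rightarrow> 'l \<Rightarrow> nat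
     \<Rightarrow> ((weil_index, 'l) mpoly set \<times> 'l) list set set" where
  "phi_image_ideal \<omega> K \<sigma> t i0 =
     a_kernel (tensor (integers \<omega> K) (OK_weil_SL3_struct \<omega> K t) (OK_weil_SL3 \<omega> K t) K)
       (SU3 K \<sigma> t) (SOME h. phi_comorphism \<omega> K \<sigma> t i0 h)"

definition uSU3_ideal ::
  "('l \<Rightarrow> ereal) \<Rightarrow> 'l::field set \<Rightarrow> ('l \<Rightarrow> 'l) \<Rightarrow> 'l \<Rightarrow> nat \<Rightarrow> (weil_index, 'l) mpoly set set" where
  "uSU3_ideal \<omega> K \<sigma> t i0 =
     adherence_ideal (integers \<omega> K) (OK_weil_SL3_struct \<omega> K t) (OK_weil_SL3 \<omega> K t) K
       (phi_image_ideal \<omega> K \<sigma> t i0)"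

text \<open>Coordinate ring of the schematic adherence.\<close>

definition uSU3 ::
  "('l \<Rightarrow> ereal) \<Rightarrow> 'l::field set \<Rightarrow> ('l \<Rightarrow> 'l) \<Rightarrow> 'l \<Rightarrow> nat
     \<Rightarrow> (weil_index, 'l) mpoly set set ring" where
  "uSU3 \<omega> K \<sigma> t i0 = OK_weil_SL3 \<omega> K t Quot uSU3_ideal \<omega> K \<sigma> t i0"

definition uSU3_struct ::
  "('l \<Rightarrow> ereal) \<Rightarrow> 'l::field set \<Rightarrow> ('l \<Rightarrow> 'l) \<Rightarrow> 'l \<Rightarrow> nat
     \<Rightarrow> 'l \<Rightarrow> (weil_index, 'l) mpoly set set" where
  "uSU3_struct \<omega> K \<sigma> t i0 =
     quot_struct (OK_weil_SL3 \<omega> K t) (uSU3_ideal \<omega> K \<sigma> t i0) (OK_weil_SL3_struct \<omega> K t)"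

text \<open>Its points in an algebra \<open>R\<close>, as matrices over the tensor product of \<open>R\<close> with the
  integers of \<open>L\<close>.\<close>

definition uSU3_points ::
  "('l \<Rightarrow> ereal) \<Rightarrow> 'l::field set \<Rightarrow> ('l \<Rightarrow> 'l) \<Rightarrow> 'l \<Rightarrow> nat \<Rightarrow> ('l \<Rightarrow> 'r) \<Rightarrow> 'r ring
     \<Rightarrow> ('r \<times> 'l) list set mat3 set" where
  "uSU3_points \<omega> K \<sigma> t i0 s R =
     (\<lambda>h. weil_matrix (integers \<omega> K) s R (integers \<omega> UNIV) t
            (\<lambda>v. h (uSU3_ideal \<omega> K \<sigma> t i0 +>\<^bsub>OK_weil_SL3 \<omega> K t\<^esub> OK_coord_fun \<omega> K t v))) `
     alg_hom (integers \<omega> K) (uSU3_struct \<omega> K \<sigma> t i0) (uSU3 \<omega> K \<sigma> t i0) s R"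

end

theory Submission
  imports Defs "HOL-Algebra.UnivPoly"
begin

text \<open>Put \<open>b = \<beta>\<^sup>i\<^sup>0\<close>. The divided trace \<open>Tr / b\<close> refines the hermitian form
  \<open>b N(v\<^sub>2) + Tr(v\<^sub>1 v\<^sub>3\<^sup>\<sigma>)\<close> to a quadratic form \<open>N(v\<^sub>2) + (Tr / b)(v\<^sub>1 v\<^sub>3\<^sup>\<sigma>)\<close>, and the equations say that
  the outer columns are isotropic for it. Since \<open>Tr / b\<close> is surjective, isotropic vectors and then
  whole matrices lift along square-zero extensions, so the scheme \<open>X\<close> cut out by the equations is
  formally smooth. For flatness, the loci where \<open>N(g\<^sub>1\<^sub>1)\<close> or \<open>N(g\<^sub>3\<^sub>1)\<close> is invertible are big cells,
  hence localisations of affine spaces, and their union contains the special fibre of \<open>X\<close>; so \<open>\<beta>\<close> is a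
  non-zero-divisor on \<open>X\<close>. Finally \<open>\<phi>\<close> identifies the generic fibre of \<open>X\<close> with \<open>SU\<^sub>3\<close>, and a
  \<open>\<beta>\<close>-torsion free closed subscheme is the adherence of its generic fibre.\<close>

subsection \<open>Subrings of a type\<close>

text \<open>In residue characteristic 2 nothing can be divided by b: the trace of O_L lies in b O_K,
  and over an algebra where b is a zero divisor the hermitian equations lose information. Two facts
  compensate. The middle column always has value 1 under the quadratic form
  (\<open>qf_middle\<close>), which must be derived without cancelling b; this reconciles the matrix
  equation, which pairs the middle column with itself, with the shorter list of equations used for
  lifting. And an element e of divided trace 1 exists (b/2 or t0 b/\<alpha> has trace b), so trace
  equations are solved by adding multiples of e. The same e yields the retraction z - (tr z + N x)
  e, which parametrises the big cell by free variables; this parametrisation is only shown to be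
  surjective on points, but that suffices to test vanishing. Modulo \<beta> the norm of p + q t is
  p^2, so the cover by two cells is seen only up to radicals, and the torsion argument runs through
  the radical of an annihilator. The equations are set up in coordinates over an open base S,
  because O_K and K are both needed.\<close>

definition closed_ring :: "'a::comm_ring_1 set \<Rightarrow> bool" where
  "closed_ring S \<longleftrightarrow> 0 \<in> S \<and> 1 \<in> S \<and> (\<forall>x\<in>S. - x \<in> S) \<and>
     (\<forall>x\<in>S. \<forall>y\<in>S. x + y \<in> S \<and> x * y \<in> S)"

lemma closed_ringD:
  assumes "closed_ring S"
  shows "0 \<in> S" "1 \<in> S" "x \<in> S \<Longrightarrow> - x \<in> S" "x \<in> S \<Longrightarrow> y \<in> S \<Longrightarrow> x + y \<in> S"
    "x \<in> S \<Longrightarrow> y \<in> S \<Longrightarrow> x * y \<in> S" "x \<in> S \<Longrightarrow> y \<in> S \<Longrightarrow> x - y \<in> S" "x \<in> S \<Longrightarrow> x ^ n \<in> S"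
proof -
  show S: "0 \<in> S" "1 \<in> S" and "x \<in> S \<Longrightarrow> - x \<in> S" and "x \<in> S \<Longrightarrow> y \<in> S \<Longrightarrow> x + y \<in> S"
    and "x \<in> S \<Longrightarrow> y \<in> S \<Longrightarrow> x * y \<in> S"
    using assms by (auto simp: closed_ring_def)
  show "x \<in> S \<Longrightarrow> y \<in> S \<Longrightarrow> x - y \<in> S"
    using assms unfolding closed_ring_def by (metis add_uminus_conv_diff)
  show "x \<in> S \<Longrightarrow> x ^ n \<in> S"
    using assms by (induction n) (auto simp: closed_ring_def)
qed

lemma ring_of_simps [simp]:
  "carrier (ring_of S) = S" "x \<otimes>\<^bsub>ring_of S\<^esub> y = x * y" "\<one>\<^bsub>ring_of S\<^esub> = 1"
  "\<zero>\<^bsub>ring_of S\<^esub> = 0" "x \<oplus>\<^bsub>ring_of S\<^esub> y = x + y"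
  by (auto simp: ring_of_def)

lemma cring_ring_of:
  assumes "closed_ring S"
  shows "cring (ring_of S)"
proof (rule cringI)
  show "abelian_group (ring_of S)"
    using closed_ringD[OF assms]
    by (intro abelian_groupI) (auto intro!: bexI[where x = "- x" for x])
  show "comm_monoid (ring_of S)"
    using closed_ringD[OF assms] by (intro comm_monoidI) (auto simp: mult.commute)
qed (use closed_ringD[OF assms] in \<open>auto simp: algebra_simps\<close>)

lemma ring_of_a_inv [simp]:
  assumes "closed_ring S" "x \<in> S"
  shows "\<ominus>\<^bsub>ring_of S\<^esub> x = - x"
proof -
  interpret cring "ring_of S" using assms by (intro cring_ring_of)
  show ?thesis
    using assms closed_ringD(3)[OF assms] by (intro minus_equality) auto
qed

lemma ring_of_a_minus [simp]:
  assumes "closed_ring S" "x \<in> S" "y \<in> S"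
  shows "x \<ominus>\<^bsub>ring_of S\<^esub> y = x - y"
  using assms by (simp add: a_minus_def)

lemma closed_ring_UNIV [simp]: "closed_ring UNIV"
  by (simp add: closed_ring_def)

lemma ring_hom_cringI':
  assumes "cring A" "cring B" "h \<in> ring_hom A B"
  shows "ring_hom_cring A B h"
  using assms by (simp add: ring_hom_cring.intro ring_hom_cring_axioms.intro)

subsection \<open>Evaluation of multivariate polynomials\<close>

definition mp_monom :: "('r, 'x) ring_scheme \<Rightarrow> ('v \<Rightarrow> 'r) \<Rightarrow> ('v \<Rightarrow>\<^sub>0 nat) \<Rightarrow> 'r" where
  "mp_monom R x m = (\<Otimes>\<^bsub>R\<^esub>v\<in>Poly_Mapping.keys m. x v [^]\<^bsub>R\<^esub> Poly_Mapping.lookup m v)"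

definition mp_eval ::
  "('r, 'x) ring_scheme \<Rightarrow> ('a::comm_ring_1 \<Rightarrow> 'r) \<Rightarrow> ('v \<Rightarrow> 'r) \<Rightarrow> ('v, 'a) mpoly \<Rightarrow> 'r" where
  "mp_eval R s x p =
     (\<Oplus>\<^bsub>R\<^esub>m\<in>Poly_Mapping.keys p. s (Poly_Mapping.lookup p m) \<otimes>\<^bsub>R\<^esub> mp_monom R x m)"

definition mpolys :: "'a::comm_ring_1 set \<Rightarrow> 'v set \<Rightarrow> ('v, 'a) mpoly set" where
  "mpolys S V = {p. (\<forall>m. Poly_Mapping.lookup p m \<in> S) \<and>
     (\<forall>m\<in>Poly_Mapping.keys p. Poly_Mapping.keys m \<subseteq> V)}"

lemma mpoly_ring_eq: "mpoly_ring S V = ring_of (mpolys S V)"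
  by (simp add: mpoly_ring_def mpolys_def)

lemma single_in_mpolys:
  assumes "closed_ring S" "c \<in> S" "Poly_Mapping.keys m \<subseteq> V"
  shows "Poly_Mapping.single m c \<in> mpolys S V"
  using assms by (auto simp: mpolys_def lookup_single when_def closed_ringD)

lemma mpolys_add:
  assumes "closed_ring S" "p \<in> mpolys S V" "q \<in> mpolys S V"
  shows "p + q \<in> mpolys S V"
proof -
  have "Poly_Mapping.keys m \<subseteq> V" if "m \<in> Poly_Mapping.keys (p + q)" for m
    using that assms Poly_Mapping.keys_add[of p q] unfolding mpolys_def by blast
  then show ?thesis using assms by (auto simp: mpolys_def lookup_add closed_ringD)
qed

lemma mpolys_uminus:
  assumes "closed_ring S" "p \<in> mpolys S V"
  shows "- p \<in> mpolys S V"
  using assms by (auto simp: mpolys_def closed_ringD)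

text \<open>Removing one monomial from the support leaves a polynomial with the same restrictions on
  coefficients and variables, so the number of terms is a measure. Products, evaluation and
  uniqueness of homomorphisms are reduced to single terms this way.\<close>

lemma mpolys_induct [consumes 2, case_names zero single]:
  fixes p :: "('v, 'a::comm_ring_1) mpoly"
  assumes S: "closed_ring S" and p: "p \<in> mpolys S V"
    and 0: "P 0"
    and add: "\<And>m c p. c \<in> S \<Longrightarrow> Poly_Mapping.keys m \<subseteq> V \<Longrightarrow> p \<in> mpolys S V \<Longrightarrow> P p \<Longrightarrow>
       P (Poly_Mapping.single m c + p)"
  shows "P p"
  using p
proof (induction "card (Poly_Mapping.keys p)" arbitrary: p)
  case 0
  then show ?case using \<open>P 0\<close> by simp
next
  case (Suc n)
  then obtain m where m: "m \<in> Poly_Mapping.keys p"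
    by (metis card.empty ex_in_conv nat.distinct(1))
  define c where "c = Poly_Mapping.lookup p m"
  define q where "q = p - Poly_Mapping.single m c"
  have "Poly_Mapping.keys q = Poly_Mapping.keys p - {m}"
    by (auto simp: q_def c_def in_keys_iff lookup_minus lookup_single when_def split: if_splits)
  then have card: "n = card (Poly_Mapping.keys q)"
    using Suc.hyps(2) m by simp
  have cS: "c \<in> S" "Poly_Mapping.keys m \<subseteq> V"
    using Suc.prems m by (auto simp: mpolys_def c_def)
  have q: "q \<in> mpolys S V"
    unfolding q_def diff_conv_add_uminus
    using Suc.prems cS S by (intro mpolys_add mpolys_uminus single_in_mpolys)
  have "p = Poly_Mapping.single m c + q" by (simp add: q_def)
  then show ?case using add[OF cS q Suc.hyps(1)[OF card q]] by simp
qed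

lemma mpolys_mult:
  assumes S: "closed_ring S" and p: "p \<in> mpolys S V" and q: "q \<in> mpolys S V"
  shows "p * q \<in> mpolys S V"
proof -
  have *: "Poly_Mapping.single m c * q \<in> mpolys S V"
    if c: "c \<in> S" and m: "Poly_Mapping.keys m \<subseteq> V" for m c
    using S q
  proof (induction rule: mpolys_induct)
    case (single n d p)
    have "Poly_Mapping.keys (m + n) \<subseteq> V"
      using m single(2) Poly_Mapping.keys_add[of m n] by blast
    then show ?case
      using single S c by (auto simp: distrib_left mult_single closed_ringD
          intro!: mpolys_add single_in_mpolys)
  qed (use S in \<open>auto simp: mpolys_def closed_ringD\<close>)
  show ?thesis
    using S p
  proof (induction rule: mpolys_induct)
    case zero
    show ?case using S by (simp add: mpolys_def closed_ringD)
  qed (simp add: S * distrib_right mpolys_add)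
qed

lemma closed_ring_mpolys:
  assumes "closed_ring S"
  shows "closed_ring (mpolys S V)"
proof -
  have "0 \<in> mpolys S V" using assms by (simp add: mpolys_def closed_ringD)
  moreover have "1 \<in> mpolys S V"
    using single_in_mpolys[OF assms closed_ringD(2)[OF assms], of 0 V]
    by (simp add: single_one)
  ultimately show ?thesis
    using assms by (simp add: closed_ring_def mpolys_add mpolys_uminus mpolys_mult)
qed

lemma cring_mpoly_ring: "closed_ring S \<Longrightarrow> cring (mpoly_ring S V)"
  by (simp add: mpoly_ring_eq closed_ring_mpolys cring_ring_of)

lemma mp_const_closed: "closed_ring S \<Longrightarrow> c \<in> S \<Longrightarrow> mp_const c \<in> mpolys S V"
  by (simp add: mp_const_def single_in_mpolys)

lemma mp_var_closed: "closed_ring S \<Longrightarrow> v \<in> V \<Longrightarrow> mp_var v \<in> mpolys S V"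
  by (simp add: mp_var_def single_in_mpolys closed_ringD)

lemma mp_const_hom:
  assumes "closed_ring S"
  shows "mp_const \<in> ring_hom (ring_of S) (mpoly_ring S V)"
  by (rule ring_hom_memI)
    (use assms in \<open>auto simp: mpoly_ring_eq mp_const_closed,
      auto simp: mp_const_def single_add mult_single\<close>)

locale mp_data = R?: cring R for R :: "('r, 'x) ring_scheme" (structure) +
  fixes S :: "'a::comm_ring_1 set" and s :: "'a \<Rightarrow> 'r" and V :: "'v set" and x :: "'v \<Rightarrow> 'r"
  assumes S: "closed_ring S" and s: "s \<in> ring_hom (ring_of S) R"
    and x: "\<And>v. v \<in> V \<Longrightarrow> x v \<in> carrier R"
begin

lemma s_closed [simp]: "c \<in> S \<Longrightarrow> s c \<in> carrier R"
  using ring_hom_closed[OF s] by simp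

lemma s_hom: "s 0 = \<zero>" "s 1 = \<one>" "c \<in> S \<Longrightarrow> d \<in> S \<Longrightarrow> s (c + d) = s c \<oplus> s d"
  "c \<in> S \<Longrightarrow> d \<in> S \<Longrightarrow> s (c * d) = s c \<otimes> s d"
  using ring_hom_zero[OF s _ R.ring_axioms] ring_hom_one[OF s] ring_hom_add[OF s]
    ring_hom_mult[OF s] cring.axioms(1)[OF cring_ring_of[OF S]] by simp_all

lemma mp_monom_closed [simp]: "Poly_Mapping.keys m \<subseteq> V \<Longrightarrow> mp_monom R x m \<in> carrier R"
  unfolding mp_monom_def by (intro finprod_closed) (auto intro!: nat_pow_closed x)

text \<open>Exponents outside the support are zero and contribute the unit, so monomials with
  different supports can be compared over one finite index set.\<close>

lemma mp_monom_superset: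
  assumes "finite F" "Poly_Mapping.keys m \<subseteq> F" "F \<subseteq> V"
  shows "mp_monom R x m = (\<Otimes>v\<in>F. x v [^] Poly_Mapping.lookup m v)"
  unfolding mp_monom_def
  by (rule finprod_mono_neutral_cong_left)
    (use assms in \<open>auto simp: in_keys_iff intro!: nat_pow_closed x\<close>)

lemma mp_monom_add:
  assumes "Poly_Mapping.keys m \<subseteq> V" "Poly_Mapping.keys n \<subseteq> V"
  shows "mp_monom R x (m + n) = mp_monom R x m \<otimes> mp_monom R x n"
proof -
  let ?F = "Poly_Mapping.keys m \<union> Poly_Mapping.keys n"
  have F: "finite ?F" "?F \<subseteq> V" using assms by auto
  have xF: "x v \<in> carrier R" if "v \<in> ?F" for v using that F x by blast
  have "mp_monom R x (m + n) = (\<Otimes>v\<in>?F. x v [^] Poly_Mapping.lookup (m + n) v)"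
    using F Poly_Mapping.keys_add[of m n] by (intro mp_monom_superset) auto
  also have "\<dots> = (\<Otimes>v\<in>?F. x v [^] Poly_Mapping.lookup m v \<otimes> x v [^] Poly_Mapping.lookup n v)"
    using xF by (intro finprod_cong') (auto simp: lookup_add nat_pow_mult)
  also have "\<dots> = (\<Otimes>v\<in>?F. x v [^] Poly_Mapping.lookup m v) \<otimes> (\<Otimes>v\<in>?F. x v [^] Poly_Mapping.lookup n v)"
    using xF by (intro finprod_multf) auto
  also have "\<dots> = mp_monom R x m \<otimes> mp_monom R x n"
    using F mp_monom_superset[of ?F m] mp_monom_superset[of ?F n] by simp
  finally show ?thesis .
qed

lemma mp_eval_superset:
  assumes "p \<in> mpolys S V" "finite F" "Poly_Mapping.keys p \<subseteq> F" "\<And>m. m \<in> F \<Longrightarrow> Poly_Mapping.keys m \<subseteq> V"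
  shows "mp_eval R s x p = (\<Oplus>m\<in>F. s (Poly_Mapping.lookup p m) \<otimes> mp_monom R x m)"
  unfolding mp_eval_def
  by (rule add.finprod_mono_neutral_cong_left)
    (use assms in \<open>auto simp: in_keys_iff s_hom mpolys_def\<close>)

lemma mp_eval_closed [simp]: "p \<in> mpolys S V \<Longrightarrow> mp_eval R s x p \<in> carrier R"
  unfolding mp_eval_def by (intro finsum_closed) (auto simp: mpolys_def)

lemma mp_eval_add:
  assumes "p \<in> mpolys S V" "q \<in> mpolys S V"
  shows "mp_eval R s x (p + q) = mp_eval R s x p \<oplus> mp_eval R s x q"
proof -
  let ?F = "Poly_Mapping.keys p \<union> Poly_Mapping.keys q"
  have F: "finite ?F" "\<And>m. m \<in> ?F \<Longrightarrow> Poly_Mapping.keys m \<subseteq> V"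
    using assms by (auto simp: mpolys_def)
  have c: "Poly_Mapping.lookup p m \<in> S" "Poly_Mapping.lookup q m \<in> S" for m
    using assms by (auto simp: mpolys_def)
  have "mp_eval R s x (p + q) = (\<Oplus>m\<in>?F. s (Poly_Mapping.lookup (p + q) m) \<otimes> mp_monom R x m)"
    using F assms S Poly_Mapping.keys_add[of p q] by (intro mp_eval_superset mpolys_add) auto
  also have "\<dots> = (\<Oplus>m\<in>?F. s (Poly_Mapping.lookup p m) \<otimes> mp_monom R x m \<oplus>
       s (Poly_Mapping.lookup q m) \<otimes> mp_monom R x m)"
    using F c by (intro finsum_cong') (auto simp: lookup_add s_hom l_distr)
  also have "\<dots> = (\<Oplus>m\<in>?F. s (Poly_Mapping.lookup p m) \<otimes> mp_monom R x m) \<oplus>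
      (\<Oplus>m\<in>?F. s (Poly_Mapping.lookup q m) \<otimes> mp_monom R x m)"
    using F c by (intro finsum_addf) auto
  also have "\<dots> = mp_eval R s x p \<oplus> mp_eval R s x q"
    using F assms mp_eval_superset[of p ?F] mp_eval_superset[of q ?F] by simp
  finally show ?thesis .
qed

lemma mp_eval_single:
  assumes "c \<in> S" "Poly_Mapping.keys m \<subseteq> V"
  shows "mp_eval R s x (Poly_Mapping.single m c) = s c \<otimes> mp_monom R x m"
  using assms by (cases "c = 0") (auto simp: mp_eval_def s_hom)

lemma mp_eval_mult:
  assumes p: "p \<in> mpolys S V" and q: "q \<in> mpolys S V"
  shows "mp_eval R s x (p * q) = mp_eval R s x p \<otimes> mp_eval R s x q"
proof -
  have *: "mp_eval R s x (Poly_Mapping.single m c * q) = s c \<otimes> mp_monom R x m \<otimes> mp_eval R s x q"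
    if c: "c \<in> S" and m: "Poly_Mapping.keys m \<subseteq> V" for m c
    using S q
  proof (induction rule: mpolys_induct)
    case zero
    then show ?case using c m by (simp add: mp_eval_def)
  next
    case (single n d p)
    have mn: "Poly_Mapping.keys (m + n) \<subseteq> V"
      using m single(2) Poly_Mapping.keys_add[of m n] by blast
    have cl: "Poly_Mapping.single n d \<in> mpolys S V" "Poly_Mapping.single (m + n) (c * d) \<in> mpolys S V"
      "Poly_Mapping.single m c * p \<in> mpolys S V"
      using S single(1,2,3) c m mn
      by (auto intro!: single_in_mpolys mpolys_mult simp: closed_ringD)
    have "mp_eval R s x (Poly_Mapping.single m c * (Poly_Mapping.single n d + p)) =
        mp_eval R s x (Poly_Mapping.single (m + n) (c * d)) \<oplus>
        mp_eval R s x (Poly_Mapping.single m c * p)"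
      using cl by (simp add: distrib_left mult_single mp_eval_add)
    also have "\<dots> = s c \<otimes> s d \<otimes> (mp_monom R x m \<otimes> mp_monom R x n) \<oplus>
         s c \<otimes> mp_monom R x m \<otimes> mp_eval R s x p"
      using single S c m mn by (simp add: mp_eval_single mp_monom_add s_hom closed_ringD)
    also have "\<dots> = s c \<otimes> mp_monom R x m \<otimes> (s d \<otimes> mp_monom R x n \<oplus> mp_eval R s x p)"
      using single c m by (simp add: r_distr m_ac)
    finally show ?case
      using single cl by (simp add: mp_eval_add mp_eval_single)
  qed
  show ?thesis
    using S p
  proof (induction rule: mpolys_induct)
    case zero
    then show ?case using q by (simp add: mp_eval_def[of R s x 0])
  next
    case (single m c p)
    then have "Poly_Mapping.single m c \<in> mpolys S V" using S by (intro single_in_mpolys)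
    with single q S show ?case
      by (simp add: distrib_right mp_eval_add mpolys_mult * mp_eval_single l_distr)
  qed
qed

lemma mp_eval_const: "c \<in> S \<Longrightarrow> mp_eval R s x (mp_const c) = s c"
  by (simp add: mp_const_def mp_eval_single mp_monom_def)

lemma mp_eval_var: "v \<in> V \<Longrightarrow> mp_eval R s x (mp_var v) = x v"
  using x[of v] by (simp add: mp_var_def mp_eval_single closed_ringD[OF S] mp_monom_def s_hom)

lemma mp_eval_hom: "ring_hom_cring (mpoly_ring S V) R (mp_eval R s x)"
proof (rule ring_hom_cringI')
  show "mp_eval R s x \<in> ring_hom (mpoly_ring S V) R"
    using mp_eval_const[of 1] S
    by (intro ring_hom_memI)
      (auto simp: mpoly_ring_eq mp_eval_add mp_eval_mult mp_const_def s_hom closed_ringD)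
qed (use S R.is_cring cring_mpoly_ring in auto)

end

text \<open>Monomials are treated by induction on the total degree, general polynomials by induction
  on the terms. This uniqueness half of the universal property serves below to identify composites
  of comparison maps.\<close>

lemma mpoly_hom_unique:
  assumes S: "closed_ring S" and g: "g \<in> ring_hom (mpoly_ring S V) R"
    and h: "h \<in> ring_hom (mpoly_ring S V) R" and R: "cring R"
    and const: "\<And>c. c \<in> S \<Longrightarrow> g (mp_const c) = h (mp_const c)"
    and var: "\<And>v. v \<in> V \<Longrightarrow> g (mp_var v) = h (mp_var v)"
    and p: "p \<in> carrier (mpoly_ring S V)"
  shows "g p = h p"
proof -
  interpret R: cring R by fact
  interpret g: ring_hom_cring "mpoly_ring S V" R g
    using S R g by (intro ring_hom_cringI' cring_mpoly_ring)
  interpret h: ring_hom_cring "mpoly_ring S V" R h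
    using S R h by (intro ring_hom_cringI' cring_mpoly_ring)
  note [simp] = mpoly_ring_eq
  have monom: "g (Poly_Mapping.single m 1) = h (Poly_Mapping.single m 1)"
    if "Poly_Mapping.keys m \<subseteq> V" for m
    using that
  proof (induction "\<Sum>v\<in>Poly_Mapping.keys m. Poly_Mapping.lookup m v" arbitrary: m)
    case 0
    then have "m = 0" by (simp add: poly_mapping_eqI in_keys_iff)
    then show ?case using const[of 1] closed_ringD(2)[OF S] by (simp add: mp_const_def)
  next
    case (Suc n)
    then obtain v where v: "v \<in> Poly_Mapping.keys m"
      by (metis Zero_not_Suc ex_in_conv sum.empty)
    \<comment> \<open>The exponent of v is lowered by one; the truncated subtraction is harmless
      because v occurs in m.\<close>
    define l where "l = m - Poly_Mapping.single v 1"
    have lookup: "Poly_Mapping.lookup l w = Poly_Mapping.lookup m w - (if w = v then 1 else 0)" for w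
      by (simp add: l_def lookup_minus lookup_single when_def)
    have m: "m = Poly_Mapping.single v 1 + l"
      using v by (intro poly_mapping_eqI)
        (auto simp: lookup lookup_add lookup_single when_def in_keys_iff)
    have keys: "Poly_Mapping.keys l \<subseteq> Poly_Mapping.keys m"
      by (auto simp: in_keys_iff lookup)
    have "(\<Sum>w\<in>Poly_Mapping.keys l. Poly_Mapping.lookup l w) =
       (\<Sum>w\<in>Poly_Mapping.keys m. Poly_Mapping.lookup l w)"
      by (rule sum.mono_neutral_left) (use keys in \<open>auto simp: in_keys_iff\<close>)
    also have "\<dots> = Poly_Mapping.lookup m v - 1 + (\<Sum>w\<in>Poly_Mapping.keys m - {v}. Poly_Mapping.lookup m w)"
      using v by (simp add: lookup sum.remove[of _ v])
    also have "\<dots> = n"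
      using Suc(2) v by (simp add: sum.remove[of _ v] in_keys_iff)
    finally have l: "g (Poly_Mapping.single l 1) = h (Poly_Mapping.single l 1)"
      using Suc keys by auto
    have "Poly_Mapping.single m 1 = mp_var v * Poly_Mapping.single l (1 :: 'a)"
      by (subst m) (simp add: mp_var_def mult_single)
    moreover have "mp_var v \<in> mpolys S V" "Poly_Mapping.single l 1 \<in> mpolys S V"
      using v keys Suc.prems S by (auto intro!: mp_var_closed single_in_mpolys simp: closed_ringD)
    ultimately show ?case
      using g.hom_mult[of "mp_var v" "Poly_Mapping.single l 1"]
        h.hom_mult[of "mp_var v" "Poly_Mapping.single l 1"] l var v Suc.prems by auto
  qed
  have "p \<in> mpolys S V" using p by simp
  with S show ?thesis
  proof (induction rule: mpolys_induct)
    case zero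
    then show ?case using g.hom_zero h.hom_zero by simp
  next
    case (single m c p)
    then have cl: "mp_const c \<in> mpolys S V" "Poly_Mapping.single m 1 \<in> mpolys S V"
       "Poly_Mapping.single m c \<in> mpolys S V"
      using S by (auto intro!: mp_const_closed single_in_mpolys simp: closed_ringD)
    have eq: "Poly_Mapping.single m c = mp_const c * Poly_Mapping.single m 1"
      by (simp add: mp_const_def mult_single)
    have "g (Poly_Mapping.single m c) = h (Poly_Mapping.single m c)"
      using cl single monom[of m] const[of c] g.hom_mult[of "mp_const c" "Poly_Mapping.single m 1"]
        h.hom_mult[of "mp_const c" "Poly_Mapping.single m 1"]
      unfolding eq by simp
    then show ?case
      using cl single g.hom_add[of "Poly_Mapping.single m c" p] h.hom_add[of "Poly_Mapping.single m c" p]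
      by simp
  qed
qed

subsection \<open>Commutative rings as quotients of integer polynomial rings\<close>

text \<open>Every commutative ring \<open>R\<close> is the image of the ring of integer polynomials in its own
  elements, which is a type of class \<open>comm_ring_1\<close>. Pulling back along this surjection
  makes the normalisation of ring expressions for that class available in \<open>R\<close>.\<close>

definition (in cring) pres :: "('a, int) mpoly \<Rightarrow> 'a" where
  "pres = mp_eval R (\<lambda>n. add_pow R n \<one>) (\<lambda>x. if x \<in> carrier R then x else \<zero>)"

context cring
begin

text \<open>Elements of the type outside the carrier are sent to zero, which makes the assignment of
  variables total; coefficients go through the canonical map from the integers.\<close>

lemma pres_mp_data:
  "mp_data R UNIV (\<lambda>n::int. add_pow R n \<one>) UNIV (\<lambda>x. if x \<in> carrier R then x else \<zero>)"
proof
  show "(\<lambda>n::int. add_pow R n \<one>) \<in> ring_hom (ring_of UNIV) R"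
  proof (rule ring_hom_memI, unfold ring_of_simps)
    fix m n :: int
    show "add_pow R (m * n) \<one> = add_pow R m \<one> \<otimes> add_pow R n \<one>"
      using add.int_pow_pow[of \<one> m n] by (simp add: add_pow_ldistr_int mult.commute)
    show "add_pow R (m + n) \<one> = add_pow R m \<one> \<oplus> add_pow R n \<one>"
      by (simp add: add.int_pow_mult)
  qed auto
qed auto

lemma pres_hom: "ring_hom_cring (ring_of UNIV) R pres"
proof -
  have "mpolys (UNIV :: int set) (UNIV :: 'a set) = UNIV" by (auto simp: mpolys_def)
  then show ?thesis
    using mp_data.mp_eval_hom[OF pres_mp_data] by (simp add: pres_def mpoly_ring_eq)
qed

lemma pres_simps:
  "pres p \<oplus> pres q = pres (p + q)" "pres p \<otimes> pres q = pres (p * q)" "\<zero> = pres 0" "\<one> = pres 1"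
  "\<ominus> pres p = pres (- p)" "pres p \<ominus> pres q = pres (p - q)"
proof -
  interpret h: ring_hom_cring "ring_of UNIV" R pres by (rule pres_hom)
  show "pres p \<oplus> pres q = pres (p + q)" "pres p \<otimes> pres q = pres (p * q)" "\<zero> = pres 0" "\<one> = pres 1"
    "\<ominus> pres p = pres (- p)" "pres p \<ominus> pres q = pres (p - q)"
    using h.hom_add[of p q] h.hom_mult[of p q] h.hom_zero h.hom_one h.hom_a_inv[of p]
      h.hom_a_inv[of q] h.hom_add[of p "- q"]
    by (simp_all add: a_minus_def)
qed

text \<open>An element of the carrier is the image of its own variable. Eliminating all carrier
  hypotheses this way turns a ring identity into one between integer polynomials, which
  \<open>algebra_simps\<close> decides; the long identities below follow this pattern.\<close>

lemma presE:
  assumes "a \<in> carrier R" "\<And>p. a = pres p \<Longrightarrow> P"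
  shows P
  using assms mp_data.mp_eval_var[OF pres_mp_data, of a] by (metis UNIV_I pres_def)

end

subsection \<open>Factoring homomorphisms through surjections\<close>

text \<open>First isomorphism theorem for a surjection \<open>p\<close> that need not be a quotient
  map. Two preimages of an element differ by something in the kernel of \<open>p\<close>, which
  \<open>e\<close> kills, so any choice of preimage gives the same value.\<close>

lemma ring_hom_factor:
  assumes P: "cring P" and A: "cring A" and R: "cring R"
    and p: "p \<in> ring_hom P A" "p ` carrier P = carrier A" and e: "e \<in> ring_hom P R"
    and ker: "\<And>x. x \<in> carrier P \<Longrightarrow> p x = \<zero>\<^bsub>A\<^esub> \<Longrightarrow> e x = \<zero>\<^bsub>R\<^esub>"
  obtains h where "h \<in> ring_hom A R" "\<And>x. x \<in> carrier P \<Longrightarrow> h (p x) = e x"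
proof -
  interpret p: ring_hom_cring P A p using assms by (intro ring_hom_cringI')
  interpret e: ring_hom_cring P R e using assms by (intro ring_hom_cringI')
  define h where "h y = e (SOME x. x \<in> carrier P \<and> p x = y)" for y
  have h: "h (p x) = e x" if x: "x \<in> carrier P" for x
  proof -
    define z where "z = (SOME z. z \<in> carrier P \<and> p z = p x)"
    have z: "z \<in> carrier P" "p z = p x"
      using someI[of "\<lambda>z. z \<in> carrier P \<and> p z = p x" x] x by (auto simp: z_def)
    have "p (z \<ominus>\<^bsub>P\<^esub> x) = \<zero>\<^bsub>A\<^esub>" using x z by (simp add: a_minus_def p.S.r_neg)
    then have "e z \<ominus>\<^bsub>R\<^esub> e x = \<zero>\<^bsub>R\<^esub>"
      using ker[of "z \<ominus>\<^bsub>P\<^esub> x"] x z by (simp add: a_minus_def)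
    then show ?thesis using x z by (simp add: h_def z_def)
  qed
  have "h \<in> ring_hom A R"
  proof (rule ring_hom_memI)
    fix y z assume "y \<in> carrier A" "z \<in> carrier A"
    then obtain x w where xw: "x \<in> carrier P" "p x = y" "w \<in> carrier P" "p w = z"
      using p by (metis imageE)
    show "h y \<in> carrier R" using xw h by auto
    show "h (y \<otimes>\<^bsub>A\<^esub> z) = h y \<otimes>\<^bsub>R\<^esub> h z"
      using xw h[of x] h[of w] h[of "x \<otimes>\<^bsub>P\<^esub> w"] by simp
    show "h (y \<oplus>\<^bsub>A\<^esub> z) = h y \<oplus>\<^bsub>R\<^esub> h z"
      using xw h[of x] h[of w] h[of "x \<oplus>\<^bsub>P\<^esub> w"] by simp
  next
    show "h \<one>\<^bsub>A\<^esub> = \<one>\<^bsub>R\<^esub>" using h[of "\<one>\<^bsub>P\<^esub>"] by simp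
  qed
  with h that show thesis by blast
qed

lemma (in ring_hom_cring) genideal_kernel:
  assumes F: "F \<subseteq> carrier R" "\<And>f. f \<in> F \<Longrightarrow> h f = \<zero>\<^bsub>S\<^esub>" and x: "x \<in> genideal R F"
  shows "h x = \<zero>\<^bsub>S\<^esub>"
proof -
  have "ideal (a_kernel R S h) R"
    using ring.ring_hom_ring_axioms by (rule ring_hom_ring.kernel_is_ideal)
  then have "genideal R F \<subseteq> a_kernel R S h"
  proof (rule R.genideal_minimal)
    show "F \<subseteq> a_kernel R S h" using F unfolding a_kernel_def' by blast
  qed
  with x show ?thesis unfolding a_kernel_def' by blast
qed

lemma (in ideal) coset_zero_iff:
  assumes "x \<in> carrier R"
  shows "I +> x = \<zero>\<^bsub>R Quot I\<^esub> \<longleftrightarrow> x \<in> I"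
  using assms a_rcos_const a_rcos_self by (auto simp: FactRing_def)

lemma (in ideal) coset_surj: "(+>) I ` carrier R = carrier (R Quot I)"
  by (auto simp: FactRing_simps)

lemma (in ideal) coset_eq_iff:
  assumes "x \<in> carrier R" "y \<in> carrier R"
  shows "I +> x = I +> y \<longleftrightarrow> x \<ominus> y \<in> I"
  using quotient_eq_iff_same_a_r_cos[OF ideal_axioms assms] by auto

subsection \<open>Localisation at an element\<close>

text \<open>A[X] / (1 - s X) is A[1/s], the class of X being the inverse of s. In this encoding the
  universal property comes from evaluation of polynomials, and no fractions appear.\<close>

definition loc_ideal :: "'r ring \<Rightarrow> 'r \<Rightarrow> (nat \<Rightarrow> 'r) set" where
  "loc_ideal A s = PIdl\<^bsub>UP A\<^esub> (\<one>\<^bsub>UP A\<^esub> \<ominus>\<^bsub>UP A\<^esub> up_ring.monom (UP A) s 1)"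

definition loc :: "'r ring \<Rightarrow> 'r \<Rightarrow> (nat \<Rightarrow> 'r) set ring" where
  "loc A s = UP A Quot loc_ideal A s"

definition loc_map :: "'r ring \<Rightarrow> 'r \<Rightarrow> 'r \<Rightarrow> (nat \<Rightarrow> 'r) set" where
  "loc_map A s a = loc_ideal A s +>\<^bsub>UP A\<^esub> up_ring.monom (UP A) a 0"

definition loc_inv :: "'r ring \<Rightarrow> 'r \<Rightarrow> (nat \<Rightarrow> 'r) set" where
  "loc_inv A s = loc_ideal A s +>\<^bsub>UP A\<^esub> up_ring.monom (UP A) \<one>\<^bsub>A\<^esub> 1"

locale localisation = A?: cring A for A :: "'r ring" (structure) +
  fixes s assumes s: "s \<in> carrier A"
begin

sublocale U: UP_cring A "UP A"
  by (simp add: UP_cring.intro A.is_cring) 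

lemma loc_elem_closed: "\<one>\<^bsub>UP A\<^esub> \<ominus>\<^bsub>UP A\<^esub> up_ring.monom (UP A) s 1 \<in> carrier (UP A)"
  using s by simp

sublocale I: ideal "loc_ideal A s" "UP A"
  unfolding loc_ideal_def by (intro U.P.cgenideal_ideal loc_elem_closed)

sublocale L: cring "loc A s"
  unfolding loc_def by (intro I.quotient_is_cring U.P.is_cring)

sublocale c: ring_hom_cring "UP A" "loc A s" "(+>\<^bsub>UP A\<^esub>) (loc_ideal A s)"
  using I.rcos_ring_hom_cring U.P.is_cring by (simp add: loc_def)

sublocale m: ring_hom_cring A "loc A s" "loc_map A s"
proof (rule ring_hom_cringI')
  show "loc_map A s \<in> ring_hom A (loc A s)"
  proof (rule ring_hom_memI)
    fix a b assume ab: "a \<in> carrier A" "b \<in> carrier A"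
    show "loc_map A s a \<in> carrier (loc A s)" using ab by (simp add: loc_map_def)
    have "up_ring.monom (UP A) (a \<otimes> b) (0 + 0) =
        up_ring.monom (UP A) a 0 \<otimes>\<^bsub>UP A\<^esub> up_ring.monom (UP A) b 0"
      using ab by (rule U.monom_mult)
    then show "loc_map A s (a \<otimes> b) = loc_map A s a \<otimes>\<^bsub>loc A s\<^esub> loc_map A s b"
      unfolding loc_map_def using ab by (simp del: U.monom_mult)
    show "loc_map A s (a \<oplus> b) = loc_map A s a \<oplus>\<^bsub>loc A s\<^esub> loc_map A s b"
      unfolding loc_map_def using ab by simp
  next
    have "up_ring.monom (UP A) \<one> 0 = \<one>\<^bsub>UP A\<^esub>" by (rule U.monom_one)
    then show "loc_map A s \<one> = \<one>\<^bsub>loc A s\<^esub>" unfolding loc_map_def by simp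
  qed
qed (auto simp: A.is_cring L.is_cring)

lemma loc_inv_closed: "loc_inv A s \<in> carrier (loc A s)"
  by (simp add: loc_inv_def)

lemma loc_inv: "loc_map A s s \<otimes>\<^bsub>loc A s\<^esub> loc_inv A s = \<one>\<^bsub>loc A s\<^esub>"
proof -
  have "up_ring.monom (UP A) s 0 \<otimes>\<^bsub>UP A\<^esub> up_ring.monom (UP A) \<one> 1 = up_ring.monom (UP A) s 1"
    using s U.monom_mult[of s \<one> 0 1] by simp
  then have "loc_map A s s \<otimes>\<^bsub>loc A s\<^esub> loc_inv A s = loc_ideal A s +>\<^bsub>UP A\<^esub> up_ring.monom (UP A) s 1"
    using s c.hom_mult[of "up_ring.monom (UP A) s 0" "up_ring.monom (UP A) \<one> 1"]
    by (simp add: loc_map_def loc_inv_def)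
  moreover have "\<one>\<^bsub>UP A\<^esub> \<ominus>\<^bsub>UP A\<^esub> up_ring.monom (UP A) s 1 \<in> loc_ideal A s"
    unfolding loc_ideal_def using loc_elem_closed by (rule U.P.cgenideal_self)
  then have "loc_ideal A s +>\<^bsub>UP A\<^esub> up_ring.monom (UP A) s 1 = loc_ideal A s +>\<^bsub>UP A\<^esub> \<one>\<^bsub>UP A\<^esub>"
    using s I.coset_eq_iff[of "\<one>\<^bsub>UP A\<^esub>" "up_ring.monom (UP A) s 1"] by simp
  ultimately show ?thesis using c.hom_one by simp
qed

text \<open>If a = p (1 - s X), comparing coefficients gives p_0 = a and p_(n+1) = s p_n, hence p_n
  = s^n a; as p is a polynomial, some s^n a vanishes.\<close>

lemma loc_map_zeroD:
  assumes a: "a \<in> carrier A" and 0: "loc_map A s a = \<zero>\<^bsub>loc A s\<^esub>"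
  shows "\<exists>k. s [^] (k::nat) \<otimes> a = \<zero>"
proof -
  let ?c = "up_ring.coeff (UP A)"
  have "up_ring.monom (UP A) a 0 \<in> loc_ideal A s"
    using I.coset_zero_iff[of "up_ring.monom (UP A) a 0"] a 0 by (simp add: loc_map_def loc_def)
  then obtain p where p: "p \<in> carrier (UP A)"
    and eq: "up_ring.monom (UP A) a 0 = p \<otimes>\<^bsub>UP A\<^esub> (\<one>\<^bsub>UP A\<^esub> \<ominus>\<^bsub>UP A\<^esub> up_ring.monom (UP A) s 1)"
    unfolding loc_ideal_def cgenideal_def by blast
  have "up_ring.monom (UP A) a 0 = p \<ominus>\<^bsub>UP A\<^esub> up_ring.monom (UP A) s 1 \<otimes>\<^bsub>UP A\<^esub> p"
    using eq p s by (simp add: U.P.r_distr U.P.r_minus U.P.minus_eq U.P.m_comm)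
  then have *: "?c (up_ring.monom (UP A) a 0) n = ?c p n \<ominus> ?c (up_ring.monom (UP A) s 1 \<otimes>\<^bsub>UP A\<^esub> p) n" for n
    using p s by (simp add: a_minus_def U.P.minus_eq)
  have Suc: "?c p (Suc n) = s \<otimes> ?c p n" for n
  proof -
    have "?c (up_ring.monom (UP A) s 1 \<otimes>\<^bsub>UP A\<^esub> p) (Suc n) = s \<otimes> ?c p n"
      using U.coeff_monom_mult[OF s p, of 1 n] unfolding One_nat_def add_Suc_right add_0_right .
    moreover have "?c (up_ring.monom (UP A) a 0) (Suc n) = \<zero>" using a by simp
    ultimately show ?thesis
      using *[of "Suc n"] p s A.r_right_minus_eq[of "?c p (Suc n)" "s \<otimes> ?c p n"] by auto
  qed
  have "?c (up_ring.monom (UP A) s 1 \<otimes>\<^bsub>UP A\<^esub> p) 0 = \<zero>"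
    using p s by (subst U.coeff_mult) auto
  then have "?c p 0 = a"
    using *[of 0] p s a by (simp add: a_minus_def)
  then have n: "?c p n = s [^] n \<otimes> a" for n
    by (induction n) (use a s Suc in \<open>auto simp: m_ac\<close>)
  obtain n where "bound \<zero> n (?c p)"
    using p by (auto simp: UP_def up_def)
  then have "?c p (Suc n) = \<zero>" by (auto simp: bound_def)
  with n show ?thesis by metis
qed

text \<open>The property passes to sums by taking a common denominator and holds for a X^n because X
  inverts s, hence for every polynomial in X.\<close>

lemma loc_cases:
  assumes "x \<in> carrier (loc A s)"
  shows "\<exists>n a. a \<in> carrier A \<and> x \<otimes>\<^bsub>loc A s\<^esub> loc_map A s s [^]\<^bsub>loc A s\<^esub> (n::nat) = loc_map A s a"
proof -
  let ?L = "loc A s"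
  let ?P = "\<lambda>x. \<exists>n a. a \<in> carrier A \<and> x \<otimes>\<^bsub>?L\<^esub> loc_map A s s [^]\<^bsub>?L\<^esub> (n::nat) = loc_map A s a"
  have add: "?P (x \<oplus>\<^bsub>?L\<^esub> y)" if x: "x \<in> carrier ?L" "?P x" and y: "y \<in> carrier ?L" "?P y" for x y
  proof -
    obtain n a m b where a: "a \<in> carrier A" "x \<otimes>\<^bsub>?L\<^esub> loc_map A s s [^]\<^bsub>?L\<^esub> (n::nat) = loc_map A s a"
      and b: "b \<in> carrier A" "y \<otimes>\<^bsub>?L\<^esub> loc_map A s s [^]\<^bsub>?L\<^esub> (m::nat) = loc_map A s b"
      using x y by blast
    have "(x \<oplus>\<^bsub>?L\<^esub> y) \<otimes>\<^bsub>?L\<^esub> loc_map A s s [^]\<^bsub>?L\<^esub> (n + m) =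
        (x \<otimes>\<^bsub>?L\<^esub> loc_map A s s [^]\<^bsub>?L\<^esub> n) \<otimes>\<^bsub>?L\<^esub> loc_map A s s [^]\<^bsub>?L\<^esub> m \<oplus>\<^bsub>?L\<^esub>
        (y \<otimes>\<^bsub>?L\<^esub> loc_map A s s [^]\<^bsub>?L\<^esub> m) \<otimes>\<^bsub>?L\<^esub> loc_map A s s [^]\<^bsub>?L\<^esub> n"
      using x y s by (simp add: L.l_distr L.m_ac flip: L.nat_pow_mult)
    also have "\<dots> = loc_map A s (a \<otimes> s [^] m \<oplus> b \<otimes> s [^] n)"
      using a b s by (simp add: m.hom_pow)
    finally show ?thesis using a b s by (meson A.a_closed A.m_closed A.nat_pow_closed)
  qed
  have mon: "loc_ideal A s +>\<^bsub>UP A\<^esub> up_ring.monom (UP A) a n \<in> carrier ?L \<and>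
      ?P (loc_ideal A s +>\<^bsub>UP A\<^esub> up_ring.monom (UP A) a n)" if a: "a \<in> carrier A" for a n
  proof -
    have "loc_ideal A s +>\<^bsub>UP A\<^esub> up_ring.monom (UP A) a n = loc_map A s a \<otimes>\<^bsub>?L\<^esub> loc_inv A s [^]\<^bsub>?L\<^esub> n"
    proof (induction n)
      case 0
      then show ?case using a by (simp add: loc_map_def)
    next
      case (Suc n)
      have "up_ring.monom (UP A) a (Suc n) = up_ring.monom (UP A) a n \<otimes>\<^bsub>UP A\<^esub> up_ring.monom (UP A) \<one> 1"
        using a U.monom_mult[of a \<one> n 1] by simp
      then show ?case
        using Suc a c.hom_mult[of "up_ring.monom (UP A) a n" "up_ring.monom (UP A) \<one> 1"]
        by (simp add: loc_inv_def L.m_assoc)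
    qed
    moreover have "loc_inv A s [^]\<^bsub>?L\<^esub> n \<otimes>\<^bsub>?L\<^esub> loc_map A s s [^]\<^bsub>?L\<^esub> n = \<one>\<^bsub>?L\<^esub>"
      using s loc_inv loc_inv_closed by (simp add: L.m_comm flip: L.nat_pow_distrib)
    ultimately have "(loc_ideal A s +>\<^bsub>UP A\<^esub> up_ring.monom (UP A) a n) \<otimes>\<^bsub>?L\<^esub> loc_map A s s [^]\<^bsub>?L\<^esub> n = loc_map A s a"
      using a s loc_inv_closed by (simp add: L.m_assoc)
    then show ?thesis using a by auto
  qed
  have fin: "finsum (UP A) (\<lambda>i. up_ring.monom (UP A) (up_ring.coeff (UP A) p i) i) {..n} \<in> carrier (UP A) \<and>
     ?P (loc_ideal A s +>\<^bsub>UP A\<^esub> finsum (UP A) (\<lambda>i. up_ring.monom (UP A) (up_ring.coeff (UP A) p i) i) {..n})"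
    if p: "p \<in> carrier (UP A)" for p n
  proof (induction n)
    case 0
    then show ?case using mon[of "up_ring.coeff (UP A) p 0" 0] p by simp
  next
    case (Suc n)
    let ?f = "\<lambda>i. up_ring.monom (UP A) (up_ring.coeff (UP A) p i) i"
    have cl: "finsum (UP A) ?f {..n} \<in> carrier (UP A)" "?f (Suc n) \<in> carrier (UP A)" 
      using Suc p by auto
    have eq: "finsum (UP A) ?f {..Suc n} = ?f (Suc n) \<oplus>\<^bsub>UP A\<^esub> finsum (UP A) ?f {..n}"
      using p by simp
    have "?P (loc_ideal A s +>\<^bsub>UP A\<^esub> (?f (Suc n) \<oplus>\<^bsub>UP A\<^esub> finsum (UP A) ?f {..n}))"
      unfolding c.hom_add[OF cl(2,1)]
      using Suc mon[of "up_ring.coeff (UP A) p (Suc n)" "Suc n"] p cl by (intro add) auto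
    then show ?case unfolding eq using cl by auto
  qed
  obtain p where p: "p \<in> carrier (UP A)" "x = loc_ideal A s +>\<^bsub>UP A\<^esub> p"
    using assms I.coset_surj by (auto simp: loc_def)
  show ?thesis
    using fin[OF p(1), of "deg A p"] U.up_repr[OF p(1)] p(2) by simp
qed

text \<open>Evaluation of A[X] at X = u kills 1 - s X and therefore factors through the
  quotient.\<close>

lemma loc_universal:
  assumes R: "cring R" and e: "e \<in> ring_hom A R" and u: "u \<in> carrier R" "e s \<otimes>\<^bsub>R\<^esub> u = \<one>\<^bsub>R\<^esub>"
  obtains h where "h \<in> ring_hom (loc A s) R" "\<And>a. a \<in> carrier A \<Longrightarrow> h (loc_map A s a) = e a"
proof -
  interpret R: cring R by fact
  interpret e: ring_hom_cring A R e using A.is_cring R e by (intro ring_hom_cringI')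
  interpret E: UP_pre_univ_prop A R e "UP A"
    by (intro UP_pre_univ_prop.intro e.ring_hom_cring_axioms U.UP_cring_axioms)
  interpret v: ring_hom_cring "UP A" R "eval A R e u"
    using E.eval_ring_hom[OF u(1)] by (intro ring_hom_cringI' U.P.is_cring R)
  have mon: "eval A R e u (up_ring.monom (UP A) a n) = e a \<otimes>\<^bsub>R\<^esub> u [^]\<^bsub>R\<^esub> n" if "a \<in> carrier A" for a n
    using E.eval_monom[OF that u(1)] .
  have "eval A R e u x = \<zero>\<^bsub>R\<^esub>" if x: "x \<in> carrier (UP A)" and 0: "loc_ideal A s +>\<^bsub>UP A\<^esub> x = \<zero>\<^bsub>loc A s\<^esub>" for x
  proof -
    have "x \<in> loc_ideal A s" using I.coset_zero_iff x 0 by (simp add: loc_def)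
    then obtain p where p: "p \<in> carrier (UP A)"
      and eq: "x = p \<otimes>\<^bsub>UP A\<^esub> (\<one>\<^bsub>UP A\<^esub> \<ominus>\<^bsub>UP A\<^esub> up_ring.monom (UP A) s 1)"
      unfolding loc_ideal_def cgenideal_def by blast
    have X: "eval A R e u (up_ring.monom (UP A) s 1) = \<one>\<^bsub>R\<^esub>"
      using mon[OF s, of 1] u by simp
    have "eval A R e u (\<one>\<^bsub>UP A\<^esub> \<ominus>\<^bsub>UP A\<^esub> up_ring.monom (UP A) s 1) =
        eval A R e u \<one>\<^bsub>UP A\<^esub> \<ominus>\<^bsub>R\<^esub> eval A R e u (up_ring.monom (UP A) s 1)"
      using s by (simp add: a_minus_def)
    also have "\<dots> = \<zero>\<^bsub>R\<^esub>"
      unfolding X v.hom_one by (simp add: R.r_right_minus_eq)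
    finally have "eval A R e u (\<one>\<^bsub>UP A\<^esub> \<ominus>\<^bsub>UP A\<^esub> up_ring.monom (UP A) s 1) = \<zero>\<^bsub>R\<^esub>" .
    then show ?thesis
      unfolding eq v.hom_mult[OF p loc_elem_closed] using v.hom_closed[OF p] by (simp only: R.r_null)
  qed
  then obtain h where h: "h \<in> ring_hom (loc A s) R"
      "\<And>x. x \<in> carrier (UP A) \<Longrightarrow> h (loc_ideal A s +>\<^bsub>UP A\<^esub> x) = eval A R e u x"
    using ring_hom_factor[of "UP A" "loc A s" R "(+>\<^bsub>UP A\<^esub>) (loc_ideal A s)" "eval A R e u"]
      U.P.is_cring L.is_cring R c.homh I.coset_surj v.homh
    by (metis loc_def)
  show thesis
    using h mon[of _ 0] by (intro that[of h]) (auto simp: loc_map_def)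
qed

end

subsection \<open>Hermitian forms with a trace form\<close>

text \<open>Cofactor expansion along the first row, suited to polynomial identities;
  \<open>mat_det_det3\<close> connects it with the Leibniz formula.\<close>

definition det3 :: "('t, 'x) ring_scheme \<Rightarrow> (3 \<Rightarrow> 3 \<Rightarrow> 't) \<Rightarrow> 't" where
  "det3 T g =
     g 1 1 \<otimes>\<^bsub>T\<^esub> (g 2 2 \<otimes>\<^bsub>T\<^esub> g 3 3 \<ominus>\<^bsub>T\<^esub> g 2 3 \<otimes>\<^bsub>T\<^esub> g 3 2) \<oplus>\<^bsub>T\<^esub>
     g 1 2 \<otimes>\<^bsub>T\<^esub> (g 2 3 \<otimes>\<^bsub>T\<^esub> g 3 1 \<ominus>\<^bsub>T\<^esub> g 2 1 \<otimes>\<^bsub>T\<^esub> g 3 3) \<oplus>\<^bsub>T\<^esub>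
     g 1 3 \<otimes>\<^bsub>T\<^esub> (g 2 1 \<otimes>\<^bsub>T\<^esub> g 3 2 \<ominus>\<^bsub>T\<^esub> g 2 2 \<otimes>\<^bsub>T\<^esub> g 3 1)"

context cring
begin

abbreviation vec :: "(3 \<Rightarrow> 'a) \<Rightarrow> bool" where
  "vec v \<equiv> \<forall>i. v i \<in> carrier R"

abbreviation mat :: "(3 \<Rightarrow> 3 \<Rightarrow> 'a) \<Rightarrow> bool" where
  "mat g \<equiv> \<forall>i j. g i j \<in> carrier R"

end

definition col :: "(3 \<Rightarrow> 3 \<Rightarrow> 't) \<Rightarrow> 3 \<Rightarrow> 3 \<Rightarrow> 't" where
  "col g j = (\<lambda>i. g i j)"

definition cols :: "(3 \<Rightarrow> 't) \<Rightarrow> (3 \<Rightarrow> 't) \<Rightarrow> (3 \<Rightarrow> 't) \<Rightarrow> 3 \<Rightarrow> 3 \<Rightarrow> 't" where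
  "cols u v w = (\<lambda>i j. if j = 1 then u i else if j = 2 then v i else w i)"

definition vec3 :: "'t \<Rightarrow> 't \<Rightarrow> 't \<Rightarrow> 3 \<Rightarrow> 't" where
  "vec3 x y z = (\<lambda>i. if i = 1 then x else if i = 2 then y else z)"

lemma index3: "(1::3) \<noteq> 2" "(2::3) \<noteq> 1" "(1::3) \<noteq> 3" "(3::3) \<noteq> 1" "(2::3) \<noteq> 3" "(3::3) \<noteq> 2"
  by simp_all

lemma UNIV3: "(UNIV :: 3 set) = {1, 2, 3}"
proof -
  have "i \<in> {1, 2, 3}" for i :: 3
  proof (cases i)
    case (of_int z)
    then have "z = 0 \<or> z = 1 \<or> z = 2" by auto
    moreover have "of_int 0 = (3 :: 3)" by simp
    ultimately show ?thesis using of_int by auto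
  qed
  then show ?thesis by blast
qed

lemma all3: "(\<forall>i::3. P i) \<longleftrightarrow> P 1 \<and> P 2 \<and> P 3"
  using UNIV3 by (metis UNIV_I insertE singletonD)

lemma vec3_simps [simp]: "vec3 x y z 1 = x" "vec3 x y z 2 = y" "vec3 x y z 3 = z"
  by (simp_all add: vec3_def del: one_neq_zero)

lemma cols_simps [simp]: "cols u v w i 1 = u i" "cols u v w i 2 = v i" "cols u v w i 3 = w i"
  "col (cols u v w) 1 = u" "col (cols u v w) 2 = v" "col (cols u v w) 3 = w"
  by (simp_all add: cols_def col_def)

lemma cols_col [simp]: "cols (col g 1) (col g 2) (col g 3) = g"
proof -
  have "\<forall>j. cols (col g 1) (col g 2) (col g 3) i j = g i j" for i
    unfolding all3 by (simp add: col_def)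
  then show ?thesis by blast
qed

lemma vec_eqI: "v 1 = w 1 \<Longrightarrow> v 2 = w 2 \<Longrightarrow> v 3 = w 3 \<Longrightarrow> v = (w :: 3 \<Rightarrow> 't)"
  using all3[of "\<lambda>i. v i = w i"] by blast

lemma (in cring) det3_closed [simp]: "mat g \<Longrightarrow> det3 R g \<in> carrier R"
  by (simp add: det3_def)

text \<open>An abstract quadratic algebra with conjugation \<open>cj\<close>, base ring
  \<open>Rs\<close> and divided trace \<open>tr\<close>. As b may be a zero divisor, or even zero,
  \<open>b_tr\<close> does not determine \<open>tr\<close>; the rules \<open>tr_add\<close>,
  \<open>tr_cj\<close> and \<open>tr_mult\<close> record the properties that cannot be recovered by
  dividing by b.\<close>

locale trace_ring = T?: cring T for T :: "'t ring" (structure) +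
  fixes cj tr :: "'t \<Rightarrow> 't" and b :: 't and Rs :: "'t set"
  assumes cj_hom: "cj \<in> ring_hom T T"
    and cj_cj [simp]: "x \<in> carrier T \<Longrightarrow> cj (cj x) = x"
    and Rs_carrier [simp]: "r \<in> Rs \<Longrightarrow> r \<in> carrier T"
    and Rs_add [simp]: "r \<in> Rs \<Longrightarrow> r' \<in> Rs \<Longrightarrow> r \<oplus> r' \<in> Rs"
    and b_Rs [simp]: "b \<in> Rs"
    and tr_Rs [simp]: "x \<in> carrier T \<Longrightarrow> tr x \<in> Rs"
    and norm_Rs [simp]: "x \<in> carrier T \<Longrightarrow> x \<otimes> cj x \<in> Rs"
    and cj_Rs [simp]: "r \<in> Rs \<Longrightarrow> cj r = r"
    and tr_add: "x \<in> carrier T \<Longrightarrow> y \<in> carrier T \<Longrightarrow> tr (x \<oplus> y) = tr x \<oplus> tr y"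
    and tr_cj: "x \<in> carrier T \<Longrightarrow> tr (cj x) = tr x"
    and tr_mult: "r \<in> Rs \<Longrightarrow> x \<in> carrier T \<Longrightarrow> tr (r \<otimes> x) = r \<otimes> tr x"
    and b_tr: "x \<in> carrier T \<Longrightarrow> b \<otimes> tr x = x \<oplus> cj x"
begin

sublocale cj: ring_hom_cring T T cj
  using T.is_cring cj_hom by (intro ring_hom_cringI')

lemma cj_minus [simp]: "x \<in> carrier T \<Longrightarrow> y \<in> carrier T \<Longrightarrow> cj (x \<ominus> y) = cj x \<ominus> cj y"
  by (simp add: a_minus_def)

lemma tr_closed [simp]: "x \<in> carrier T \<Longrightarrow> tr x \<in> carrier T"
  by simp

lemma tr_zero [simp]: "tr \<zero> = \<zero>"
  using tr_add[of \<zero> \<zero>] T.add.l_cancel_one[of "tr \<zero>" "tr \<zero>"] by simp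

lemma tr_uminus: "x \<in> carrier T \<Longrightarrow> tr (\<ominus> x) = \<ominus> tr x"
  using tr_add[of "\<ominus> x" x] by (intro T.minus_equality[symmetric]) (simp_all add: T.l_neg)

text \<open>The sesquilinear form with Gram matrix antidiag(1, b, 1), conjugate linear in the first
  argument.\<close>

definition herm :: "(3 \<Rightarrow> 't) \<Rightarrow> (3 \<Rightarrow> 't) \<Rightarrow> 't" where
  "herm v w = cj (v 3) \<otimes> w 1 \<oplus> b \<otimes> (cj (v 2) \<otimes> w 2) \<oplus> cj (v 1) \<otimes> w 3"

definition qf :: "(3 \<Rightarrow> 't) \<Rightarrow> 't" where
  "qf v = tr (cj (v 3) \<otimes> v 1) \<oplus> v 2 \<otimes> cj (v 2)"

text \<open>Isotropy under \<open>qf\<close> replaces the pairings of the outer columns with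
  themselves, conjugation supplies the pairings in the other order, and the pairing of the middle
  column with itself follows from the rest by \<open>qf_middle\<close>.\<close>

definition unitary :: "(3 \<Rightarrow> 3 \<Rightarrow> 't) \<Rightarrow> bool" where
  "unitary g \<longleftrightarrow> mat g \<and> det3 T g = \<one> \<and> qf (col g 1) = \<zero> \<and> qf (col g 3) = \<zero> \<and>
     herm (col g 3) (col g 1) = \<one> \<and> herm (col g 1) (col g 2) = \<zero> \<and> herm (col g 3) (col g 2) = \<zero>"

lemma herm_closed [simp]: "vec v \<Longrightarrow> vec w \<Longrightarrow> herm v w \<in> carrier T"
  by (simp add: herm_def)

lemma qf_Rs [simp]: "vec v \<Longrightarrow> qf v \<in> Rs"
  by (simp add: qf_def)

lemma qf_closed [simp]: "vec v \<Longrightarrow> qf v \<in> carrier T"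
  by simp

lemma vec_col [simp]: "mat g \<Longrightarrow> vec (col g j)"
  by (simp add: col_def)

lemma cj_herm: "vec v \<Longrightarrow> vec w \<Longrightarrow> cj (herm v w) = herm w v"
  by (simp add: herm_def T.m_ac T.a_ac)

lemma b_qf: 
  assumes "vec v"
  shows "b \<otimes> qf v = herm v v"
proof -
  have "b \<otimes> qf v = b \<otimes> tr (cj (v 3) \<otimes> v 1) \<oplus> b \<otimes> (v 2 \<otimes> cj (v 2))"
    using assms by (simp add: qf_def T.r_distr)
  also have "\<dots> = herm v v"
    using assms by (simp add: b_tr herm_def T.m_ac T.a_ac)
  finally show ?thesis .
qed

lemma tr_b: "x \<in> carrier T \<Longrightarrow> tr (b \<otimes> x) = x \<oplus> cj x"
  by (simp add: tr_mult b_tr)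

lemma herm_add_right:
  assumes "vec u" "vec v" "vec w" "x \<in> carrier T"
  shows "herm u (\<lambda>i. v i \<oplus> w i \<otimes> x) = herm u v \<oplus> herm u w \<otimes> x"
proof -
  have *: "p \<otimes> (v1 \<oplus> w1 \<otimes> x) \<oplus> b \<otimes> (q \<otimes> (v2 \<oplus> w2 \<otimes> x)) \<oplus> r \<otimes> (v3 \<oplus> w3 \<otimes> x) =
     p \<otimes> v1 \<oplus> b \<otimes> (q \<otimes> v2) \<oplus> r \<otimes> v3 \<oplus> (p \<otimes> w1 \<oplus> b \<otimes> (q \<otimes> w2) \<oplus> r \<otimes> w3) \<otimes> x"
    if "p \<in> carrier T" "q \<in> carrier T" "r \<in> carrier T" "v1 \<in> carrier T" "v2 \<in> carrier T" "v3 \<in> carrier T"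
     "w1 \<in> carrier T" "w2 \<in> carrier T" "w3 \<in> carrier T" "x \<in> carrier T" "b \<in> carrier T"
    for p q r v1 v2 v3 w1 w2 w3 x b
    using that by (elim presE) (simp only: pres_simps, rule arg_cong[where f = pres], simp add: algebra_simps)
  show ?thesis unfolding herm_def using assms by (intro *) auto
qed

lemma herm_scale_right:
  assumes "vec u" "vec w" "x \<in> carrier T"
  shows "herm u (\<lambda>i. w i \<otimes> x) = herm u w \<otimes> x"
  using herm_add_right[of u "\<lambda>_. \<zero>" w x] assms by (simp add: herm_def)

text \<open>The polar form of \<open>qf\<close> is \<open>tr\<close> applied to \<open>herm\<close>:
  the middle coordinate of \<open>herm\<close> carries a factor b, and
  \<open>tr (b \<otimes> d) = d \<oplus> cj d\<close> is exactly the cross term of the norm.\<close>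

lemma qf_add:
  assumes v: "vec v" and w: "vec w" and x: "x \<in> carrier T"
  shows "qf (\<lambda>i. v i \<oplus> w i \<otimes> x) = qf v \<oplus> tr (herm v w \<otimes> x) \<oplus> x \<otimes> cj x \<otimes> qf w"
proof -
  note [simp] = v[rule_format] w[rule_format] x
  let ?c = "cj (v 3) \<otimes> w 1 \<otimes> x" and ?d = "cj (v 2) \<otimes> w 2 \<otimes> x" and ?e = "cj (v 1) \<otimes> w 3 \<otimes> x"
  have "cj (v 3 \<oplus> w 3 \<otimes> x) \<otimes> (v 1 \<oplus> w 1 \<otimes> x) =
     cj (v 3) \<otimes> v 1 \<oplus> ?c \<oplus> cj ?e \<oplus> x \<otimes> cj x \<otimes> (cj (w 3) \<otimes> w 1)"
    by (simp add: T.l_distr T.r_distr T.m_ac T.a_ac)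
  then have t: "tr (cj (v 3 \<oplus> w 3 \<otimes> x) \<otimes> (v 1 \<oplus> w 1 \<otimes> x)) =
     tr (cj (v 3) \<otimes> v 1) \<oplus> tr ?c \<oplus> tr ?e \<oplus> x \<otimes> cj x \<otimes> tr (cj (w 3) \<otimes> w 1)"
    by (simp add: tr_add tr_cj[of ?e] tr_mult del: cj.hom_mult)
  have "herm v w \<otimes> x = ?c \<oplus> b \<otimes> ?d \<oplus> ?e"
    by (simp add: herm_def T.l_distr T.m_assoc)
  then have h: "tr (herm v w \<otimes> x) = tr ?c \<oplus> (?d \<oplus> cj ?d) \<oplus> tr ?e"
    by (simp add: tr_add tr_b del: cj.hom_mult)
  have n: "(v 2 \<oplus> w 2 \<otimes> x) \<otimes> cj (v 2 \<oplus> w 2 \<otimes> x) =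
     v 2 \<otimes> cj (v 2) \<oplus> (?d \<oplus> cj ?d) \<oplus> x \<otimes> cj x \<otimes> (w 2 \<otimes> cj (w 2))"
    by (simp add: T.l_distr T.r_distr T.m_ac T.a_ac)
  have cl: "tr (cj (v 3) \<otimes> v 1) \<in> carrier T" "tr ?c \<in> carrier T" "tr ?e \<in> carrier T"
    "tr (cj (w 3) \<otimes> w 1) \<in> carrier T" "?d \<oplus> cj ?d \<in> carrier T" "v 2 \<otimes> cj (v 2) \<in> carrier T"
    "w 2 \<otimes> cj (w 2) \<in> carrier T" "x \<otimes> cj x \<in> carrier T"
    by simp_all
  show ?thesis
    unfolding qf_def t h n using cl
    by (simp only: T.r_distr T.a_ac T.a_closed T.m_closed)
qed

lemma qf_scale:
  assumes "vec w" "x \<in> carrier T"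
  shows "qf (\<lambda>i. w i \<otimes> x) = x \<otimes> cj x \<otimes> qf w"
  using qf_add[of "\<lambda>_. \<zero>" w x] assms by (simp add: qf_def herm_def)

lemma unitary_herm:
  assumes "unitary g"
  shows "herm (col g 1) (col g 1) = \<zero>" "herm (col g 3) (col g 3) = \<zero>"
    "herm (col g 1) (col g 3) = \<one>" "herm (col g 2) (col g 1) = \<zero>" "herm (col g 2) (col g 3) = \<zero>"
proof -
  have g [simp]: "vec (col g j)" for j using assms by (simp add: unitary_def)
  show "herm (col g 1) (col g 1) = \<zero>" "herm (col g 3) (col g 3) = \<zero>"
    using assms by (simp_all add: unitary_def flip: b_qf)
  show "herm (col g 1) (col g 3) = \<one>"
    by (subst cj_herm[symmetric]) (use assms in \<open>auto simp: unitary_def\<close>)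
  show "herm (col g 2) (col g 1) = \<zero>" "herm (col g 2) (col g 3) = \<zero>"
    by (subst cj_herm[symmetric]; use assms in \<open>auto simp: unitary_def\<close>)+
qed

end

section \<open>Determinant identities in rank three\<close>

context cring
begin

text \<open>Nine separate arguments, so that every entry is a variable to which \<open>presE\<close>
  applies.\<close>

definition det9 :: "'a \<Rightarrow> 'a \<Rightarrow> 'a \<Rightarrow> 'a \<Rightarrow> 'a \<Rightarrow> 'a \<Rightarrow> 'a \<Rightarrow> 'a \<Rightarrow> 'a \<Rightarrow> 'a" where
  "det9 a1 a2 a3 b1 b2 b3 c1 c2 c3 =
     a1 \<otimes> (b2 \<otimes> c3 \<ominus> b3 \<otimes> c2) \<oplus> a2 \<otimes> (b3 \<otimes> c1 \<ominus> b1 \<otimes> c3) \<oplus> a3 \<otimes> (b1 \<otimes> c2 \<ominus> b2 \<otimes> c1)"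

lemma det3_det9:
  "det3 R g = det9 (g 1 1) (g 1 2) (g 1 3) (g 2 1) (g 2 2) (g 2 3) (g 3 1) (g 3 2) (g 3 3)"
  by (simp add: det3_def det9_def)

text \<open>The identity (r M) adj M = r det M, one coordinate at a time.\<close>

lemma cramer_rows:
  assumes [simp]: "a1 \<in> carrier R" "a2 \<in> carrier R" "a3 \<in> carrier R" "b1 \<in> carrier R" "b2 \<in> carrier R"
    "b3 \<in> carrier R" "c1 \<in> carrier R" "c2 \<in> carrier R" "c3 \<in> carrier R"
    and r: "r1 \<in> carrier R" "r2 \<in> carrier R" "r3 \<in> carrier R"
  shows
   "(r1 \<otimes> a1 \<oplus> r2 \<otimes> b1 \<oplus> r3 \<otimes> c1) \<otimes> (b2 \<otimes> c3 \<ominus> b3 \<otimes> c2) \<oplus>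
    (r1 \<otimes> a2 \<oplus> r2 \<otimes> b2 \<oplus> r3 \<otimes> c2) \<otimes> (b3 \<otimes> c1 \<ominus> b1 \<otimes> c3) \<oplus>
    (r1 \<otimes> a3 \<oplus> r2 \<otimes> b3 \<oplus> r3 \<otimes> c3) \<otimes> (b1 \<otimes> c2 \<ominus> b2 \<otimes> c1) = r1 \<otimes> det9 a1 a2 a3 b1 b2 b3 c1 c2 c3"
   "(r1 \<otimes> a1 \<oplus> r2 \<otimes> b1 \<oplus> r3 \<otimes> c1) \<otimes> (a3 \<otimes> c2 \<ominus> a2 \<otimes> c3) \<oplus>
    (r1 \<otimes> a2 \<oplus> r2 \<otimes> b2 \<oplus> r3 \<otimes> c2) \<otimes> (a1 \<otimes> c3 \<ominus> a3 \<otimes> c1) \<oplus>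
    (r1 \<otimes> a3 \<oplus> r2 \<otimes> b3 \<oplus> r3 \<otimes> c3) \<otimes> (a2 \<otimes> c1 \<ominus> a1 \<otimes> c2) = r2 \<otimes> det9 a1 a2 a3 b1 b2 b3 c1 c2 c3"
   "(r1 \<otimes> a1 \<oplus> r2 \<otimes> b1 \<oplus> r3 \<otimes> c1) \<otimes> (a2 \<otimes> b3 \<ominus> a3 \<otimes> b2) \<oplus>
    (r1 \<otimes> a2 \<oplus> r2 \<otimes> b2 \<oplus> r3 \<otimes> c2) \<otimes> (a3 \<otimes> b1 \<ominus> a1 \<otimes> b3) \<oplus>
    (r1 \<otimes> a3 \<oplus> r2 \<otimes> b3 \<oplus> r3 \<otimes> c3) \<otimes> (a1 \<otimes> b2 \<ominus> a2 \<otimes> b1) = r3 \<otimes> det9 a1 a2 a3 b1 b2 b3 c1 c2 c3"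
  using assms unfolding det9_def
  by (elim presE, simp only: pres_simps, intro arg_cong[where f = pres], simp add: algebra_simps)+

text \<open>Jacobi's identity: a two by two minor of the adjugate is the complementary entry times
  the determinant.\<close>

lemma adjugate_minor:
  assumes "a1 \<in> carrier R" "a2 \<in> carrier R" "a3 \<in> carrier R" "b1 \<in> carrier R" "b2 \<in> carrier R"
    "b3 \<in> carrier R" "c1 \<in> carrier R" "c2 \<in> carrier R" "c3 \<in> carrier R"
  shows "(a1 \<otimes> b2 \<ominus> a2 \<otimes> b1) \<otimes> (b2 \<otimes> c3 \<ominus> b3 \<otimes> c2) \<ominus> (a2 \<otimes> b3 \<ominus> a3 \<otimes> b2) \<otimes> (b1 \<otimes> c2 \<ominus> b2 \<otimes> c1) =
     b2 \<otimes> det9 a1 a2 a3 b1 b2 b3 c1 c2 c3"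
  using assms unfolding det9_def
  by (elim presE) (simp only: pres_simps, rule arg_cong[where f = pres], simp add: algebra_simps)

lemma det9_middle:
  assumes "a1 \<in> carrier R" "a2 \<in> carrier R" "a3 \<in> carrier R" "b1 \<in> carrier R" "b2 \<in> carrier R"
    "b3 \<in> carrier R" "c1 \<in> carrier R" "c2 \<in> carrier R" "c3 \<in> carrier R"
  shows "a2 \<otimes> (b3 \<otimes> c1 \<ominus> b1 \<otimes> c3) \<oplus> b2 \<otimes> (a1 \<otimes> c3 \<ominus> a3 \<otimes> c1) \<oplus> c2 \<otimes> (a3 \<otimes> b1 \<ominus> a1 \<otimes> b3) =
     det9 a1 a2 a3 b1 b2 b3 c1 c2 c3"
  using assms unfolding det9_def
  by (elim presE) (simp only: pres_simps, rule arg_cong[where f = pres], simp add: algebra_simps)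

text \<open>Reflection in the anti-diagonal preserves the determinant; the middle column of the
  reflected matrix is moreover scaled by b.\<close>

lemma det9_reflect:
  assumes "a1 \<in> carrier R" "a2 \<in> carrier R" "a3 \<in> carrier R" "b1 \<in> carrier R" "b2 \<in> carrier R"
    "b3 \<in> carrier R" "c1 \<in> carrier R" "c2 \<in> carrier R" "c3 \<in> carrier R" "b \<in> carrier R"
  shows "det9 c3 (b \<otimes> b3) a3 c2 (b \<otimes> b2) a2 c1 (b \<otimes> b1) a1 = b \<otimes> det9 a1 a2 a3 b1 b2 b3 c1 c2 c3"
  using assms unfolding det9_def
  by (elim presE) (simp only: pres_simps, rule arg_cong[where f = pres], simp add: algebra_simps)

text \<open>In rank three the adjugate has determinant (det M)^2; here its middle row is scaled by
  t.\<close>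

lemma det9_adjugate:
  assumes "a1 \<in> carrier R" "a2 \<in> carrier R" "a3 \<in> carrier R" "b1 \<in> carrier R" "b2 \<in> carrier R"
    "b3 \<in> carrier R" "c1 \<in> carrier R" "c2 \<in> carrier R" "c3 \<in> carrier R" "t \<in> carrier R"
  shows "det9 (b2 \<otimes> c3 \<ominus> b3 \<otimes> c2) (a3 \<otimes> c2 \<ominus> a2 \<otimes> c3) (a2 \<otimes> b3 \<ominus> a3 \<otimes> b2)
       (t \<otimes> (b3 \<otimes> c1 \<ominus> b1 \<otimes> c3)) (t \<otimes> (a1 \<otimes> c3 \<ominus> a3 \<otimes> c1)) (t \<otimes> (a3 \<otimes> b1 \<ominus> a1 \<otimes> b3))
       (b1 \<otimes> c2 \<ominus> b2 \<otimes> c1) (a2 \<otimes> c1 \<ominus> a1 \<otimes> c2) (a1 \<otimes> b2 \<ominus> a2 \<otimes> b1) =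
     t \<otimes> (det9 a1 a2 a3 b1 b2 b3 c1 c2 c3 \<otimes> det9 a1 a2 a3 b1 b2 b3 c1 c2 c3)"
  using assms unfolding det9_def
  by (elim presE) (simp only: pres_simps, rule arg_cong[where f = pres], simp add: algebra_simps)

lemma det3_cols_scale:
  assumes "vec u" "vec v" "vec w" "x \<in> carrier R"
  shows "det3 R (cols u (\<lambda>i. v i \<otimes> x) w) = det3 R (cols u v w) \<otimes> x"
proof -
  have *: "det9 u1 (v1 \<otimes> x) w1 u2 (v2 \<otimes> x) w2 u3 (v3 \<otimes> x) w3 = det9 u1 v1 w1 u2 v2 w2 u3 v3 w3 \<otimes> x"
    if "u1 \<in> carrier R" "u2 \<in> carrier R" "u3 \<in> carrier R" "v1 \<in> carrier R" "v2 \<in> carrier R" "v3 \<in> carrier R"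
     "w1 \<in> carrier R" "w2 \<in> carrier R" "w3 \<in> carrier R" "x \<in> carrier R"
    for u1 u2 u3 v1 v2 v3 w1 w2 w3 x
    using that unfolding det9_def
    by (elim presE) (simp only: pres_simps, rule arg_cong[where f = pres], simp add: algebra_simps)
  show ?thesis unfolding det3_det9 cols_simps using assms by (intro *) auto
qed

end

lemma (in ring_hom_cring) hom_det3:
  assumes "R.mat g"
  shows "h (det3 R g) = det3 S (\<lambda>i j. h (g i j))"
  using assms by (simp add: det3_def a_minus_def)

section \<open>The value of the quadratic form on the middle column\<close>

context trace_ring
begin

lemma cj_det3: "mat g \<Longrightarrow> cj (det3 T g) = det3 T (\<lambda>i j. cj (g i j))"
  by (rule cj.hom_det3)

lemma unitary_cols:
  "unitary (cols u v w) \<longleftrightarrow> vec u \<and> vec v \<and> vec w \<and> det3 T (cols u v w) = \<one> \<and>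
     qf u = \<zero> \<and> qf w = \<zero> \<and> herm w u = \<one> \<and> herm u v = \<zero> \<and> herm w v = \<zero>"
proof -
  have "mat (cols u v w) \<longleftrightarrow> vec u \<and> vec v \<and> vec w"
    by (simp add: all3 cols_def[abs_def] del: cols_simps) (auto simp: all3)
  then show ?thesis by (simp add: unitary_def)
qed

text \<open>The row (cj v_3, b cj v_2, cj v_1) times g is the row of pairings of v with the columns
  of g, and Cramer's rule recovers it since det g = 1. Only b cj v_2 is recovered, not cj v_2
  itself; this is the difficulty in \<open>qf_middle\<close>.\<close>

lemma herm_cramer:
  assumes v: "vec v" and g: "mat g" "det3 T g = \<one>"
  shows
   "cj (v 3) = herm v (col g 1) \<otimes> (g 2 2 \<otimes> g 3 3 \<ominus> g 2 3 \<otimes> g 3 2) \<oplus>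
      herm v (col g 2) \<otimes> (g 2 3 \<otimes> g 3 1 \<ominus> g 2 1 \<otimes> g 3 3) \<oplus>
      herm v (col g 3) \<otimes> (g 2 1 \<otimes> g 3 2 \<ominus> g 2 2 \<otimes> g 3 1)" (is ?A)
   "b \<otimes> cj (v 2) = herm v (col g 1) \<otimes> (g 1 3 \<otimes> g 3 2 \<ominus> g 1 2 \<otimes> g 3 3) \<oplus>
      herm v (col g 2) \<otimes> (g 1 1 \<otimes> g 3 3 \<ominus> g 1 3 \<otimes> g 3 1) \<oplus>
      herm v (col g 3) \<otimes> (g 1 2 \<otimes> g 3 1 \<ominus> g 1 1 \<otimes> g 3 2)" (is ?B)
   "cj (v 1) = herm v (col g 1) \<otimes> (g 1 2 \<otimes> g 2 3 \<ominus> g 1 3 \<otimes> g 2 2) \<oplus>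
      herm v (col g 2) \<otimes> (g 1 3 \<otimes> g 2 1 \<ominus> g 1 1 \<otimes> g 2 3) \<oplus>
      herm v (col g 3) \<otimes> (g 1 1 \<otimes> g 2 2 \<ominus> g 1 2 \<otimes> g 2 1)" (is ?C)
proof -
  have r: "cj (v 3) \<in> carrier T" "b \<otimes> cj (v 2) \<in> carrier T" "cj (v 1) \<in> carrier T"
    using v by simp_all
  have h: "cj (v 3) \<otimes> g 1 j \<oplus> b \<otimes> cj (v 2) \<otimes> g 2 j \<oplus> cj (v 1) \<otimes> g 3 j = herm v (col g j)" for j
    using v g by (simp add: herm_def col_def T.m_assoc)
  note c = T.cramer_rows[of "g 1 1" "g 1 2" "g 1 3" "g 2 1" "g 2 2" "g 2 3" "g 3 1" "g 3 2" "g 3 3",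
      OF _ _ _ _ _ _ _ _ _ r, unfolded h, folded T.det3_det9, unfolded g(2)]
  show ?A ?B ?C using c g v by simp_all
qed

text \<open>Comparing determinants only yields b q = b, where q is the value sought, and b cannot be
  cancelled. But the outer entries of the middle column are multiples of b q, so q disappears from
  them, and the expansion of det g along the middle column turns into the formula for q.\<close>

theorem qf_middle:
  assumes "unitary g"
  shows "qf (col g 2) = \<one>"
proof -
  have g: "mat g" and det: "det3 T g = \<one>" and q: "qf (col g 1) = \<zero>" "qf (col g 3) = \<zero>"
    and h: "herm (col g 3) (col g 1) = \<one>" "herm (col g 1) (col g 2) = \<zero>" "herm (col g 3) (col g 2) = \<zero>"
    using assms by (auto simp: unitary_def)
  note [simp] = g[rule_format]
  note h' = unitary_herm[OF assms]
  define q where "q = qf (col g 2)"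
  have qRs [simp]: "q \<in> Rs" and qb: "herm (col g 2) (col g 2) = b \<otimes> q"
    using g b_qf[of "col g 2"] by (simp_all add: q_def)
  define p m r where "p = g 2 3 \<otimes> g 3 1 \<ominus> g 2 1 \<otimes> g 3 3"
    and "m = g 1 1 \<otimes> g 3 3 \<ominus> g 1 3 \<otimes> g 3 1" and "r = g 1 3 \<otimes> g 2 1 \<ominus> g 1 1 \<otimes> g 2 3"
  have [simp]: "p \<in> carrier T" "m \<in> carrier T" "r \<in> carrier T"
    by (simp_all add: p_def m_def r_def)
  note c = herm_cramer[OF vec_col[OF g] g det, unfolded col_def]
  have r1: "cj (g 3 1) = g 2 1 \<otimes> g 3 2 \<ominus> g 2 2 \<otimes> g 3 1"
      "b \<otimes> cj (g 2 1) = g 1 2 \<otimes> g 3 1 \<ominus> g 1 1 \<otimes> g 3 2"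
      "cj (g 1 1) = g 1 1 \<otimes> g 2 2 \<ominus> g 1 2 \<otimes> g 2 1"
    using c[of 1] h h' by (simp_all add: col_def)
  have r3: "cj (g 3 3) = g 2 2 \<otimes> g 3 3 \<ominus> g 2 3 \<otimes> g 3 2"
      "b \<otimes> cj (g 2 3) = g 1 3 \<otimes> g 3 2 \<ominus> g 1 2 \<otimes> g 3 3"
      "cj (g 1 3) = g 1 2 \<otimes> g 2 3 \<ominus> g 1 3 \<otimes> g 2 2"
    using c[of 3] h h' by (simp_all add: col_def)
  have r2: "cj (g 3 2) = b \<otimes> q \<otimes> p" "b \<otimes> cj (g 2 2) = b \<otimes> q \<otimes> m" "cj (g 1 2) = b \<otimes> q \<otimes> r"
    using c[of 2] h' qb by (simp_all add: col_def p_def m_def r_def)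
  \<comment> \<open>Cramer's rule only gives
    \<open>b \<otimes> cj (g 2 2) = b \<otimes> q \<otimes> m\<close>, where b cannot be removed;
    Jacobi's identity reaches m directly.\<close>
  have "cj m = g 2 2"
    using T.adjugate_minor[of "g 1 1" "g 1 2" "g 1 3" "g 2 1" "g 2 2" "g 2 3" "g 3 1" "g 3 2" "g 3 3"]
      det by (simp add: m_def r1 r3 T.det3_det9)
  then have m: "m = cj (g 2 2)" using cj_cj[of m] by simp
  have a: "g 1 2 = b \<otimes> q \<otimes> cj r" "g 3 2 = b \<otimes> q \<otimes> cj p"
    using r2(1,3)[THEN arg_cong[where f = cj]] by simp_all
  \<comment> \<open>By Cramer's rule, the reflected conjugate of g with middle column scaled by b is
    the adjugate of g with middle row scaled by b q.\<close>
  have "b \<otimes> det3 T (\<lambda>i j. cj (g i j)) = b \<otimes> q \<otimes> (det3 T g \<otimes> det3 T g)"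
    unfolding T.det3_det9
    by (subst T.det9_reflect[symmetric], simp_all only: cj.hom_closed g T.det9_adjugate[symmetric] b_Rs Rs_carrier qRs T.m_closed)
      (simp only: r1 r2 r3 p_def m_def r_def)
  moreover have "det3 T (\<lambda>i j. cj (g i j)) = \<one>"
    by (metis cj_det3[OF g] det cj.hom_one)
  ultimately have bq: "b \<otimes> q = b"
    by (simp add: det)
  have w: "g 1 2 \<otimes> p \<oplus> g 3 2 \<otimes> r = b \<otimes> (p \<otimes> cj r \<oplus> cj (p \<otimes> cj r))" (is "_ = ?w")
    unfolding a bq by (simp add: T.r_distr T.m_ac)
  have one: "\<one> = ?w \<oplus> g 2 2 \<otimes> cj (g 2 2)"
  proof -
    have "\<one> = g 1 2 \<otimes> p \<oplus> g 2 2 \<otimes> m \<oplus> g 3 2 \<otimes> r"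
      using T.det9_middle[of "g 1 1" "g 1 2" "g 1 3" "g 2 1" "g 2 2" "g 2 3" "g 3 1" "g 3 2" "g 3 3"] det
      by (simp add: T.det3_det9 p_def m_def r_def)
    also have "\<dots> = g 1 2 \<otimes> p \<oplus> g 3 2 \<otimes> r \<oplus> g 2 2 \<otimes> cj (g 2 2)"
      by (simp add: m T.a_ac)
    finally show ?thesis unfolding w .
  qed
  \<comment> \<open>Both factors are multiples of b, so the divided trace of the product is computed
    by \<open>tr_b\<close>.\<close>
  have "cj (g 3 2) \<otimes> g 1 2 = b \<otimes> (b \<otimes> (p \<otimes> cj r))"
    unfolding r2 a bq by (simp add: T.m_ac)
  then have "tr (cj (g 3 2) \<otimes> g 1 2) = ?w"
    by (simp add: tr_b T.r_distr)
  then have "q = \<one>"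
    using one by (simp add: q_def qf_def col_def)
  then show ?thesis by (simp add: q_def)
qed

end

subsection \<open>Lifting unitary matrices along square-zero ideals\<close>

context trace_ring
begin

text \<open>Columns are corrected in the order third, first, middle. All corrections have
  coefficients in J, so quadratic error terms vanish, and each keeps what is already achieved. Only
  the outer columns must be made isotropic; the middle one just needs orthogonality and a
  rescaling.\<close>

lemma unitary_lift:
  assumes J: "ideal J T" and sq: "\<And>x y. x \<in> J \<Longrightarrow> y \<in> J \<Longrightarrow> x \<otimes> y = \<zero>"
    and cjJ: "\<And>x. x \<in> J \<Longrightarrow> cj x \<in> J"
    and e: "e \<in> carrier T" "tr e = \<one>"
    and g: "mat g"
    and det: "det3 T g \<ominus> \<one> \<in> J"
    and q: "qf (col g 1) \<in> J" "qf (col g 3) \<in> J"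
    and h: "herm (col g 3) (col g 1) \<ominus> \<one> \<in> J" "herm (col g 1) (col g 2) \<in> J"
      "herm (col g 3) (col g 2) \<in> J"
  obtains g' where "unitary g'" "\<And>i j. J +> g' i j = J +> g i j"
proof -
  interpret J: ideal J T by fact
  let ?c = "(+>) J"
  interpret c: ring_hom_cring T "T Quot J" ?c
    using J.rcos_ring_hom_cring T.is_cring by blast
  have c1: "?c x = ?c \<one> \<longleftrightarrow> x \<ominus> \<one> \<in> J" if "x \<in> carrier T" for x
    using that by (intro J.coset_eq_iff) auto
  have JT [simp]: "x \<in> J \<Longrightarrow> x \<in> carrier T" for x by (rule J.Icarr)
  have cJ: "?c x = \<zero>\<^bsub>T Quot J\<^esub>" if "x \<in> J" for x
    using that J.coset_zero_iff by simp
  \<comment> \<open>Since j = x - 1 has square zero, the inverse of 1 + j is 1 - j.\<close>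
  have inv: "x \<otimes> (\<one> \<ominus> (x \<ominus> \<one>)) = \<one>" if "x \<in> carrier T" "x \<ominus> \<one> \<in> J" for x
  proof -
    have *: "x \<otimes> (\<one> \<ominus> (x \<ominus> \<one>)) = \<one> \<ominus> (x \<ominus> \<one>) \<otimes> (x \<ominus> \<one>)"
      using that(1) by (elim T.presE) (simp only: T.pres_simps, rule arg_cong[where f = pres], simp add: algebra_simps)
    show ?thesis
      unfolding * sq[OF that(2,2)] by (simp add: a_minus_def)
  qed
  have one: "x \<otimes> y = y" if "x \<in> carrier T" "x \<ominus> \<one> \<in> J" "y \<in> J" for x y
  proof -
    have "(x \<ominus> \<one>) \<otimes> y = \<zero>" using that by (intro sq)
    moreover have "(x \<ominus> \<one>) \<otimes> y = x \<otimes> y \<ominus> y"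
      using that by (simp add: a_minus_def T.l_distr T.l_minus)
    ultimately show ?thesis using that by (simp add: T.r_right_minus_eq)
  qed
  have cj_cong: "?c (cj x) = ?c (cj y)" if "x \<in> carrier T" "y \<in> carrier T" "?c x = ?c y" for x y
    using that cjJ[of "x \<ominus> y"] J.coset_eq_iff[of x y] J.coset_eq_iff[of "cj x" "cj y"] by simp
  have herm_cong: "?c (herm v w) = ?c (herm v' w')"
    if "vec v" "vec v'" "vec w" "vec w'" "\<And>i. ?c (v i) = ?c (v' i)" "\<And>i. ?c (w i) = ?c (w' i)"
    for v v' w w'
    using that cj_cong[of "v i" "v' i" for i] by (simp add: herm_def)
  have add_cong: "?c (x \<oplus> y \<otimes> z) = ?c x" if "x \<in> carrier T" "y \<in> carrier T" "z \<in> J" for x y z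
    using that cJ[of z] by simp
  have scale_cong: "?c (x \<otimes> (\<one> \<ominus> z)) = ?c x" if "x \<in> carrier T" "z \<in> J" for x z
    using that cJ[of z] by (simp add: a_minus_def)
  define u v w where "u = col g 1" and "v = col g 2" and "w = col g 3"
  have [simp]: "vec u" "vec v" "vec w" using g by (simp_all add: u_def v_def w_def)
  have gc: "g = cols u v w" by (simp add: u_def v_def w_def)
  note q = q[folded u_def w_def] and h = h[folded u_def v_def w_def]
  note elems = \<open>vec u\<close>[rule_format] \<open>vec v\<close>[rule_format] \<open>vec w\<close>[rule_format]

  \<comment> \<open>Adding u X to w changes \<open>qf w\<close> by tr(herm(w, u) X), which is tr X
    because herm(w, u) is 1 modulo J; the factor e of divided trace 1 makes this -
    \<open>qf w\<close>.\<close>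
  define X where "X = \<ominus> (e \<otimes> qf w)"
  have X [simp]: "X \<in> J"
    unfolding X_def using e q(2) by (intro J.a_inv_closed J.I_l_closed)
  define w' where "w' = (\<lambda>i. w i \<oplus> u i \<otimes> X)"
  have w' [simp]: "vec w'" by (simp add: w'_def elems)
  have w'w: "?c (w' i) = ?c (w i)" for i
    unfolding w'_def by (intro add_cong elems X)
  have "tr X = \<ominus> (qf w \<otimes> tr e)"
    unfolding X_def using e by (simp add: tr_uminus T.m_comm[of e] tr_mult)
  then have "qf w' = \<zero>"
    unfolding w'_def using e one[OF _ h(1) X] sq[OF X cjJ[OF X]] by (simp add: qf_add T.r_neg)
  have cw'u: "?c (herm w' u) = ?c \<one>"
    using herm_cong[of w' w u u] w'w h(1) c1[of "herm w u"] w' by auto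
  then have w'u: "herm w' u \<ominus> \<one> \<in> J" using c1[of "herm w' u"] w' by auto
  have "?c (cj (herm w' u)) = ?c (cj \<one>)"
    using w' by (intro cj_cong cw'u) auto
  then have "?c (herm u w') = ?c \<one>"
    by (simp only: cj_herm[OF w' \<open>vec u\<close>] cj.hom_one)
  then have uw': "herm u w' \<ominus> \<one> \<in> J" using c1[of "herm u w'"] w' by auto

  \<comment> \<open>The same correction for u along w', which is isotropic by now, so that the
    pairing of w' with u does not change.\<close>
  define Y where "Y = \<ominus> (e \<otimes> qf u)"
  have Y [simp]: "Y \<in> J"
    unfolding Y_def using e q(1) by (intro J.a_inv_closed J.I_l_closed)
  define u' where "u' = (\<lambda>i. u i \<oplus> w' i \<otimes> Y)"
  have u' [simp]: "vec u'" using w' by (simp add: u'_def elems)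
  have u'u: "?c (u' i) = ?c (u i)" for i
    unfolding u'_def using w' by (intro add_cong elems Y) auto
  have "tr Y = \<ominus> (qf u \<otimes> tr e)"
    unfolding Y_def using e by (simp add: tr_uminus T.m_comm[of e] tr_mult)
  then have "qf u' = \<zero>"
    unfolding u'_def using e one[OF _ uw' Y] sq[OF Y cjJ[OF Y]] by (simp add: qf_add T.r_neg)
  define k where "k = herm w' u'"
  have "herm w' w' = \<zero>"
    using b_qf[OF w'] \<open>qf w' = \<zero>\<close> by simp
  then have k: "k = herm w' u"
    unfolding k_def u'_def by (simp add: herm_add_right)
  have kc: "k \<in> carrier T" and k1: "k \<ominus> \<one> \<in> J"
    using w'u by (simp_all add: k)
  \<comment> \<open>Multiplying by the inverse of k normalises the pairing with w' and preserves
    isotropy.\<close>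
  define u'' where "u'' = (\<lambda>i. u' i \<otimes> (\<one> \<ominus> (k \<ominus> \<one>)))"
  have u'' [simp]: "vec u''" using u' k1 by (simp add: u''_def)
  have u''u: "?c (u'' i) = ?c (u i)" for i
    unfolding u''_def u'u[symmetric] using u' k1 by (intro scale_cong) auto
  have qu'': "qf u'' = \<zero>"
    unfolding u''_def using k1 \<open>qf u' = \<zero>\<close> by (simp add: qf_scale)
  have hw'u'': "herm w' u'' = \<one>"
    unfolding u''_def using k1 kc inv[OF kc k1] by (simp add: herm_scale_right flip: k_def)
  have hu''w': "herm u'' w' = \<one>"
    using cj_herm[of w' u''] hw'u'' by simp
  have hu''u'': "herm u'' u'' = \<zero>"
    using b_qf[OF u''] qu'' by simp

  \<comment> \<open>Projection away from a hyperbolic plane: the coefficient along u'' is read off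
    by pairing with w', the one along w' by pairing with u''.\<close>
  define Z W where "Z = \<ominus> herm w' v" and "W = \<ominus> herm u'' v"
  have "?c (herm w' v) = ?c (herm w v)" "?c (herm u'' v) = ?c (herm u v)"
    using w'w u''u w' u'' by (intro herm_cong; simp)+
  then have "herm w' v \<in> J" "herm u'' v \<in> J"
    using h J.coset_zero_iff[of "herm w' v"] J.coset_zero_iff[of "herm u'' v"]
      J.coset_zero_iff[of "herm w v"] J.coset_zero_iff[of "herm u v"] by simp_all
  then have ZW [simp]: "Z \<in> J" "W \<in> J" by (simp_all add: Z_def W_def)
  define v' where "v' = (\<lambda>i. v i \<oplus> u'' i \<otimes> Z \<oplus> w' i \<otimes> W)"
  have v' [simp]: "vec v'" using w' u'' by (simp add: v'_def elems)
  have v'v: "?c (v' i) = ?c (v i)" for i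
  proof -
    have "?c (v' i) = ?c (v i \<oplus> u'' i \<otimes> Z)"
      unfolding v'_def using w' u'' elems by (intro add_cong ZW) auto
    also have "\<dots> = ?c (v i)" using u'' elems by (intro add_cong ZW) auto
    finally show ?thesis .
  qed
  have vZ: "vec (\<lambda>i. v i \<oplus> u'' i \<otimes> Z)" using u'' by (simp add: elems)
  have hv': "herm w' v' = \<zero>" "herm u'' v' = \<zero>"
    unfolding v'_def using vZ \<open>herm w' w' = \<zero>\<close> hw'u'' hu''w' hu''u''
    by (simp_all add: herm_add_right Z_def W_def T.r_neg)
  define d where "d = det3 T (cols u'' v' w')"
  have dc: "d \<in> carrier T" and mats: "mat (cols u'' v' w')" "mat (cols u v w)"
    using u'' v' w' elems by (auto simp: d_def cols_def)
  have "?c (cols u'' v' w' i j) = ?c (cols u v w i j)" for i j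
    by (simp add: cols_def u''u v'v w'w)
  then have "?c d = ?c (det3 T g)"
    unfolding d_def gc c.hom_det3[OF mats(1)] c.hom_det3[OF mats(2)] by simp
  moreover have "?c (det3 T g) = ?c \<one>"
    using det g c1[of "det3 T g"] by auto
  ultimately have d1: "d \<ominus> \<one> \<in> J" using dc c1[of d] by auto
  \<comment> \<open>A scalar on the middle column repairs the determinant and does not disturb
    orthogonality.\<close>
  define v'' where "v'' = (\<lambda>i. v' i \<otimes> (\<one> \<ominus> (d \<ominus> \<one>)))"
  have v'' [simp]: "vec v''" using v' d1 by (simp add: v''_def)
  have v''v: "?c (v'' i) = ?c (v i)" for i
    unfolding v''_def v'v[symmetric] using v' d1 by (intro scale_cong) auto
  have "det3 T (cols u'' v'' w') = \<one>"
    unfolding v''_def using d1 dc inv[OF dc d1] by (simp add: T.det3_cols_scale flip: d_def)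
  moreover have "herm u'' v'' = \<zero>" "herm w' v'' = \<zero>"
    unfolding v''_def using d1 hv' by (simp_all add: herm_scale_right)
  ultimately have "unitary (cols u'' v'' w')"
    unfolding unitary_cols using qu'' \<open>qf w' = \<zero>\<close> hw'u'' by simp
  moreover have "?c (cols u'' v'' w' i j) = ?c (g i j)" for i j
    unfolding gc by (simp add: cols_def u''u v''v w'w)
  ultimately show thesis by (rule that)
qed

subsection \<open>The big cell\<close>

text \<open>The lower unitriangular matrix with first column (1, x, y) and last entry - b cj x below
  the middle one, applied to v. That entry is forced by orthogonality for
  \<open>herm\<close>.\<close>

definition lower :: "'t \<Rightarrow> 't \<Rightarrow> (3 \<Rightarrow> 't) \<Rightarrow> 3 \<Rightarrow> 't" where
  "lower x y v = vec3 (v 1) (x \<otimes> v 1 \<oplus> v 2) (y \<otimes> v 1 \<ominus> b \<otimes> cj x \<otimes> v 2 \<oplus> v 3)"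

text \<open>The product of \<open>lower x y\<close>, the torus element diag(a, cj a a', cj a') and
  an upper unipotent element with parameters x2, y2. The inverse a' of a is a separate argument, so
  the formula needs no division.\<close>

definition cell :: "'t \<Rightarrow> 't \<Rightarrow> 't \<Rightarrow> 't \<Rightarrow> 't \<Rightarrow> 't \<Rightarrow> 3 \<Rightarrow> 3 \<Rightarrow> 't" where
  "cell a a' x y x2 y2 = cols
     (lower x y (vec3 a \<zero> \<zero>))
     (lower x y (vec3 (\<ominus> (a \<otimes> b \<otimes> cj x2)) (cj a \<otimes> a') \<zero>))
     (lower x y (vec3 (a \<otimes> y2) (cj a \<otimes> a' \<otimes> x2) (cj a')))"

text \<open>By \<open>tr_cj\<close> this says that \<open>qf\<close> vanishes at the vector (1, x,
  y).\<close>

definition isotropic :: "'t \<Rightarrow> 't \<Rightarrow> bool" where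
  "isotropic x y \<longleftrightarrow> x \<in> carrier T \<and> y \<in> carrier T \<and> tr y \<oplus> x \<otimes> cj x = \<zero>"

lemma isotropic_b:
  assumes "isotropic x y"
  shows "y \<oplus> cj y \<oplus> b \<otimes> (x \<otimes> cj x) = \<zero>"
proof -
  have c: "x \<in> carrier T" "y \<in> carrier T" and 0: "tr y \<oplus> x \<otimes> cj x = \<zero>"
    using assms by (auto simp: isotropic_def)
  have "y \<oplus> cj y \<oplus> b \<otimes> (x \<otimes> cj x) = b \<otimes> (tr y \<oplus> x \<otimes> cj x)"
    using c by (simp add: T.r_distr b_tr)
  then show ?thesis unfolding 0 by simp
qed

lemma vec_vec3 [simp]: "vec (vec3 x y z) \<longleftrightarrow> x \<in> carrier T \<and> y \<in> carrier T \<and> z \<in> carrier T"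
  by (simp add: all3)

lemma lower_closed [simp]: "x \<in> carrier T \<Longrightarrow> y \<in> carrier T \<Longrightarrow> vec v \<Longrightarrow> vec (lower x y v)"
  by (simp add: lower_def)

text \<open>The defect from being an isometry is \<open>cj (v 1) \<otimes> w 1\<close> times b times
  the left side of the isotropy equation.\<close>

lemma herm_lower:
  assumes xy: "isotropic x y" and v: "vec v" and w: "vec w"
  shows "herm (lower x y v) (lower x y w) = herm v w"
proof -
  have *: "(y' \<otimes> v1 \<ominus> b \<otimes> x \<otimes> v2 \<oplus> v3) \<otimes> w1 \<oplus> b \<otimes> ((x' \<otimes> v1 \<oplus> v2) \<otimes> (x \<otimes> w1 \<oplus> w2)) \<oplus>
      v1 \<otimes> (y \<otimes> w1 \<ominus> b \<otimes> x' \<otimes> w2 \<oplus> w3) =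
      v3 \<otimes> w1 \<oplus> b \<otimes> (v2 \<otimes> w2) \<oplus> v1 \<otimes> w3 \<oplus> v1 \<otimes> w1 \<otimes> (y \<oplus> y' \<oplus> b \<otimes> (x \<otimes> x'))"
    if "v1 \<in> carrier T" "v2 \<in> carrier T" "v3 \<in> carrier T" "w1 \<in> carrier T" "w2 \<in> carrier T" "w3 \<in> carrier T"
      "x \<in> carrier T" "x' \<in> carrier T" "y \<in> carrier T" "y' \<in> carrier T" "b \<in> carrier T"
    for v1 v2 v3 w1 w2 w3 x x' y y' b
    using that by (elim T.presE) (simp only: T.pres_simps, rule arg_cong[where f = pres], simp add: algebra_simps)
  note [simp] = v[rule_format] w[rule_format]
  have xy' [simp]: "x \<in> carrier T" "y \<in> carrier T" using xy by (auto simp: isotropic_def)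
  have "herm (lower x y v) (lower x y w) =
     herm v w \<oplus> cj (v 1) \<otimes> w 1 \<otimes> (y \<oplus> cj y \<oplus> b \<otimes> (x \<otimes> cj x))"
    using *[of "cj (v 1)" "cj (v 2)" "cj (v 3)" "w 1" "w 2" "w 3" x "cj x" y "cj y" b]
    by (simp add: herm_def lower_def)
  then show ?thesis using isotropic_b[OF xy] by simp
qed

text \<open>This cannot be deduced from \<open>herm_lower\<close>, since b need not be cancellable.
  The cross terms z + cj z coming from the trace and from the norm of the second entry cancel,
  leaving N(v_1) times the isotropy equation.\<close>

lemma qf_lower:
  assumes xy: "isotropic x y" and v: "vec v"
  shows "qf (lower x y v) = qf v"
proof -
  note [simp] = v[rule_format]
  have xy' [simp]: "x \<in> carrier T" "y \<in> carrier T" and iso: "tr y \<oplus> x \<otimes> cj x = \<zero>"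
    using xy by (auto simp: isotropic_def)
  let ?n = "v 1 \<otimes> cj (v 1)" and ?z = "cj x \<otimes> cj (v 1) \<otimes> v 2"
  have *: "(y' \<otimes> v1' \<ominus> b \<otimes> x \<otimes> v2' \<oplus> v3') \<otimes> v1 = v1 \<otimes> v1' \<otimes> y' \<oplus> (v3' \<otimes> v1 \<ominus> b \<otimes> (x \<otimes> v1 \<otimes> v2'))"
    if "v1 \<in> carrier T" "v1' \<in> carrier T" "v2' \<in> carrier T" "v3' \<in> carrier T"
       "x \<in> carrier T" "y' \<in> carrier T" "b \<in> carrier T"
     for v1 v1' v2' v3' x y' b
    using that by (elim T.presE) (simp only: T.pres_simps, rule arg_cong[where f = pres], simp add: algebra_simps)
  have "cj (lower x y v 3) \<otimes> lower x y v 1 =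
     ?n \<otimes> cj y \<oplus> (cj (v 3) \<otimes> v 1 \<ominus> b \<otimes> cj ?z)"
    using *[of "v 1" "cj (v 1)" "cj (v 2)" "cj (v 3)" x "cj y" b] by (simp add: lower_def)
  moreover have tr: "tr (n \<otimes> cj y \<oplus> (f \<ominus> b \<otimes> cj z)) = n \<otimes> tr y \<oplus> (tr f \<ominus> (z \<oplus> cj z))"
    if "n \<in> Rs" "f \<in> carrier T" "z \<in> carrier T" for n f z
    using that by (simp add: a_minus_def tr_add tr_mult tr_cj tr_uminus b_tr)
  ultimately have t: "tr (cj (lower x y v 3) \<otimes> lower x y v 1) =
     ?n \<otimes> tr y \<oplus> (tr (cj (v 3) \<otimes> v 1) \<ominus> (?z \<oplus> cj ?z))"
    using tr[of ?n "cj (v 3) \<otimes> v 1" ?z] by simp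
  have n: "lower x y v 2 \<otimes> cj (lower x y v 2) =
     ?n \<otimes> (x \<otimes> cj x) \<oplus> (?z \<oplus> cj ?z) \<oplus> v 2 \<otimes> cj (v 2)"
    by (simp add: lower_def T.l_distr T.r_distr T.m_ac T.a_ac)
  have **: "n \<otimes> t \<oplus> (f \<ominus> z) \<oplus> (n \<otimes> s \<oplus> z \<oplus> k) = f \<oplus> k \<oplus> n \<otimes> (t \<oplus> s)"
    if "n \<in> carrier T" "t \<in> carrier T" "f \<in> carrier T" "z \<in> carrier T" "k \<in> carrier T" "s \<in> carrier T"
    for n t f z k s
    using that by (elim T.presE) (simp only: T.pres_simps, rule arg_cong[where f = pres], simp add: algebra_simps)
  show ?thesis
    unfolding qf_def t n using iso by (subst **) auto
qed

lemma det3_lower: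
  assumes x: "x \<in> carrier T" "y \<in> carrier T" and v: "vec v1" "vec v2" "vec v3"
  shows "det3 T (cols (lower x y v1) (lower x y v2) (lower x y v3)) = det3 T (cols v1 v2 v3)"
proof -
  have *: "T.det9 a1 a2 a3 (x \<otimes> a1 \<oplus> b1) (x \<otimes> a2 \<oplus> b2) (x \<otimes> a3 \<oplus> b3)
     (y \<otimes> a1 \<ominus> z \<otimes> b1 \<oplus> c1) (y \<otimes> a2 \<ominus> z \<otimes> b2 \<oplus> c2) (y \<otimes> a3 \<ominus> z \<otimes> b3 \<oplus> c3) =
     T.det9 a1 a2 a3 b1 b2 b3 c1 c2 c3"
    if "a1 \<in> carrier T" "a2 \<in> carrier T" "a3 \<in> carrier T" "b1 \<in> carrier T" "b2 \<in> carrier T"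
      "b3 \<in> carrier T" "c1 \<in> carrier T" "c2 \<in> carrier T" "c3 \<in> carrier T"
      "x \<in> carrier T" "y \<in> carrier T" "z \<in> carrier T"
    for a1 a2 a3 b1 b2 b3 c1 c2 c3 x y z
    using that unfolding T.det9_def
    by (elim T.presE) (simp only: T.pres_simps, rule arg_cong[where f = pres], simp add: algebra_simps)
  show ?thesis
    unfolding T.det3_det9 cols_simps lower_def vec3_simps using assms by (intro *) auto
qed

text \<open>After removal of the isometry \<open>lower\<close> the matrix is upper triangular, and
  its equations reduce to isotropy of the pair x2, y2 and to cj a a' having norm one.\<close>

lemma unitary_cell:
  assumes a: "a \<in> carrier T" "a' \<in> carrier T" "a \<otimes> a' = \<one>"
    and xy: "isotropic x y" and xy2: "isotropic x2 y2"
  shows "unitary (cell a a' x y x2 y2)"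
proof -
  note [simp] = a
  have [simp]: "x \<in> carrier T" "y \<in> carrier T" "x2 \<in> carrier T" "y2 \<in> carrier T"
    using xy xy2 by (auto simp: isotropic_def)
  have a1 [simp]: "a' \<otimes> a = \<one>" using a by (simp add: T.m_comm)
  have a2 [simp]: "cj a \<otimes> cj a' = \<one>" "cj a' \<otimes> cj a = \<one>"
    by (metis a cj.hom_closed cj.hom_mult cj.hom_one T.m_comm)+
  let ?d = "cj a \<otimes> a'"
  have d [simp]: "?d \<otimes> cj ?d = \<one>" "cj ?d \<otimes> ?d = \<one>"
  proof -
    have "?d \<otimes> cj ?d = (cj a \<otimes> cj a') \<otimes> (a \<otimes> a')"
      by (simp add: T.m_ac del: a2 a(3) a1)
    then show "?d \<otimes> cj ?d = \<one>" by simp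
    then show "cj ?d \<otimes> ?d = \<one>" by (simp add: T.m_comm del: cj.hom_mult)
  qed
  define v1 v2 v3 where "v1 = vec3 a \<zero> \<zero>" and "v2 = vec3 (\<ominus> (a \<otimes> b \<otimes> cj x2)) ?d \<zero>"
    and "v3 = vec3 (a \<otimes> y2) (?d \<otimes> x2) (cj a')"
  have v [simp]: "vec v1" "vec v2" "vec v3" by (simp_all add: v1_def v2_def v3_def)
  have c: "cell a a' x y x2 y2 = cols (lower x y v1) (lower x y v2) (lower x y v3)"
    by (simp add: cell_def v1_def v2_def v3_def)
  have "qf v3 = \<zero>"
  proof -
    have "cj (v3 3) \<otimes> v3 1 = (a' \<otimes> a) \<otimes> y2" by (simp add: v3_def T.m_assoc del: a1)
    moreover have "v3 2 \<otimes> cj (v3 2) = (?d \<otimes> cj ?d) \<otimes> (x2 \<otimes> cj x2)"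
      by (simp add: v3_def T.m_ac del: d a(3) a1 a2)
    then have "v3 2 \<otimes> cj (v3 2) = x2 \<otimes> cj x2" unfolding d by simp
    ultimately show ?thesis
      using xy2 by (simp add: qf_def isotropic_def del: cj.hom_mult)
  qed
  moreover have "herm v3 v2 = \<zero>"
  proof -
    have "herm v3 v2 = \<ominus> ((a' \<otimes> a) \<otimes> (b \<otimes> cj x2)) \<oplus> (cj ?d \<otimes> ?d) \<otimes> (b \<otimes> cj x2)"
      by (simp add: herm_def v2_def v3_def T.r_minus T.m_ac del: d a1 a2 a(3))
    then show ?thesis by (simp add: T.l_neg del: cj.hom_mult)
  qed
  moreover have "det3 T (cols v1 v2 v3) = \<one>"
  proof -
    have "det3 T (cols v1 v2 v3) = a \<otimes> (?d \<otimes> cj a')"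
      by (simp add: det3_def v1_def v2_def v3_def a_minus_def)
    also have "\<dots> = (a \<otimes> a') \<otimes> (cj a \<otimes> cj a')" by (simp add: T.m_ac del: a(3) a1 a2)
    finally show ?thesis by simp
  qed
  moreover have "qf v1 = \<zero>" "herm v3 v1 = \<one>" "herm v1 v2 = \<zero>"
    by (simp_all add: qf_def herm_def v1_def v2_def v3_def)
  ultimately show ?thesis
    unfolding c unitary_cols by (simp add: det3_lower herm_lower[OF xy] qf_lower[OF xy])
qed

end

section \<open>Unitary matrices with invertible corner entry\<close>

context trace_ring
begin

text \<open>The middle column of a unitary matrix is determined by the outer ones: the two
  orthogonality relations and the determinant kill all its coordinates in the basis of columns.\<close>

lemma unitary_middle_unique:
  assumes u: "unitary (cols u v w)" and u': "unitary (cols u v' w)"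
  shows "v = v'"
proof -
  have cl [simp]: "vec u" "vec v" "vec w" "vec v'"
    and det: "det3 T (cols u v w) = \<one>" "det3 T (cols u v' w) = \<one>"
    and h: "herm u v = \<zero>" "herm w v = \<zero>" "herm u v' = \<zero>" "herm w v' = \<zero>"
    using u u' by (auto simp: unitary_cols)
  note h' = unitary_herm[OF u, simplified] 
  have huw: "herm w u = \<one>" using u by (simp add: unitary_cols)
  \<comment> \<open>The Cramer coordinates of v' along u, v and w; the middle one, y, is 1 by
    hypothesis.\<close>
  define x y z where "x = det3 T (cols v' v w)" and "y = det3 T (cols u v' w)" and "z = det3 T (cols u v v')"
  have xyz [simp]: "x \<in> carrier T" "y \<in> carrier T" "z \<in> carrier T"
    by (auto simp: x_def y_def z_def cols_def intro!: T.det3_closed)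
  have *: "p1 \<otimes> T.det9 u1 v1 w1 u2 v2 w2 u3 v3 w3 =
      v1 \<otimes> T.det9 u1 p1 w1 u2 p2 w2 u3 p3 w3 \<oplus> u1 \<otimes> T.det9 p1 v1 w1 p2 v2 w2 p3 v3 w3 \<oplus>
      w1 \<otimes> T.det9 u1 v1 p1 u2 v2 p2 u3 v3 p3"
     "p2 \<otimes> T.det9 u1 v1 w1 u2 v2 w2 u3 v3 w3 =
      v2 \<otimes> T.det9 u1 p1 w1 u2 p2 w2 u3 p3 w3 \<oplus> u2 \<otimes> T.det9 p1 v1 w1 p2 v2 w2 p3 v3 w3 \<oplus>
      w2 \<otimes> T.det9 u1 v1 p1 u2 v2 p2 u3 v3 p3"
     "p3 \<otimes> T.det9 u1 v1 w1 u2 v2 w2 u3 v3 w3 =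
      v3 \<otimes> T.det9 u1 p1 w1 u2 p2 w2 u3 p3 w3 \<oplus> u3 \<otimes> T.det9 p1 v1 w1 p2 v2 w2 p3 v3 w3 \<oplus>
      w3 \<otimes> T.det9 u1 v1 p1 u2 v2 p2 u3 v3 p3"
    if "u1 \<in> carrier T" "u2 \<in> carrier T" "u3 \<in> carrier T" "v1 \<in> carrier T" "v2 \<in> carrier T" "v3 \<in> carrier T"
       "w1 \<in> carrier T" "w2 \<in> carrier T" "w3 \<in> carrier T" "p1 \<in> carrier T" "p2 \<in> carrier T" "p3 \<in> carrier T"
    for u1 u2 u3 v1 v2 v3 w1 w2 w3 p1 p2 p3
    using that unfolding T.det9_def
    by (elim T.presE, simp only: T.pres_simps, intro arg_cong[where f = pres], simp add: algebra_simps)+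
  have "\<forall>i. v' i \<otimes> det3 T (cols u v w) = v i \<otimes> y \<oplus> u i \<otimes> x \<oplus> w i \<otimes> z"
    unfolding all3 T.det3_det9 cols_simps x_def y_def z_def
    by (intro conjI *) auto
  then have v': "v' = (\<lambda>i. v i \<oplus> u i \<otimes> x \<oplus> w i \<otimes> z)"
    using det by (auto simp: y_def)
  have hv': "herm q v' = herm q v \<oplus> herm q u \<otimes> x \<oplus> herm q w \<otimes> z" if "vec q" for q
    using that by (subst v') (simp add: herm_add_right)
  have "z = \<zero>" using hv'[of u] h h' by simp
  moreover have "x = \<zero>" using hv'[of w] h h' huw by simp
  ultimately show ?thesis by (subst v') simp
qed

text \<open>Dividing the first column by g_11 gives (1, x, y). The first two entries of the third
  column give y2 and x2, its last entry is forced by the pairing with the first column, and the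
  middle column is forced by \<open>unitary_middle_unique\<close>.\<close>

lemma unitary_cellE:
  assumes g: "unitary g" and a: "a' \<in> carrier T" "g 1 1 \<otimes> a' = \<one>"
  obtains x y x2 y2 where "isotropic x y" "isotropic x2 y2" "g = cell (g 1 1) a' x y x2 y2"
proof -
  define u v w where "u = col g 1" and "v = col g 2" and "w = col g 3"
  have gc: "g = cols u v w" by (simp add: u_def v_def w_def)
  have cl: "vec u" "vec v" "vec w" and qu: "qf u = \<zero>" and qw: "qf w = \<zero>" and wu: "herm w u = \<one>"
    using g unfolding gc unitary_cols by auto
  note [simp] = cl[rule_format]
  have uw: "herm u w = \<one>" using unitary_herm(3)[OF g] by (simp add: u_def w_def)
  define a where "a = u 1"
  have aa' [simp]: "a \<otimes> a' = \<one>" and [simp]: "a \<in> carrier T" "a' \<in> carrier T" "g 1 1 = a"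
    using a cl(1)[rule_format, of 1] by (simp_all add: a_def u_def col_def)
  have a'a [simp]: "a' \<otimes> a = \<one>" by (simp add: T.m_comm[of a' a])
  have caa [simp]: "cj a \<otimes> cj a' = \<one>" "cj a' \<otimes> cj a = \<one>"
    by (metis aa' cj.hom_closed cj.hom_mult cj.hom_one T.m_comm \<open>a \<in> carrier T\<close> \<open>a' \<in> carrier T\<close>)+
  define x y where "x = u 2 \<otimes> a'" and "y = u 3 \<otimes> a'"
  have xy [simp]: "x \<in> carrier T" "y \<in> carrier T" by (simp_all add: x_def y_def)
  have inv: "s \<otimes> a' \<otimes> a = s" "s \<otimes> cj a' \<otimes> cj a = s" if "s \<in> carrier T" for s
    using that by (simp_all add: T.m_assoc)
  have iso: "isotropic x y"
  proof -
    have "qf (\<lambda>i. u i \<otimes> a') = \<zero>" using cl qu by (simp add: qf_scale)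
    moreover have "qf (\<lambda>i. u i \<otimes> a') = tr (cj y) \<oplus> x \<otimes> cj x"
      by (simp add: qf_def x_def y_def flip: a_def)
    ultimately show ?thesis by (simp add: isotropic_def tr_cj)
  qed
  have u: "u = lower x y (vec3 a \<zero> \<zero>)"
    by (rule vec_eqI)
      (simp_all add: lower_def a_def[symmetric] a_minus_def, simp_all add: x_def y_def inv)
  \<comment> \<open>Solutions of a y2 = w_1 and cj a a' x2 = w_2 - x w_1, the first two entries of
    the third column of the cell.\<close>
  define y2 x2 where "y2 = a' \<otimes> w 1" and "x2 = cj a' \<otimes> a \<otimes> (w 2 \<ominus> x \<otimes> w 1)"
  have [simp]: "x2 \<in> carrier T" "y2 \<in> carrier T" by (simp_all add: x2_def y2_def)
  define k where "k = lower x y (vec3 (a \<otimes> y2) (cj a \<otimes> a' \<otimes> x2) (cj a'))"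
  have k: "vec k" by (simp add: k_def)
  have ay2: "a \<otimes> y2 = w 1" by (simp add: y2_def flip: T.m_assoc)
  have dx2: "cj a \<otimes> a' \<otimes> x2 = w 2 \<ominus> x \<otimes> w 1"
  proof -
    have "cj a \<otimes> a' \<otimes> x2 = (cj a \<otimes> cj a') \<otimes> (a' \<otimes> a) \<otimes> (w 2 \<ominus> x \<otimes> w 1)"
      by (simp add: x2_def T.m_ac del: caa a'a aa')
    then show ?thesis by simp
  qed
  have k12: "k 1 = w 1" "k 2 = w 2"
  proof -
    have "p \<oplus> (q \<ominus> p) = q" if "p \<in> carrier T" "q \<in> carrier T" for p q
      using that by (elim T.presE) (simp only: T.pres_simps, rule arg_cong[where f = pres], simp)
    then show "k 1 = w 1" "k 2 = w 2" by (simp_all add: k_def lower_def ay2 dx2)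
  qed
  have "herm u k = \<one>"
    unfolding u k_def by (simp add: herm_lower[OF iso]) (simp add: herm_def)
  then have "herm u k = herm u w" using uw by simp
  then have "cj a \<otimes> k 3 \<oplus> (cj (u 3) \<otimes> w 1 \<oplus> b \<otimes> (cj (u 2) \<otimes> w 2)) =
      cj a \<otimes> w 3 \<oplus> (cj (u 3) \<otimes> w 1 \<oplus> b \<otimes> (cj (u 2) \<otimes> w 2))"
    using k unfolding herm_def k12 a_def by (simp add: T.a_ac)
  then have "cj a \<otimes> k 3 = cj a \<otimes> w 3"
    using k by (subst (asm) T.add.right_cancel) auto
  then have "(cj a' \<otimes> cj a) \<otimes> k 3 = (cj a' \<otimes> cj a) \<otimes> w 3"
    using k by (simp add: T.m_assoc del: caa)
  then have "k 3 = w 3" using k by simp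
  with k12 have w: "w = k" by (intro vec_eqI) auto
  have iso2: "isotropic x2 y2"
  proof -
    have "qf (vec3 (a \<otimes> y2) (cj a \<otimes> a' \<otimes> x2) (cj a')) = \<zero>"
      using qw unfolding w k_def by (simp add: qf_lower[OF iso])
    moreover have "cj (cj a') \<otimes> (a \<otimes> y2) = y2"
    proof -
      have "cj (cj a') \<otimes> (a \<otimes> y2) = (a' \<otimes> a) \<otimes> y2" by (simp add: T.m_assoc del: a'a)
      then show ?thesis by simp
    qed
    moreover have "cj a \<otimes> a' \<otimes> x2 \<otimes> cj (cj a \<otimes> a' \<otimes> x2) = x2 \<otimes> cj x2"
    proof -
      have "cj a \<otimes> a' \<otimes> x2 \<otimes> cj (cj a \<otimes> a' \<otimes> x2) = (cj a \<otimes> cj a') \<otimes> (a \<otimes> a') \<otimes> (x2 \<otimes> cj x2)"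
        by (simp add: T.m_ac del: a'a caa aa')
      then show ?thesis by simp
    qed
    ultimately show ?thesis by (simp add: qf_def isotropic_def del: cj.hom_mult)
  qed
  have cell: "unitary (cell a a' x y x2 y2)"
    by (intro unitary_cell iso iso2) auto
  define v' where "v' = lower x y (vec3 (\<ominus> (a \<otimes> b \<otimes> cj x2)) (cj a \<otimes> a') \<zero>)"
  have c: "cell a a' x y x2 y2 = cols u v' w"
    unfolding cell_def u[symmetric] w k_def v'_def ..
  have "v = v'"
    using g cell unfolding gc c by (rule unitary_middle_unique)
  then have "g = cell a a' x y x2 y2"
    using c gc by simp
  then have "g = cell (g 1 1) a' x y x2 y2"
    unfolding \<open>g 1 1 = a\<close> .
  with iso iso2 show thesis by (rule that)
qed

lemma isotropicE:
  assumes e: "e \<in> carrier T" "tr e = \<one>" and xy: "isotropic x y"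
  shows "y = y \<ominus> (tr y \<oplus> x \<otimes> cj x) \<otimes> e"
  using assms by (simp add: isotropic_def a_minus_def)

text \<open>As tr e = 1, subtracting (tr z + N x) e corrects the trace exactly. With
  \<open>isotropicE\<close> this is a retraction of all pairs onto the isotropic ones, which
  parametrises the latter by free variables.\<close>

lemma isotropicI:
  assumes e: "e \<in> carrier T" "tr e = \<one>" and x: "x \<in> carrier T" "z \<in> carrier T"
  shows "isotropic x (z \<ominus> (tr z \<oplus> x \<otimes> cj x) \<otimes> e)"
proof -
  define r where "r = tr z \<oplus> x \<otimes> cj x"
  have r: "r \<in> Rs" unfolding r_def using x by simp
  have "tr (z \<ominus> r \<otimes> e) = tr z \<ominus> r"
    using x r e by (simp add: a_minus_def tr_add tr_uminus tr_mult)
  moreover have "p \<ominus> (p \<oplus> q) \<oplus> q = \<zero>" if "p \<in> carrier T" "q \<in> carrier T" for p q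
    using that by (elim T.presE) (simp only: T.pres_simps, rule arg_cong[where f = pres], simp)
  ultimately show ?thesis
    unfolding isotropic_def r_def[symmetric] using x r e by (simp add: r_def)
qed

text \<open>Left multiplication by antidiag(1, -1, 1), a Weyl element; the sign gives it determinant
  one. It brings g_31 into the corner, so the second big cell is a flip of the first.\<close>

definition flip :: "(3 \<Rightarrow> 3 \<Rightarrow> 't) \<Rightarrow> 3 \<Rightarrow> 3 \<Rightarrow> 't" where
  "flip g i = (if i = 1 then g 3 else if i = 2 then (\<lambda>j. \<ominus> g 2 j) else g 1)"

lemma flip_simps [simp]: "flip g 1 j = g 3 j" "flip g 2 j = \<ominus> g 2 j" "flip g 3 j = g 1 j"
  by (simp_all add: flip_def)

lemma flip_flip:
  assumes "mat g"
  shows "flip (flip g) = g"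
proof -
  have "\<forall>i. flip (flip g) i = g i"
    unfolding all3 using assms by (auto simp: flip_def)
  then show ?thesis by blast
qed

lemma unitary_flip:
  assumes "unitary g"
  shows "unitary (flip g)"
proof -
  have g: "mat g" using assms by (simp add: unitary_def)
  note [simp] = g[rule_format]
  have m: "mat (flip g)" unfolding all3[of "\<lambda>i. \<forall>j. flip g i j \<in> carrier T"] by simp
  have h: "herm (col (flip g) i) (col (flip g) j) = herm (col g i) (col g j)" for i j
    by (simp add: herm_def col_def T.l_minus T.r_minus T.a_ac)
  have q: "qf (col (flip g) i) = qf (col g i)" for i
  proof -
    have "cj (g 1 i) \<otimes> g 3 i = cj (cj (g 3 i) \<otimes> g 1 i)" by (simp add: T.m_comm)
    then have "tr (cj (g 1 i) \<otimes> g 3 i) = tr (cj (g 3 i) \<otimes> g 1 i)"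
      by (simp only: tr_cj cj.hom_closed T.m_closed g)
    then show ?thesis by (simp add: qf_def col_def T.l_minus T.r_minus)
  qed
  have "det3 T (flip g) = det3 T g"
  proof -
    have *: "T.det9 c1 c2 c3 (\<ominus> b1) (\<ominus> b2) (\<ominus> b3) a1 a2 a3 = T.det9 a1 a2 a3 b1 b2 b3 c1 c2 c3"
      if "a1 \<in> carrier T" "a2 \<in> carrier T" "a3 \<in> carrier T" "b1 \<in> carrier T" "b2 \<in> carrier T"
        "b3 \<in> carrier T" "c1 \<in> carrier T" "c2 \<in> carrier T" "c3 \<in> carrier T"
      for a1 a2 a3 b1 b2 b3 c1 c2 c3
      using that unfolding T.det9_def
      by (elim T.presE) (simp only: T.pres_simps, rule arg_cong[where f = pres], simp add: algebra_simps)
    show ?thesis unfolding T.det3_det9 flip_simps by (intro *) auto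
  qed
  with assms m show ?thesis by (simp add: unitary_def h q)
qed

subsection \<open>Comparison with the standard hermitian form\<close>

definition std_herm :: "(3 \<Rightarrow> 't) \<Rightarrow> (3 \<Rightarrow> 't) \<Rightarrow> 't" where
  "std_herm v w = cj (v 3) \<otimes> w 1 \<oplus> cj (v 2) \<otimes> w 2 \<oplus> cj (v 1) \<otimes> w 3"

definition std_unitary :: "(3 \<Rightarrow> 3 \<Rightarrow> 't) \<Rightarrow> bool" where
  "std_unitary g \<longleftrightarrow> mat g \<and> det3 T g = \<one> \<and>
     (\<forall>i j. std_herm (col g i) (col g j) = (if 4 - i = j then \<one> else \<zero>))"

text \<open>For \<theta> \<theta>' = 1 this is conjugation by diag(1, \<theta>, 1), which fixes the
  middle entry.\<close>

definition phi :: "'t \<Rightarrow> 't \<Rightarrow> (3 \<Rightarrow> 3 \<Rightarrow> 't) \<Rightarrow> 3 \<Rightarrow> 3 \<Rightarrow> 't" where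
  "phi \<theta> \<theta>' g = (\<lambda>i j. if i \<noteq> 2 \<and> j = 2 then \<theta> \<otimes> g i j else if i = 2 \<and> j \<noteq> 2 then \<theta>' \<otimes> g i j else g i j)"

lemma phi_closed [simp]:
  assumes "\<theta> \<in> carrier T" "\<theta>' \<in> carrier T" "mat g"
  shows "mat (phi \<theta> \<theta>' g)"
  using assms by (simp add: phi_def)

lemma phi_phi:
  assumes "\<theta> \<in> carrier T" "\<theta>' \<in> carrier T" "\<theta> \<otimes> \<theta>' = \<one>" "mat g"
  shows "phi \<theta> \<theta>' (phi \<theta>' \<theta> g) = g"
proof -
  have "\<theta> \<otimes> (\<theta>' \<otimes> x) = x" "\<theta>' \<otimes> (\<theta> \<otimes> x) = x" if "x \<in> carrier T" for x
    using that assms by (simp_all add: T.m_comm[of \<theta>' \<theta>] flip: T.m_assoc)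
  then show ?thesis using assms(4) by (intro ext) (simp add: phi_def)
qed

lemma det3_phi:
  assumes "\<theta> \<in> carrier T" "\<theta>' \<in> carrier T" "\<theta> \<otimes> \<theta>' = \<one>" "mat g"
  shows "det3 T (phi \<theta> \<theta>' g) = det3 T g"
proof -
  have *: "T.det9 a1 (\<theta> \<otimes> a2) a3 (\<theta>' \<otimes> b1) b2 (\<theta>' \<otimes> b3) c1 (\<theta> \<otimes> c2) c3 =
      T.det9 a1 a2 a3 b1 b2 b3 c1 c2 c3 \<oplus> (\<theta> \<otimes> \<theta>' \<ominus> \<one>) \<otimes>
        (a1 \<otimes> (\<ominus> (b3 \<otimes> c2)) \<oplus> a2 \<otimes> (b3 \<otimes> c1 \<ominus> b1 \<otimes> c3) \<oplus> a3 \<otimes> (b1 \<otimes> c2))"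
    if "a1 \<in> carrier T" "a2 \<in> carrier T" "a3 \<in> carrier T" "b1 \<in> carrier T" "b2 \<in> carrier T"
      "b3 \<in> carrier T" "c1 \<in> carrier T" "c2 \<in> carrier T" "c3 \<in> carrier T" "\<theta> \<in> carrier T" "\<theta>' \<in> carrier T"
    for a1 a2 a3 b1 b2 b3 c1 c2 c3 \<theta> \<theta>'
    using that unfolding T.det9_def
    by (elim T.presE) (simp only: T.pres_simps, rule arg_cong[where f = pres], simp add: algebra_simps)
  show ?thesis
    unfolding T.det3_det9
    using assms *[of "g 1 1" "g 1 2" "g 1 3" "g 2 1" "g 2 2" "g 2 3" "g 3 1" "g 3 2" "g 3 3" \<theta> \<theta>']
    by (simp add: phi_def a_minus_def T.r_neg T.det9_def)
qed

text \<open>The row factor \<theta>' has norm inverse to b and cancels the b in \<open>herm\<close>;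
  the column factor \<theta> accounts for the scalars on the right.\<close>

lemma herm_phi:
  assumes \<theta>: "\<theta> \<in> carrier T" "\<theta>' \<in> carrier T" "\<theta> \<otimes> \<theta>' = \<one>" "\<theta> \<otimes> cj \<theta> = b" and g: "mat g"
  shows "herm (col (phi \<theta> \<theta>' g) i) (col (phi \<theta> \<theta>' g) j) =
    (if i = 2 then cj \<theta> else \<one>) \<otimes> (if j = 2 then \<theta> else \<one>) \<otimes> std_herm (col g i) (col g j)"
proof -
  note [simp] = \<theta>(1,2) g[rule_format]
  have t1: "\<theta> \<otimes> (\<theta>' \<otimes> x) = x" if "x \<in> carrier T" for x
    using that \<theta>(3) by (simp flip: T.m_assoc)
  have t2: "cj \<theta> \<otimes> (cj \<theta>' \<otimes> x) = x" if "x \<in> carrier T" for x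
    using that arg_cong[OF \<theta>(3), of cj] by (simp flip: T.m_assoc)
  have t3: "\<theta>' \<otimes> (\<theta> \<otimes> x) = x" "cj \<theta>' \<otimes> (cj \<theta> \<otimes> x) = x" if "x \<in> carrier T" for x
    using that t1 t2 by (simp_all add: T.m_lcomm)
  have t4: "\<theta>' \<otimes> (cj \<theta>' \<otimes> (\<theta> \<otimes> (cj \<theta> \<otimes> x))) = x" if "x \<in> carrier T" for x
    using that by (simp add: T.m_lcomm[of "cj \<theta>'" \<theta>] t3)
  show ?thesis
    unfolding herm_def std_herm_def col_def phi_def
    unfolding \<theta>(4)[symmetric]
    by (cases "i = 2"; cases "j = 2") (simp_all add: T.r_distr T.m_ac t1 t2 t3 t4)
qed

lemma minus_index3: "(4::3) - 1 = 3" "(4::3) - 2 = 2" "(4::3) - 3 = 1"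
  by simp_all

text \<open>Invertibility of b, witnessed by b', is what turns hermitian isotropy into isotropy for
  \<open>qf\<close>.\<close>

lemma unitary_phi:
  assumes \<theta>: "\<theta> \<in> carrier T" "\<theta>' \<in> carrier T" "\<theta> \<otimes> \<theta>' = \<one>" "\<theta> \<otimes> cj \<theta> = b"
    and b: "b' \<in> carrier T" "b' \<otimes> b = \<one>" and g: "std_unitary g"
  shows "unitary (phi \<theta> \<theta>' g)"
proof -
  have m: "mat g" and det: "det3 T g = \<one>"
    and h: "std_herm (col g i) (col g j) = (if 4 - i = j then \<one> else \<zero>)" for i j
    using g by (auto simp: std_unitary_def)
  have m': "mat (phi \<theta> \<theta>' g)" using \<theta> m by simp
  note hp = herm_phi[OF \<theta> m, unfolded h]
  have q: "qf v = \<zero>" if "vec v" "herm v v = \<zero>" for v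
  proof -
    have "qf v = b' \<otimes> (b \<otimes> qf v)" using b that by (simp flip: T.m_assoc)
    then show ?thesis using that b by (simp add: b_qf)
  qed
  show ?thesis
    unfolding unitary_def using m' det \<theta>(1-3) m
    by (auto simp: det3_phi hp minus_index3 intro!: q vec_col)
qed

text \<open>The pairing of the middle column with itself comes from \<open>qf_middle\<close>; the
  factors \<theta> introduced by the change of form are units and are cancelled.\<close>

lemma std_unitary_phi:
  assumes \<theta>: "\<theta> \<in> carrier T" "\<theta>' \<in> carrier T" "\<theta> \<otimes> \<theta>' = \<one>" "\<theta> \<otimes> cj \<theta> = b" and g: "unitary g"
  shows "std_unitary (phi \<theta>' \<theta> g)"
proof -
  have m: "mat g" and det: "det3 T g = \<one>" using g by (auto simp: unitary_def)
  define k where "k = phi \<theta>' \<theta> g"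
  have k: "mat k" and gk: "g = phi \<theta> \<theta>' k"
    using \<theta> m phi_phi[of \<theta> \<theta>' g] by (simp_all add: k_def)
  have "det3 T k = \<one>"
    using det3_phi[OF \<theta>(1,2,3) k] det gk by simp
  note hp = herm_phi[OF \<theta> k, folded gk]
  have t: "(cj \<theta>' \<otimes> cj \<theta>) = \<one>" "\<theta>' \<otimes> \<theta> = \<one>"
    by (metis \<theta>(1-3) cj.hom_closed cj.hom_mult cj.hom_one T.m_comm)+
  have s: "std_herm (col k i) (col k j) \<in> carrier T" for i j
    using k by (simp add: std_herm_def)
  have cancel: "x = y" if "c \<otimes> x = c \<otimes> y" "c' \<otimes> c = \<one>" "x \<in> carrier T" "y \<in> carrier T" "c \<in> carrier T" "c' \<in> carrier T" for x y c c'
  proof -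
    have "(c' \<otimes> c) \<otimes> x = (c' \<otimes> c) \<otimes> y" using that(1,3-) by (simp add: T.m_assoc)
    then show ?thesis using that by simp
  qed
  have g22: "herm (col g 2) (col g 2) = b"
    using b_qf[of "col g 2"] qf_middle[OF g] m by simp
  have 22: "std_herm (col k 2) (col k 2) = \<one>"
  proof (rule cancel[of "cj \<theta> \<otimes> \<theta>" _ _ "cj \<theta>' \<otimes> \<theta>'"])
    show "cj \<theta> \<otimes> \<theta> \<otimes> std_herm (col k 2) (col k 2) = cj \<theta> \<otimes> \<theta> \<otimes> \<one>"
      using hp[of 2 2] g22 \<theta>(1,4) T.m_comm[of \<theta> "cj \<theta>"] by auto
    have "cj \<theta>' \<otimes> \<theta>' \<otimes> (cj \<theta> \<otimes> \<theta>) = (cj \<theta>' \<otimes> cj \<theta>) \<otimes> (\<theta>' \<otimes> \<theta>)"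
      using \<theta>(1,2) by (simp only: T.m_ac cj.hom_closed T.m_closed)
    then show "cj \<theta>' \<otimes> \<theta>' \<otimes> (cj \<theta> \<otimes> \<theta>) = \<one>" unfolding t by simp
  qed (use \<theta>(1,2) s in auto)
  note hg = unitary_herm[OF g] g[unfolded unitary_def]
  have 21: "std_herm (col k 2) (col k j) = \<zero>" if "j \<noteq> 2" "herm (col g 2) (col g j) = \<zero>" for j
    by (rule cancel[of "cj \<theta>" _ _ "cj \<theta>'"])
      (use hp[of 2 j, symmetric] that s[of 2 j] \<theta>(1,2) t(1) in simp_all)
  have 12: "std_herm (col k j) (col k 2) = \<zero>" if "j \<noteq> 2" "herm (col g j) (col g 2) = \<zero>" for j
    by (rule cancel[of \<theta> _ _ \<theta>'])
      (use hp[of j 2, symmetric] that s[of j 2] \<theta>(1,2) t(2) in simp_all)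
  have "std_herm (col k 2) (col k 1) = \<zero>" "std_herm (col k 2) (col k 3) = \<zero>"
    using hg(4,5) by (auto intro!: 21)
  moreover have "std_herm (col k 1) (col k 2) = \<zero>" "std_herm (col k 3) (col k 2) = \<zero>"
    using hg(6) by (auto intro!: 12)
  moreover have "std_herm (col k 1) (col k 1) = \<zero>" "std_herm (col k 1) (col k 3) = \<one>"
    "std_herm (col k 3) (col k 1) = \<one>" "std_herm (col k 3) (col k 3) = \<zero>"
    using hp[of 1 1, symmetric] hp[of 1 3, symmetric] hp[of 3 1, symmetric] hp[of 3 3, symmetric] hg s
    by simp_all
  ultimately show ?thesis
    unfolding k_def[symmetric] std_unitary_def all3 minus_index3
    using k 22 \<open>det3 T k = \<one>\<close> by (simp add: all3)
qed

end

subsection \<open>Tensor products\<close>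

definition prod_list2 :: "('r, 'x) ring_scheme \<Rightarrow> ('r \<times> 'a::comm_ring_1) list \<Rightarrow> ('r \<times> 'a) list \<Rightarrow> ('r \<times> 'a) list" where
  "prod_list2 R xs ys = [(fst p \<otimes>\<^bsub>R\<^esub> fst q, snd p * snd q). p \<leftarrow> xs, q \<leftarrow> ys]"

definition lin_list ::
  "('a \<Rightarrow> 'r) \<Rightarrow> ('r, 'x) ring_scheme \<Rightarrow> ('a \<Rightarrow> 'a) \<Rightarrow> ('r \<times> 'a) list \<Rightarrow> 'r" where
  "lin_list s R f xs = foldr (\<lambda>(r, b) y. r \<otimes>\<^bsub>R\<^esub> s (f b) \<oplus>\<^bsub>R\<^esub> y) xs \<zero>\<^bsub>R\<^esub>"

lemma prod_list2_simps [simp]: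
  "prod_list2 R [] ys = []"
  "prod_list2 R (p # xs) ys = map (\<lambda>q. (fst p \<otimes>\<^bsub>R\<^esub> fst q, snd p * snd q)) ys @ prod_list2 R xs ys"
  by (simp_all add: prod_list2_def)

lemma lin_list_simps [simp]:
  "lin_list s R f [] = \<zero>\<^bsub>R\<^esub>"
  "lin_list s R f (p # xs) = fst p \<otimes>\<^bsub>R\<^esub> s (f (snd p)) \<oplus>\<^bsub>R\<^esub> lin_list s R f xs"
  by (simp_all add: lin_list_def split_beta)

locale base_alg = R?: cring R for R :: "'r ring" (structure) +
  fixes S B :: "'a::comm_ring_1 set" and s :: "'a \<Rightarrow> 'r"
  assumes S: "closed_ring S" and B: "closed_ring B" and SB: "S \<subseteq> B"
    and s: "s \<in> ring_hom (ring_of S) R"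
begin

lemma s_closed [simp]: "c \<in> S \<Longrightarrow> s c \<in> carrier R"
  using ring_hom_closed[OF s] by simp

lemma s_hom: "s 0 = \<zero>" "s 1 = \<one>" "c \<in> S \<Longrightarrow> d \<in> S \<Longrightarrow> s (c + d) = s c \<oplus> s d"
  "c \<in> S \<Longrightarrow> d \<in> S \<Longrightarrow> s (c * d) = s c \<otimes> s d" "c \<in> S \<Longrightarrow> s (- c) = \<ominus> s c"
  "c \<in> S \<Longrightarrow> d \<in> S \<Longrightarrow> s (c - d) = s c \<ominus> s d"
proof -
  interpret s: ring_hom_cring "ring_of S" R s
    using cring_ring_of[OF S] R.is_cring s by (rule ring_hom_cringI')
  show "s 0 = \<zero>" "s 1 = \<one>" "c \<in> S \<Longrightarrow> d \<in> S \<Longrightarrow> s (c + d) = s c \<oplus> s d"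
    "c \<in> S \<Longrightarrow> d \<in> S \<Longrightarrow> s (c * d) = s c \<otimes> s d"
    using s.hom_zero s.hom_one s.hom_add[of c d] s.hom_mult[of c d] by simp_all
  have m: "s (- c) = \<ominus> s c" if "c \<in> S" for c
    using s.hom_a_inv[of c] S that by simp
  then show "c \<in> S \<Longrightarrow> s (- c) = \<ominus> s c" .
  show "c \<in> S \<Longrightarrow> d \<in> S \<Longrightarrow> s (c - d) = s c \<ominus> s d"
    using s.hom_add[of c "- d"] m[of d] closed_ringD(3)[OF S] by (simp add: a_minus_def)
qed

lemma s_pow: "c \<in> S \<Longrightarrow> s (c ^ n) = s c [^] n"
  by (induction n) (simp_all add: s_hom closed_ringD[OF S] R.m_comm)

abbreviation lst :: "('r \<times> 'a) list set" where
  "lst \<equiv> lists (carrier R \<times> B)"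

abbreviation rel :: "(('r \<times> 'a) list \<times> ('r \<times> 'a) list) set" where
  "rel \<equiv> tensor_rel S s R B"

lemma rel_lists: "(xs, ys) \<in> rel \<Longrightarrow> xs \<in> lst \<and> ys \<in> lst"
proof (induction rule: tensor_rel.induct)
  case (balanced r c b)
  then show ?case using SB closed_ringD(5)[OF B, of c b] by auto
qed (use closed_ringD(4)[OF B] in auto)

lemma rel_equiv: "equiv lst rel"
  by (intro equivI refl_onI symI transI)
    (use rel_lists in \<open>auto intro: tensor_rel.intros\<close>)

lemma class_eq_iff: "xs \<in> lst \<Longrightarrow> ys \<in> lst \<Longrightarrow>
    tensor_class S s R B xs = tensor_class S s R B ys \<longleftrightarrow> (xs, ys) \<in> rel"
  unfolding tensor_class_def using eq_equiv_class_iff[OF rel_equiv] by simp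

lemma mem_class_iff: "ys \<in> tensor_class S s R B xs \<longleftrightarrow> (xs, ys) \<in> rel"
  by (simp add: tensor_class_def)

text \<open>The generators only swap whole blocks; moving the head of the list to its place in the
  permuted list is such a swap inside a context.\<close>

lemma rel_perm: "mset xs = mset ys \<Longrightarrow> xs \<in> lst \<Longrightarrow> (xs, ys) \<in> rel"
proof (induction xs arbitrary: ys)
  case Nil
  then show ?case by (simp add: tensor_rel.refl)
next
  case (Cons x xs)
  then have "x \<in> set ys" by (metis list.set_intros(1) set_mset_mset)
  then obtain us vs where ys: "ys = us @ x # vs" by (meson split_list)
  then have "mset xs = mset (us @ vs)" using Cons.prems(1) by simp
  then have 1: "(xs, us @ vs) \<in> rel" using Cons by simp
  have l: "us \<in> lst" "vs \<in> lst" "[x] \<in> lst"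
    using rel_lists[OF 1] Cons.prems(2) by auto
  have "([x] @ xs, [x] @ (us @ vs)) \<in> rel"
    using 1 l by (intro tensor_rel.append tensor_rel.refl)
  moreover have "(([x] @ us) @ vs, (us @ [x]) @ vs) \<in> rel"
    using l by (intro tensor_rel.append[OF tensor_rel.commute tensor_rel.refl])
  ultimately show ?case unfolding ys using tensor_rel.trans by fastforce
qed

lemma prod_list2_closed [simp]: "xs \<in> lst \<Longrightarrow> ys \<in> lst \<Longrightarrow> prod_list2 R xs ys \<in> lst"
proof (induction xs)
  case (Cons p xs)
  then have "map (\<lambda>q. (fst p \<otimes> fst q, snd p * snd q)) ys \<in> lst"
    using closed_ringD(5)[OF B] by (auto simp: in_lists_conv_set)
  then show ?case using Cons by simp
qed simp

lemma mset_prod_list2_Cons: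
  "mset (prod_list2 R xs (q # ys)) =
     mset (map (\<lambda>p. (fst p \<otimes> fst q, snd p * snd q)) xs) + mset (prod_list2 R xs ys)"
  by (induction xs) simp_all

lemma prod_list2_comm: "xs \<in> lst \<Longrightarrow> ys \<in> lst \<Longrightarrow> mset (prod_list2 R xs ys) = mset (prod_list2 R ys xs)"
proof (induction xs)
  case Nil
  show ?case by (induction ys) simp_all
next
  case (Cons p xs)
  have "image_mset (\<lambda>q. (fst p \<otimes> fst q, snd p * snd q)) (mset ys) =
      image_mset (\<lambda>q. (fst q \<otimes> fst p, snd q * snd p)) (mset ys)"
    using Cons.prems by (intro image_mset_cong) (auto simp: R.m_comm mult.commute)
  then show ?case using Cons by (simp add: mset_prod_list2_Cons)
qed

lemma rel_scale:
  assumes "(ys, ys') \<in> rel" and r: "r \<in> carrier R" and x: "x \<in> B"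
  shows "(map (\<lambda>q. (r \<otimes> fst q, x * snd q)) ys, map (\<lambda>q. (r \<otimes> fst q, x * snd q)) ys') \<in> rel"
  using assms(1)
proof (induction rule: tensor_rel.induct)
  case (refl xs)
  then show ?case using r x closed_ringD(5)[OF B]
    by (intro tensor_rel.refl) (auto simp: in_lists_conv_set)
next
  case (commute xs ys)
  then show ?case using r x closed_ringD(5)[OF B]
    unfolding map_append by (intro tensor_rel.commute) (auto simp: in_lists_conv_set)
next
  case (add_left a a' b)
  then show ?case using r x closed_ringD(5)[OF B] by (auto simp: R.r_distr intro!: tensor_rel.add_left)
next
  case (add_right a b b')
  then show ?case using r x closed_ringD(5)[OF B] by (auto simp: distrib_left intro!: tensor_rel.add_right)
next
  case (zero b)
  then show ?case using r x closed_ringD(5)[OF B] by (auto intro!: tensor_rel.zero)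
next
  case (balanced a c b)
  then have "([((r \<otimes> a) \<otimes> s c, x * b)], [(r \<otimes> a, c * (x * b))]) \<in> rel"
    using r x closed_ringD(5)[OF B] by (intro tensor_rel.balanced) auto
  then show ?case using balanced r by (simp add: R.m_assoc mult.left_commute)
next
  case (append xs xs' ys ys')
  then show ?case by (simp add: tensor_rel.append)
qed (blast intro: tensor_rel.sym tensor_rel.trans)+

text \<open>In the second argument this is an induction on the list \<open>xs\<close> using
  \<open>rel_scale\<close>. The first argument is reduced to the second, as the two orders of
  multiplication give the same multiset of terms.\<close>

lemma rel_mult:
  assumes xs: "(xs, xs') \<in> rel" and ys: "(ys, ys') \<in> rel"
  shows "(prod_list2 R xs ys, prod_list2 R xs' ys') \<in> rel"
proof -
  have right: "(prod_list2 R xs ys, prod_list2 R xs ys') \<in> rel"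
    if "xs \<in> lst" "(ys, ys') \<in> rel" for xs ys ys'
    using that(1)
    by (induction xs) (auto intro!: tensor_rel.append rel_scale that(2) intro: tensor_rel.refl)
  have l: "xs \<in> lst" "xs' \<in> lst" "ys \<in> lst" "ys' \<in> lst"
    using rel_lists[OF xs] rel_lists[OF ys] by auto
  have "(prod_list2 R xs ys, prod_list2 R xs ys') \<in> rel" using l ys by (intro right)
  moreover have "(prod_list2 R xs ys', prod_list2 R ys' xs) \<in> rel"
    using l by (intro rel_perm prod_list2_comm prod_list2_closed)
  moreover have "(prod_list2 R ys' xs, prod_list2 R ys' xs') \<in> rel" using l xs by (intro right)
  moreover have "(prod_list2 R ys' xs', prod_list2 R xs' ys') \<in> rel"
    using l by (intro rel_perm prod_list2_comm prod_list2_closed)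
  ultimately show ?thesis using tensor_rel.trans by metis
qed

abbreviation cls :: "('r \<times> 'a) list \<Rightarrow> ('r \<times> 'a) list set" where
  "cls \<equiv> tensor_class S s R B"

lemma carrier_tensor: "carrier (tensor S s R B) = cls ` lst"
  by (auto simp: tensor_def quotient_def tensor_class_def)

text \<open>The operations of the tensor product are unions over representatives; such a union is a
  single value once the function is constant on the class.\<close>

lemma cls_UN:
  assumes "xs \<in> lst" "\<And>ys. (xs, ys) \<in> rel \<Longrightarrow> f ys = c"
  shows "(\<Union>ys\<in>cls xs. f ys) = c"
proof -
  have "xs \<in> cls xs" using assms(1) by (simp add: mem_class_iff tensor_rel.refl)
  moreover have "f ys = c" if "ys \<in> cls xs" for ys using that assms(2) by (simp add: mem_class_iff)
  ultimately show ?thesis by blast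
qed

lemma cls_add:
  assumes "xs \<in> lst" "ys \<in> lst"
  shows "cls xs \<oplus>\<^bsub>tensor S s R B\<^esub> cls ys = cls (xs @ ys)"
proof -
  have "cls (xs' @ ys') = cls (xs @ ys)" if "(xs, xs') \<in> rel" "(ys, ys') \<in> rel" for xs' ys'
    using that rel_lists[OF that(1)] rel_lists[OF that(2)]
    by (subst class_eq_iff) (auto intro!: tensor_rel.append intro: tensor_rel.sym)
  then show ?thesis using assms by (simp add: tensor_def cls_UN)
qed

lemma cls_mult:
  assumes "xs \<in> lst" "ys \<in> lst"
  shows "cls xs \<otimes>\<^bsub>tensor S s R B\<^esub> cls ys = cls (prod_list2 R xs ys)"
proof -
  have "cls (prod_list2 R xs' ys') = cls (prod_list2 R xs ys)"
    if "(xs, xs') \<in> rel" "(ys, ys') \<in> rel" for xs' ys'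
    using that rel_lists[OF that(1)] rel_lists[OF that(2)]
    by (subst class_eq_iff) (auto intro!: rel_mult intro: tensor_rel.sym)
  then show ?thesis using assms by (simp add: tensor_def cls_UN flip: prod_list2_def)
qed

lemma tens_closed [simp]: "r \<in> carrier R \<Longrightarrow> x \<in> B \<Longrightarrow> tens S s R B r x \<in> carrier (tensor S s R B)"
  by (simp add: tens_def carrier_tensor)

lemma tens_mult:
  assumes "r \<in> carrier R" "r' \<in> carrier R" "x \<in> B" "x' \<in> B"
  shows "tens S s R B r x \<otimes>\<^bsub>tensor S s R B\<^esub> tens S s R B r' x' = tens S s R B (r \<otimes> r') (x * x')"
  using assms by (simp add: tens_def cls_mult)

lemma tens_add:
  assumes "r \<in> carrier R" "r' \<in> carrier R" "x \<in> B"
  shows "tens S s R B r x \<oplus>\<^bsub>tensor S s R B\<^esub> tens S s R B r' x = tens S s R B (r \<oplus> r') x"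
  using assms by (simp add: tens_def cls_add class_eq_iff tensor_rel.sym tensor_rel.add_left)

lemma tens_balanced:
  assumes "r \<in> carrier R" "c \<in> S" "x \<in> B"
  shows "tens S s R B (r \<otimes> s c) x = tens S s R B r (c * x)"
  unfolding tens_def using assms SB closed_ringD(5)[OF B, of c x]
  by (subst class_eq_iff) (auto simp: tensor_rel.balanced)

lemma lin_list_append:
  assumes "\<And>b. b \<in> B \<Longrightarrow> s (f b) \<in> carrier R" "xs \<in> lst" "ys \<in> lst"
  shows "lin_list s R f (xs @ ys) = lin_list s R f xs \<oplus> lin_list s R f ys"
    and "lin_list s R f xs \<in> carrier R"
proof -
  have c: "lin_list s R f zs \<in> carrier R" if "zs \<in> lst" for zs
    using that by (induction zs) (auto simp: assms(1))
  then show "lin_list s R f xs \<in> carrier R" using assms by blast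
  show "lin_list s R f (xs @ ys) = lin_list s R f xs \<oplus> lin_list s R f ys"
    using assms(2)
  proof (induction xs)
    case (Cons p xs)
    then show ?case using c[of xs] c[OF assms(3)] assms(1)[of "snd p"] by (auto simp: R.a_assoc)
  qed (use c[OF assms(3)] in simp)
qed

lemma lin_list_rel:
  assumes f: "\<And>b. b \<in> B \<Longrightarrow> f b \<in> S" "\<And>b b'. b \<in> B \<Longrightarrow> b' \<in> B \<Longrightarrow> f (b + b') = f b + f b'"
      "\<And>c b. c \<in> S \<Longrightarrow> b \<in> B \<Longrightarrow> f (c * b) = c * f b"
    and "(xs, ys) \<in> rel"
  shows "lin_list s R f xs = lin_list s R f ys"
  using assms(4)
proof (induction rule: tensor_rel.induct)
  case (append xs xs' ys ys')
  then show ?case using rel_lists f(1) by (simp add: lin_list_append)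
next
  case (commute xs ys)
  then show ?case using f(1) by (simp add: lin_list_append R.a_comm)
qed (use f s_hom in \<open>auto simp: R.l_distr R.r_distr R.m_assoc\<close>)

lemma tensor_linear_ext_cls:
  assumes f: "\<And>b. b \<in> B \<Longrightarrow> f b \<in> S" "\<And>b b'. b \<in> B \<Longrightarrow> b' \<in> B \<Longrightarrow> f (b + b') = f b + f b'"
      "\<And>c b. c \<in> S \<Longrightarrow> b \<in> B \<Longrightarrow> f (c * b) = c * f b"
    and xs: "xs \<in> lst"
  shows "tensor_linear_ext s R f (cls xs) = lin_list s R f xs"
proof -
  have "lin_list s R f ` cls xs = {lin_list s R f xs}"
    using lin_list_rel[OF f] xs tensor_rel.refl[OF xs]
    by (auto simp: mem_class_iff image_iff)
  then show ?thesis
    unfolding tensor_linear_ext_def lin_list_def[symmetric, abs_def]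
    by (simp flip: lin_list_def)
qed

end

subsection \<open>Quadratic algebras\<close>

text \<open>\<open>R[t]\<close> with \<open>t\<^sup>2 = \<tau> t - \<beta>\<close>; the pair \<open>(p, q)\<close> stands for \<open>p + q t\<close>.\<close>

definition quad :: "('r, 'x) ring_scheme \<Rightarrow> 'r \<Rightarrow> 'r \<Rightarrow> ('r \<times> 'r) ring" where
  "quad R \<tau> \<beta> =
     \<lparr>carrier = carrier R \<times> carrier R,
      monoid.mult = (\<lambda>x y. (fst x \<otimes>\<^bsub>R\<^esub> fst y \<ominus>\<^bsub>R\<^esub> \<beta> \<otimes>\<^bsub>R\<^esub> (snd x \<otimes>\<^bsub>R\<^esub> snd y),
         fst x \<otimes>\<^bsub>R\<^esub> snd y \<oplus>\<^bsub>R\<^esub> snd x \<otimes>\<^bsub>R\<^esub> fst y \<oplus>\<^bsub>R\<^esub> \<tau> \<otimes>\<^bsub>R\<^esub> (snd x \<otimes>\<^bsub>R\<^esub> snd y))),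
      one = (\<one>\<^bsub>R\<^esub>, \<zero>\<^bsub>R\<^esub>), zero = (\<zero>\<^bsub>R\<^esub>, \<zero>\<^bsub>R\<^esub>),
      add = (\<lambda>x y. (fst x \<oplus>\<^bsub>R\<^esub> fst y, snd x \<oplus>\<^bsub>R\<^esub> snd y))\<rparr>"

text \<open>The conjugate of t is \<tau> - t.\<close>

definition qconj :: "('r, 'x) ring_scheme \<Rightarrow> 'r \<Rightarrow> 'r \<times> 'r \<Rightarrow> 'r \<times> 'r" where
  "qconj R \<tau> x = (fst x \<oplus>\<^bsub>R\<^esub> \<tau> \<otimes>\<^bsub>R\<^esub> snd x, \<ominus>\<^bsub>R\<^esub> snd x)"

text \<open>Intended for the images of \<tau>0 = Tr(1) / b and \<tau>1 = Tr(t) / b, quotients that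
  are formed in O_K before passing to R.\<close>

definition qtr :: "('r, 'x) ring_scheme \<Rightarrow> 'r \<Rightarrow> 'r \<Rightarrow> 'r \<times> 'r \<Rightarrow> 'r \<times> 'r" where
  "qtr R \<tau>0 \<tau>1 x = (\<tau>0 \<otimes>\<^bsub>R\<^esub> fst x \<oplus>\<^bsub>R\<^esub> \<tau>1 \<otimes>\<^bsub>R\<^esub> snd x, \<zero>\<^bsub>R\<^esub>)"

lemma quad_simps [simp]:
  "carrier (quad R \<tau> \<beta>) = carrier R \<times> carrier R"
  "x \<otimes>\<^bsub>quad R \<tau> \<beta>\<^esub> y = (fst x \<otimes>\<^bsub>R\<^esub> fst y \<ominus>\<^bsub>R\<^esub> \<beta> \<otimes>\<^bsub>R\<^esub> (snd x \<otimes>\<^bsub>R\<^esub> snd y),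
         fst x \<otimes>\<^bsub>R\<^esub> snd y \<oplus>\<^bsub>R\<^esub> snd x \<otimes>\<^bsub>R\<^esub> fst y \<oplus>\<^bsub>R\<^esub> \<tau> \<otimes>\<^bsub>R\<^esub> (snd x \<otimes>\<^bsub>R\<^esub> snd y))"
  "\<one>\<^bsub>quad R \<tau> \<beta>\<^esub> = (\<one>\<^bsub>R\<^esub>, \<zero>\<^bsub>R\<^esub>)" "\<zero>\<^bsub>quad R \<tau> \<beta>\<^esub> = (\<zero>\<^bsub>R\<^esub>, \<zero>\<^bsub>R\<^esub>)"
  "x \<oplus>\<^bsub>quad R \<tau> \<beta>\<^esub> y = (fst x \<oplus>\<^bsub>R\<^esub> fst y, snd x \<oplus>\<^bsub>R\<^esub> snd y)"
  by (simp_all add: quad_def)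

lemma (in cring) cring_quad:
  assumes [simp]: "\<tau> \<in> carrier R" "\<beta> \<in> carrier R"
  shows "cring (quad R \<tau> \<beta>)"
proof (rule cringI)
  have assoc: "(p \<otimes> p' \<ominus> \<beta> \<otimes> (q \<otimes> q')) \<otimes> p'' \<ominus> \<beta> \<otimes> ((p \<otimes> q' \<oplus> q \<otimes> p' \<oplus> \<tau> \<otimes> (q \<otimes> q')) \<otimes> q'') =
      p \<otimes> (p' \<otimes> p'' \<ominus> \<beta> \<otimes> (q' \<otimes> q'')) \<ominus> \<beta> \<otimes> (q \<otimes> (p' \<otimes> q'' \<oplus> q' \<otimes> p'' \<oplus> \<tau> \<otimes> (q' \<otimes> q'')))"
     "(p \<otimes> p' \<ominus> \<beta> \<otimes> (q \<otimes> q')) \<otimes> q'' \<oplus> (p \<otimes> q' \<oplus> q \<otimes> p' \<oplus> \<tau> \<otimes> (q \<otimes> q')) \<otimes> p'' \<oplus>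
        \<tau> \<otimes> ((p \<otimes> q' \<oplus> q \<otimes> p' \<oplus> \<tau> \<otimes> (q \<otimes> q')) \<otimes> q'') =
      p \<otimes> (p' \<otimes> q'' \<oplus> q' \<otimes> p'' \<oplus> \<tau> \<otimes> (q' \<otimes> q'')) \<oplus> q \<otimes> (p' \<otimes> p'' \<ominus> \<beta> \<otimes> (q' \<otimes> q'')) \<oplus>
        \<tau> \<otimes> (q \<otimes> (p' \<otimes> q'' \<oplus> q' \<otimes> p'' \<oplus> \<tau> \<otimes> (q' \<otimes> q'')))"
     "(p \<oplus> p') \<otimes> p'' \<ominus> \<beta> \<otimes> ((q \<oplus> q') \<otimes> q'') =
      p \<otimes> p'' \<ominus> \<beta> \<otimes> (q \<otimes> q'') \<oplus> (p' \<otimes> p'' \<ominus> \<beta> \<otimes> (q' \<otimes> q''))"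
     "(p \<oplus> p') \<otimes> q'' \<oplus> (q \<oplus> q') \<otimes> p'' \<oplus> \<tau> \<otimes> ((q \<oplus> q') \<otimes> q'') =
      p \<otimes> q'' \<oplus> q \<otimes> p'' \<oplus> \<tau> \<otimes> (q \<otimes> q'') \<oplus> (p' \<otimes> q'' \<oplus> q' \<otimes> p'' \<oplus> \<tau> \<otimes> (q' \<otimes> q''))"
    if "p \<in> carrier R" "q \<in> carrier R" "p' \<in> carrier R" "q' \<in> carrier R" "p'' \<in> carrier R" "q'' \<in> carrier R"
      "\<tau> \<in> carrier R" "\<beta> \<in> carrier R"
    for p q p' q' p'' q'' \<tau> \<beta>
    using that
    by (elim presE, simp only: pres_simps, intro arg_cong[where f = pres], simp add: algebra_simps)+
  show "abelian_group (quad R \<tau> \<beta>)"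
    by (intro abelian_groupI) (auto simp: a_ac intro!: bexI[where x = "\<ominus> x" for x] l_neg)
  show "Group.comm_monoid (quad R \<tau> \<beta>)"
  proof (rule comm_monoidI)
    fix x y z
    assume "x \<in> carrier (quad R \<tau> \<beta>)" "y \<in> carrier (quad R \<tau> \<beta>)"
    then show "x \<otimes>\<^bsub>quad R \<tau> \<beta>\<^esub> y = y \<otimes>\<^bsub>quad R \<tau> \<beta>\<^esub> x" "x \<otimes>\<^bsub>quad R \<tau> \<beta>\<^esub> y \<in> carrier (quad R \<tau> \<beta>)"
      by (auto simp: m_ac a_ac)
    assume "z \<in> carrier (quad R \<tau> \<beta>)"
    then show "x \<otimes>\<^bsub>quad R \<tau> \<beta>\<^esub> y \<otimes>\<^bsub>quad R \<tau> \<beta>\<^esub> z = x \<otimes>\<^bsub>quad R \<tau> \<beta>\<^esub> (y \<otimes>\<^bsub>quad R \<tau> \<beta>\<^esub> z)"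
      using \<open>x \<in> carrier (quad R \<tau> \<beta>)\<close> \<open>y \<in> carrier (quad R \<tau> \<beta>)\<close> by (auto simp: assoc assms)
  qed (auto simp: a_minus_def)
  show "(x \<oplus>\<^bsub>quad R \<tau> \<beta>\<^esub> y) \<otimes>\<^bsub>quad R \<tau> \<beta>\<^esub> z =
      x \<otimes>\<^bsub>quad R \<tau> \<beta>\<^esub> z \<oplus>\<^bsub>quad R \<tau> \<beta>\<^esub> y \<otimes>\<^bsub>quad R \<tau> \<beta>\<^esub> z"
    if "x \<in> carrier (quad R \<tau> \<beta>)" "y \<in> carrier (quad R \<tau> \<beta>)" "z \<in> carrier (quad R \<tau> \<beta>)" for x y z
    using that by (auto simp: assoc assms)
qed

lemma quad_hom:
  assumes "ring_hom_cring R R' h" "\<tau> \<in> carrier R" "\<beta> \<in> carrier R"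
  shows "ring_hom_cring (quad R \<tau> \<beta>) (quad R' (h \<tau>) (h \<beta>)) (map_prod h h)"
proof -
  interpret h: ring_hom_cring R R' h by fact
  show ?thesis
    by (intro ring_hom_cringI' ring_hom_memI h.R.cring_quad h.S.cring_quad)
      (use assms in \<open>auto simp: a_minus_def\<close>)
qed

lemma (in cring) trace_ring_quad:
  assumes [simp]: "\<tau> \<in> carrier R" "\<beta> \<in> carrier R" "b \<in> carrier R" "\<tau>0 \<in> carrier R" "\<tau>1 \<in> carrier R"
    and 2: "b \<otimes> \<tau>0 = \<one> \<oplus> \<one>" and \<tau>: "b \<otimes> \<tau>1 = \<tau>"
  shows "trace_ring (quad R \<tau> \<beta>) (qconj R \<tau>) (qtr R \<tau>0 \<tau>1) (b, \<zero>) (carrier R \<times> {\<zero>})"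
proof (intro trace_ring.intro trace_ring_axioms.intro)
  show "cring (quad R \<tau> \<beta>)" by (intro cring_quad) auto
  have id: "p \<otimes> p' \<ominus> \<beta> \<otimes> (q \<otimes> q') \<oplus> \<tau> \<otimes> (p \<otimes> q' \<oplus> q \<otimes> p' \<oplus> \<tau> \<otimes> (q \<otimes> q')) =
      (p \<oplus> \<tau> \<otimes> q) \<otimes> (p' \<oplus> \<tau> \<otimes> q') \<ominus> \<beta> \<otimes> (q \<otimes> q')"
     "\<ominus> (p \<otimes> q' \<oplus> q \<otimes> p' \<oplus> \<tau> \<otimes> (q \<otimes> q')) =
       (p \<oplus> \<tau> \<otimes> q) \<otimes> \<ominus> q' \<oplus> \<ominus> q \<otimes> (p' \<oplus> \<tau> \<otimes> q') \<oplus> \<tau> \<otimes> (\<ominus> q \<otimes> \<ominus> q')"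
     "p \<oplus> p' \<oplus> \<tau> \<otimes> (q \<oplus> q') = p \<oplus> \<tau> \<otimes> q \<oplus> (p' \<oplus> \<tau> \<otimes> q')" "\<ominus> (q \<oplus> q') = \<ominus> q \<oplus> \<ominus> q'"
     "p \<oplus> \<tau> \<otimes> q \<oplus> \<tau> \<otimes> \<ominus> q = p" "q \<oplus> \<ominus> q = \<zero>"
     "p \<otimes> \<ominus> q \<oplus> q \<otimes> (p \<oplus> \<tau> \<otimes> q) \<oplus> \<tau> \<otimes> (q \<otimes> \<ominus> q) = \<zero>"
     "p \<oplus> (p \<oplus> \<tau> \<otimes> q) = (\<one> \<oplus> \<one>) \<otimes> p \<oplus> \<tau> \<otimes> q" "\<ominus> q \<otimes> \<ominus> q' = q \<otimes> q'"
    if "p \<in> carrier R" "q \<in> carrier R" "p' \<in> carrier R" "q' \<in> carrier R" "\<tau> \<in> carrier R" "\<beta> \<in> carrier R"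
    for p q p' q' \<tau> \<beta>
    using that
    by (elim presE, simp only: pres_simps, intro arg_cong[where f = pres], simp add: algebra_simps)+
  show "qconj R \<tau> \<in> ring_hom (quad R \<tau> \<beta>) (quad R \<tau> \<beta>)"
  proof (rule ring_hom_memI)
    fix x y assume "x \<in> carrier (quad R \<tau> \<beta>)" "y \<in> carrier (quad R \<tau> \<beta>)"
    then have *: "fst x \<in> carrier R" "snd x \<in> carrier R" "fst y \<in> carrier R" "snd y \<in> carrier R" by auto
    show "qconj R \<tau> (x \<otimes>\<^bsub>quad R \<tau> \<beta>\<^esub> y) = qconj R \<tau> x \<otimes>\<^bsub>quad R \<tau> \<beta>\<^esub> qconj R \<tau> y"
      using * id(1,2)[OF *, of \<tau> \<beta>] id(9)[of _ "snd x" _ "snd y"] assms(1,2) by (simp add: qconj_def)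
    show "qconj R \<tau> (x \<oplus>\<^bsub>quad R \<tau> \<beta>\<^esub> y) = qconj R \<tau> x \<oplus>\<^bsub>quad R \<tau> \<beta>\<^esub> qconj R \<tau> y"
      using * id(3,4)[OF *, of \<tau>] by (simp add: qconj_def)
  qed (auto simp: qconj_def)
  fix x y r r'
  show "qconj R \<tau> (qconj R \<tau> x) = x" if "x \<in> carrier (quad R \<tau> \<beta>)"
    using that id(5) by (auto simp: qconj_def)
  show "x \<otimes>\<^bsub>quad R \<tau> \<beta>\<^esub> qconj R \<tau> x \<in> carrier R \<times> {\<zero>}" if "x \<in> carrier (quad R \<tau> \<beta>)"
    using that by (auto simp: qconj_def id)
  show "qtr R \<tau>0 \<tau>1 (x \<oplus>\<^bsub>quad R \<tau> \<beta>\<^esub> y) = qtr R \<tau>0 \<tau>1 x \<oplus>\<^bsub>quad R \<tau> \<beta>\<^esub> qtr R \<tau>0 \<tau>1 y"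
    if "x \<in> carrier (quad R \<tau> \<beta>)" "y \<in> carrier (quad R \<tau> \<beta>)"
    using that by (auto simp: qtr_def r_distr a_ac)
  \<comment> \<open>Invariance of the divided trace under conjugation amounts to \<tau>0 \<tau> = 2
    \<tau>1, obtained by moving the factor b of \<tau> over to \<tau>0 instead of cancelling
    it.\<close>
  have "\<tau>0 \<otimes> \<tau> = \<tau>1 \<oplus> \<tau>1"
  proof -
    have "\<tau>0 \<otimes> \<tau> = (b \<otimes> \<tau>0) \<otimes> \<tau>1" by (simp add: m_ac flip: \<tau>)
    then show ?thesis by (simp add: 2 l_distr)
  qed
  moreover have "\<tau>0 \<otimes> (p \<oplus> \<tau> \<otimes> q) \<oplus> \<tau>1 \<otimes> \<ominus> q = \<tau>0 \<otimes> p \<oplus> \<tau>1 \<otimes> q \<oplus> (\<tau>0 \<otimes> \<tau> \<ominus> (\<tau>1 \<oplus> \<tau>1)) \<otimes> q"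
    if "p \<in> carrier R" "q \<in> carrier R" "\<tau> \<in> carrier R" "\<tau>0 \<in> carrier R" "\<tau>1 \<in> carrier R" for p q \<tau> \<tau>0 \<tau>1
    using that by (elim presE) (simp only: pres_simps, rule arg_cong[where f = pres], simp add: algebra_simps)
  ultimately show "qtr R \<tau>0 \<tau>1 (qconj R \<tau> x) = qtr R \<tau>0 \<tau>1 x" if "x \<in> carrier (quad R \<tau> \<beta>)"
    using that by (auto simp: qtr_def qconj_def a_minus_def r_neg)
  show "qtr R \<tau>0 \<tau>1 (r \<otimes>\<^bsub>quad R \<tau> \<beta>\<^esub> x) = r \<otimes>\<^bsub>quad R \<tau> \<beta>\<^esub> qtr R \<tau>0 \<tau>1 x"
    if "r \<in> carrier R \<times> {\<zero>}" "x \<in> carrier (quad R \<tau> \<beta>)"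
    using that by (auto simp: qtr_def a_minus_def r_distr m_ac)
  show "(b, \<zero>) \<otimes>\<^bsub>quad R \<tau> \<beta>\<^esub> qtr R \<tau>0 \<tau>1 x = x \<oplus>\<^bsub>quad R \<tau> \<beta>\<^esub> qconj R \<tau> x"
    if "x \<in> carrier (quad R \<tau> \<beta>)"
    using that by (auto simp: qtr_def qconj_def a_minus_def r_distr id 2 \<tau> r_neg simp flip: m_assoc)
qed (auto simp: qconj_def qtr_def)

subsection \<open>Tensor products with quadratic extensions\<close>

locale quad_ext = base_alg R S B s for R :: "'r ring" (structure) and S B :: "'a::comm_ring_1 set" and s +
  fixes t \<tau> \<beta> :: 'a and \<sigma> :: "'a \<Rightarrow> 'a"
  assumes \<tau>: "\<tau> \<in> S" and \<beta>: "\<beta> \<in> S" and t_sq: "t * t = \<tau> * t - \<beta>"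
    and B_eq: "B = {c + d * t | c d. c \<in> S \<and> d \<in> S}"
    and indep: "c \<in> S \<Longrightarrow> d \<in> S \<Longrightarrow> c + d * t = 0 \<Longrightarrow> c = 0 \<and> d = 0"
    and \<sigma>: "c \<in> S \<Longrightarrow> d \<in> S \<Longrightarrow> \<sigma> (c + d * t) = c + d * (\<tau> - t)"
begin

definition co0 :: "'a \<Rightarrow> 'a" where
  "co0 x = (SOME c. c \<in> S \<and> (\<exists>d\<in>S. x = c + d * t))"

definition co1 :: "'a \<Rightarrow> 'a" where
  "co1 x = (SOME d. d \<in> S \<and> (\<exists>c\<in>S. x = c + d * t))"

lemma indep2:
  assumes "c \<in> S" "d \<in> S" "c' \<in> S" "d' \<in> S" "c + d * t = c' + d' * t"
  shows "c = c' \<and> d = d'"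
  using indep[of "c - c'" "d - d'"] assms closed_ringD(6)[OF S] by (simp add: algebra_simps)

lemma co_eq [simp]:
  assumes "c \<in> S" "d \<in> S"
  shows "co0 (c + d * t) = c" "co1 (c + d * t) = d"
proof -
  have "co0 (c + d * t) \<in> S \<and> (\<exists>d'\<in>S. c + d * t = co0 (c + d * t) + d' * t)"
    unfolding co0_def by (rule someI[of _ c]) (use assms in auto)
  then obtain d' where "d' \<in> S" "c + d * t = co0 (c + d * t) + d' * t" "co0 (c + d * t) \<in> S" by blast
  then show "co0 (c + d * t) = c" using indep2[of c d "co0 (c + d * t)" d'] assms by metis
  have "co1 (c + d * t) \<in> S \<and> (\<exists>c'\<in>S. c + d * t = c' + co1 (c + d * t) * t)"
    unfolding co1_def by (rule someI[of _ d]) (use assms in auto)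
  then obtain c' where "c' \<in> S" "c + d * t = c' + co1 (c + d * t) * t" "co1 (c + d * t) \<in> S" by blast
  then show "co1 (c + d * t) = d" using indep2[of c d c' "co1 (c + d * t)"] assms by metis
qed

lemma BE:
  assumes "x \<in> B"
  obtains c d where "c \<in> S" "d \<in> S" "x = c + d * t"
  using assms B_eq by blast

lemma coB: "x \<in> B \<Longrightarrow> co0 x \<in> S" "x \<in> B \<Longrightarrow> co1 x \<in> S" "x \<in> B \<Longrightarrow> x = co0 x + co1 x * t"
  by (erule BE; simp)+

lemma t_B: "t \<in> B"
proof -
  have "t = 0 + 1 * t" by simp
  then show ?thesis using B_eq closed_ringD(1,2)[OF S] by blast
qed

lemma co_special: "c \<in> S \<Longrightarrow> co0 c = c" "c \<in> S \<Longrightarrow> co1 c = 0" "co0 t = 0" "co1 t = 1"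
  "co0 (t * t) = - \<beta>" "co1 (t * t) = \<tau>" "co0 1 = 1" "co1 1 = 0"
  using co_eq[of c 0] co_eq[of 0 1] co_eq[of "- \<beta>" \<tau>] co_eq[of 1 0] closed_ringD(1,2,3)[OF S] \<tau> \<beta> t_sq
  by auto

lemma co_linear:
  assumes "x \<in> B"
  shows "y \<in> B \<Longrightarrow> co0 (x + y) = co0 x + co0 y" "y \<in> B \<Longrightarrow> co1 (x + y) = co1 x + co1 y"
    "c \<in> S \<Longrightarrow> co0 (c * x) = c * co0 x" "c \<in> S \<Longrightarrow> co1 (c * x) = c * co1 x"
proof -
  obtain p q where x: "p \<in> S" "q \<in> S" "x = p + q * t" using assms by (rule BE)
  have "co0 (x + y) = co0 x + co0 y \<and> co1 (x + y) = co1 x + co1 y" if yB: "y \<in> B"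
  proof -
    obtain p' q' where y: "p' \<in> S" "q' \<in> S" "y = p' + q' * t" using yB by (rule BE)
    have "x + y = (p + p') + (q + q') * t" using x y by (simp add: algebra_simps)
    moreover have "p + p' \<in> S" "q + q' \<in> S" using x y closed_ringD(4)[OF S] by auto
    ultimately have "co0 (x + y) = p + p'" "co1 (x + y) = q + q'" using co_eq by simp_all
    then show ?thesis using x y by simp
  qed
  then show "y \<in> B \<Longrightarrow> co0 (x + y) = co0 x + co0 y" "y \<in> B \<Longrightarrow> co1 (x + y) = co1 x + co1 y"
    by auto
  have "co0 (c * x) = c * co0 x \<and> co1 (c * x) = c * co1 x" if "c \<in> S"
  proof -
    have "c * x = c * p + c * q * t" using x by (simp add: algebra_simps)
    moreover have "c * p \<in> S" "c * q \<in> S" using x that closed_ringD(5)[OF S] by auto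
    ultimately have "co0 (c * x) = c * p" "co1 (c * x) = c * q" using co_eq by simp_all
    then show ?thesis using x by simp
  qed
  then show "c \<in> S \<Longrightarrow> co0 (c * x) = c * co0 x" "c \<in> S \<Longrightarrow> co1 (c * x) = c * co1 x" by auto
qed

lemma \<sigma>_B: "x \<in> B \<Longrightarrow> \<sigma> x \<in> B" "x \<in> B \<Longrightarrow> co0 (\<sigma> x) = co0 x + \<tau> * co1 x" "x \<in> B \<Longrightarrow> co1 (\<sigma> x) = - co1 x"
proof -
  have *: "\<sigma> x = (co0 x + \<tau> * co1 x) + (- co1 x) * t" if "x \<in> B" for x
    using \<sigma>[of "co0 x" "co1 x"] coB[OF that] by (simp add: algebra_simps)
  have S': "co0 x + \<tau> * co1 x \<in> S" "- co1 x \<in> S" if "x \<in> B" for x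
    using coB[OF that] \<tau> closed_ringD[OF S] by auto
  show "x \<in> B \<Longrightarrow> \<sigma> x \<in> B" using * S' B_eq by blast
  show "co0 (\<sigma> x) = co0 x + \<tau> * co1 x" "co1 (\<sigma> x) = - co1 x" if "x \<in> B"
    using co_eq[OF S'[OF that]] *[OF that] by simp_all
qed

abbreviation Q :: "('r \<times> 'r) ring" where "Q \<equiv> quad R (s \<tau>) (s \<beta>)"
abbreviation T :: "('r \<times> 'a) list set ring" where "T \<equiv> tensor S s R B"

text \<open>The normal form of a class. With \<open>val\<close> reading off the coordinates, the
  tensor product becomes isomorphic to the quadratic algebra \<open>Q\<close>, where all
  computations take place.\<close>

definition el :: "'r \<times> 'r \<Rightarrow> ('r \<times> 'a) list set" where
  "el x = cls [(fst x, 1), (snd x, t)]"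

definition val :: "('r \<times> 'a) list \<Rightarrow> 'r \<times> 'r" where
  "val xs = (lin_list s R co0 xs, lin_list s R co1 xs)"

lemma el_lst [simp]: "x \<in> carrier R \<times> carrier R \<Longrightarrow> [(fst x, 1), (snd x, t)] \<in> lst"
  using t_B closed_ringD(2)[OF B] by auto

lemma val_closed: "xs \<in> lst \<Longrightarrow> val xs \<in> carrier R \<times> carrier R"
  unfolding val_def using lin_list_append(2)[of co0 xs] lin_list_append(2)[of co1 xs] coB by auto

lemma val_rel: "(xs, ys) \<in> rel \<Longrightarrow> val xs = val ys"
  unfolding val_def using lin_list_rel[of co0 xs ys] lin_list_rel[of co1 xs ys] coB co_linear by simp

text \<open>A pure tensor (r, c + d t) splits by bilinearity into multiples of 1 and of t, and terms
  with the same second factor are collected.\<close>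

lemma cls_eq_el:
  assumes "xs \<in> lst"
  shows "cls xs = el (val xs)"
proof -
  have "(xs, [(fst (val xs), 1), (snd (val xs), t)]) \<in> rel"
    using assms
  proof (induction xs)
    case Nil
    have "([(\<zero>, 1)] @ [(\<zero>, t)], [] @ []) \<in> rel"
      using t_B closed_ringD(2)[OF B] by (intro tensor_rel.append tensor_rel.zero)
    then show ?case by (simp add: val_def tensor_rel.sym)
  next
    case (Cons p xs)
    define r x where "r = fst p" and "x = snd p"
    have "p \<in> carrier R \<times> B" using Cons.hyps by simp
    then have p: "p = (r, x)" "r \<in> carrier R" "x \<in> B" by (auto simp: r_def x_def)
    define c d P Q' where "c = co0 x" and "d = co1 x" and "P = fst (val xs)" and "Q' = snd (val xs)"
    have cd: "c \<in> S" "d \<in> S" "x = c + d * t" using coB p by (auto simp: c_def d_def)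
    have PQ: "P \<in> carrier R" "Q' \<in> carrier R"
      using Cons.hyps val_closed[of xs] by (auto simp: P_def Q'_def)
    note B' = t_B closed_ringD(2)[OF B] closed_ringD(5)[OF B]
    have cB: "c \<in> B" "d * t \<in> B" using cd SB B' by auto
    have 1: "([(r, x)], [(r, c)] @ [(r, d * t)]) \<in> rel"
      using tensor_rel.add_right[OF p(2) cB, of S s] cd by simp
    have "([(r, c)] @ [(r, d * t)], [(r \<otimes> s c, 1)] @ [(r \<otimes> s d, t)]) \<in> rel"
      using tensor_rel.balanced[OF p(2) cd(1) B'(2), of s] tensor_rel.balanced[OF p(2) cd(2) t_B, of s]
      by (intro tensor_rel.append) (auto intro: tensor_rel.sym)
    with 1 have 2: "([(r, x)], [(r \<otimes> s c, 1)] @ [(r \<otimes> s d, t)]) \<in> rel" by (rule tensor_rel.trans)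
    have 3: "([(r, x)] @ xs, ([(r \<otimes> s c, 1)] @ [(r \<otimes> s d, t)]) @ [(P, 1), (Q', t)]) \<in> rel"
      unfolding P_def Q'_def using Cons 2 by (intro tensor_rel.append) auto
    have l: "([(r \<otimes> s c, 1)] @ [(r \<otimes> s d, t)]) @ [(P, 1), (Q', t)] \<in> lst"
      using p cd PQ B' by auto
    have 4: "(([(r \<otimes> s c, 1)] @ [(r \<otimes> s d, t)]) @ [(P, 1), (Q', t)],
      [(r \<otimes> s c, 1), (P, 1)] @ [(r \<otimes> s d, t), (Q', t)]) \<in> rel"
      by (rule rel_perm[OF _ l]) simp
    have 5: "([(r \<otimes> s c \<oplus> P, 1)] @ [(r \<otimes> s d \<oplus> Q', t)],
       [(r \<otimes> s c, 1), (P, 1)] @ [(r \<otimes> s d, t), (Q', t)]) \<in> rel"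
      using p cd PQ B' by (intro tensor_rel.append tensor_rel.add_left) auto
    have "([(r, x)] @ xs, [(r \<otimes> s c \<oplus> P, 1)] @ [(r \<otimes> s d \<oplus> Q', t)]) \<in> rel"
      using tensor_rel.trans[OF 3 tensor_rel.trans[OF 4 tensor_rel.sym[OF 5]]] .
    then show ?case by (simp add: p val_def c_def d_def P_def Q'_def)
  qed
  then show ?thesis
    unfolding el_def using assms el_lst[OF val_closed[OF assms]] by (subst class_eq_iff)
qed

lemma val_el [simp]: "x \<in> carrier R \<times> carrier R \<Longrightarrow> val [(fst x, 1), (snd x, t)] = x"
  using s_hom by (auto simp: val_def co_special)

lemma carrier_T: "carrier T = el ` (carrier R \<times> carrier R)"
proof -
  have a: "el x \<in> cls ` lst" if "x \<in> carrier R \<times> carrier R" for x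
    unfolding el_def using el_lst[OF that] by blast
  have b: "cls xs \<in> el ` (carrier R \<times> carrier R)" if "xs \<in> lst" for xs
    by (subst cls_eq_el[OF that]) (rule imageI[OF val_closed[OF that]])
  show ?thesis
    unfolding carrier_tensor
    by (rule equalityI; rule image_subsetI; (rule a | rule b); assumption)
qed

text \<open>\<open>val\<close> is constant on classes, so the congruence cannot identify different
  coordinates.\<close>

lemma el_inj:
  assumes "x \<in> carrier R \<times> carrier R" "y \<in> carrier R \<times> carrier R"
  shows "el x = el y \<longleftrightarrow> x = y"
  using assms class_eq_iff[OF el_lst el_lst, of x y] val_rel val_el by (metis el_def)

lemma \<tau>\<beta> [simp]: "s \<tau> \<in> carrier R" "s \<beta> \<in> carrier R"
  using \<tau> \<beta> by auto

sublocale Q: cring Q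
  by (intro cring_quad) auto

lemma el_hom: "el \<in> ring_hom Q T"
proof (rule ring_hom_memI)
  fix x y assume "x \<in> carrier Q" "y \<in> carrier Q"
  then have x: "x \<in> carrier R \<times> carrier R" and y: "y \<in> carrier R \<times> carrier R" by auto
  then have c [simp]: "fst x \<in> carrier R" "snd x \<in> carrier R" "fst y \<in> carrier R" "snd y \<in> carrier R" by auto
  have [simp]: "s 0 = \<zero>" "s 1 = \<one>" "s (- \<beta>) = \<ominus> s \<beta>" using s_hom \<beta> by auto
  show "el x \<in> carrier T" using x carrier_T by blast
  have "el x \<otimes>\<^bsub>T\<^esub> el y = cls (prod_list2 R [(fst x, 1), (snd x, t)] [(fst y, 1), (snd y, t)])"
    unfolding el_def using x y by (intro cls_mult el_lst)
  also have "\<dots> = el (val (prod_list2 R [(fst x, 1), (snd x, t)] [(fst y, 1), (snd y, t)]))"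
    using x y by (intro cls_eq_el prod_list2_closed el_lst)
  also have "val (prod_list2 R [(fst x, 1), (snd x, t)] [(fst y, 1), (snd y, t)]) = x \<otimes>\<^bsub>Q\<^esub> y"
    by (simp add: val_def co_special a_minus_def R.r_minus R.m_ac R.a_ac)
  finally show "el (x \<otimes>\<^bsub>Q\<^esub> y) = el x \<otimes>\<^bsub>T\<^esub> el y" ..
  have "el x \<oplus>\<^bsub>T\<^esub> el y = cls ([(fst x, 1), (snd x, t)] @ [(fst y, 1), (snd y, t)])"
    unfolding el_def using x y by (intro cls_add el_lst)
  also have "\<dots> = el (val ([(fst x, 1), (snd x, t)] @ [(fst y, 1), (snd y, t)]))"
    using x y by (intro cls_eq_el) (use el_lst[of x] el_lst[of y] in simp)
  also have "val ([(fst x, 1), (snd x, t)] @ [(fst y, 1), (snd y, t)]) = x \<oplus>\<^bsub>Q\<^esub> y"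
    by (simp add: val_def co_special)
  finally show "el (x \<oplus>\<^bsub>Q\<^esub> y) = el x \<oplus>\<^bsub>T\<^esub> el y" ..
next
  have "\<one>\<^bsub>T\<^esub> = cls [(\<one>, 1)]" by (simp add: tensor_def tens_def)
  also have "\<dots> = el (val [(\<one>, 1)])" using closed_ringD(2)[OF B] by (intro cls_eq_el) auto
  finally show "el \<one>\<^bsub>Q\<^esub> = \<one>\<^bsub>T\<^esub>" using s_hom by (simp add: val_def co_special)
qed

lemma el_zero: "\<zero>\<^bsub>T\<^esub> = el \<zero>\<^bsub>Q\<^esub>"
  using cls_eq_el[of "[]"] by (simp add: tensor_def val_def)

sublocale T: cring T
proof -
  have "el \<in> ring_iso Q T"
    using el_hom el_inj carrier_T by (simp add: ring_iso_def bij_betw_def inj_on_def)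
  \<comment> \<open>The transported structure has its zero replaced by the image of zero, which by
    \<open>el_zero\<close> is the zero of \<open>T\<close> already.\<close>
  then have "cring (T\<lparr>zero := el \<zero>\<^bsub>Q\<^esub>\<rparr>)" by (rule Q.ring_iso_imp_img_cring)
  then show "cring T" unfolding el_zero[symmetric] by (simp add: tensor_def)
qed

sublocale el: ring_hom_cring Q T el
  using el_hom by (intro ring_hom_cringI' Q.is_cring T.is_cring)

lemma tens_el:
  assumes "r \<in> carrier R" "x \<in> B"
  shows "tens S s R B r x = el (r \<otimes> s (co0 x), r \<otimes> s (co1 x))"
  unfolding tens_def using assms coB[OF assms(2)] by (subst cls_eq_el) (auto simp: val_def)

lemma lin_list_el:
  assumes f: "\<And>b. b \<in> B \<Longrightarrow> f b \<in> S" "\<And>b b'. b \<in> B \<Longrightarrow> b' \<in> B \<Longrightarrow> f (b + b') = f b + f b'"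
      "\<And>c b. c \<in> S \<Longrightarrow> b \<in> B \<Longrightarrow> f (c * b) = c * f b"
    and x: "x \<in> carrier R \<times> carrier R"
  shows "tensor_linear_ext s R f (el x) = fst x \<otimes> s (f 1) \<oplus> snd x \<otimes> s (f t)"
proof -
  have "f 1 \<in> S" "f t \<in> S" using f(1) t_B closed_ringD(2)[OF B] by auto
  then show ?thesis
    unfolding el_def using tensor_linear_ext_cls[OF f el_lst[OF x]] x by auto
qed

lemma tensor_map_el:
  assumes x: "x \<in> carrier R \<times> carrier R"
  shows "tensor_map S s R B \<sigma> (el x) = el (qconj R (s \<tau>) x)"
proof -
  have map: "lin_list s R f (map (apsnd \<sigma>) ys) = lin_list s R (f \<circ> \<sigma>) ys" for f ys
    by (induction ys) auto
  have "cls (map (apsnd \<sigma>) ys) = el (qconj R (s \<tau>) x)" if "([(fst x, 1), (snd x, t)], ys) \<in> rel" for ys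
  proof -
    have ys: "ys \<in> lst" using rel_lists that by blast
    then have "map (apsnd \<sigma>) ys \<in> lst" using \<sigma>_B by (auto simp: in_lists_conv_set)
    then have "cls (map (apsnd \<sigma>) ys) = el (val (map (apsnd \<sigma>) ys))" by (rule cls_eq_el)
    also have "val (map (apsnd \<sigma>) ys) = (lin_list s R (co0 \<circ> \<sigma>) ys, lin_list s R (co1 \<circ> \<sigma>) ys)"
      by (simp add: val_def map)
    also have "lin_list s R (co0 \<circ> \<sigma>) ys = lin_list s R (co0 \<circ> \<sigma>) [(fst x, 1), (snd x, t)]"
      using coB(1,2) co_linear closed_ringD(4,5)[OF B] closed_ringD(3,4,5)[OF S] \<tau> SB \<sigma>_B
      by (intro lin_list_rel[OF _ _ _ tensor_rel.sym[OF that]])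
        (auto simp: subset_iff distrib_left mult.left_commute)
    also have "lin_list s R (co1 \<circ> \<sigma>) ys = lin_list s R (co1 \<circ> \<sigma>) [(fst x, 1), (snd x, t)]"
      using coB(1,2) co_linear closed_ringD(4,5)[OF B] closed_ringD(3,4,5)[OF S] \<tau> SB \<sigma>_B
      by (intro lin_list_rel[OF _ _ _ tensor_rel.sym[OF that]]) (auto simp: subset_iff)
    finally have eq: "cls (map (apsnd \<sigma>) ys) =
        el (lin_list s R (co0 \<circ> \<sigma>) [(fst x, 1), (snd x, t)], lin_list s R (co1 \<circ> \<sigma>) [(fst x, 1), (snd x, t)])" .
    have "1 \<in> B" using closed_ringD(2)[OF B] .
    then have co: "co0 (\<sigma> 1) = 1" "co0 (\<sigma> t) = \<tau>" "co1 (\<sigma> 1) = 0" "co1 (\<sigma> t) = - 1"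
      using t_B by (simp_all only: \<sigma>_B co_special) simp_all
    have c: "fst x \<in> carrier R" "snd x \<in> carrier R" using x by auto
    have "s (- 1) = \<ominus> \<one>" using s_hom(2) s_hom(5)[of 1] closed_ringD(2)[OF S] by simp
    then show ?thesis
      unfolding eq using c s_hom(1,2) by (simp add: co qconj_def R.m_comm[of "snd x"] R.l_minus)
  qed
  then show ?thesis
    unfolding tensor_map_def using x by (subst el_def) (intro cls_UN el_lst; simp)
qed

lemma tensor_norm_el:
  assumes x: "x \<in> carrier R \<times> carrier R" and n: "x \<otimes>\<^bsub>Q\<^esub> qconj R (s \<tau>) x = (n, \<zero>)" "n \<in> carrier R"
  shows "tensor_norm S s R B \<sigma> (el x) = n"
proof -
  have c: "qconj R (s \<tau>) x \<in> carrier R \<times> carrier R" using x by (auto simp: qconj_def)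
  have "tens S s R B r 1 = el (r, \<zero>)" if "r \<in> carrier R" for r
    using that s_hom closed_ringD(2)[OF B] by (simp add: tens_el co_special)
  moreover have "el x \<otimes>\<^bsub>T\<^esub> tensor_map S s R B \<sigma> (el x) = el (n, \<zero>)"
    using el.hom_mult[of x "qconj R (s \<tau>) x"] x c n by (simp add: tensor_map_el)
  ultimately show ?thesis
    unfolding tensor_norm_def using n(2) by (intro the_equality) (auto simp: el_inj)
qed

text \<open>Coordinates are unique by \<open>el_inj\<close>, so the union in
  \<open>weil_coords\<close> runs over a single pair.\<close>

lemma weil_coords_el:
  assumes "x \<in> carrier R \<times> carrier R"
  shows "weil_coords S s R B t (el x) = {fst x, snd x}"
proof -
  have "tens S s R B p 1 \<oplus>\<^bsub>T\<^esub> tens S s R B q t = el (p, q)" if "p \<in> carrier R" "q \<in> carrier R" for p q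
    using that el.hom_add[of "(p, \<zero>)" "(\<zero>, q)"] s_hom t_B closed_ringD(2)[OF B]
    by (simp add: tens_el co_special)
  then have "weil_coords S s R B t (el x) = \<Union> {{p, q} | p q. p \<in> carrier R \<and> q \<in> carrier R \<and> el x = el (p, q)}"
    unfolding weil_coords_def by (metis (lifting))
  also have "{{p, q} | p q. p \<in> carrier R \<and> q \<in> carrier R \<and> el x = el (p, q)} = {{fst x, snd x}}"
    using assms by (cases x) (auto simp: el_inj cong: conj_cong)
  finally show ?thesis by simp
qed

lemma weil_matrix_el:
  assumes "\<And>v. x v \<in> carrier R"
  shows "weil_matrix S s R B t x = (\<lambda>i j. el (x (i, j, 0), x (i, j, 1)))"
  using assms el.hom_add[of "(x (i, j, 0), \<zero>)" "(\<zero>, x (i, j, 1))" for i j] s_hom t_B closed_ringD(2)[OF B]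
  by (intro ext) (simp add: weil_matrix_def tens_el co_special)

end

subsection \<open>Arithmetic of the ramified extension\<close>

locale valued_field =
  fixes \<omega> :: "'l::field \<Rightarrow> ereal"
  assumes val: "valuation_on UNIV \<omega>"
begin

lemma val_facts: "\<omega> x \<noteq> - \<infinity>" "\<omega> x = \<infinity> \<longleftrightarrow> x = 0" "\<omega> (x * y) = \<omega> x + \<omega> y"
  "min (\<omega> x) (\<omega> y) \<le> \<omega> (x + y)"
  using val by (auto simp: valuation_on_def)

text \<open>The valuation as a real number; at zero it takes the default value 0.\<close>

definition w :: "'l \<Rightarrow> real" where "w x = real_of_ereal (\<omega> x)"

lemma \<omega>_w: "x \<noteq> 0 \<Longrightarrow> \<omega> x = ereal (w x)"
  unfolding w_def using val_facts(1,2)[of x] by (cases "\<omega> x") auto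

lemma \<omega>_0 [simp]: "\<omega> 0 = \<infinity>"
  using val_facts(2)[of 0] by simp

lemma w_mult: "x \<noteq> 0 \<Longrightarrow> y \<noteq> 0 \<Longrightarrow> w (x * y) = w x + w y"
  using val_facts(3)[of x y] \<omega>_w[of x] \<omega>_w[of y] \<omega>_w[of "x * y"] by simp

lemma w_1 [simp]: "w 1 = 0"
  using w_mult[of 1 1] by simp

lemma w_minus [simp]: "w (- x) = w x"
proof (cases "x = 0")
  case False
  have "w (-1) + w (-1) = 0" using w_mult[of "-1" "-1"] by simp
  then show ?thesis using w_mult[of "-1" x] False by simp
qed simp

lemma \<omega>_minus [simp]: "\<omega> (- x) = \<omega> x"
  using \<omega>_w[of x] \<omega>_w[of "- x"] by (cases "x = 0") auto

lemma w_inverse: "x \<noteq> 0 \<Longrightarrow> w (inverse x) = - w x"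
  using w_mult[of x "inverse x"] by simp

lemma w_divide: "x \<noteq> 0 \<Longrightarrow> y \<noteq> 0 \<Longrightarrow> w (x / y) = w x - w y"
  using w_mult[of x "inverse y"] w_inverse[of y] by (simp add: divide_inverse)

lemma w_power: "x \<noteq> 0 \<Longrightarrow> w (x ^ n) = real n * w x"
  by (induction n) (auto simp: w_mult algebra_simps)

text \<open>The isosceles triangle principle: a larger valuation of the sum would, after subtracting
  y, contradict the valuation of x.\<close>

lemma \<omega>_add_less:
  assumes "\<omega> x < \<omega> y"
  shows "\<omega> (x + y) = \<omega> x"
proof (rule antisym)
  show "\<omega> x \<le> \<omega> (x + y)" using val_facts(4)[of x y] assms by simp
  have "min (\<omega> (x + y)) (\<omega> y) \<le> \<omega> x" using val_facts(4)[of "x + y" "- y"] by simp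
  then show "\<omega> (x + y) \<le> \<omega> x" using assms by (auto simp: min_def split: if_splits)
qed

lemma \<omega>_add_neq: "\<omega> x \<noteq> \<omega> y \<Longrightarrow> \<omega> (x + y) = min (\<omega> x) (\<omega> y)"
  using \<omega>_add_less[of x y] \<omega>_add_less[of y x] by (cases "\<omega> x < \<omega> y") (auto simp: add.commute min_def)

end

locale ramified_setting =
  fixes K :: "'l::field set" and \<omega> :: "'l \<Rightarrow> ereal" and \<sigma> :: "'l \<Rightarrow> 'l" and t \<beta> :: 'l and i0 :: nat
  assumes local_field: "local_field \<omega> K"
    and residue: "residue_char_two \<omega> K"
    and ext: "ramified_separable_quadratic \<omega> K \<sigma>"
    and param: "ramification_parameter \<omega> K i0"
    and unif_t: "uniformiser \<omega> UNIV t"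
    and \<beta>_def: "\<beta> = t * \<sigma> t"
begin

sublocale valued_field \<omega>
  using ext by unfold_locales (simp add: ramified_separable_quadratic_def)

lemma K_closed: "closed_ring K" "x \<in> K \<Longrightarrow> inverse x \<in> K"
proof -
  have K: "subfield K (ring_of UNIV)" using local_field by (simp add: local_field_def)
  interpret U: cring "ring_of (UNIV :: 'l set)" by (rule cring_ring_of) simp
  have f: "field (ring_of (UNIV :: 'l set))"
  proof (rule U.cring_fieldI2)
    fix a :: 'l assume "a \<in> carrier (ring_of UNIV)" "a \<noteq> \<zero>\<^bsub>ring_of UNIV\<^esub>"
    then show "\<exists>b\<in>carrier (ring_of UNIV). a \<otimes>\<^bsub>ring_of UNIV\<^esub> b = \<one>\<^bsub>ring_of UNIV\<^esub>"
      by (auto intro!: exI[of _ "inverse a"])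
  qed simp
  have s: "subring K (ring_of UNIV)" using K subfieldE(1) by blast
  show c: "closed_ring K"
    using subringE(2,3,5,6,7)[OF s] by (simp add: closed_ring_def)
  show "inverse x \<in> K" if "x \<in> K"
  proof (cases "x = 0")
    case False
    have "x \<in> Units ((ring_of UNIV)\<lparr>carrier := K\<rparr>)"
      using subfield.subfield_Units[OF K] that False by simp
    then obtain y where "y \<in> K" "x * y = 1" by (auto simp: Units_def)
    then show ?thesis using False by (metis inverse_unique)
  qed (use that in simp)
qed

lemmas K = closed_ringD[OF K_closed(1)] K_closed(2)

lemma K_divide: "x \<in> K \<Longrightarrow> y \<in> K \<Longrightarrow> x / y \<in> K"
  using K(5)[of x "inverse y"] K(8)[of y] by (simp add: divide_inverse)

lemma \<sigma>_hom: "\<sigma> (x + y) = \<sigma> x + \<sigma> y" "\<sigma> (x * y) = \<sigma> x * \<sigma> y" "\<sigma> 1 = 1" "x \<in> K \<Longrightarrow> \<sigma> x = x" "\<sigma> \<noteq> id"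
proof -
  have "\<sigma> \<in> ring_hom (ring_of UNIV) (ring_of UNIV)" "\<forall>x\<in>K. \<sigma> x = x" "\<sigma> \<noteq> id"
    using ext by (auto simp: ramified_separable_quadratic_def conjugation_def ring_iso_def)
  then show "\<sigma> (x + y) = \<sigma> x + \<sigma> y" "\<sigma> (x * y) = \<sigma> x * \<sigma> y" "\<sigma> 1 = 1" "x \<in> K \<Longrightarrow> \<sigma> x = x" "\<sigma> \<noteq> id"
    using ring_hom_add[of \<sigma> "ring_of UNIV" "ring_of UNIV" x y]
      ring_hom_mult[of \<sigma> "ring_of UNIV" "ring_of UNIV" x y] ring_hom_one[of \<sigma> "ring_of UNIV" "ring_of UNIV"]
    by simp_all
qed

text \<open>The normalisation: \<open>h\<close> is the valuation of a uniformiser of \<open>L\<close>, so \<open>K\<close> has value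
  group \<open>2 h \<int>\<close>.\<close>

lemma structure_exists:
  "\<exists>h t0 \<alpha> \<beta>0. 0 < h \<and> \<alpha> \<in> K \<and> \<beta>0 \<in> K \<and> t0 * t0 = \<alpha> * t0 - \<beta>0 \<and>
     (\<forall>x\<in>K. x \<noteq> 0 \<longrightarrow> (\<exists>n::int. w x = 2 * h * of_int n)) \<and>
     (\<forall>x. \<exists>y\<in>K. \<exists>z\<in>K. x = y + z * t0) \<and> w \<beta>0 = 2 * h \<and> \<beta>0 \<noteq> 0 \<and> t0 \<noteq> 0 \<and> w t0 = h \<and>
     \<sigma> t0 = \<alpha> - t0 \<and> w (\<sigma> t0) = h \<and>
     0 < i0 \<and> ereal (2 * h * real i0) \<le> \<omega> 2 \<and> ereal (2 * h * real i0) \<le> \<omega> \<alpha> \<and>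
     (if \<alpha> = 0 then \<omega> 2 else \<omega> \<alpha>) = ereal (2 * h * real i0)"
proof -
  obtain t0 \<alpha> \<beta>0 p where a: "\<alpha> \<in> K" "\<beta>0 \<in> K" and gen: "\<And>x. \<exists>f. set (coeffs f) \<subseteq> K \<and> poly f t0 = x"
    and eq: "t0\<^sup>2 - \<alpha> * t0 + \<beta>0 = 0" and \<beta>0: "uniformiser \<omega> K \<beta>0"
    and \<alpha>: "\<alpha> = 0 \<or> 0 < \<omega> \<beta>0 \<and> \<omega> \<beta>0 \<le> \<omega> \<alpha> \<and> \<omega> \<alpha> \<le> \<omega> 2"
    and p: "uniformiser \<omega> K p" "\<omega> (p ^ i0) = (if \<alpha> = 0 then \<omega> 2 else \<omega> \<alpha>)"
    using param unfolding ramification_parameter_def by blast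
  define h where "h = w \<beta>0 / 2"
  have b0: "\<beta>0 \<noteq> 0" "0 < \<omega> \<beta>0" using \<beta>0 by (auto simp: uniformiser_def max_ideal_def)
  have w0: "0 < w \<beta>0" using b0 \<omega>_w[of \<beta>0] by simp
  have min: "w \<beta>0 \<le> w x" if "x \<in> K" "x \<noteq> 0" "0 < w x" for x
    using \<beta>0 that \<omega>_w[of x] \<omega>_w[of \<beta>0] b0 by (auto simp: uniformiser_def max_ideal_def)
  have vals: "\<exists>n::int. w x = w \<beta>0 * of_int n" if x: "x \<in> K" "x \<noteq> 0" for x
  proof -
    \<comment> \<open>Dividing by the power of \<beta>0 given by the floor leaves an element with
      valuation in [0, w \<beta>0), which must be 0 by minimality of \<beta>0.\<close>
    define n where "n = \<lfloor>w x / w \<beta>0\<rfloor>"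
    define y where "y = (if 0 \<le> n then x / \<beta>0 ^ nat n else x * \<beta>0 ^ nat (- n))"
    have y: "y \<in> K" "y \<noteq> 0" unfolding y_def using x a b0 by (auto intro!: K(5,7) K_divide)
    have wy: "w y = w x - of_int n * w \<beta>0"
      unfolding y_def using x b0 by (auto simp: w_divide w_mult w_power)
    have "of_int n \<le> w x / w \<beta>0" "w x / w \<beta>0 < of_int n + 1" unfolding n_def by linarith+
    then have "0 \<le> w y" "w y < w \<beta>0" unfolding wy using w0 by (auto simp: field_simps)
    then have "w y = 0" using min[OF y] by linarith
    then show ?thesis using wy by (intro exI[of _ n]) (simp add: mult.commute)
  qed
  have t0: "t0 * t0 = \<alpha> * t0 - \<beta>0" using eq by (simp add: power2_eq_square algebra_simps)
  have \<alpha>0: "w \<beta>0 \<le> w \<alpha>" if "\<alpha> \<noteq> 0" using \<alpha> that \<omega>_w[of \<alpha>] \<omega>_w[of \<beta>0] b0 by auto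
  \<comment> \<open>A Newton polygon argument, used both for t0 and for its conjugate: \<alpha> u
    has larger valuation than \<beta>0, so u^2 has the valuation of \<beta>0.\<close>
  have root: "u \<noteq> 0 \<and> w u = h" if u: "u * u = \<alpha> * u - \<beta>0" for u
  proof -
    have u0: "u \<noteq> 0" using u b0 by auto
    have s: "\<omega> (\<beta>0 + - (\<alpha> * u)) = ereal (w u + w u)"
    proof -
      have "\<beta>0 + - (\<alpha> * u) = - (u * u)" using u by simp
      then show ?thesis using \<omega>_w[of "u * u"] u0 by (simp only: \<omega>_minus) (simp add: w_mult)
    qed
    have m: "min (\<omega> \<beta>0) (\<omega> (\<alpha> * u)) \<le> ereal (w u + w u)"
      using val_facts(4)[of \<beta>0 "- (\<alpha> * u)"] s by simp
    have "0 < w u"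
    proof (rule ccontr)
      assume n: "\<not> 0 < w u"
      show False
      proof (cases "\<alpha> = 0")
        case True
        then show ?thesis using m n w0 \<omega>_w[of \<beta>0] b0 by simp
      next
        case False
        then have "\<omega> (\<alpha> * u) = ereal (w \<alpha> + w u)" using u0 \<omega>_w[of "\<alpha> * u"] by (simp add: w_mult)
        then show ?thesis using m n w0 \<alpha>0[OF False] \<omega>_w[of \<beta>0] b0 by (auto simp: min_def split: if_splits)
      qed
    qed
    then have "\<omega> \<beta>0 < \<omega> (- (\<alpha> * u))"
      using \<alpha>0 u0 \<omega>_w[of "\<alpha> * u"] \<omega>_w[of \<beta>0] b0 by (cases "\<alpha> = 0") (auto simp: w_mult)
    then have "\<omega> (\<beta>0 + - (\<alpha> * u)) = \<omega> \<beta>0" by (rule \<omega>_add_less)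
    then have "w \<beta>0 = w u + w u" using s \<omega>_w[of \<beta>0] b0 by simp
    then show ?thesis using u0 by (simp add: h_def)
  qed
  \<comment> \<open>Polynomials in t0 are reduced to degree one by the quadratic equation.\<close>
  have span: "\<exists>y\<in>K. \<exists>z\<in>K. x = y + z * t0" for x
  proof -
    obtain f where f: "set (coeffs f) \<subseteq> K" "poly f t0 = x" using gen by blast
    have "\<exists>y\<in>K. \<exists>z\<in>K. poly f t0 = y + z * t0" using f(1)
    proof (induction f)
      case 0
      then show ?case using K(1) by (auto intro!: bexI[of _ 0])
    next
      case (pCons c f)
      then have c: "c \<in> K" and "set (coeffs f) \<subseteq> K"
        by (auto simp: coeffs_pCons_eq_cCons cCons_def split: if_splits)
      then obtain y z where yz: "y \<in> K" "z \<in> K" "poly f t0 = y + z * t0" using pCons by blast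
      have "poly (pCons c f) t0 = c + y * t0 + z * (t0 * t0)" using yz by (simp add: algebra_simps)
      also have "\<dots> = (c - z * \<beta>0) + (y + z * \<alpha>) * t0" unfolding t0 by (simp add: algebra_simps)
      finally have "poly (pCons c f) t0 = (c - z * \<beta>0) + (y + z * \<alpha>) * t0" .
      moreover have "c - z * \<beta>0 \<in> K" "y + z * \<alpha> \<in> K" using c yz a by (auto intro!: K(4,5,6))
      ultimately show ?case by blast
    qed
    then show ?thesis using f by simp
  qed
  have \<sigma>neg: "\<sigma> (x - y) = \<sigma> x - \<sigma> y" for x y
    using \<sigma>_hom(1)[of "x - y" y] by simp
  have \<sigma>t: "\<sigma> t0 * \<sigma> t0 = \<alpha> * \<sigma> t0 - \<beta>0"
    using arg_cong[OF t0, of \<sigma>] a by (simp add: \<sigma>_hom \<sigma>neg)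
  have "\<sigma> t0 \<noteq> t0"
  proof
    assume *: "\<sigma> t0 = t0"
    have "\<sigma> x = x" for x
    proof -
      obtain y z where "y \<in> K" "z \<in> K" "x = y + z * t0" using span by blast
      then show ?thesis using * by (simp add: \<sigma>_hom)
    qed
    then show False using \<sigma>_hom(5) by auto
  qed
  moreover have "(\<sigma> t0 - t0) * (\<sigma> t0 - (\<alpha> - t0)) = 0"
  proof -
    have "(\<sigma> t0 - t0) * (\<sigma> t0 - (\<alpha> - t0)) = (\<sigma> t0 * \<sigma> t0 - \<alpha> * \<sigma> t0) - (t0 * t0 - \<alpha> * t0)"
      by (simp add: algebra_simps)
    then show ?thesis unfolding \<sigma>t t0 by simp
  qed
  ultimately have st: "\<sigma> t0 = \<alpha> - t0" by simp
  have pw: "w p = 2 * h" and p0: "p \<noteq> 0"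
  proof -
    show "p \<noteq> 0" using p(1) by (simp add: uniformiser_def)
    have "p \<in> K" "0 < w p" "\<omega> p \<le> \<omega> \<beta>0"
      using p(1) \<beta>0 \<omega>_w[of p] by (auto simp: uniformiser_def max_ideal_def)
    then show "w p = 2 * h" using min[of p] \<open>p \<noteq> 0\<close> \<omega>_w[of p] \<omega>_w[of \<beta>0] b0 by (simp add: h_def)
  qed
  have pi: "\<omega> (p ^ i0) = ereal (2 * h * real i0)"
    using \<omega>_w[of "p ^ i0"] p0 pw by (simp add: w_power mult.commute)
  have 2: "0 < \<omega> 2" using residue by (simp add: residue_char_two_def max_ideal_def)
  have "0 < i0"
  proof (rule ccontr)
    assume "\<not> 0 < i0"
    then have "(if \<alpha> = 0 then \<omega> 2 else \<omega> \<alpha>) = 0" using pi p(2) by (simp add: zero_ereal_def)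
    moreover have "0 < \<omega> \<alpha>" if "\<alpha> \<noteq> 0" using \<alpha> that by auto
    ultimately show False using 2 by (auto split: if_splits)
  qed
  moreover have "ereal (2 * h * real i0) \<le> \<omega> 2" "ereal (2 * h * real i0) \<le> \<omega> \<alpha>"
    using p(2) \<alpha> unfolding pi by (auto split: if_splits)
  ultimately show ?thesis
    using a t0 vals span b0 root[OF t0] root[OF \<sigma>t] st w0 p(2)[symmetric] unfolding pi
    by (intro exI[of _ h] exI[of _ t0] exI[of _ \<alpha>] exI[of _ \<beta>0]) (simp add: h_def)
qed

definition \<tau> :: 'l where "\<tau> = t + \<sigma> t"
definition b :: 'l where "b = \<beta> ^ i0"

abbreviation OK :: "'l set" where "OK \<equiv> integers \<omega> K"
abbreviation OL :: "'l set" where "OL \<equiv> integers \<omega> UNIV"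

lemma closed_OK: "closed_ring OK" and closed_OL: "closed_ring OL"
proof -
  have "0 \<le> \<omega> 1" using \<omega>_w[of 1] by simp
  moreover have "0 \<le> \<omega> (x + y)" "0 \<le> \<omega> (x * y)" if "0 \<le> \<omega> x" "0 \<le> \<omega> y" for x y
    using val_facts(3,4)[of x y] that by (auto simp: min_def split: if_splits)
  ultimately show "closed_ring OK" "closed_ring OL"
    using K by (auto simp: closed_ring_def integers_def)
qed

text \<open>The uniformiser t is arbitrary, whereas i0 is defined through a particular generator t0.
  Writing t = y + z t0 with y of valuation at least 2 h and z integral transfers the divisibility of
  traces from 2 and \<alpha> to \<tau>.\<close>

lemma arithmetic:
  shows \<tau>_OK: "\<tau> \<in> OK" and \<beta>_OK: "\<beta> \<in> OK" and t_sq: "t * t = \<tau> * t - \<beta>"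
    and OL_eq: "OL = {c + d * t | c d. c \<in> OK \<and> d \<in> OK}"
    and UNIV_eq: "UNIV = {c + d * t | c d. c \<in> K \<and> d \<in> K}"
    and indep: "c \<in> K \<Longrightarrow> d \<in> K \<Longrightarrow> c + d * t = 0 \<Longrightarrow> c = 0 \<and> d = 0"
    and \<sigma>_eq: "c \<in> K \<Longrightarrow> d \<in> K \<Longrightarrow> \<sigma> (c + d * t) = c + d * (\<tau> - t)"
    and \<tau>01: "\<exists>\<tau>0\<in>OK. \<exists>\<tau>1\<in>OK. \<exists>e0\<in>OK. \<exists>e1\<in>OK. b * \<tau>0 = 2 \<and> b * \<tau>1 = \<tau> \<and> \<tau>0 * e0 + \<tau>1 * e1 = 1"
    and \<beta>_nz: "\<beta> \<noteq> 0" and \<beta>_dvd_b: "\<exists>c\<in>OK. b = \<beta> * c"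
    and clear: "x \<in> K \<Longrightarrow> \<exists>n. \<beta> ^ n * x \<in> OK"
proof -
  obtain h t0 \<alpha> \<beta>0 where h: "0 < h" and a: "\<alpha> \<in> K" "\<beta>0 \<in> K" and t0: "t0 * t0 = \<alpha> * t0 - \<beta>0"
    and vals: "\<And>x. x \<in> K \<Longrightarrow> x \<noteq> 0 \<Longrightarrow> \<exists>n::int. w x = 2 * h * of_int n"
    and span: "\<And>x. \<exists>y\<in>K. \<exists>z\<in>K. x = y + z * t0" and b0: "w \<beta>0 = 2 * h" "\<beta>0 \<noteq> 0"
    and wt0: "t0 \<noteq> 0" "w t0 = h" and st0: "\<sigma> t0 = \<alpha> - t0" and wst0: "w (\<sigma> t0) = h"
    and i0: "0 < i0" "ereal (2 * h * real i0) \<le> \<omega> 2" "ereal (2 * h * real i0) \<le> \<omega> \<alpha>"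
      "(if \<alpha> = 0 then \<omega> 2 else \<omega> \<alpha>) = ereal (2 * h * real i0)"
    using structure_exists by blast
  \<comment> \<open>For nonzero c and d the valuation of c is an even multiple of h and that of d u
    an odd one, so no cancellation occurs.\<close>
  have parity: "\<omega> (c + d * u) = min (\<omega> c) (\<omega> d + ereal h)"
    if c: "c \<in> K" and d: "d \<in> K" and u: "u \<noteq> 0" "w u = h" for c d u
  proof (cases "c = 0 \<or> d = 0")
    case True
    then show ?thesis using val_facts(3)[of d u] u \<omega>_w[of u] by auto
  next
    case False
    obtain m n :: int where m: "w c = 2 * h * of_int m" and n: "w d = 2 * h * of_int n"
      using vals c d False by metis
    have "w c \<noteq> w d + h"
    proof
      assume "w c = w d + h"
      then have "h * of_int (2 * m) = h * of_int (2 * n + 1)"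
        unfolding m n by (simp add: algebra_simps)
      then have "2 * m = 2 * n + 1" using h by (metis mult_cancel_left of_int_eq_iff less_irrefl)
      then show False by presburger
    qed
    moreover have "\<omega> c = ereal (w c)" "\<omega> (d * u) = ereal (w d + h)" "\<omega> d = ereal (w d)"
      using False u \<omega>_w[of c] \<omega>_w[of "d * u"] \<omega>_w[of d] by (auto simp: w_mult)
    ultimately show ?thesis using \<omega>_add_neq[of c "d * u"] by simp
  qed
  have \<sigma>t0: "\<sigma> t0 \<noteq> 0"
  proof
    assume "\<sigma> t0 = 0"
    \<comment> \<open>The default value of w at zero contradicts w (\<sigma> t0) = h > 0.\<close>
    then have "w (\<sigma> t0) = 0" by (simp add: w_def)
    then show False using wst0 h by simp
  qed
  \<comment> \<open>The parity formula gives the same value for t0 and for its conjugate.\<close>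
  have \<omega>\<sigma>: "\<omega> (\<sigma> x) = \<omega> x" for x
  proof -
    obtain y z where x: "y \<in> K" "z \<in> K" "x = y + z * t0" using span by blast
    then have "\<sigma> x = y + z * \<sigma> t0" by (simp add: \<sigma>_hom)
    then show ?thesis using parity[OF x(1,2) \<sigma>t0 wst0] parity[OF x(1,2) wt0] x(3) by simp
  qed
  obtain y z where yz: "y \<in> K" "z \<in> K" "t = y + z * t0" using span by blast
  have tnz: "t \<noteq> 0" and tpos: "0 < \<omega> t" and tmin: "\<omega> t \<le> \<omega> t0"
  proof -
    have "0 < \<omega> t0" using \<omega>_w[of t0] wt0 h by simp
    then show "t \<noteq> 0" "0 < \<omega> t" "\<omega> t \<le> \<omega> t0"
      using unif_t by (auto simp: uniformiser_def max_ideal_def)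
  qed
  have \<omega>yz: "min (\<omega> y) (\<omega> z + ereal h) = \<omega> t" using parity[OF yz(1,2) wt0] yz(3) by simp
  \<comment> \<open>y lies in K and has positive valuation; the smallest such value is 2 h.\<close>
  have yh: "ereal (2 * h) \<le> \<omega> y"
  proof (cases "y = 0")
    case False
    then obtain n :: int where n: "w y = 2 * h * of_int n" using vals yz by blast
    have "0 < \<omega> y" using \<omega>yz tpos by (metis min_less_iff_conj)
    then have "0 < w y" using \<omega>_w[OF False] by simp
    then have "0 < n" using n h by (simp add: zero_less_mult_iff)
    then have "1 \<le> n" by simp
    then show ?thesis using n h \<omega>_w[OF False] by simp
  qed simp
  have z: "0 \<le> \<omega> z"
  proof (cases "z = 0")
    case False
    then obtain n :: int where n: "w z = 2 * h * of_int n" using vals yz by blast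
    have "0 < \<omega> z + ereal h" using \<omega>yz tpos by (metis min_less_iff_conj)
    then have "0 < w z + h" using \<omega>_w[OF False] by simp
    then have "0 < h * (2 * of_int n + 1)" using n by (simp add: algebra_simps)
    then have "0 < 2 * of_int n + (1 :: real)" using h by (simp add: zero_less_mult_iff)
    then have "0 \<le> n" by linarith
    then show ?thesis using n h \<omega>_w[OF False] by simp
  qed simp
  \<comment> \<open>Minimality of the uniformiser gives one inequality, the bounds on y and z the
    other.\<close>
  have wt: "w t = h"
  proof -
    have "ereal h \<le> \<omega> t"
      unfolding \<omega>yz[symmetric] using yh z h by (cases "\<omega> y"; cases "\<omega> z") (auto simp: zero_ereal_def)
    then show ?thesis using tmin \<omega>_w[OF tnz] \<omega>_w[OF wt0(1)] wt0 by simp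
  qed
  have \<sigma>t: "\<sigma> t = y + z * (\<alpha> - t0)" using yz by (simp add: \<sigma>_hom st0)
  have \<tau>2: "\<tau> = 2 * y + z * \<alpha>" unfolding \<tau>_def \<sigma>t using yz(3) by (simp add: algebra_simps)
  have "\<beta> = y * y + y * z * \<alpha> + z * z * (\<alpha> * t0 - t0 * t0)"
    unfolding \<beta>_def \<sigma>t using yz(3) by (simp add: algebra_simps)
  then have \<beta>2: "\<beta> = y * y + y * z * \<alpha> + z * z * \<beta>0" unfolding t0 by simp
  have "1 \<in> K" "2 \<in> K" using K(2) K(4)[of 1 1] by auto
  then have \<tau>K: "\<tau> \<in> K" and \<beta>K: "\<beta> \<in> K" unfolding \<tau>2 \<beta>2 using yz a by (auto intro!: K(4,5))
  have \<sigma>tnz: "\<sigma> t \<noteq> 0" using \<omega>\<sigma>[of t] tnz val_facts(2) by metis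
  have w\<sigma>t: "w (\<sigma> t) = h" using \<omega>\<sigma>[of t] wt by (simp add: w_def)
  have w\<beta>: "w \<beta> = 2 * h" unfolding \<beta>_def using tnz \<sigma>tnz wt w\<sigma>t by (simp add: w_mult)
  show \<beta>nz: "\<beta> \<noteq> 0" unfolding \<beta>_def using tnz \<sigma>tnz by simp
  show \<beta>O: "\<beta> \<in> OK" using \<beta>K w\<beta> h \<omega>_w[OF \<beta>nz] by (simp add: integers_def)
  have "0 \<le> \<omega> \<tau>"
    using val_facts(4)[of t "\<sigma> t"] \<omega>\<sigma>[of t] tpos by (simp add: \<tau>_def)
  then show \<tau>O: "\<tau> \<in> OK" using \<tau>K by (simp add: integers_def)
  show tsq: "t * t = \<tau> * t - \<beta>" by (simp add: \<tau>_def \<beta>_def algebra_simps)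
  show indep: "c = 0 \<and> d = 0" if "c \<in> K" "d \<in> K" "c + d * t = 0" for c d
  proof -
    have "min (\<omega> c) (\<omega> d + ereal h) = \<infinity>" using parity[OF that(1,2) tnz wt] that(3) by simp
    then have "\<omega> c = \<infinity>" "\<omega> d + ereal h = \<infinity>" by (auto simp: min_def split: if_splits)
    then show ?thesis using val_facts(2) by auto
  qed
  have znz: "z \<noteq> 0"
  proof
    assume "z = 0"
    then have "\<omega> t = \<omega> y" using yz by simp
    then have "ereal (2 * h) \<le> ereal h" using yh \<omega>_w[OF tnz] wt by simp
    then show False using h by simp
  qed
  have span': "\<exists>c\<in>K. \<exists>d\<in>K. x = c + d * t" for x
  proof -
    obtain p q where pq: "p \<in> K" "q \<in> K" "x = p + q * t0" using span by blast
    have "x = (p - q * y / z) + (q / z) * t"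
      using znz pq(3) yz(3) by (simp add: field_simps)
    moreover have "p - q * y / z \<in> K" "q / z \<in> K" using pq yz by (auto intro!: K(5,6) K_divide)
    ultimately show ?thesis by blast
  qed
  then show "UNIV = {c + d * t | c d. c \<in> K \<and> d \<in> K}" by blast
  show \<sigma>eq: "\<sigma> (c + d * t) = c + d * (\<tau> - t)" if "c \<in> K" "d \<in> K" for c d
    using that by (simp add: \<sigma>_hom \<tau>_def)
  \<comment> \<open>By parity d has valuation at least - h; being a multiple of 2 h, it is
    nonnegative. So integrality is tested on coordinates.\<close>
  have OLD: "c \<in> OK \<and> d \<in> OK" if cd: "c \<in> K" "d \<in> K" "0 \<le> \<omega> (c + d * t)" for c d
  proof -
    have m: "0 \<le> \<omega> c" "0 \<le> \<omega> d + ereal h"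
      using parity[OF cd(1,2) tnz wt] cd(3) by simp_all
    have "0 \<le> \<omega> d"
    proof (cases "d = 0")
      case False
      then obtain n :: int where n: "w d = 2 * h * of_int n" using vals cd by blast
      have "0 \<le> w d + h" using m(2) \<omega>_w[OF False] by simp
      then have "0 \<le> h * (2 * of_int n + 1)" using n by (simp add: algebra_simps)
      then have "0 \<le> 2 * of_int n + (1 :: real)" using h by (simp add: zero_le_mult_iff)
      then have "0 \<le> n" by linarith
      then show ?thesis using n h \<omega>_w[OF False] by simp
    qed simp
    then show ?thesis using m cd by (simp add: integers_def)
  qed
  show OLeq: "OL = {c + d * t | c d. c \<in> OK \<and> d \<in> OK}"
  proof (intro equalityI subsetI)
    fix x assume "x \<in> OL"
    then have "0 \<le> \<omega> x" by (simp add: integers_def)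
    then show "x \<in> {c + d * t | c d. c \<in> OK \<and> d \<in> OK}" using span'[of x] OLD by blast
  next
    fix x assume "x \<in> {c + d * t | c d. c \<in> OK \<and> d \<in> OK}"
    then obtain c d where "c \<in> OK" "d \<in> OK" "x = c + d * t" by blast
    moreover have "t \<in> OL" "OK \<subseteq> OL" using tpos by (auto simp: integers_def)
    ultimately show "x \<in> OL" using closed_ringD(4,5)[OF closed_OL] by (simp add: subset_iff)
  qed
  have bnz: "b \<noteq> 0" and bK: "b \<in> K" and wb: "w b = 2 * h * real i0"
    unfolding b_def using \<beta>nz \<beta>K K(7) w\<beta> by (auto simp: w_power)
  have div: "x / b \<in> OK" if "x \<in> K" "ereal (2 * h * real i0) \<le> \<omega> x" for x
  proof (cases "x = 0")
    case False
    then show ?thesis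
      using that bnz bK K_divide[of x b] \<omega>_w[of x] \<omega>_w[of "x / b"] wb
      by (simp add: integers_def w_divide)
  qed (simp add: integers_def K(1))
  \<comment> \<open>Both 2 and \<alpha> have at least the valuation of b, and y, z are integral; the
    argument of the valuation is \<tau>.\<close>
  have ge: "ereal (2 * h * real i0) \<le> \<omega> (2 * y + z * \<alpha>)"
  proof -
    have "0 \<le> ereal (2 * h)" using h by simp
    then have y0: "0 \<le> \<omega> y" using yh by (rule order.trans)
    have "\<omega> 2 \<le> \<omega> (2 * y)"
      using val_facts(3)[of 2 y] add_mono[OF order_refl y0, of "\<omega> 2"] by simp
    moreover have "\<omega> \<alpha> \<le> \<omega> (z * \<alpha>)"
      using val_facts(3)[of z \<alpha>] add_mono[of 0 "\<omega> z" "\<omega> \<alpha>" "\<omega> \<alpha>"] z by simp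
    ultimately have "ereal (2 * h * real i0) \<le> min (\<omega> (2 * y)) (\<omega> (z * \<alpha>))"
      using i0 by auto
    also have "\<dots> \<le> \<omega> (2 * y + z * \<alpha>)" by (rule val_facts(4))
    finally show ?thesis .
  qed
  define \<tau>0 \<tau>1 where "\<tau>0 = 2 / b" and "\<tau>1 = \<tau> / b"
  have \<tau>01: "\<tau>0 \<in> OK" "\<tau>1 \<in> OK" "b * \<tau>0 = 2" "b * \<tau>1 = \<tau>"
    unfolding \<tau>0_def \<tau>1_def using div[of 2] div[of \<tau>] \<open>2 \<in> K\<close> \<tau>K i0 ge bnz by (auto simp: \<tau>2)
  \<comment> \<open>An element of O_L with trace b. If \<alpha> = 0, then 2 has the valuation of b
    and b/2 works; otherwise \<alpha> has it, and t0 b/\<alpha> works because t0 has trace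
    \<alpha>.\<close>
  have "\<exists>e\<in>OL. e + \<sigma> e = b"
  proof (cases "\<alpha> = 0")
    case True
    then have 2: "\<omega> 2 = ereal (2 * h * real i0)" using i0 by simp
    then have nz: "(2 :: 'l) \<noteq> 0" using val_facts(2)[of 2] by auto
    have "w (b / 2) = 0" using nz bnz wb 2 \<omega>_w[OF nz] by (simp add: w_divide)
    then have "b / 2 \<in> OL" using \<omega>_w[of "b / 2"] nz bnz by (simp add: integers_def)
    moreover have "b / 2 \<in> K" using bK \<open>2 \<in> K\<close> K_divide by blast
    then have "b / 2 + \<sigma> (b / 2) = b" using \<sigma>_hom(4) nz
      by (simp add: field_simps) 
    ultimately show ?thesis by blast
  next
    case False
    then have w\<alpha>: "w \<alpha> = 2 * h * real i0" using i0 \<omega>_w[of \<alpha>] by simp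
    have "w (t0 * (b / \<alpha>)) = h" using wt0 bnz False wb w\<alpha> by (simp add: w_mult w_divide)
    then have "t0 * (b / \<alpha>) \<in> OL" using \<omega>_w[of "t0 * (b / \<alpha>)"] wt0 bnz False h by (simp add: integers_def)
    moreover have "t0 * k + \<sigma> (t0 * k) = \<alpha> * k" if "k \<in> K" for k
      unfolding \<sigma>_hom(2) \<sigma>_hom(4)[OF that] st0 by (simp add: algebra_simps)
    then have "t0 * (b / \<alpha>) + \<sigma> (t0 * (b / \<alpha>)) = \<alpha> * (b / \<alpha>)" using bK a K_divide by blast
    then have "t0 * (b / \<alpha>) + \<sigma> (t0 * (b / \<alpha>)) = b" using False by simp
    ultimately show ?thesis by blast
  qed
  then obtain e where e': "e \<in> OL" "e + \<sigma> e = b" by blast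
  have "\<exists>e0 e1. e0 \<in> OK \<and> e1 \<in> OK \<and> e = e0 + e1 * t"
    using e'(1) by (subst (asm) OLeq) blast
  then obtain e0 e1 where e: "e0 \<in> OK" "e1 \<in> OK" "(e0 + e1 * t) + \<sigma> (e0 + e1 * t) = b"
    using e'(2) by blast
  then have "e0 \<in> K" "e1 \<in> K" by (auto simp: integers_def)
  \<comment> \<open>The coordinates of e write b as a combination of the traces 2 of 1 and \<tau> of
    t; dividing by b in the field gives the unimodular relation, that is, surjectivity of the
    divided trace.\<close>
  then have "2 * e0 + e1 * \<tau> = b" using e(3) \<sigma>eq[of e0 e1] by (simp add: algebra_simps)
  moreover have "b * (\<tau>0 * e0 + \<tau>1 * e1) = (b * \<tau>0) * e0 + (b * \<tau>1) * e1"
    by (simp add: algebra_simps)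
  ultimately have "b * (\<tau>0 * e0 + \<tau>1 * e1) = b * 1"
    unfolding \<tau>01 by (simp add: mult.commute)
  then have "\<tau>0 * e0 + \<tau>1 * e1 = 1" using bnz by (metis mult_left_cancel)
  then show "\<exists>\<tau>0\<in>OK. \<exists>\<tau>1\<in>OK. \<exists>e0\<in>OK. \<exists>e1\<in>OK. b * \<tau>0 = 2 \<and> b * \<tau>1 = \<tau> \<and> \<tau>0 * e0 + \<tau>1 * e1 = 1"
    using \<tau>01 e by blast
  show "\<exists>c\<in>OK. b = \<beta> * c"
  proof -
    \<comment> \<open>As i0 is positive, b contains at least one factor \<beta>.\<close>
    obtain k where "i0 = Suc k" using i0(1) gr0_implies_Suc by blast
    then show ?thesis unfolding b_def
      using closed_ringD(7)[OF closed_OK \<beta>O, of k] by (intro bexI[of _ "\<beta> ^ k"]) simp_all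
  qed
  show "\<exists>n. \<beta> ^ n * x \<in> OK" if xK: "x \<in> K" for x
  proof (cases "x = 0")
    case False
    obtain n :: int where n: "w x = 2 * h * of_int n" using vals xK False by blast
    have "w (\<beta> ^ nat (- n) * x) = 2 * h * (real (nat (- n)) + of_int n)"
      using False \<beta>nz w\<beta> n by (simp add: w_mult w_power algebra_simps)
    moreover have "0 \<le> real (nat (- n)) + of_int n" by linarith
    ultimately have "0 \<le> w (\<beta> ^ nat (- n) * x)" using h by simp
    then have "\<beta> ^ nat (- n) * x \<in> OK"
      using xK \<beta>K K(5,7) False \<beta>nz \<omega>_w[of "\<beta> ^ nat (- n) * x"] by (simp add: integers_def)
    then show ?thesis by blast
  qed (use closed_ringD(1)[OF closed_OK] in auto)
qed

end

section \<open>The radical of an annihilator\<close>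

definition (in cring) ann_rad :: "'a \<Rightarrow> 'a set" where
  "ann_rad u = {x \<in> carrier R. \<exists>k::nat. x [^] k \<otimes> u = \<zero>}"

context cring
begin

text \<open>In place of the binomial theorem, induction on k + l takes one factor x + y off the
  power and lets it act on u, lowering one of the two exponents.\<close>

lemma ann_rad_add:
  assumes u: "u \<in> carrier R" and x: "x \<in> ann_rad u" and y: "y \<in> ann_rad u"
  shows "x \<oplus> y \<in> ann_rad u"
proof -
  have c [simp]: "x \<in> carrier R" "y \<in> carrier R" using x y by (auto simp: ann_rad_def)
  have "(x \<oplus> y) [^] (k + l) \<otimes> u = \<zero>"
    if "x [^] k \<otimes> u = \<zero>" "y [^] l \<otimes> u = \<zero>" "u \<in> carrier R" for k l :: nat and u
    using that
  proof (induction "k + l" arbitrary: k l u)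
    case 0
    then show ?case by simp
  next
    case (Suc n)
    show ?case
    proof (cases "k = 0 \<or> l = 0")
      case True
      then show ?thesis using Suc.prems by auto
    next
      case False
      then obtain k' l' where S: "k = Suc k'" "l = Suc l'" by (metis not0_implies_Suc)
      note [simp] = Suc.prems(3)
      have "x [^] k' \<otimes> (x \<otimes> u) = \<zero>" "y [^] l' \<otimes> (y \<otimes> u) = \<zero>"
        using Suc.prems S by (simp_all add: m_assoc)
      moreover have "y [^] l \<otimes> (x \<otimes> u) = x \<otimes> (y [^] l \<otimes> u)" "x [^] k \<otimes> (y \<otimes> u) = y \<otimes> (x [^] k \<otimes> u)"
        by (simp_all add: m_lcomm)
      ultimately have "(x \<oplus> y) [^] (k' + l) \<otimes> (x \<otimes> u) = \<zero>" "(x \<oplus> y) [^] (k + l') \<otimes> (y \<otimes> u) = \<zero>"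
        using Suc.hyps(1)[of k' l "x \<otimes> u"] Suc.hyps(1)[of k l' "y \<otimes> u"] Suc.hyps(2) Suc.prems S
        by simp_all
      moreover have "(x \<oplus> y) [^] (k + l) \<otimes> u =
          (x \<oplus> y) [^] (k' + l) \<otimes> (x \<otimes> u) \<oplus> (x \<oplus> y) [^] (k + l') \<otimes> (y \<otimes> u)"
        by (simp add: S m_assoc l_distr r_distr)
      ultimately show ?thesis by simp
    qed
  qed
  then show ?thesis using x y u unfolding ann_rad_def by blast
qed

lemma ann_rad_mult:
  assumes u: "u \<in> carrier R" and x: "x \<in> ann_rad u" and c: "c \<in> carrier R"
  shows "c \<otimes> x \<in> ann_rad u"
proof -
  obtain k :: nat where k: "x \<in> carrier R" "x [^] k \<otimes> u = \<zero>" using x by (auto simp: ann_rad_def)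
  then have "(c \<otimes> x) [^] k \<otimes> u = c [^] k \<otimes> (x [^] k \<otimes> u)"
    using u c by (simp add: nat_pow_distrib m_assoc)
  then show ?thesis using k c by (auto simp: ann_rad_def)
qed

lemma ann_rad_square:
  assumes x: "x \<in> carrier R" and xx: "x \<otimes> x \<in> ann_rad u"
  shows "x \<in> ann_rad u"
proof -
  obtain k :: nat where "(x \<otimes> x) [^] k \<otimes> u = \<zero>" using xx by (auto simp: ann_rad_def)
  moreover have "(x \<otimes> x) [^] k = x [^] (k + k)" using x by (simp add: nat_pow_distrib nat_pow_mult)
  ultimately show ?thesis using x by (auto simp: ann_rad_def)
qed

lemma ann_rad_one: "u \<in> carrier R \<Longrightarrow> \<one> \<in> ann_rad u \<Longrightarrow> u = \<zero>"
  by (auto simp: ann_rad_def)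

end

subsection \<open>Functoriality\<close>

text \<open>Unitarity, the cell and the flip are built from the ring operations, \<open>cj\<close>,
  \<open>tr\<close> and b alone, so a map respecting these transports them.\<close>

locale trace_hom = A: trace_ring A cj tr b Rs + B: trace_ring B cj' tr' b' Rs' +
  h: ring_hom_cring A B h
  for A :: "'s ring" and cj tr b Rs and B :: "'t ring" and cj' tr' b' Rs' and h +
  assumes h_cj: "x \<in> carrier A \<Longrightarrow> h (cj x) = cj' (h x)"
    and h_tr: "x \<in> carrier A \<Longrightarrow> h (tr x) = tr' (h x)"
    and h_b: "h b = b'"
begin

lemma h_minus [simp]: "x \<in> carrier A \<Longrightarrow> y \<in> carrier A \<Longrightarrow> h (x \<ominus>\<^bsub>A\<^esub> y) = h x \<ominus>\<^bsub>B\<^esub> h y"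
  by (simp add: a_minus_def)

lemma hom_herm: "A.T.vec v \<Longrightarrow> A.T.vec w \<Longrightarrow> h (A.herm v w) = B.herm (h \<circ> v) (h \<circ> w)"
  by (simp add: A.herm_def B.herm_def h_cj h_b)

lemma hom_qf: "A.T.vec v \<Longrightarrow> h (A.qf v) = B.qf (h \<circ> v)"
  by (simp add: A.qf_def B.qf_def h_cj h_tr)

lemma col_hom: "h \<circ> col g j = col (\<lambda>i j. h (g i j)) j"
  by (simp add: col_def fun_eq_iff)

lemma hom_unitary:
  assumes "A.unitary g"
  shows "B.unitary (\<lambda>i j. h (g i j))"
proof -
  have m: "A.T.mat g" using assms by (simp add: A.unitary_def)
  then have v: "A.T.vec (col g j)" for j by simp
  show ?thesis
    using assms m h.hom_det3[OF m] unfolding B.unitary_def A.unitary_def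
    by (simp flip: col_hom hom_herm[OF v v] hom_qf[OF v])
qed

lemma cols_hom: "(\<lambda>i j. h (cols u v w i j)) = cols (h \<circ> u) (h \<circ> v) (h \<circ> w)"
  by (simp add: cols_def fun_eq_iff)

lemma lower_hom:
  assumes "x \<in> carrier A" "y \<in> carrier A" "p \<in> carrier A" "q \<in> carrier A" "r \<in> carrier A"
  shows "h \<circ> A.lower x y (vec3 p q r) = B.lower (h x) (h y) (vec3 (h p) (h q) (h r))"
  using assms by (intro vec_eqI) (simp_all add: A.lower_def B.lower_def h_cj h_b)

lemma hom_cell:
  assumes "a \<in> carrier A" "a' \<in> carrier A" "x \<in> carrier A" "y \<in> carrier A" "x2 \<in> carrier A" "y2 \<in> carrier A"
  shows "(\<lambda>i j. h (A.cell a a' x y x2 y2 i j)) = B.cell (h a) (h a') (h x) (h y) (h x2) (h y2)"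
  using assms by (simp add: A.cell_def B.cell_def cols_hom lower_hom h_cj h_b)

lemma hom_flip:
  assumes "A.T.mat g"
  shows "(\<lambda>i j. h (A.flip g i j)) = B.flip (\<lambda>i j. h (g i j))"
  using assms by (intro ext) (simp add: A.flip_def B.flip_def)

end

subsection \<open>The equations over an algebra\<close>

lemma UNIV2: "(UNIV :: 2 set) = {0, 1}"
proof -
  have "i \<in> {0, 1}" for i :: 2
  proof (cases i)
    case (of_int z)
    then have "z = 0 \<or> z = 1" by auto
    then show ?thesis using of_int by auto
  qed
  then show ?thesis by blast
qed

lemma index2: "(k::2) \<noteq> 0 \<Longrightarrow> k = 1"
  using UNIV2 by blast

text \<open>Identifies a family of coordinates with a matrix over the quadratic algebra; index 0 is
  the coefficient of 1 and index 1 that of t.\<close>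

definition wm :: "(weil_index \<Rightarrow> 'r) \<Rightarrow> 3 \<Rightarrow> 3 \<Rightarrow> 'r \<times> 'r" where
  "wm x = (\<lambda>i j. (x (i, j, 0), x (i, j, 1)))"

definition unwm :: "(3 \<Rightarrow> 3 \<Rightarrow> 'r \<times> 'r) \<Rightarrow> weil_index \<Rightarrow> 'r" where
  "unwm g = (\<lambda>(i, j, k). if k = 0 then fst (g i j) else snd (g i j))"

lemma wm_unwm [simp]: "wm (unwm g) = g"
  by (simp add: wm_def unwm_def)

lemma unwm_wm [simp]: "unwm (wm x) = x"
  using index2 by (auto simp: wm_def unwm_def fun_eq_iff)

lemma wm_comp: "wm (h \<circ> x) = (\<lambda>i j. map_prod h h (wm x i j))"
  by (simp add: wm_def)

lemma wm_closed: "(\<forall>i j. wm x i j \<in> C \<times> C) \<longleftrightarrow> (\<forall>v. x v \<in> C)"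
proof
  assume *: "\<forall>i j. wm x i j \<in> C \<times> C"
  have "x (i, j, k) \<in> C" for i j k
    using *[rule_format, of i j] index2[of k] by (cases "k = 0") (auto simp: wm_def)
  then show "\<forall>v. x v \<in> C" by (metis prod_cases3)
qed (simp add: wm_def)

text \<open>The base S stays open because both O_K and K are needed. The constants are those of
  \<open>arithmetic\<close>: \<tau>0 and \<tau>1 are the divided traces of 1 and t, e0 + e1 t has
  divided trace 1, and c0 is b / \<beta>.\<close>

locale scheme_alg = base_alg R S S s for R :: "'r ring" (structure) and S :: "'a::idom set" and s +
  fixes \<tau> \<beta> b \<tau>0 \<tau>1 e0 e1 c0 :: 'a
  assumes data: "\<tau> \<in> S" "\<beta> \<in> S" "b \<in> S" "\<tau>0 \<in> S" "\<tau>1 \<in> S" "e0 \<in> S" "e1 \<in> S" "c0 \<in> S"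
    and b\<tau>: "b * \<tau>0 = 2" "b * \<tau>1 = \<tau>" and e: "\<tau>0 * e0 + \<tau>1 * e1 = 1" and b\<beta>: "b = \<beta> * c0"
    and \<beta>_nz: "\<beta> \<noteq> 0"
begin

abbreviation Q :: "('r \<times> 'r) ring" where "Q \<equiv> quad R (s \<tau>) (s \<beta>)"

lemma s_data [simp]: "s \<tau> \<in> carrier R" "s \<beta> \<in> carrier R" "s b \<in> carrier R" "s \<tau>0 \<in> carrier R"
  "s \<tau>1 \<in> carrier R" "s e0 \<in> carrier R" "s e1 \<in> carrier R" "s c0 \<in> carrier R"
  using data by auto

sublocale Q: trace_ring Q "qconj R (s \<tau>)" "qtr R (s \<tau>0) (s \<tau>1)" "(s b, \<zero>)" "carrier R \<times> {\<zero>}"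
proof (rule R.trace_ring_quad)
  have "s b \<otimes> s \<tau>0 = s (1 + 1)" using b\<tau> data s_hom(4)[of b \<tau>0] by simp
  also have "\<dots> = \<one> \<oplus> \<one>" using s_hom(2) s_hom(3)[of 1 1] closed_ringD(2)[OF S] by simp
  finally show "s b \<otimes> s \<tau>0 = \<one> \<oplus> \<one>" .
  show "s b \<otimes> s \<tau>1 = s \<tau>" using b\<tau> data s_hom(4)[of b \<tau>1] by simp
qed auto

definition ee :: "'r \<times> 'r" where "ee = (s e0, s e1)"

lemma ee: "ee \<in> carrier Q" "qtr R (s \<tau>0) (s \<tau>1) ee = \<one>\<^bsub>Q\<^esub>"
proof -
  have "s \<tau>0 \<otimes> s e0 \<oplus> s \<tau>1 \<otimes> s e1 = \<one>"
    using e data s_hom(2) s_hom(3)[of "\<tau>0 * e0" "\<tau>1 * e1"] s_hom(4)[of \<tau>0 e0] s_hom(4)[of \<tau>1 e1]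
      closed_ringD(5)[OF S] by simp
  then show "ee \<in> carrier Q" "qtr R (s \<tau>0) (s \<tau>1) ee = \<one>\<^bsub>Q\<^esub>" by (auto simp: ee_def qtr_def)
qed

definition pt :: "(weil_index \<Rightarrow> 'r) \<Rightarrow> bool" where
  "pt x \<longleftrightarrow> Q.unitary (wm x)"

lemma mat_wm [simp]: "Q.T.mat (wm x) \<longleftrightarrow> (\<forall>v. x v \<in> carrier R)"
  using wm_closed[of x "carrier R"] by simp

lemma pt_closed: "pt x \<Longrightarrow> x v \<in> carrier R"
  unfolding pt_def Q.unitary_def using mat_wm[of x] by blast

definition eq_elems :: "(weil_index \<Rightarrow> 'r) \<Rightarrow> ('r \<times> 'r) set" where
  "eq_elems x = {det3 Q (wm x) \<ominus>\<^bsub>Q\<^esub> \<one>\<^bsub>Q\<^esub>, Q.qf (col (wm x) 1), Q.qf (col (wm x) 3),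
     Q.herm (col (wm x) 3) (col (wm x) 1) \<ominus>\<^bsub>Q\<^esub> \<one>\<^bsub>Q\<^esub>, Q.herm (col (wm x) 1) (col (wm x) 2),
     Q.herm (col (wm x) 3) (col (wm x) 2)}"

definition eqs :: "(weil_index \<Rightarrow> 'r) \<Rightarrow> 'r set" where
  "eqs x = fst ` eq_elems x \<union> snd ` eq_elems x"

lemma eq_elems_closed: "\<forall>v. x v \<in> carrier R \<Longrightarrow> eq_elems x \<subseteq> carrier Q"
proof -
  assume "\<forall>v. x v \<in> carrier R"
  then have m: "Q.T.mat (wm x)" using mat_wm[of x] by blast
  then show ?thesis
    unfolding eq_elems_def using Q.T.det3_closed[OF m] Q.herm_closed[OF Q.vec_col[OF m] Q.vec_col[OF m]]
      Q.qf_closed[OF Q.vec_col[OF m]] Q.T.minus_closed Q.T.one_closed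
    by (intro insert_subsetI empty_subsetI) auto
qed

lemma eqs_closed: "\<forall>v. x v \<in> carrier R \<Longrightarrow> eqs x \<subseteq> carrier R"
  using eq_elems_closed[of x] by (auto simp: eqs_def)

lemma finite_eqs: "finite (eqs x)"
  by (simp add: eqs_def eq_elems_def)

lemma pt_iff_eqs: "pt x \<longleftrightarrow> (\<forall>v. x v \<in> carrier R) \<and> eqs x \<subseteq> {\<zero>}"
proof (cases "\<forall>v. x v \<in> carrier R")
  case True
  then have m: "Q.T.mat (wm x)" using mat_wm[of x] by blast
  have iff: "y \<ominus>\<^bsub>Q\<^esub> z = \<zero>\<^bsub>Q\<^esub> \<longleftrightarrow> y = z" if "y \<in> carrier Q" "z \<in> carrier Q" for y z
    using that by (rule Q.T.r_right_minus_eq)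
  have "eqs x \<subseteq> {\<zero>} \<longleftrightarrow> eq_elems x \<subseteq> {\<zero>\<^bsub>Q\<^esub>}"
    by (auto simp: eqs_def prod_eq_iff)
  also have "\<dots> \<longleftrightarrow> Q.unitary (wm x)"
    unfolding eq_elems_def Q.unitary_def insert_subset
    using m iff[OF Q.T.det3_closed[OF m] Q.T.one_closed]
      iff[OF Q.herm_closed[OF Q.vec_col[OF m] Q.vec_col[OF m]] Q.T.one_closed, of 3 1]
    by (simp del: quad_simps)
  finally show ?thesis using True by (simp add: pt_def)
next
  case False
  then show ?thesis using pt_closed by blast
qed

text \<open>Ten free parameters form the elements a, x, z, x2, z2; the retraction of
  \<open>isotropicI\<close> turns z and z2 into admissible y and y2. The argument u stands for the
  inverse of the norm of a, so that the conjugate of a times u inverts a.\<close>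

definition cell_pt :: "(nat \<Rightarrow> 'r) \<Rightarrow> 'r \<Rightarrow> 3 \<Rightarrow> 3 \<Rightarrow> 'r \<times> 'r" where
  "cell_pt \<rho> u =
     (let a = (\<rho> 0, \<rho> 1); x = (\<rho> 2, \<rho> 3); z = (\<rho> 4, \<rho> 5); x2 = (\<rho> 6, \<rho> 7); z2 = (\<rho> 8, \<rho> 9);
        y = z \<ominus>\<^bsub>Q\<^esub> (qtr R (s \<tau>0) (s \<tau>1) z \<oplus>\<^bsub>Q\<^esub> x \<otimes>\<^bsub>Q\<^esub> qconj R (s \<tau>) x) \<otimes>\<^bsub>Q\<^esub> ee;
        y2 = z2 \<ominus>\<^bsub>Q\<^esub> (qtr R (s \<tau>0) (s \<tau>1) z2 \<oplus>\<^bsub>Q\<^esub> x2 \<otimes>\<^bsub>Q\<^esub> qconj R (s \<tau>) x2) \<otimes>\<^bsub>Q\<^esub> ee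
      in Q.cell a (qconj R (s \<tau>) a \<otimes>\<^bsub>Q\<^esub> (u, \<zero>)) x y x2 y2)"

definition nrm :: "'r \<times> 'r \<Rightarrow> 'r" where
  "nrm x = fst (x \<otimes>\<^bsub>Q\<^esub> qconj R (s \<tau>) x)"

lemma nrm: "x \<in> carrier Q \<Longrightarrow> x \<otimes>\<^bsub>Q\<^esub> qconj R (s \<tau>) x = (nrm x, \<zero>)"
  using Q.norm_Rs[of x] unfolding nrm_def by (metis SigmaE fst_conv singletonD)

lemma nrm_closed: "x \<in> carrier Q \<Longrightarrow> nrm x \<in> carrier R"
  using nrm[of x] Q.norm_Rs[of x] by (metis SigmaD1)

lemma nrm_inverse:
  assumes "x \<in> carrier Q" "u \<in> carrier R" "nrm x \<otimes> u = \<one>"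
  shows "x \<otimes>\<^bsub>Q\<^esub> (qconj R (s \<tau>) x \<otimes>\<^bsub>Q\<^esub> (u, \<zero>)) = \<one>\<^bsub>Q\<^esub>"
proof -
  have u: "(u, \<zero>) \<in> carrier Q" using assms by simp
  have "x \<otimes>\<^bsub>Q\<^esub> (qconj R (s \<tau>) x \<otimes>\<^bsub>Q\<^esub> (u, \<zero>)) = (nrm x, \<zero>) \<otimes>\<^bsub>Q\<^esub> (u, \<zero>)"
    using Q.T.m_assoc[OF assms(1) Q.cj.hom_closed[OF assms(1)] u] nrm[OF assms(1)] by simp
  also have "\<dots> = \<one>\<^bsub>Q\<^esub>" using assms nrm_closed[OF assms(1)] by (simp add: a_minus_def)
  finally show ?thesis .
qed

lemma cell_pt_unitary:
  assumes \<rho>: "\<And>n. \<rho> n \<in> carrier R" and u: "u \<in> carrier R" "nrm (\<rho> 0, \<rho> 1) \<otimes> u = \<one>"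
  shows "Q.unitary (cell_pt \<rho> u)"
proof -
  have c: "(\<rho> i, \<rho> j) \<in> carrier Q" for i j using \<rho> by simp
  have uc: "(u, \<zero>) \<in> carrier Q" using u by simp
  show ?thesis
    unfolding cell_pt_def Let_def
    by (intro Q.unitary_cell Q.isotropicI ee c Q.T.m_closed Q.cj.hom_closed uc nrm_inverse u)
qed

text \<open>Isotropic pairs are fixed by the retraction, so the y and y2 of the given matrix serve
  as parameters z and z2.\<close>

lemma cell_pt_surj:
  assumes g: "Q.unitary g" and u: "u \<in> carrier R" "nrm (g 1 1) \<otimes> u = \<one>"
  obtains \<rho> where "\<And>n. \<rho> n \<in> carrier R" "(\<rho> 0, \<rho> 1) = g 1 1" "g = cell_pt \<rho> u"
proof -
  have a: "g 1 1 \<in> carrier Q" using g by (simp add: Q.unitary_def)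
  have uc: "(u, \<zero>) \<in> carrier Q" using u by simp
  obtain x y x2 y2 where iso: "Q.isotropic x y" "Q.isotropic x2 y2"
    and gc: "g = Q.cell (g 1 1) (qconj R (s \<tau>) (g 1 1) \<otimes>\<^bsub>Q\<^esub> (u, \<zero>)) x y x2 y2"
    using Q.unitary_cellE[OF g Q.T.m_closed[OF Q.cj.hom_closed[OF a] uc] nrm_inverse[OF a u]] .
  define \<rho> where "\<rho> n = (if n = 0 then fst (g 1 1) else if n = 1 then snd (g 1 1)
     else if n = 2 then fst x else if n = 3 then snd x else if n = 4 then fst y else if n = 5 then snd y
     else if n = 6 then fst x2 else if n = 7 then snd x2 else if n = 8 then fst y2 else snd y2)" for n :: nat
  have "x \<in> carrier Q" "y \<in> carrier Q" "x2 \<in> carrier Q" "y2 \<in> carrier Q"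
    using iso by (auto simp only: Q.isotropic_def)
  then have "\<rho> n \<in> carrier R" for n using a by (auto simp: \<rho>_def)
  moreover have "(\<rho> 0, \<rho> 1) = g 1 1" by (simp add: \<rho>_def)
  moreover have "cell_pt \<rho> u = g"
  proof -
    have \<rho>: "(\<rho> 0, \<rho> 1) = g 1 1" "(\<rho> 2, \<rho> 3) = x" "(\<rho> 4, \<rho> 5) = y" "(\<rho> 6, \<rho> 7) = x2" "(\<rho> 8, \<rho> 9) = y2"
      by (simp_all add: \<rho>_def)
    show ?thesis
      unfolding cell_pt_def Let_def \<rho> Q.isotropicE[OF ee iso(1), symmetric]
        Q.isotropicE[OF ee iso(2), symmetric] gc[symmetric] ..
  qed
  ultimately show thesis using that by metis
qed

definition flip_if :: "bool \<Rightarrow> (3 \<Rightarrow> 3 \<Rightarrow> 'r \<times> 'r) \<Rightarrow> 3 \<Rightarrow> 3 \<Rightarrow> 'r \<times> 'r" where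
  "flip_if c g = (if c then Q.flip g else g)"

lemma flip_if_unitary: "Q.unitary g \<Longrightarrow> Q.unitary (flip_if c g)"
  by (simp add: flip_if_def Q.unitary_flip)

lemma flip_if_flip_if: "Q.T.mat g \<Longrightarrow> flip_if c (flip_if c g) = g"
  using Q.flip_flip[of g] by (simp add: flip_if_def)

end

locale scheme_hom = A: scheme_alg A S s \<tau> \<beta> b \<tau>0 \<tau>1 e0 e1 c0 + B: scheme_alg B S s' \<tau> \<beta> b \<tau>0 \<tau>1 e0 e1 c0 +
  h: ring_hom_cring A B h
  for A :: "'p ring" and B :: "'q ring" and S :: "'a::idom set" and s s' \<tau> \<beta> b \<tau>0 \<tau>1 e0 e1 c0 h +
  assumes h_s: "c \<in> S \<Longrightarrow> h (s c) = s' c"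
begin

lemma map_prod_hom: "ring_hom_cring A.Q B.Q (map_prod h h)"
  using quad_hom[OF h.ring_hom_cring_axioms, of "s \<tau>" "s \<beta>"] A.data by (simp add: h_s)

sublocale Q: trace_hom A.Q "qconj A (s \<tau>)" "qtr A (s \<tau>0) (s \<tau>1)" "(s b, \<zero>\<^bsub>A\<^esub>)" "carrier A \<times> {\<zero>\<^bsub>A\<^esub>}"
    B.Q "qconj B (s' \<tau>)" "qtr B (s' \<tau>0) (s' \<tau>1)" "(s' b, \<zero>\<^bsub>B\<^esub>)" "carrier B \<times> {\<zero>\<^bsub>B\<^esub>}" "map_prod h h"
  by (intro trace_hom.intro trace_hom_axioms.intro A.Q.trace_ring_axioms B.Q.trace_ring_axioms map_prod_hom)
    (use A.data in \<open>auto simp: qconj_def qtr_def h_s\<close>)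

lemma pt_hom: "A.pt x \<Longrightarrow> B.pt (h \<circ> x)"
  unfolding A.pt_def B.pt_def wm_comp by (rule Q.hom_unitary)

lemma eqs_hom:
  assumes x: "\<forall>v. x v \<in> carrier A"
  shows "h ` A.eqs x = B.eqs (h \<circ> x)"
proof -
  have m: "A.Q.T.mat (wm x)" using x A.mat_wm[of x] by blast
  note v = A.Q.vec_col[OF m]
  have "map_prod h h ` A.eq_elems x = B.eq_elems (h \<circ> x)"
    unfolding A.eq_elems_def B.eq_elems_def image_insert image_empty wm_comp
    using Q.hom_herm[OF v v] Q.hom_qf[OF v] Q.h.hom_det3[OF m] Q.h.hom_one
      Q.h_minus[OF A.Q.T.det3_closed[OF m] A.Q.T.one_closed]
      Q.h_minus[OF A.Q.herm_closed[OF v v] A.Q.T.one_closed, of 3 1]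
    by (simp only: Q.col_hom)
  then have "fst ` B.eq_elems (h \<circ> x) = h ` fst ` A.eq_elems x"
    "snd ` B.eq_elems (h \<circ> x) = h ` snd ` A.eq_elems x"
    by (simp_all add: image_image flip: \<open>map_prod h h ` A.eq_elems x = B.eq_elems (h \<circ> x)\<close>)
  then show ?thesis by (simp add: A.eqs_def B.eqs_def image_Un)
qed

lemma cell_pt_hom:
  assumes \<rho>: "\<And>n. \<rho> n \<in> carrier A" and u: "u \<in> carrier A"
  shows "(\<lambda>i j. map_prod h h (A.cell_pt \<rho> u i j)) = B.cell_pt (h \<circ> \<rho>) (h u)"
proof -
  have c: "(\<rho> i, \<rho> j) \<in> carrier A.Q" for i j using \<rho> by simp
  have uc: "(u, \<zero>\<^bsub>A\<^esub>) \<in> carrier A.Q" using u by simp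
  have e: "map_prod h h A.ee = B.ee" using A.data by (simp add: A.ee_def B.ee_def h_s)
  have u': "map_prod h h (u, \<zero>\<^bsub>A\<^esub>) = (h u, \<zero>\<^bsub>B\<^esub>)" by simp
  have \<rho>': "map_prod h h (\<rho> i, \<rho> j) = ((h \<circ> \<rho>) i, (h \<circ> \<rho>) j)" for i j by simp
  have t: "qtr A (s \<tau>0) (s \<tau>1) (\<rho> i, \<rho> j) \<in> carrier A.Q" for i j
    using A.Q.tr_closed[OF c] .
  note cl = c uc A.ee(1) t A.Q.cj.hom_closed A.Q.T.m_closed A.Q.T.a_closed A.Q.T.minus_closed
  show ?thesis
    unfolding A.cell_pt_def B.cell_pt_def Let_def
    by (simp only: Q.hom_cell cl Q.h.hom_mult Q.h.hom_add Q.h_minus Q.h_cj Q.h_tr e u' \<rho>')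
qed

lemma nrm_hom: "x \<in> carrier A.Q \<Longrightarrow> h (A.nrm x) = B.nrm (map_prod h h x)"
  using Q.h.hom_mult[of x "qconj A (s \<tau>) x"] Q.h_cj[of x] A.Q.cj.hom_closed[of x]
  unfolding A.nrm_def B.nrm_def by (metis fst_map_prod)

lemma flip_if_hom:
  "A.Q.T.mat g \<Longrightarrow> (\<lambda>i j. map_prod h h (A.flip_if c g i j)) = B.flip_if c (\<lambda>i j. map_prod h h (g i j))"
  using Q.hom_flip[of g] by (simp add: A.flip_if_def B.flip_if_def)

end

subsection \<open>Saturation of the ideal of equations\<close>

context scheme_alg
begin

lemma ann_rad_minus:
  assumes "u \<in> carrier R" "x \<in> ann_rad u" "y \<in> ann_rad u"
  shows "x \<ominus> y \<in> ann_rad u"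
proof -
  have "x \<in> carrier R" "y \<in> carrier R" using assms by (auto simp: ann_rad_def)
  then have "x \<ominus> y = x \<oplus> (\<ominus> \<one>) \<otimes> y" by (simp add: a_minus_def R.l_minus)
  then show ?thesis using assms ann_rad_add ann_rad_mult by simp
qed

text \<open>Modulo \<open>\<beta>\<close> the norm of \<open>p + q t\<close> is \<open>p\<^sup>2\<close>, and the outer columns span a unimodular plane.
  So \<open>\<beta>\<close> and the norms of the entries \<open>g\<^sub>1\<^sub>1\<close>, \<open>g\<^sub>3\<^sub>1\<close> generate the unit ideal.\<close>

lemma norms_comaximal:
  assumes x: "pt x" and u: "u \<in> carrier R"
    and \<beta>': "s \<beta> \<in> ann_rad u" and n1: "nrm (wm x 1 1) \<in> ann_rad u" and n3: "nrm (wm x 3 1) \<in> ann_rad u"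
  shows "u = \<zero>"
proof -
  have \<beta>m: "s \<beta> \<otimes> c \<in> ann_rad u" if "c \<in> carrier R" for c
    using ann_rad_mult[OF u \<beta>' that] that by (simp add: R.m_comm)
  have \<tau>: "s \<tau> = s \<beta> \<otimes> (s c0 \<otimes> s \<tau>1)"
    using b\<tau>(2) b\<beta> data s_hom(4)[of "\<beta> * c0" \<tau>1] s_hom(4)[of \<beta> c0] closed_ringD(5)[OF S]
    by (simp add: R.m_assoc)
  have fst_rad: "fst y \<in> ann_rad u" if y: "y \<in> carrier Q" and n: "nrm y \<in> ann_rad u" for y
  proof -
    have c: "fst y \<in> carrier R" "snd y \<in> carrier R" using y by auto
    \<comment> \<open>With \<tau> = \<beta> c the norm of p + q t is p^2 + \<beta> (c p q + q^2); so
      p^2, and hence p, lies in the radical ideal.\<close>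
    have *: "p \<otimes> p = p \<otimes> (p \<oplus> \<beta> \<otimes> c \<otimes> q) \<ominus> \<beta> \<otimes> (q \<otimes> \<ominus> q) \<ominus> \<beta> \<otimes> (c \<otimes> p \<otimes> q \<oplus> q \<otimes> q)"
      if "p \<in> carrier R" "q \<in> carrier R" "\<beta> \<in> carrier R" "c \<in> carrier R" for p q \<beta> c
      using that by (elim R.presE) (simp only: R.pres_simps, rule arg_cong[where f = pres], simp add: algebra_simps)
    have "fst y \<otimes> fst y = nrm y \<ominus> s \<beta> \<otimes> (s c0 \<otimes> s \<tau>1 \<otimes> fst y \<otimes> snd y \<oplus> snd y \<otimes> snd y)"
      using *[of "fst y" "snd y" "s \<beta>" "s c0 \<otimes> s \<tau>1"] c by (simp add: nrm_def qconj_def \<tau>)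
    also have "\<dots> \<in> ann_rad u" using c n \<beta>m by (intro ann_rad_minus u) auto
    finally show ?thesis by (rule ann_rad_square[OF c(1)])
  qed
  have m: "Q.T.mat (wm x)" using x unfolding pt_def Q.unitary_def by blast
  note [simp] = Q.cj.hom_closed[OF m[rule_format], simplified mem_Times_iff quad_simps(1), THEN conjunct1]
     Q.cj.hom_closed[OF m[rule_format], simplified mem_Times_iff quad_simps(1), THEN conjunct2]
     m[rule_format, simplified mem_Times_iff quad_simps(1), THEN conjunct1]
     m[rule_format, simplified mem_Times_iff quad_simps(1), THEN conjunct2]
  have p: "fst (wm x 1 1) \<in> ann_rad u" "fst (wm x 3 1) \<in> ann_rad u"
    using fst_rad n1 n3 m by blast+
  have prod: "fst (y \<otimes>\<^bsub>Q\<^esub> z) \<in> ann_rad u"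
    if "fst z \<in> ann_rad u" "fst y \<in> carrier R" "snd y \<in> carrier R" "snd z \<in> carrier R" for y z
    using that by (auto intro!: ann_rad_minus ann_rad_mult \<beta>m u)
  have sb: "s b = s \<beta> \<otimes> s c0" using b\<beta> data s_hom(4)[of \<beta> c0] by simp
  have mid: "fst ((s b, \<zero>) \<otimes>\<^bsub>Q\<^esub> z) \<in> ann_rad u" if "fst z \<in> carrier R" "snd z \<in> carrier R" for z
    using that unfolding sb by (simp add: a_minus_def R.m_assoc \<beta>m)
  \<comment> \<open>The coefficient of 1 in the pairing of the outer columns is 1, while each of its
    three summands lies in the radical ideal.\<close>
  have "\<one> = fst (Q.herm (col (wm x) 3) (col (wm x) 1))"
    using x unfolding pt_def Q.unitary_def by (simp del: quad_simps(2,5))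
  also have "\<dots> = fst (qconj R (s \<tau>) (wm x 3 3) \<otimes>\<^bsub>Q\<^esub> wm x 1 1) \<oplus>
      fst ((s b, \<zero>) \<otimes>\<^bsub>Q\<^esub> (qconj R (s \<tau>) (wm x 2 3) \<otimes>\<^bsub>Q\<^esub> wm x 2 1)) \<oplus>
      fst (qconj R (s \<tau>) (wm x 1 3) \<otimes>\<^bsub>Q\<^esub> wm x 3 1)"
    unfolding Q.herm_def by (simp add: col_def)
  also have "\<dots> \<in> ann_rad u"
  proof (rule ann_rad_add[OF u ann_rad_add[OF u]])
    have "qconj R (s \<tau>) (wm x 2 3) \<otimes>\<^bsub>Q\<^esub> wm x 2 1 \<in> carrier Q"
      using m by (intro Q.T.m_closed Q.cj.hom_closed) auto
    then show "fst ((s b, \<zero>) \<otimes>\<^bsub>Q\<^esub> (qconj R (s \<tau>) (wm x 2 3) \<otimes>\<^bsub>Q\<^esub> wm x 2 1)) \<in> ann_rad u"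
      by (intro mid) (simp_all only: quad_simps(1) mem_Times_iff)
    show "fst (qconj R (s \<tau>) (wm x 3 3) \<otimes>\<^bsub>Q\<^esub> wm x 1 1) \<in> ann_rad u"
      by (rule prod[OF p(1)]) simp_all
    show "fst (qconj R (s \<tau>) (wm x 1 3) \<otimes>\<^bsub>Q\<^esub> wm x 3 1) \<in> ann_rad u"
      by (rule prod[OF p(2)]) simp_all
  qed
  finally show ?thesis using ann_rad_one[OF u] by blast
qed

end

section \<open>The ideal of equations over a domain\<close>

lemma mp_data_alg:
  assumes "closed_ring S" "algebra_over S s R" "\<And>v. v \<in> V \<Longrightarrow> x v \<in> carrier R"
  shows "mp_data R S s V x"
  using assms by (simp add: mp_data_def mp_data_axioms_def algebra_over_def)

lemma mp_eval_comp:
  assumes S: "closed_ring S" and R: "algebra_over S s R" and R': "algebra_over S s' R'"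
    and h: "h \<in> alg_hom S s R s' R'" and xc: "range x \<subseteq> carrier R" and f: "f \<in> carrier (mpoly_ring S UNIV)"
  shows "h (mp_eval R s x f) = mp_eval R' s' (h \<circ> x) f"
proof -
  have x: "x v \<in> carrier R" for v using xc by blast
  have hr: "h \<in> ring_hom R R'" and hs: "\<And>c. c \<in> S \<Longrightarrow> h (s c) = s' c" using h by (auto simp: alg_hom_def)
  define y where "y = h \<circ> x"
  have hy: "h (x v) = y v" for v by (simp add: y_def)
  have y: "y v \<in> carrier R'" for v using ring_hom_closed[OF hr x] by (simp flip: hy)
  interpret E: mp_data R S s UNIV x using S R x by (intro mp_data_alg)
  interpret E': mp_data R' S s' UNIV y using S R' y by (intro mp_data_alg)
  have "(\<lambda>f. h (mp_eval R s x f)) f = mp_eval R' s' y f"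
  proof (rule mpoly_hom_unique[OF S _ _ E'.R.is_cring _ _ f])
    show "(\<lambda>f. h (mp_eval R s x f)) \<in> ring_hom (mpoly_ring S UNIV) R'"
      using ring_hom_trans[OF ring_hom_cring.homh[OF E.mp_eval_hom] hr] by (simp add: comp_def)
    show "mp_eval R' s' y \<in> ring_hom (mpoly_ring S UNIV) R'"
      using ring_hom_cring.homh[OF E'.mp_eval_hom] .
  qed (simp_all add: E.mp_eval_const E'.mp_eval_const E.mp_eval_var E'.mp_eval_var hs hy)
  then show ?thesis by (simp add: y_def)
qed

locale scheme =
  fixes S :: "'a::idom set" and \<tau> \<beta> b \<tau>0 \<tau>1 e0 e1 c0 :: 'a
  assumes S: "closed_ring S"
    and data: "\<tau> \<in> S" "\<beta> \<in> S" "b \<in> S" "\<tau>0 \<in> S" "\<tau>1 \<in> S" "e0 \<in> S" "e1 \<in> S" "c0 \<in> S"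
    and b\<tau>: "b * \<tau>0 = 2" "b * \<tau>1 = \<tau>" and e: "\<tau>0 * e0 + \<tau>1 * e1 = 1" and b\<beta>: "b = \<beta> * c0"
    and \<beta>_nz: "\<beta> \<noteq> 0"
begin

lemma alg:
  assumes "algebra_over S s R"
  shows "scheme_alg R S s \<tau> \<beta> b \<tau>0 \<tau>1 e0 e1 c0"
  using assms S data b\<tau> e b\<beta> \<beta>_nz
  by (intro scheme_alg.intro base_alg.intro base_alg_axioms.intro scheme_alg_axioms.intro)
    (auto simp: algebra_over_def)

lemma alg_homI:
  assumes "algebra_over S s R" "algebra_over S s' R'" "h \<in> alg_hom S s R s' R'"
  shows "scheme_hom R R' S s s' \<tau> \<beta> b \<tau>0 \<tau>1 e0 e1 c0 h"
  using assms alg[OF assms(1)] alg[OF assms(2)]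
  by (intro scheme_hom.intro scheme_hom_axioms.intro ring_hom_cringI')
    (auto simp: algebra_over_def alg_hom_def)

abbreviation PR :: "(weil_index, 'a) mpoly ring" where "PR \<equiv> weil_polys S"

lemma alg_mpoly: "algebra_over S mp_const (mpoly_ring S V)"
  unfolding algebra_over_def by (intro conjI cring_mpoly_ring mp_const_hom S)

sublocale P: scheme_alg PR S mp_const \<tau> \<beta> b \<tau>0 \<tau>1 e0 e1 c0
  by (rule alg[OF alg_mpoly])

lemma var_closed [simp]: "mp_var v \<in> carrier (mpoly_ring S UNIV)"
  by (simp add: mpoly_ring_eq mp_var_closed[OF S])

lemma const_closed [simp]: "c \<in> S \<Longrightarrow> mp_const c \<in> carrier (mpoly_ring S V)"
  by (simp add: mpoly_ring_eq mp_const_closed[OF S])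

text \<open>The ideal of the scheme X; \<open>AJ\<close> is its coordinate ring and
  \<open>xJ\<close> its universal point.\<close>

definition J :: "(weil_index, 'a) mpoly set" where
  "J = genideal PR (P.eqs mp_var)"

lemma eqs_var: "P.eqs mp_var \<subseteq> carrier PR"
  using P.eqs_closed[of mp_var] by (simp del: split_paired_All)

sublocale J: ideal J PR
  unfolding J_def using eqs_var by (rule P.R.genideal_ideal)

definition AJ :: "(weil_index, 'a) mpoly set ring" where "AJ = PR Quot J"
definition aJ :: "'a \<Rightarrow> (weil_index, 'a) mpoly set" where "aJ c = J +>\<^bsub>PR\<^esub> mp_const c"
definition xJ :: "weil_index \<Rightarrow> (weil_index, 'a) mpoly set" where "xJ v = J +>\<^bsub>PR\<^esub> mp_var v"

sublocale AJ: cring AJ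
  unfolding AJ_def by (rule J.quotient_is_cring[OF P.R.is_cring])

lemma coset_hom: "(+>\<^bsub>PR\<^esub>) J \<in> ring_hom PR AJ"
  unfolding AJ_def by (rule J.rcos_ring_hom)

lemma alg_AJ: "algebra_over S aJ AJ"
  using ring_hom_trans[OF mp_const_hom[OF S] coset_hom] AJ.is_cring
  by (simp add: algebra_over_def aJ_def[abs_def] comp_def)

lemma eval_hom:
  assumes "algebra_over S s R" "range x \<subseteq> carrier R"
  shows "mp_eval R s x \<in> alg_hom S mp_const (mpoly_ring S UNIV) s R" "mp_eval R s x (mp_var v) = x v"
proof -
  interpret mp_data R S s UNIV x using S assms by (intro mp_data_alg) auto
  show "mp_eval R s x \<in> alg_hom S mp_const (mpoly_ring S UNIV) s R" "mp_eval R s x (mp_var v) = x v"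
    using ring_hom_cring.homh[OF mp_eval_hom] by (simp_all add: alg_hom_def mp_eval_const mp_eval_var)
qed

lemma eval_comp_var:
  assumes "algebra_over S s R" "range x \<subseteq> carrier R"
  shows "mp_eval R s x \<circ> mp_var = x"
  by (rule ext) (simp add: eval_hom(2)[OF assms])

text \<open>The equations are natural in the algebra, so evaluation carries those of the generic
  matrix to those at x.\<close>

lemma pt_iff_eval:
  assumes R: "algebra_over S s R" and x: "range x \<subseteq> carrier R"
  shows "scheme_alg.pt R s \<tau> \<beta> b \<tau>0 \<tau>1 x \<longleftrightarrow> (\<forall>f\<in>P.eqs mp_var. mp_eval R s x f = \<zero>\<^bsub>R\<^esub>)"
proof -
  interpret R: scheme_alg R S s \<tau> \<beta> b \<tau>0 \<tau>1 e0 e1 c0 by (rule alg[OF R])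
  interpret E: scheme_hom PR R S mp_const s \<tau> \<beta> b \<tau>0 \<tau>1 e0 e1 c0 "mp_eval R s x"
    by (rule alg_homI[OF alg_mpoly R eval_hom(1)[OF R x]])
  have eq: "R.eqs x = mp_eval R s x ` P.eqs mp_var"
    using E.eqs_hom[of mp_var] eval_comp_var[OF R x] var_closed by metis
  have "\<forall>v. x v \<in> carrier R" using x by blast
  then show ?thesis unfolding R.pt_iff_eqs eq by blast
qed

lemma eval_J:
  assumes R: "algebra_over S s R" and x: "scheme_alg.pt R s \<tau> \<beta> b \<tau>0 \<tau>1 x" and f: "f \<in> J"
  shows "mp_eval R s x f = \<zero>\<^bsub>R\<^esub>"
proof -
  interpret R: scheme_alg R S s \<tau> \<beta> b \<tau>0 \<tau>1 e0 e1 c0 by (rule alg[OF R])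
  have xc: "range x \<subseteq> carrier R" using R.pt_closed[OF x] by blast
  interpret E: scheme_hom PR R S mp_const s \<tau> \<beta> b \<tau>0 \<tau>1 e0 e1 c0 "mp_eval R s x"
    by (rule alg_homI[OF alg_mpoly R eval_hom(1)[OF R xc]])
  show ?thesis
    using E.h.genideal_kernel[OF eqs_var _ f[unfolded J_def]] pt_iff_eval[OF R xc] x by blast
qed

lemma xJ_closed: "range xJ \<subseteq> carrier AJ"
  unfolding xJ_def using ring_hom_closed[OF coset_hom] by auto

lemma eval_xJ:
  assumes "f \<in> carrier PR"
  shows "mp_eval AJ aJ xJ f = J +>\<^bsub>PR\<^esub> f"
proof (rule mpoly_hom_unique[OF S _ coset_hom AJ.is_cring _ _ assms])
  show "mp_eval AJ aJ xJ \<in> ring_hom PR AJ"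
    using eval_hom(1)[OF alg_AJ xJ_closed] by (simp add: alg_hom_def)
  show "mp_eval AJ aJ xJ (mp_const c) = J +>\<^bsub>PR\<^esub> mp_const c" if "c \<in> S" for c
    using eval_hom(1)[OF alg_AJ xJ_closed] that by (auto simp: alg_hom_def aJ_def)
  show "mp_eval AJ aJ xJ (mp_var v) = J +>\<^bsub>PR\<^esub> mp_var v" for v
    using eval_hom(2)[OF alg_AJ xJ_closed] by (simp add: xJ_def)
qed

lemma pt_xJ: "scheme_alg.pt AJ aJ \<tau> \<beta> b \<tau>0 \<tau>1 xJ"
proof -
  have "mp_eval AJ aJ xJ f = \<zero>\<^bsub>AJ\<^esub>" if f: "f \<in> P.eqs mp_var" for f
  proof -
    have fP: "f \<in> carrier PR" and "f \<in> J"
      using f eqs_var P.R.genideal_self[OF eqs_var] by (auto simp: J_def)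
    then show ?thesis using J.coset_zero_iff[OF fP] unfolding eval_xJ[OF fP] by (simp add: AJ_def)
  qed
  then show ?thesis using pt_iff_eval[OF alg_AJ xJ_closed] by blast
qed

abbreviation MR :: "(nat, 'a) mpoly ring" where "MR \<equiv> mpoly_ring S UNIV"

text \<open>Polynomials that become equations after multiplication by a power of \<open>\<beta>\<close> vanish on the
  big cell, because the cell is parametrised by a localised polynomial ring over a domain.\<close>

lemma cell_vanish:
  assumes R: "algebra_over S s R" and y: "scheme_alg.pt R s \<tau> \<beta> b \<tau>0 \<tau>1 y"
    and u: "u \<in> carrier R" "scheme_alg.nrm R s \<tau> \<beta> (scheme_alg.flip_if R s \<tau> \<beta> c (wm y) 1 1) \<otimes>\<^bsub>R\<^esub> u = \<one>\<^bsub>R\<^esub>"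
    and f: "f \<in> carrier PR" "mp_const (\<beta> ^ n) * f \<in> J"
  shows "mp_eval R s y f = \<zero>\<^bsub>R\<^esub>"
proof -
  interpret R: scheme_alg R S s \<tau> \<beta> b \<tau>0 \<tau>1 e0 e1 c0 by (rule alg[OF R])
  interpret M: scheme_alg MR S mp_const \<tau> \<beta> b \<tau>0 \<tau>1 e0 e1 c0 by (rule alg[OF alg_mpoly])
  \<comment> \<open>The norm of the generic corner entry; once it is inverted, the generic cell is a
    unitary matrix over a localised polynomial ring.\<close>
  define N where "N = M.nrm (mp_var 0, mp_var 1)"
  have N: "N \<in> carrier MR" unfolding N_def by (rule M.nrm_closed) simp
  interpret L: localisation MR N by unfold_locales (rule N)
  define LR j where "LR = loc MR N" and "j = loc_map MR N"
  have jh: "j \<in> ring_hom MR LR" unfolding j_def LR_def by (rule L.m.homh)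
  have LR: "cring LR" unfolding LR_def by (rule L.L.is_cring)
  have alg_L: "algebra_over S (j \<circ> mp_const) LR"
    using ring_hom_trans[OF mp_const_hom[OF S] jh] LR by (simp add: algebra_over_def)
  have j_alg: "j \<in> alg_hom S mp_const MR (j \<circ> mp_const) LR" using jh by (simp add: alg_hom_def)
  interpret L': scheme_alg LR S "j \<circ> mp_const" \<tau> \<beta> b \<tau>0 \<tau>1 e0 e1 c0 by (rule alg[OF alg_L])
  interpret j: scheme_hom MR LR S mp_const "j \<circ> mp_const" \<tau> \<beta> b \<tau>0 \<tau>1 e0 e1 c0 j
    by (rule alg_homI[OF alg_mpoly alg_L j_alg])
  define v where "v = loc_inv MR N"
  have v: "v \<in> carrier LR" "j N \<otimes>\<^bsub>LR\<^esub> v = \<one>\<^bsub>LR\<^esub>"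
    using L.loc_inv_closed L.loc_inv by (simp_all add: v_def j_def LR_def)
  have jc: "(j \<circ> mp_var) i \<in> carrier LR" for i by simp
  have "j N = L'.nrm ((j \<circ> mp_var) 0, (j \<circ> mp_var) 1)"
    unfolding N_def using j.nrm_hom[of "(mp_var 0, mp_var 1)"] by simp
  then have "L'.Q.unitary (L'.cell_pt (j \<circ> mp_var) v)"
    using v jc by (intro L'.cell_pt_unitary) auto
  \<comment> \<open>The universal point of the cell, flipped if c holds.\<close>
  define \<gamma> where "\<gamma> = unwm (L'.flip_if c (L'.cell_pt (j \<circ> mp_var) v))"
  have cellm: "L'.Q.T.mat (L'.cell_pt (j \<circ> mp_var) v)"
    using \<open>L'.Q.unitary (L'.cell_pt (j \<circ> mp_var) v)\<close> unfolding L'.Q.unitary_def by blast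
  have \<gamma>: "L'.pt \<gamma>"
    unfolding \<gamma>_def L'.pt_def wm_unwm
    by (rule L'.flip_if_unitary) fact
  have \<gamma>c: "range \<gamma> \<subseteq> carrier LR" using L'.pt_closed[OF \<gamma>] by blast
  define q where "q = mp_eval LR (j \<circ> mp_const) \<gamma> f"
  have eh: "mp_eval LR (j \<circ> mp_const) \<gamma> \<in> alg_hom S mp_const PR (j \<circ> mp_const) LR"
    by (rule eval_hom(1)[OF alg_L \<gamma>c])
  then have q: "q \<in> carrier LR" unfolding q_def using f ring_hom_closed by (auto simp: alg_hom_def)
  have \<beta>n: "\<beta> ^ n \<in> S" using closed_ringD(7)[OF S] data by blast
  have "mp_eval LR (j \<circ> mp_const) \<gamma> (mp_const (\<beta> ^ n) \<otimes>\<^bsub>PR\<^esub> f) = j (mp_const (\<beta> ^ n)) \<otimes>\<^bsub>LR\<^esub> q"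
  proof -
    have "mp_eval LR (j \<circ> mp_const) \<gamma> \<in> ring_hom PR LR"
      "mp_eval LR (j \<circ> mp_const) \<gamma> (mp_const (\<beta> ^ n)) = j (mp_const (\<beta> ^ n))"
      using eh \<beta>n by (simp_all add: alg_hom_def)
    then show ?thesis
      unfolding q_def using ring_hom_mult[OF _ const_closed[OF \<beta>n] f(1)] by metis
  qed
  then have tor: "j (mp_const (\<beta> ^ n)) \<otimes>\<^bsub>LR\<^esub> q = \<zero>\<^bsub>LR\<^esub>"
    using eval_J[OF alg_L \<gamma> f(2)] by (simp add: mpoly_ring_eq)
  \<comment> \<open>A power of N times q comes from a polynomial p, and torsion of q becomes the
    relation N^k \<beta>^n p = 0 in a domain.\<close>
  have "q = \<zero>\<^bsub>LR\<^esub>"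
  proof -
    obtain m p where p: "p \<in> carrier MR" "q \<otimes>\<^bsub>LR\<^esub> j N [^]\<^bsub>LR\<^esub> (m::nat) = j p"
      using L.loc_cases q unfolding LR_def j_def by blast
    have jN: "j N [^]\<^bsub>LR\<^esub> k \<in> carrier LR" for k :: nat using N by simp
    have "j (mp_const (\<beta> ^ n) \<otimes>\<^bsub>MR\<^esub> p) = j (mp_const (\<beta> ^ n)) \<otimes>\<^bsub>LR\<^esub> q \<otimes>\<^bsub>LR\<^esub> j N [^]\<^bsub>LR\<^esub> m"
      using p q \<beta>n jN by (simp add: L'.R.m_assoc)
    then have "j (mp_const (\<beta> ^ n) \<otimes>\<^bsub>MR\<^esub> p) = \<zero>\<^bsub>LR\<^esub>" using tor jN by simp
    then obtain k :: nat where "N [^]\<^bsub>MR\<^esub> k \<otimes>\<^bsub>MR\<^esub> (mp_const (\<beta> ^ n) \<otimes>\<^bsub>MR\<^esub> p) = \<zero>\<^bsub>MR\<^esub>"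
      using L.loc_map_zeroD[of "mp_const (\<beta> ^ n) \<otimes>\<^bsub>MR\<^esub> p"] p \<beta>n unfolding j_def LR_def by auto
    moreover have "N [^]\<^bsub>MR\<^esub> k = N ^ k" for k :: nat
      by (induction k) (simp_all add: mpoly_ring_eq)
    ultimately have "N ^ k * (mp_const (\<beta> ^ n) * p) = 0" by (simp add: mpoly_ring_eq)
    moreover have "mp_const (\<beta> ^ n) \<noteq> (0 :: (nat, 'a) mpoly)"
    proof -
      have "Poly_Mapping.lookup (mp_const (\<beta> ^ n)) (0 :: nat \<Rightarrow>\<^sub>0 nat) = \<beta> ^ n"
        by (simp add: mp_const_def lookup_single)
      then show ?thesis using \<beta>_nz by (metis lookup_zero power_not_zero)
    qed
    \<comment> \<open>N takes the value 1 at a = 1.\<close>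
    moreover have "N \<noteq> 0"
    proof
      assume "N = 0"
      define \<rho> :: "nat \<Rightarrow> 'a" where "\<rho> i = (if i = 0 then 1 else 0)" for i
      have alg_S: "algebra_over S id (ring_of S)"
        using cring_ring_of[OF S] by (simp add: algebra_over_def ring_hom_def)
      have \<rho>: "range \<rho> \<subseteq> carrier (ring_of S)" using closed_ringD[OF S] by (auto simp: \<rho>_def)
      interpret S': scheme_alg "ring_of S" S id \<tau> \<beta> b \<tau>0 \<tau>1 e0 e1 c0 by (rule alg[OF alg_S])
      interpret e: scheme_hom MR "ring_of S" S mp_const id \<tau> \<beta> b \<tau>0 \<tau>1 e0 e1 c0 "mp_eval (ring_of S) id \<rho>"
        by (rule alg_homI[OF alg_mpoly alg_S eval_hom(1)[OF alg_S \<rho>]])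
      have "mp_eval (ring_of S) id \<rho> N = S'.nrm (\<rho> 0, \<rho> 1)"
        unfolding N_def using e.nrm_hom[of "(mp_var 0, mp_var 1)"] eval_hom(2)[OF alg_S \<rho>] by simp
      also have "\<dots> = 1"
        using S data closed_ringD[OF S] by (simp add: S'.nrm_def qconj_def \<rho>_def)
      finally show False using \<open>N = 0\<close> e.h.hom_zero by (simp add: mpoly_ring_eq)
    qed
    ultimately have "p = 0" by simp
    then have "q \<otimes>\<^bsub>LR\<^esub> j N [^]\<^bsub>LR\<^esub> m = \<zero>\<^bsub>LR\<^esub>"
      using p(2) j.h.hom_zero by (simp add: mpoly_ring_eq)
    moreover have "j N [^]\<^bsub>LR\<^esub> m \<otimes>\<^bsub>LR\<^esub> v [^]\<^bsub>LR\<^esub> m = \<one>\<^bsub>LR\<^esub>"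
      using v N L'.R.nat_pow_distrib[of "j N" v m] by simp
    ultimately show ?thesis
      using q v jN[of m] L'.R.m_assoc[of q "j N [^]\<^bsub>LR\<^esub> m" "v [^]\<^bsub>LR\<^esub> m"] by simp
  qed
  \<comment> \<open>The given point lies in the cell, so its parameters define a map e out of the
    localisation with e(\<gamma>) = y; then f(y) is the image of f(\<gamma>) = 0.\<close>
  define g where "g = R.flip_if c (wm y)"
  have wy: "R.Q.unitary (wm y)" using y by (simp add: R.pt_def)
  then have g: "R.Q.unitary g" unfolding g_def by (rule R.flip_if_unitary)
  obtain \<rho> where \<rho>: "\<And>n. \<rho> n \<in> carrier R" "(\<rho> 0, \<rho> 1) = g 1 1" "g = R.cell_pt \<rho> u"
    using R.cell_pt_surj[OF g u(1)] u(2) unfolding g_def by metis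
  define eM where "eM = mp_eval R s \<rho>"
  have eM: "eM \<in> alg_hom S mp_const MR s R" "eM (mp_var n) = \<rho> n" for n
    unfolding eM_def using eval_hom[OF R, of \<rho>] \<rho>(1) by auto
  interpret eM: scheme_hom MR R S mp_const s \<tau> \<beta> b \<tau>0 \<tau>1 e0 e1 c0 eM
    by (rule alg_homI[OF alg_mpoly R eM(1)])
  have "eM N = R.nrm (\<rho> 0, \<rho> 1)"
    unfolding N_def using eM.nrm_hom[of "(mp_var 0, mp_var 1)"] eM(2) by simp
  then have eMu: "eM N \<otimes>\<^bsub>R\<^esub> u = \<one>\<^bsub>R\<^esub>" using u(2) \<rho>(2) by (simp add: g_def)
  obtain e where e: "e \<in> ring_hom LR R" "\<And>a. a \<in> carrier MR \<Longrightarrow> e (j a) = eM a"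
  proof (rule L.loc_universal[of R eM u])
    show "eM \<in> ring_hom MR R" using eM(1) by (simp add: alg_hom_def)
  qed (use R.R.is_cring u(1) eMu that in \<open>auto simp: LR_def j_def\<close>)
  have e_alg: "e \<in> alg_hom S (j \<circ> mp_const) LR s R"
    using e eM(1) by (simp add: alg_hom_def)
  interpret e: scheme_hom LR R S "j \<circ> mp_const" s \<tau> \<beta> b \<tau>0 \<tau>1 e0 e1 c0 e
    by (rule alg_homI[OF alg_L R e_alg])
  have "eM N \<otimes>\<^bsub>R\<^esub> e v = \<one>\<^bsub>R\<^esub>"
    using e.h.hom_mult[of "j N" v] v N e(2)[OF N] by simp
  then have ev: "e v = u"
    using R.R.inv_unique[of u "eM N" "e v"] eMu u(1) v N R.R.m_comm[of "eM N" u] by simp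
  have "wm (e \<circ> \<gamma>) = R.flip_if c (\<lambda>i j'. map_prod e e (L'.cell_pt (j \<circ> mp_var) v i j'))"
    unfolding wm_comp \<gamma>_def wm_unwm by (rule e.flip_if_hom[OF cellm])
  also have "\<dots> = R.flip_if c (R.cell_pt (e \<circ> (j \<circ> mp_var)) (e v))"
    using e.cell_pt_hom[of "j \<circ> mp_var", OF jc v(1)] by simp
  also have "e \<circ> (j \<circ> mp_var) = \<rho>" using e(2) eM(2) by (simp add: fun_eq_iff)
  also have "R.flip_if c (R.cell_pt \<rho> (e v)) = wm y"
    unfolding ev \<rho>(3)[symmetric] g_def
    by (rule R.flip_if_flip_if) (use wy in \<open>unfold R.Q.unitary_def, blast\<close>)
  finally have "e \<circ> \<gamma> = y" by (metis unwm_wm)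
  then have "mp_eval R s y f = e q"
    unfolding q_def using mp_eval_comp[OF S alg_L R e_alg \<gamma>c f(1)] by simp
  then show ?thesis using \<open>q = \<zero>\<^bsub>LR\<^esub>\<close> by simp
qed

text \<open>Let u be the class of f. The radical of its annihilator contains \<beta> by hypothesis
  and both norms by \<open>cell_vanish\<close> over the localisations of \<open>AJ\<close>; then
  \<open>norms_comaximal\<close> forces u = 0.\<close>

theorem J_saturated:
  assumes f: "f \<in> carrier PR" "mp_const (\<beta> ^ n) * f \<in> J"
  shows "f \<in> J"
proof -
  interpret A: scheme_alg AJ S aJ \<tau> \<beta> b \<tau>0 \<tau>1 e0 e1 c0 by (rule alg[OF alg_AJ])
  define u where "u = J +>\<^bsub>PR\<^esub> f"
  have u: "u \<in> carrier AJ" unfolding u_def using ring_hom_closed[OF coset_hom f(1)] .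
  have \<beta>n: "\<beta> ^ n \<in> S" using closed_ringD(7)[OF S] data by blast
  have "aJ (\<beta> ^ n) \<otimes>\<^bsub>AJ\<^esub> u = J +>\<^bsub>PR\<^esub> (mp_const (\<beta> ^ n) * f)"
    unfolding aJ_def u_def using ring_hom_mult[OF coset_hom const_closed[OF \<beta>n] f(1)] by (simp add: mpoly_ring_eq)
  also have "\<dots> = \<zero>\<^bsub>AJ\<^esub>"
    unfolding AJ_def using f(2) J.coset_zero_iff[of "mp_const (\<beta> ^ n) * f"] J.Icarr by blast
  finally have "aJ \<beta> \<in> AJ.ann_rad u"
    using data unfolding AJ.ann_rad_def by (auto simp: A.s_pow)
  \<comment> \<open>The flag c selects the cell: after the flip the corner entry is g_31.\<close>
  moreover have "A.nrm (A.flip_if c (wm xJ) 1 1) \<in> AJ.ann_rad u" for c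
  proof -
    define N where "N = A.nrm (A.flip_if c (wm xJ) 1 1)"
    have un: "A.Q.unitary (wm xJ)" using pt_xJ by (simp add: A.pt_def)
    then have "A.Q.unitary (A.flip_if c (wm xJ))" by (rule A.flip_if_unitary)
    then have e11: "A.flip_if c (wm xJ) 1 1 \<in> carrier A.Q" unfolding A.Q.unitary_def by blast
    then have N: "N \<in> carrier AJ" unfolding N_def by (rule A.nrm_closed)
    interpret L: localisation AJ N by unfold_locales (rule N)
    define LR j where "LR = loc AJ N" and "j = loc_map AJ N"
    have jh: "j \<in> ring_hom AJ LR" unfolding j_def LR_def by (rule L.m.homh)
    have LR: "cring LR" unfolding LR_def by (rule L.L.is_cring)
    have alg_L: "algebra_over S (j \<circ> aJ) LR"
      using ring_hom_trans[of aJ "ring_of S" AJ j LR] alg_AJ jh LR by (simp add: algebra_over_def)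
    have j_alg: "j \<in> alg_hom S aJ AJ (j \<circ> aJ) LR" using jh by (simp add: alg_hom_def)
    interpret L': scheme_alg LR S "j \<circ> aJ" \<tau> \<beta> b \<tau>0 \<tau>1 e0 e1 c0 by (rule alg[OF alg_L])
    interpret j: scheme_hom AJ LR S aJ "j \<circ> aJ" \<tau> \<beta> b \<tau>0 \<tau>1 e0 e1 c0 j
      by (rule alg_homI[OF alg_AJ alg_L j_alg])
    have pt: "L'.pt (j \<circ> xJ)" by (rule j.pt_hom[OF pt_xJ])
    have "L'.flip_if c (wm (j \<circ> xJ)) 1 1 = map_prod j j (A.flip_if c (wm xJ) 1 1)"
    proof -
      have "A.Q.T.mat (wm xJ)" using un unfolding A.Q.unitary_def by blast
      then show ?thesis unfolding wm_comp using j.flip_if_hom[of "wm xJ" c] by metis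
    qed
    then have "L'.nrm (L'.flip_if c (wm (j \<circ> xJ)) 1 1) = j N"
      unfolding N_def using j.nrm_hom[OF e11] by simp
    then have "L'.nrm (L'.flip_if c (wm (j \<circ> xJ)) 1 1) \<otimes>\<^bsub>LR\<^esub> loc_inv AJ N = \<one>\<^bsub>LR\<^esub>"
      using L.loc_inv by (simp add: j_def LR_def)
    moreover have "loc_inv AJ N \<in> carrier LR" using L.loc_inv_closed by (simp add: LR_def)
    ultimately have "mp_eval LR (j \<circ> aJ) (j \<circ> xJ) f = \<zero>\<^bsub>LR\<^esub>"
      using f by (intro cell_vanish[OF alg_L pt])
    moreover have "mp_eval LR (j \<circ> aJ) (j \<circ> xJ) f = j u"
      using mp_eval_comp[OF S alg_AJ alg_L j_alg xJ_closed f(1)] eval_xJ[OF f(1)] by (simp add: u_def)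
    ultimately have "\<exists>k::nat. N [^]\<^bsub>AJ\<^esub> k \<otimes>\<^bsub>AJ\<^esub> u = \<zero>\<^bsub>AJ\<^esub>"
      using L.loc_map_zeroD[OF u] by (simp add: j_def LR_def)
    then show ?thesis using N by (auto simp: AJ.ann_rad_def N_def)
  qed
  from this[of False] this[of True] have "A.nrm (wm xJ 1 1) \<in> AJ.ann_rad u" "A.nrm (wm xJ 3 1) \<in> AJ.ann_rad u"
    by (simp_all add: A.flip_if_def)
  ultimately have "u = \<zero>\<^bsub>AJ\<^esub>"
    using u pt_xJ by (intro A.norms_comaximal)
  then show ?thesis using J.coset_zero_iff[OF f(1)] by (simp add: u_def AJ_def)
qed

end

subsection \<open>Points and smoothness of the represented scheme\<close>

text \<open>Abstracts from how the quotient by J is presented. The adherence is a quotient of a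
  quotient, so its coordinate ring is \<open>AJ\<close> only up to isomorphism.\<close>

locale scheme_rep = scheme S \<tau> \<beta> b \<tau>0 \<tau>1 e0 e1 c0
  for S :: "'a::idom set" and \<tau> \<beta> b \<tau>0 \<tau>1 e0 e1 c0 +
  fixes Z :: "'z ring" and \<pi> :: "(weil_index, 'a) mpoly \<Rightarrow> 'z"
  assumes Z: "cring Z" and \<pi>: "\<pi> \<in> ring_hom PR Z" and \<pi>_surj: "\<pi> ` carrier PR = carrier Z"
    and \<pi>_ker: "f \<in> carrier PR \<Longrightarrow> \<pi> f = \<zero>\<^bsub>Z\<^esub> \<longleftrightarrow> f \<in> J"
begin

abbreviation struct :: "'a \<Rightarrow> 'z" where "struct c \<equiv> \<pi> (mp_const c)"

lemma alg_Z: "algebra_over S struct Z"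
  using ring_hom_trans[OF mp_const_hom[OF S] \<pi>] Z by (simp add: algebra_over_def comp_def)

lemma J_eqs: "f \<in> P.eqs mp_var \<Longrightarrow> f \<in> carrier PR \<and> f \<in> J"
  using eqs_var P.R.genideal_self[OF eqs_var] by (auto simp: J_def)

lemma eval_unique:
  assumes R: "algebra_over S s R" and h: "h \<in> alg_hom S mp_const PR s R" and f: "f \<in> carrier PR"
  shows "h f = mp_eval R s (\<lambda>v. h (mp_var v)) f"
proof -
  define y where "y = (\<lambda>v. h (mp_var v))"
  have hr: "h \<in> ring_hom PR R" using h by (simp add: alg_hom_def)
  have y: "range y \<subseteq> carrier R" using ring_hom_closed[OF hr var_closed] by (auto simp: y_def)
  note E = eval_hom[OF R y]
  have "h f = mp_eval R s y f"
  proof (rule mpoly_hom_unique[OF S hr _ _ _ _ f])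
    show "mp_eval R s y \<in> ring_hom PR R" using E(1) by (simp add: alg_hom_def)
    show "cring R" using R by (simp add: algebra_over_def)
    show "h (mp_const c) = mp_eval R s y (mp_const c)" if "c \<in> S" for c
      using E(1) h that by (simp add: alg_hom_def)
    show "h (mp_var v) = mp_eval R s y (mp_var v)" for v
      using E(2) by (simp add: y_def)
  qed
  then show ?thesis by (simp add: y_def)
qed

lemma hom_pt:
  assumes R: "algebra_over S s R" and h: "h \<in> alg_hom S struct Z s R"
  shows "scheme_alg.pt R s \<tau> \<beta> b \<tau>0 \<tau>1 (\<lambda>v. h (\<pi> (mp_var v)))"
proof -
  have hr: "h \<in> ring_hom Z R" using h by (simp add: alg_hom_def)
  have k: "(\<lambda>f. h (\<pi> f)) \<in> alg_hom S mp_const PR s R"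
    using ring_hom_trans[OF \<pi> hr] h by (simp add: alg_hom_def comp_def)
  have kr: "(\<lambda>f. h (\<pi> f)) \<in> ring_hom PR R" using k by (simp add: alg_hom_def)
  have x: "range (\<lambda>v. h (\<pi> (mp_var v))) \<subseteq> carrier R" using ring_hom_closed[OF kr var_closed] by auto
  interpret h: ring_hom_cring Z R h using Z R hr by (intro ring_hom_cringI') (auto simp: algebra_over_def)
  have "mp_eval R s (\<lambda>v. h (\<pi> (mp_var v))) f = \<zero>\<^bsub>R\<^esub>" if f: "f \<in> P.eqs mp_var" for f
  proof -
    have "h (\<pi> f) = mp_eval R s (\<lambda>v. h (\<pi> (mp_var v))) f"
      using eval_unique[OF R k] J_eqs[OF f] by blast
    moreover have "\<pi> f = \<zero>\<^bsub>Z\<^esub>" using \<pi>_ker J_eqs[OF f] by blast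
    ultimately show ?thesis using h.hom_zero by metis
  qed
  then show ?thesis using pt_iff_eval[OF R x] by blast
qed

lemma pt_hom:
  assumes R: "algebra_over S s R" and x: "scheme_alg.pt R s \<tau> \<beta> b \<tau>0 \<tau>1 x"
  obtains h where "h \<in> alg_hom S struct Z s R" "\<And>v. h (\<pi> (mp_var v)) = x v"
proof -
  interpret R: scheme_alg R S s \<tau> \<beta> b \<tau>0 \<tau>1 e0 e1 c0 by (rule alg[OF R])
  have xc: "range x \<subseteq> carrier R" using R.pt_closed[OF x] by blast
  note E = eval_hom[OF R xc]
  have Er: "mp_eval R s x \<in> ring_hom PR R" using E(1) by (simp add: alg_hom_def)
  obtain h where h: "h \<in> ring_hom Z R" "\<And>f. f \<in> carrier PR \<Longrightarrow> h (\<pi> f) = mp_eval R s x f"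
  proof (rule ring_hom_factor[OF P.R.is_cring Z R.R.is_cring \<pi> \<pi>_surj Er])
    show "mp_eval R s x f = \<zero>\<^bsub>R\<^esub>" if "f \<in> carrier PR" "\<pi> f = \<zero>\<^bsub>Z\<^esub>" for f
      using that \<pi>_ker eval_J[OF R x] by blast
  qed blast
  have "h \<in> alg_hom S struct Z s R"
    using h E(1) by (simp add: alg_hom_def)
  moreover have "h (\<pi> (mp_var v)) = x v" for v using h(2)[OF var_closed] E(2) by simp
  ultimately show thesis by (rule that)
qed

text \<open>The definition wants variables indexed by an initial segment of the naturals, so the
  finitely many coordinates are renumbered; the isomorphism r carries the equations to generators of
  the kernel.\<close>

lemma finitely_presented_Z: "finitely_presented S struct Z"
proof -
  let ?n = "card (UNIV :: weil_index set)"
  let ?M = "mpoly_ring S {..<?n} :: (nat, 'a) mpoly ring"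
  obtain \<phi> where \<phi>: "bij_betw \<phi> (UNIV :: weil_index set) {0..<?n}"
    using ex_bij_betw_finite_nat[of "UNIV :: weil_index set"] by auto
  define \<psi> where "\<psi> = the_inv_into UNIV \<phi>"
  have \<phi>n: "\<phi> v \<in> {..<?n}" and \<psi>\<phi>: "\<psi> (\<phi> v) = v" for v
    using \<phi> by (auto simp: bij_betw_def \<psi>_def the_inv_into_f_f)
  have \<phi>\<psi>: "\<phi> (\<psi> i) = i" if "i \<in> {..<?n}" for i
    using \<phi> that f_the_inv_into_f[of \<phi> UNIV i] by (auto simp: bij_betw_def \<psi>_def)
  have M: "cring ?M" by (rule cring_mpoly_ring[OF S])
  have var: "mp_var i \<in> carrier ?M" if "i \<in> {..<?n}" for i
    using mp_var_closed[OF S that] by (simp add: mpoly_ring_eq)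
  define r where "r = mp_eval ?M mp_const (\<lambda>v::weil_index. mp_var (\<phi> v))"
  define r' where "r' = mp_eval PR mp_const (\<lambda>i::nat. mp_var (\<psi> i))"
  have rc: "range (\<lambda>v::weil_index. mp_var (\<phi> v)) \<subseteq> carrier ?M" using var[OF \<phi>n] by blast
  have r: "r \<in> ring_hom PR ?M" "\<And>c. c \<in> S \<Longrightarrow> r (mp_const c) = mp_const c" "\<And>v. r (mp_var v) = mp_var (\<phi> v)"
    using eval_hom[OF alg_mpoly rc] by (simp_all add: r_def alg_hom_def)
  interpret r': mp_data PR S mp_const "{..<?n}" "\<lambda>i::nat. mp_var (\<psi> i)"
    by (rule mp_data_alg[OF S alg_mpoly var_closed])
  have r': "r' \<in> ring_hom ?M PR" "\<And>c. c \<in> S \<Longrightarrow> r' (mp_const c) = mp_const c"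
    "\<And>i. i \<in> {..<?n} \<Longrightarrow> r' (mp_var i) = mp_var (\<psi> i)"
    using ring_hom_cring.homh[OF r'.mp_eval_hom] r'.mp_eval_const r'.mp_eval_var by (simp_all add: r'_def)
  have "(\<lambda>f. r' (r f)) f = (\<lambda>f. f) f" if "f \<in> carrier PR" for f
    by (rule mpoly_hom_unique[OF S _ _ P.R.is_cring _ _ that])
      (use ring_hom_trans[OF r(1) r'(1)] r r' \<phi>n \<psi>\<phi> in \<open>auto simp: comp_def ring_hom_def\<close>)
  then have r'r: "r' (r f) = f" if "f \<in> carrier PR" for f using that by simp
  have "(\<lambda>f. r (r' f)) f = (\<lambda>f. f) f" if "f \<in> carrier ?M" for f
    by (rule mpoly_hom_unique[OF S _ _ M _ _ that])
      (use ring_hom_trans[OF r'(1) r(1)] r r' \<phi>\<psi> in \<open>auto simp: comp_def ring_hom_def\<close>)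
  then have rr': "r (r' f) = f" if "f \<in> carrier ?M" for f using that by simp
  define F where "F = r ` P.eqs mp_var"
  have F: "finite F" "F \<subseteq> carrier ?M"
    using P.finite_eqs ring_hom_closed[OF r(1)] J_eqs by (auto simp: F_def)
  interpret M: cring ?M by (rule M)
  interpret I: ideal "genideal ?M F" ?M by (rule M.genideal_ideal[OF F(2)])
  define h where "h = (\<lambda>p. \<pi> (r' p))"
  have hr: "h \<in> ring_hom ?M Z" using ring_hom_trans[OF r'(1) \<pi>] by (simp add: h_def comp_def)
  interpret h: ring_hom_cring ?M Z h using M Z hr by (rule ring_hom_cringI')
  have ker: "a_kernel ?M Z h = genideal ?M F"
  proof
    show "genideal ?M F \<subseteq> a_kernel ?M Z h"
    proof (rule M.genideal_minimal)
      show "ideal (a_kernel ?M Z h) ?M"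
        using h.ring.ring_hom_ring_axioms by (rule ring_hom_ring.kernel_is_ideal)
      have "h (r f) = \<zero>\<^bsub>Z\<^esub>" if "f \<in> P.eqs mp_var" for f
        using J_eqs[OF that] r'r \<pi>_ker by (simp add: h_def)
      then show "F \<subseteq> a_kernel ?M Z h"
        using F(2) unfolding a_kernel_def' F_def by blast
    qed
  next
    \<comment> \<open>For the other inclusion: renumbering followed by the quotient map kills the
      equations, hence J, so a polynomial that dies in Z lies in the ideal generated by F.\<close>
    define k where "k = (\<lambda>f. genideal ?M F +>\<^bsub>?M\<^esub> r f)"
    have kr: "k \<in> ring_hom PR (?M Quot genideal ?M F)"
      using ring_hom_trans[OF r(1) I.rcos_ring_hom] by (simp add: k_def comp_def)
    interpret k: ring_hom_cring PR "?M Quot genideal ?M F" k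
      using P.R.is_cring I.quotient_is_cring[OF M] kr by (rule ring_hom_cringI')
    have "k f = \<zero>\<^bsub>?M Quot genideal ?M F\<^esub>" if "f \<in> P.eqs mp_var" for f
    proof -
      have "r f \<in> F" using that by (simp add: F_def)
      then have "r f \<in> genideal ?M F" "r f \<in> carrier ?M" using M.genideal_self[OF F(2)] F(2) by auto
      then show ?thesis unfolding k_def using I.coset_zero_iff by blast
    qed
    then have kJ: "k f = \<zero>\<^bsub>?M Quot genideal ?M F\<^esub>" if "f \<in> J" for f
      using k.genideal_kernel[OF eqs_var] that unfolding J_def by blast
    show "a_kernel ?M Z h \<subseteq> genideal ?M F"
    proof
      fix p assume "p \<in> a_kernel ?M Z h"
      then have p: "p \<in> carrier ?M" "\<pi> (r' p) = \<zero>\<^bsub>Z\<^esub>" unfolding a_kernel_def' by (auto simp: h_def)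
      then have "r' p \<in> J" using \<pi>_ker ring_hom_closed[OF r'(1) p(1)] by blast
      then have "genideal ?M F +>\<^bsub>?M\<^esub> p = \<zero>\<^bsub>?M Quot genideal ?M F\<^esub>"
        using kJ[of "r' p"] rr'[OF p(1)] by (simp add: k_def)
      then show "p \<in> genideal ?M F" using I.coset_zero_iff[OF p(1)] by blast
    qed
  qed
  have surj: "h ` carrier ?M = carrier Z"
  proof
    show "h ` carrier ?M \<subseteq> carrier Z" using ring_hom_closed[OF hr] by blast
    show "carrier Z \<subseteq> h ` carrier ?M"
    proof
      fix z assume "z \<in> carrier Z"
      then obtain f where f: "f \<in> carrier PR" "z = \<pi> f" using \<pi>_surj by blast
      then have "z = h (r f)" using r'r by (simp add: h_def)
      then show "z \<in> h ` carrier ?M" using ring_hom_closed[OF r(1) f(1)] by blast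
    qed
  qed
  have "h \<in> alg_hom S mp_const ?M struct Z"
    using hr r'(2) by (simp add: alg_hom_def h_def)
  then show ?thesis
    unfolding finitely_presented_def using surj F ker by blast
qed

text \<open>The coordinates of the point over C / I are lifted arbitrarily. The resulting matrix
  satisfies the equations modulo I \<times> I, an ideal of the quadratic algebra that has square
  zero and is stable under conjugation, so \<open>unitary_lift\<close> applies.\<close>

lemma formally_smooth_Z: "formally_smooth TYPE('c) S struct Z"
  unfolding formally_smooth_def
proof (intro allI impI ballI)
  fix C :: "'c ring" and c I h
  assume C: "algebra_over S c C" and I: "ideal I C" and sq: "\<forall>x\<in>I. \<forall>y\<in>I. x \<otimes>\<^bsub>C\<^esub> y = \<zero>\<^bsub>C\<^esub>"
    and h: "h \<in> alg_hom S struct Z (quot_struct C I c) (C Quot I)"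
  interpret C: scheme_alg C S c \<tau> \<beta> b \<tau>0 \<tau>1 e0 e1 c0 by (rule alg[OF C])
  interpret I: ideal I C by fact
  let ?D = "C Quot I" and ?e = "(+>\<^bsub>C\<^esub>) I" and ?d = "quot_struct C I c"
  have D: "algebra_over S ?d ?D"
    using ring_hom_trans[OF C.s I.rcos_ring_hom] I.quotient_is_cring[OF C.R.is_cring]
    by (simp add: algebra_over_def quot_struct_def[abs_def] comp_def)
  interpret D: scheme_alg ?D S ?d \<tau> \<beta> b \<tau>0 \<tau>1 e0 e1 c0 by (rule alg[OF D])
  have e_alg: "?e \<in> alg_hom S c C ?d ?D"
    using I.rcos_ring_hom by (simp add: alg_hom_def quot_struct_def)
  interpret e: scheme_hom C ?D S c ?d \<tau> \<beta> b \<tau>0 \<tau>1 e0 e1 c0 ?e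
    by (rule alg_homI[OF C D e_alg])
  let ?E = "map_prod ?e ?e"
  define xq where "xq = (\<lambda>v. h (\<pi> (mp_var v)))"
  have xq: "D.pt xq" unfolding xq_def by (rule hom_pt[OF D h])
  have "\<exists>y. y \<in> carrier C \<and> ?e y = xq v" for v
    using D.pt_closed[OF xq, of v] I.coset_surj by (metis imageE)
  then obtain x where x: "\<And>v. x v \<in> carrier C" "\<And>v. ?e (x v) = xq v" by metis
  have ex: "?e \<circ> x = xq" using x(2) by (simp add: fun_eq_iff)
  have m: "C.Q.T.mat (wm x)" using x(1) C.mat_wm[of x] by blast
  note v = C.Q.vec_col[OF m]
  define JT where "JT = a_kernel C.Q D.Q ?E"
  have JT: "ideal JT C.Q"
    unfolding JT_def using e.Q.h.ring.ring_hom_ring_axioms by (rule ring_hom_ring.kernel_is_ideal)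
  have JT_iff: "z \<in> JT \<longleftrightarrow> fst z \<in> I \<and> snd z \<in> I" if "z \<in> carrier C.Q" for z
  proof -
    have "z \<in> JT \<longleftrightarrow> ?e (fst z) = \<zero>\<^bsub>?D\<^esub> \<and> ?e (snd z) = \<zero>\<^bsub>?D\<^esub>"
      using that unfolding JT_def a_kernel_def' by (auto simp: map_prod_def split_beta)
    moreover have f: "fst z \<in> carrier C" "snd z \<in> carrier C" using that by auto
    ultimately show ?thesis by (simp only: I.coset_zero_iff[OF f(1)] I.coset_zero_iff[OF f(2)])
  qed
  have JT_in: "z \<in> JT" if "z \<in> carrier C.Q" "?E z = \<zero>\<^bsub>D.Q\<^esub>" for z
    using that unfolding JT_def a_kernel_def' by blast
  have JT_sub: "z \<in> carrier C.Q" if "z \<in> JT" for z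
    using that unfolding JT_def a_kernel_def' by blast
  have one: "\<one>\<^bsub>C.Q\<^esub> \<in> carrier C.Q" by (rule C.Q.T.one_closed)
  have un: "D.Q.unitary (\<lambda>i j. ?E (wm x i j))"
    using xq unfolding D.pt_def ex[symmetric] wm_comp .
  note un' = un[unfolded D.Q.unitary_def]
  have minus: "?E (z \<ominus>\<^bsub>C.Q\<^esub> \<one>\<^bsub>C.Q\<^esub>) = \<zero>\<^bsub>D.Q\<^esub>" if "z \<in> carrier C.Q" "?E z = \<one>\<^bsub>D.Q\<^esub>" for z
    using e.Q.h_minus[OF that(1) one] that e.Q.h.hom_one D.Q.T.r_right_minus_eq[of "\<one>\<^bsub>D.Q\<^esub>" "\<one>\<^bsub>D.Q\<^esub>"]
      D.Q.T.one_closed by (simp only:)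
  note hom = e.Q.hom_herm[OF v v] e.Q.hom_qf[OF v] e.Q.h.hom_det3[OF m] e.Q.col_hom
  obtain g where g: "C.Q.unitary g" "\<And>i j. JT +>\<^bsub>C.Q\<^esub> g i j = JT +>\<^bsub>C.Q\<^esub> wm x i j"
  proof (rule C.Q.unitary_lift[OF JT _ _ C.ee m])
    show "y \<otimes>\<^bsub>C.Q\<^esub> z = \<zero>\<^bsub>C.Q\<^esub>" if yz: "y \<in> JT" "z \<in> JT" for y z
    proof -
      have "fst y \<in> I" "snd y \<in> I" "fst z \<in> I" "snd z \<in> I"
        using yz JT_iff JT_sub by blast+
      then show ?thesis using sq by (simp add: a_minus_def)
    qed
    show "qconj C (c \<tau>) y \<in> JT" if y: "y \<in> JT" for y
    proof -
      have "fst y \<in> I" "snd y \<in> I" using y JT_iff JT_sub by blast+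
      then have "fst (qconj C (c \<tau>) y) \<in> I" "snd (qconj C (c \<tau>) y) \<in> I"
        by (simp_all add: qconj_def I.I_l_closed)
      then show ?thesis using JT_iff C.Q.cj.hom_closed[OF JT_sub[OF y]] by blast
    qed
    show "det3 C.Q (wm x) \<ominus>\<^bsub>C.Q\<^esub> \<one>\<^bsub>C.Q\<^esub> \<in> JT"
      using un' C.Q.T.det3_closed[OF m] one by (intro JT_in minus C.Q.T.minus_closed) (simp_all only: hom)
    show "C.Q.qf (col (wm x) 1) \<in> JT" "C.Q.qf (col (wm x) 3) \<in> JT"
      using un' C.Q.qf_closed[OF v] by (intro JT_in; simp only: hom)+
    show "C.Q.herm (col (wm x) 3) (col (wm x) 1) \<ominus>\<^bsub>C.Q\<^esub> \<one>\<^bsub>C.Q\<^esub> \<in> JT"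
      using un' C.Q.herm_closed[OF v v] one by (intro JT_in minus C.Q.T.minus_closed) (simp_all only: hom)
    show "C.Q.herm (col (wm x) 1) (col (wm x) 2) \<in> JT" "C.Q.herm (col (wm x) 3) (col (wm x) 2) \<in> JT"
      using un' C.Q.herm_closed[OF v v] by (intro JT_in; simp only: hom)+
  qed (rule that)
  interpret JT: ideal JT C.Q by (rule JT)
  have gm: "C.Q.T.mat g" using g(1) unfolding C.Q.unitary_def by blast
  have Eg: "?E (g i j) = ?E (wm x i j)" for i j
  proof -
    have "g i j \<ominus>\<^bsub>C.Q\<^esub> wm x i j \<in> JT"
      using g(2)[of i j] JT.coset_eq_iff[of "g i j" "wm x i j"] gm m by blast
    then have "?E (g i j \<ominus>\<^bsub>C.Q\<^esub> wm x i j) = \<zero>\<^bsub>D.Q\<^esub>" unfolding JT_def a_kernel_def' by blast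
    then have "?E (g i j) \<ominus>\<^bsub>D.Q\<^esub> ?E (wm x i j) = \<zero>\<^bsub>D.Q\<^esub>"
      using e.Q.h_minus[of "g i j" "wm x i j"] gm m by metis
    then show ?thesis
      using D.Q.T.r_right_minus_eq[OF e.Q.h.hom_closed e.Q.h.hom_closed, of "g i j" "wm x i j"] gm m by blast
  qed
  define x' where "x' = unwm g"
  have pt: "C.pt x'" unfolding x'_def C.pt_def wm_unwm by (rule g(1))
  have "wm (?e \<circ> x') = wm xq"
    unfolding ex[symmetric] wm_comp using Eg by (simp add: x'_def)
  then have ex': "?e \<circ> x' = xq" by (metis unwm_wm)
  obtain h' where h': "h' \<in> alg_hom S struct Z c C" "\<And>v. h' (\<pi> (mp_var v)) = x' v"
  proof (rule pt_hom[OF C pt])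
  qed (rule that)
  have h'r: "h' \<in> ring_hom Z C" and hr: "h \<in> ring_hom Z ?D" using h h' by (auto simp: alg_hom_def)
  have "?e (h' z) = h z" if z: "z \<in> carrier Z" for z
  proof -
    obtain f where f: "f \<in> carrier PR" "z = \<pi> f" using z \<pi>_surj by blast
    have "(\<lambda>f. ?e (h' (\<pi> f))) f = (\<lambda>f. h (\<pi> f)) f"
    proof (rule mpoly_hom_unique[OF S _ _ D.R.is_cring _ _ f(1)])
      show "(\<lambda>f. ?e (h' (\<pi> f))) \<in> ring_hom PR ?D"
        using ring_hom_trans[OF ring_hom_trans[OF \<pi> h'r] I.rcos_ring_hom] by (simp add: comp_def)
      show "(\<lambda>f. h (\<pi> f)) \<in> ring_hom PR ?D"
        using ring_hom_trans[OF \<pi> hr] by (simp add: comp_def)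
      show "?e (h' (struct k)) = h (struct k)" if "k \<in> S" for k
        using h h' that by (simp add: alg_hom_def quot_struct_def)
      show "?e (h' (\<pi> (mp_var v))) = h (\<pi> (mp_var v))" for v
        using h'(2) fun_cong[OF ex', of v] by (simp add: xq_def)
    qed
    then show ?thesis by (simp add: f)
  qed
  with h'(1) show "\<exists>h'\<in>alg_hom S struct Z c C. \<forall>x\<in>carrier Z. ?e (h' x) = h x" by blast
qed

theorem smooth_Z: "smooth_algebra TYPE('c) S struct Z"
  unfolding smooth_algebra_def using alg_Z finitely_presented_Z formally_smooth_Z by blast

end

section \<open>Leibniz determinant and matrix products in rank three\<close>

lemma permutes_3:
  "{p :: 3 \<Rightarrow> 3. p permutes UNIV} =
     {id, transpose 2 3, transpose 1 2, transpose 1 2 \<circ> transpose 2 3, transpose 1 3, transpose 1 3 \<circ> transpose 2 3}"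
proof -
  have "{(b, p). b \<in> {2, 3} \<and> p \<in> {p. p permutes {3::3}}} = {(2::3, id), (3, id)}" by auto
  then have "{p. p permutes {2, 3::3}} = (\<lambda>(b, p). transpose 2 b \<circ> p) ` {(2, id), (3, id)}"
    by (subst permutes_insert) (simp only:)
  then have 2: "{p. p permutes {2, 3::3}} = {id, transpose 2 3}" by simp
  have "{(b, p). b \<in> {1, 2, 3} \<and> p \<in> {p. p permutes {2, 3::3}}} =
      {(1::3, id), (1, transpose 2 3), (2, id), (2, transpose 2 3), (3, id), (3, transpose 2 3)}"
    unfolding 2 by auto
  then have "{p. p permutes {1, 2, 3::3}} = (\<lambda>(b, p). transpose 1 b \<circ> p) `
      {(1, id), (1, transpose 2 3), (2, id), (2, transpose 2 3), (3, id), (3, transpose 2 3)}"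
    by (subst permutes_insert) (simp only:)
  then show ?thesis unfolding UNIV3 by simp
qed

lemma (in cring) finsum_6:
  assumes "distinct [p1, p2, p3, p4, p5, p6]"
    and "f p1 \<in> carrier R" "f p2 \<in> carrier R" "f p3 \<in> carrier R" "f p4 \<in> carrier R" "f p5 \<in> carrier R" "f p6 \<in> carrier R"
  shows "finsum R f {p1, p2, p3, p4, p5, p6} = f p1 \<oplus> (f p2 \<oplus> (f p3 \<oplus> (f p4 \<oplus> (f p5 \<oplus> f p6))))"
  using assms by (simp add: finsum_insert Pi_def)

lemma (in cring) det9_leibniz:
  assumes "a1 \<in> carrier R" "a2 \<in> carrier R" "a3 \<in> carrier R" "b1 \<in> carrier R" "b2 \<in> carrier R"
    "b3 \<in> carrier R" "c1 \<in> carrier R" "c2 \<in> carrier R" "c3 \<in> carrier R"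
  shows "a1 \<otimes> (b2 \<otimes> c3) \<oplus> (\<ominus> (a1 \<otimes> (b3 \<otimes> c2)) \<oplus> (\<ominus> (a2 \<otimes> (b1 \<otimes> c3)) \<oplus>
     (a2 \<otimes> (b3 \<otimes> c1) \<oplus> (\<ominus> (a3 \<otimes> (b2 \<otimes> c1)) \<oplus> a3 \<otimes> (b1 \<otimes> c2))))) = det9 a1 a2 a3 b1 b2 b3 c1 c2 c3"
  using assms unfolding det9_def
  by (elim presE) (simp only: pres_simps, rule arg_cong[where f = pres], simp add: algebra_simps)

context
  fixes R :: "'r ring" (structure)
  assumes R: "cring R"
begin

interpretation cring R by (rule R)

lemma mat_det_det3:
  assumes "mat g"
  shows "mat_det R g = det3 R g"
proof -
  have g[simp]: "g i j \<in> carrier R" for i j using assms by blast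
  have P: "(\<Otimes>i\<in>UNIV. g i (p i)) = g 1 (p 1) \<otimes> (g 2 (p 2) \<otimes> g 3 (p 3))" for p
    unfolding UNIV3 by (simp add: finprod_insert Pi_def index3)
  let ?f = "\<lambda>p. if evenperm p then g 1 (p 1) \<otimes> (g 2 (p 2) \<otimes> g 3 (p 3)) else \<ominus> (g 1 (p 1) \<otimes> (g 2 (p 2) \<otimes> g 3 (p 3)))"
  have d: "distinct [id, transpose 2 3, transpose 1 2, transpose 1 2 \<circ> transpose 2 3, transpose 1 3, transpose 1 3 \<circ> transpose 2 (3::3)]"
    by (simp add: fun_eq_iff all3 transpose_def index3)
  have ev: "evenperm (transpose a b \<circ> transpose c d) \<longleftrightarrow> (a = b) = (c = d)" for a b c d :: 3
    by (simp add: evenperm_comp evenperm_swap permutation_swap_id)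
  have "mat_det R g = finsum R ?f {p. p permutes UNIV}"
    unfolding mat_det_def P ..
  also have "\<dots> = det9 (g 1 1) (g 1 2) (g 1 3) (g 2 1) (g 2 2) (g 2 3) (g 3 1) (g 3 2) (g 3 3)"
    unfolding permutes_3
    apply (subst finsum_6[OF d])
          apply (simp_all add: ev evenperm_swap index3 transpose_def del: comp_apply)
    using det9_leibniz[of "g 1 1" "g 1 2" "g 1 3" "g 2 1" "g 2 2" "g 2 3" "g 3 1" "g 3 2" "g 3 3"]
    by simp
  finally show ?thesis by (simp only: det3_det9)
qed

lemma mat_mul_3:
  assumes "mat g" "mat h"
  shows "mat_mul R g h i j = g i 1 \<otimes> h 1 j \<oplus> (g i 2 \<otimes> h 2 j \<oplus> g i 3 \<otimes> h 3 j)"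
  using assms unfolding mat_mul_def UNIV3 by (simp add: finsum_insert Pi_def index3)

lemma mat_mul_diag:
  assumes "mat g" "vec d"
  shows "mat_mul R g (mat_diag R d) i j = g i j \<otimes> d j"
proof -
  have [simp]: "g i j \<in> carrier R" "d j \<in> carrier R" for i j using assms by blast+
  have D: "mat (mat_diag R d)" by (simp add: mat_diag_def)
  have "j = 1 \<or> j = 2 \<or> j = 3" using UNIV3 by blast
  then show ?thesis unfolding mat_mul_3[OF assms(1) D] by (auto simp: mat_diag_def index3)
qed

end

section \<open>Matrix equations over the tensor product in coordinates\<close>

context quad_ext
begin

lemma mat_T_iff:
  "(\<forall>i j. g i j \<in> carrier T) \<longleftrightarrow> (\<exists>x. range x \<subseteq> carrier R \<and> g = (\<lambda>i j. el (wm x i j)))"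
proof
  assume "\<forall>i j. g i j \<in> carrier T"
  then have "\<forall>i j. \<exists>p. p \<in> carrier R \<times> carrier R \<and> g i j = el p" unfolding carrier_T by blast
  then obtain f where f: "\<And>i j. f i j \<in> carrier R \<times> carrier R" "\<And>i j. g i j = el (f i j)" by metis
  have "\<forall>i j. wm (unwm f) i j \<in> carrier R \<times> carrier R" using f(1) by simp
  then have "range (unwm f) \<subseteq> carrier R" unfolding wm_closed by blast
  moreover have "g = (\<lambda>i j. el (wm (unwm f) i j))" using f(2) by (simp add: fun_eq_iff)
  ultimately show "\<exists>x. range x \<subseteq> carrier R \<and> g = (\<lambda>i j. el (wm x i j))" by blast
next
  assume "\<exists>x. range x \<subseteq> carrier R \<and> g = (\<lambda>i j. el (wm x i j))"
  then obtain x where x: "range x \<subseteq> carrier R" "g = (\<lambda>i j. el (wm x i j))" by blast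
  have "\<forall>i j. wm x i j \<in> carrier R \<times> carrier R" unfolding wm_closed using x(1) by blast
  then show "\<forall>i j. g i j \<in> carrier T" unfolding carrier_T x(2) by blast
qed

lemma weil_matrix_wm:
  assumes "range x \<subseteq> carrier R"
  shows "weil_matrix S s R B t x = (\<lambda>i j. el (wm x i j))"
  using assms by (subst weil_matrix_el) (auto simp: wm_def)

lemma mat_det_el:
  assumes "Q.mat g"
  shows "mat_det T (\<lambda>i j. el (g i j)) = el (det3 Q g)"
proof -
  have "T.mat (\<lambda>i j. el (g i j))" using assms el.hom_closed by blast
  then show ?thesis using mat_det_det3[OF T.is_cring] el.hom_det3[OF assms] by simp
qed

lemma el_wm_inj:
  assumes "range x \<subseteq> carrier R" "range y \<subseteq> carrier R" "(\<lambda>i j. el (wm x i j)) = (\<lambda>i j. el (wm y i j))"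
  shows "x = y"
proof -
  have c: "\<forall>i j. wm x i j \<in> carrier R \<times> carrier R" "\<forall>i j. wm y i j \<in> carrier R \<times> carrier R"
    unfolding wm_closed using assms by blast+
  have "wm x i j = wm y i j" for i j
    using el_inj[of "wm x i j" "wm y i j"] c assms(3)[THEN fun_cong, of i, THEN fun_cong, of j] by blast
  then have "wm x = wm y" by (simp add: fun_eq_iff)
  then show ?thesis by (metis unwm_wm)
qed

end

locale ext_alg = scheme_alg R S s \<tau> \<beta> b \<tau>0 \<tau>1 e0 e1 c0 + E: quad_ext R S B s t \<tau> \<beta> \<sigma>
  for R :: "'r ring" (structure) and S B :: "'a::idom set" and s t \<tau> \<beta> b \<tau>0 \<tau>1 e0 e1 c0 \<sigma>
begin

lemma conj_T: "Q.T.mat g \<Longrightarrow> anti_transpose (mat_conj S s R B \<sigma> (\<lambda>i j. E.el (g i j))) i k =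
    E.el (qconj R (s \<tau>) (g (4 - k) (4 - i)))"
  unfolding anti_transpose_def mat_conj_def by (rule E.tensor_map_el) simp

text \<open>Anti-transposition places the conjugate of column 4 - i, in reverse order, in row i; so
  the product is the matrix of pairings of columns.\<close>

lemma std_herm_T:
  assumes g: "Q.T.mat g"
  shows "mat_mul E.T (anti_transpose (mat_conj S s R B \<sigma> (\<lambda>i j. E.el (g i j)))) (\<lambda>i j. E.el (g i j)) i j =
    E.el (Q.std_herm (col g (4 - i)) (col g j))"
proof -
  have gc[simp]: "g i j \<in> carrier Q" for i j using g by blast
  have m: "E.T.mat (anti_transpose (mat_conj S s R B \<sigma> (\<lambda>i j. E.el (g i j))))" "E.T.mat (\<lambda>i j. E.el (g i j))"
    unfolding conj_T[OF g] by (auto intro!: E.el.hom_closed Q.cj.hom_closed gc simp del: quad_simps)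
  have c: "Q.std_herm (col g (4 - i)) (col g j) = qconj R (s \<tau>) (g 3 (4 - i)) \<otimes>\<^bsub>Q\<^esub> g 1 j \<oplus>\<^bsub>Q\<^esub>
      (qconj R (s \<tau>) (g 2 (4 - i)) \<otimes>\<^bsub>Q\<^esub> g 2 j \<oplus>\<^bsub>Q\<^esub> qconj R (s \<tau>) (g 1 (4 - i)) \<otimes>\<^bsub>Q\<^esub> g 3 j)"
    unfolding Q.std_herm_def col_def by (intro Q.T.a_assoc Q.T.m_closed Q.cj.hom_closed gc)
  show ?thesis
    unfolding mat_mul_3[OF E.T.is_cring m] conj_T[OF g] c Q.minus_index3
    by (simp only: E.el.hom_add E.el.hom_mult Q.cj.hom_closed gc Q.T.m_closed Q.T.a_closed)
qed

lemma herm_T: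
  assumes g: "Q.T.mat g"
  shows "mat_mul E.T (mat_mul E.T (anti_transpose (mat_conj S s R B \<sigma> (\<lambda>i j. E.el (g i j))))
      (mat_diag E.T (\<lambda>i. if i = 2 then E.el (s b, \<zero>) else \<one>\<^bsub>E.T\<^esub>))) (\<lambda>i j. E.el (g i j)) i j =
    E.el (Q.herm (col g (4 - i)) (col g j))"
proof -
  have gc[simp]: "g i j \<in> carrier Q" for i j using g by blast
  have bc: "(s b, \<zero>) \<in> carrier Q" by simp
  have m: "E.T.mat (anti_transpose (mat_conj S s R B \<sigma> (\<lambda>i j. E.el (g i j))))" "E.T.mat (\<lambda>i j. E.el (g i j))"
    unfolding conj_T[OF g] by (auto intro!: E.el.hom_closed Q.cj.hom_closed gc simp del: quad_simps)
  have d: "E.T.vec (\<lambda>i::3. if i = 2 then E.el (s b, \<zero>) else \<one>\<^bsub>E.T\<^esub>)"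
    using E.el.hom_closed[OF bc] by simp
  have D: "E.T.mat (mat_diag E.T (\<lambda>i. if i = 2 then E.el (s b, \<zero>) else \<one>\<^bsub>E.T\<^esub>))"
    using d by (simp add: mat_diag_def)
  have m2: "E.T.mat (mat_mul E.T (anti_transpose (mat_conj S s R B \<sigma> (\<lambda>i j. E.el (g i j))))
      (mat_diag E.T (\<lambda>i. if i = 2 then E.el (s b, \<zero>) else \<one>\<^bsub>E.T\<^esub>)))"
    unfolding mat_mul_diag[OF E.T.is_cring m(1) d] using m d by blast
  let ?c = "\<lambda>k. qconj R (s \<tau>) (g k (4 - i))"
  have cc[simp]: "?c k \<in> carrier Q" for k by (rule Q.cj.hom_closed[OF gc])
  have c: "Q.herm (col g (4 - i)) (col g j) = ?c 3 \<otimes>\<^bsub>Q\<^esub> \<one>\<^bsub>Q\<^esub> \<otimes>\<^bsub>Q\<^esub> g 1 j \<oplus>\<^bsub>Q\<^esub>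
      (?c 2 \<otimes>\<^bsub>Q\<^esub> (s b, \<zero>) \<otimes>\<^bsub>Q\<^esub> g 2 j \<oplus>\<^bsub>Q\<^esub> ?c 1 \<otimes>\<^bsub>Q\<^esub> \<one>\<^bsub>Q\<^esub> \<otimes>\<^bsub>Q\<^esub> g 3 j)"
    unfolding Q.herm_def col_def using gc[of 1 j] gc[of 2 j] gc[of 3 j] cc[of 1] cc[of 2] cc[of 3] bc
    by (simp only: Q.T.m_assoc[symmetric] Q.T.m_comm[of "(s b, \<zero>)"] Q.T.r_one Q.T.a_assoc Q.T.m_closed)
  show ?thesis
    unfolding mat_mul_3[OF E.T.is_cring m2 m(2)] mat_mul_diag[OF E.T.is_cring m(1) d] conj_T[OF g] c Q.minus_index3
    by (simp only: E.el.hom_add E.el.hom_mult E.el.hom_one cc gc bc Q.T.one_closed Q.T.m_closed Q.T.a_closed index3 simp_thms if_False if_True)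
qed

text \<open>In coordinates the linear extension of f is the divided trace and the tensor norm is
  \<open>nrm\<close>, so the equation for column j is the vanishing of \<open>qf\<close> on
  it.\<close>

lemma tr_T:
  assumes f: "\<And>x. x \<in> B \<Longrightarrow> f x \<in> S" "\<And>x y. x \<in> B \<Longrightarrow> y \<in> B \<Longrightarrow> f (x + y) = f x + f y"
      "\<And>c x. c \<in> S \<Longrightarrow> x \<in> B \<Longrightarrow> f (c * x) = c * f x" "f 1 = \<tau>0" "f t = \<tau>1"
    and g: "Q.T.mat g"
  shows "tensor_linear_ext s R f (tensor_map S s R B \<sigma> (E.el (g 3 j)) \<otimes>\<^bsub>E.T\<^esub> E.el (g 1 j)) =
      \<ominus> tensor_norm S s R B \<sigma> (E.el (g 2 j)) \<longleftrightarrow> Q.qf (col g j) = \<zero>\<^bsub>Q\<^esub>"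
proof -
  have gc[simp]: "g i j \<in> carrier Q" for i j using g by blast
  let ?p = "qconj R (s \<tau>) (g 3 j) \<otimes>\<^bsub>Q\<^esub> g 1 j"
  have pc: "?p \<in> carrier Q" by (intro Q.T.m_closed Q.cj.hom_closed gc)
  have pc': "fst ?p \<in> carrier R" "snd ?p \<in> carrier R" using pc by (simp_all only: quad_simps mem_Times_iff)
  have "tensor_map S s R B \<sigma> (E.el (g 3 j)) \<otimes>\<^bsub>E.T\<^esub> E.el (g 1 j) = E.el ?p"
    using E.tensor_map_el[of "g 3 j"] E.el.hom_mult[OF Q.cj.hom_closed[OF gc] gc] gc[of 3 j]
    by (simp only: quad_simps)
  then have "tensor_linear_ext s R f (tensor_map S s R B \<sigma> (E.el (g 3 j)) \<otimes>\<^bsub>E.T\<^esub> E.el (g 1 j)) =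
      fst ?p \<otimes> s (f 1) \<oplus> snd ?p \<otimes> s (f t)"
    using E.lin_list_el[of f ?p] f(1-3) pc by (simp only: quad_simps)
  also have "\<dots> = s \<tau>0 \<otimes> fst ?p \<oplus> s \<tau>1 \<otimes> snd ?p"
    unfolding f(4,5) using pc' by (simp only: m_comm s_data)
  finally have 1: "tensor_linear_ext s R f (tensor_map S s R B \<sigma> (E.el (g 3 j)) \<otimes>\<^bsub>E.T\<^esub> E.el (g 1 j)) =
      s \<tau>0 \<otimes> fst ?p \<oplus> s \<tau>1 \<otimes> snd ?p" (is "?tr = ?e") .
  have nc: "nrm (g 2 j) \<in> carrier R" by (rule nrm_closed[OF gc])
  have 2: "tensor_norm S s R B \<sigma> (E.el (g 2 j)) = nrm (g 2 j)"
    using gc[of 2 j] by (intro E.tensor_norm_el nrm nc) (simp_all only: quad_simps)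
  have ec: "?e \<in> carrier R" using pc' by simp
  have "Q.qf (col g j) = (?e \<oplus> nrm (g 2 j), \<zero>)"
    unfolding Q.qf_def col_def nrm[OF gc] qtr_def quad_simps(5) fst_conv snd_conv by simp
  then have "Q.qf (col g j) = \<zero>\<^bsub>Q\<^esub> \<longleftrightarrow> ?e \<oplus> nrm (g 2 j) = \<zero>" by simp
  also have "\<dots> \<longleftrightarrow> ?e = \<ominus> nrm (g 2 j)"
    using ec nc by (metis minus_equality r_neg l_neg a_comm)
  finally show ?thesis unfolding 1 2 by blast
qed

end

context trace_ring
begin

text \<open>The full matrix equation requires the middle column to pair to b with itself; this value
  is supplied by \<open>qf_middle\<close>.\<close>

lemma unitary_iff:
  "unitary g \<longleftrightarrow> mat g \<and> det3 T g = \<one> \<and>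
     (\<forall>i j. herm (col g (4 - i)) (col g j) = (if i = j then if i = 2 then b else \<one> else \<zero>)) \<and>
     qf (col g 1) = \<zero> \<and> qf (col g 3) = \<zero>" (is "_ \<longleftrightarrow> ?r")
proof
  assume u: "unitary g"
  have v: "vec (col g 2)" using u by (simp add: unitary_def col_def)
  have bc: "b \<in> carrier T" by (rule Rs_carrier[OF b_Rs])
  have "herm (col g 2) (col g 2) = b" using b_qf[OF v] qf_middle[OF u] bc by simp
  then show ?r using u unitary_herm[OF u] by (simp add: unitary_def all3 minus_index3 index3)
next
  assume r: ?r
  then have h: "herm (col g (4 - i)) (col g j) = (if i = j then if i = 2 then b else \<one> else \<zero>)" for i j by blast
  show "unitary g"
    using r h[of 1 1] h[of 3 2] h[of 1 2] by (simp add: unitary_def minus_index3 index3)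
qed

end

section \<open>Equations of the standard hermitian form\<close>

lemma (in trace_hom) hom_std_herm:
  "A.T.vec v \<Longrightarrow> A.T.vec w \<Longrightarrow> h (A.std_herm v w) = B.std_herm (h \<circ> v) (h \<circ> w)"
  by (simp add: A.std_herm_def B.std_herm_def h_cj)

lemma (in trace_hom) hom_phi:
  "A.T.mat g \<Longrightarrow> \<theta> \<in> carrier A \<Longrightarrow> \<theta>' \<in> carrier A \<Longrightarrow>
    (\<lambda>i j. h (A.phi \<theta> \<theta>' g i j)) = B.phi (h \<theta>) (h \<theta>') (\<lambda>i j. h (g i j))"
  by (simp add: A.phi_def B.phi_def fun_eq_iff)

context trace_ring
begin

lemma std_herm_closed [simp]: "vec v \<Longrightarrow> vec w \<Longrightarrow> std_herm v w \<in> carrier T"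
  by (simp add: std_herm_def)

lemma std_unitary_iff:
  "std_unitary g \<longleftrightarrow> mat g \<and> det3 T g = \<one> \<and>
    (\<forall>i j. std_herm (col g (4 - i)) (col g j) = (if i = j then \<one> else \<zero>))"
  unfolding std_unitary_def by (simp add: all3 minus_index3 index3) blast

end

context scheme_alg
begin

definition std_elems :: "(weil_index \<Rightarrow> 'r) \<Rightarrow> ('r \<times> 'r) set" where
  "std_elems x = insert (det3 Q (wm x) \<ominus>\<^bsub>Q\<^esub> \<one>\<^bsub>Q\<^esub>)
     (\<Union>i j. {Q.std_herm (col (wm x) (4 - i)) (col (wm x) j) \<ominus>\<^bsub>Q\<^esub> (if i = j then \<one>\<^bsub>Q\<^esub> else \<zero>\<^bsub>Q\<^esub>)})"

definition std_eqs :: "(weil_index \<Rightarrow> 'r) \<Rightarrow> 'r set" where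
  "std_eqs x = (\<Union>p\<in>std_elems x. {fst p, snd p})"

lemma std_elems_closed:
  assumes "range x \<subseteq> carrier R"
  shows "std_elems x \<subseteq> carrier Q"
proof -
  have "\<forall>v. x v \<in> carrier R" using assms by blast
  then have m: "Q.T.mat (wm x)" using mat_wm by blast
  have "(if i = j then \<one>\<^bsub>Q\<^esub> else \<zero>\<^bsub>Q\<^esub>) \<in> carrier Q" for i j :: 3
    using Q.T.one_closed Q.T.zero_closed by presburger
  then show ?thesis unfolding std_elems_def
    using Q.T.minus_closed[OF Q.T.det3_closed[OF m] Q.T.one_closed]
      Q.T.minus_closed[OF Q.std_herm_closed[OF Q.vec_col[OF m] Q.vec_col[OF m]]] by blast
qed

lemma std_eqs_closed:
  assumes "range x \<subseteq> carrier R"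
  shows "std_eqs x \<subseteq> carrier R"
  using std_elems_closed[OF assms] unfolding std_eqs_def by auto

lemma std_unitary_iff_elems:
  assumes "range x \<subseteq> carrier R"
  shows "Q.std_unitary (wm x) \<longleftrightarrow> std_elems x \<subseteq> {\<zero>\<^bsub>Q\<^esub>}"
proof -
  have "\<forall>v. x v \<in> carrier R" using assms by blast
  then have m: "Q.T.mat (wm x)" using mat_wm by blast
  have c: "(if i = j then \<one>\<^bsub>Q\<^esub> else \<zero>\<^bsub>Q\<^esub>) \<in> carrier Q" for i j :: 3
    using Q.T.one_closed Q.T.zero_closed by presburger
  have 1: "det3 Q (wm x) = \<one>\<^bsub>Q\<^esub> \<longleftrightarrow> det3 Q (wm x) \<ominus>\<^bsub>Q\<^esub> \<one>\<^bsub>Q\<^esub> = \<zero>\<^bsub>Q\<^esub>"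
    using Q.T.r_right_minus_eq[OF Q.T.det3_closed[OF m] Q.T.one_closed] by blast
  have 2: "Q.std_herm (col (wm x) (4 - i)) (col (wm x) j) = (if i = j then \<one>\<^bsub>Q\<^esub> else \<zero>\<^bsub>Q\<^esub>) \<longleftrightarrow>
      Q.std_herm (col (wm x) (4 - i)) (col (wm x) j) \<ominus>\<^bsub>Q\<^esub> (if i = j then \<one>\<^bsub>Q\<^esub> else \<zero>\<^bsub>Q\<^esub>) = \<zero>\<^bsub>Q\<^esub>" for i j
    using Q.T.r_right_minus_eq[OF Q.std_herm_closed[OF Q.vec_col[OF m] Q.vec_col[OF m]] c] by blast
  show ?thesis unfolding Q.std_unitary_iff std_elems_def 1 2 using m by blast
qed

end

text \<open>A map of algebras carries the defining elements at x to those at the image point, so the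
  image is unitary exactly when the map kills their coordinates.\<close>

lemma (in scheme_hom) std_unitary_iff_eqs:
  assumes x: "range x \<subseteq> carrier A"
  shows "B.Q.std_unitary (wm (h \<circ> x)) \<longleftrightarrow> (\<forall>f\<in>A.std_eqs x. h f = \<zero>\<^bsub>B\<^esub>)"
proof -
  have "\<forall>v. x v \<in> carrier A" using x by blast
  then have m: "A.Q.T.mat (wm x)" using A.mat_wm by blast
  have hx: "range (h \<circ> x) \<subseteq> carrier B" using x h.hom_closed by (auto simp: image_subset_iff)
  note v = A.Q.vec_col[OF m]
  have c: "(if i = j then \<one>\<^bsub>A.Q\<^esub> else \<zero>\<^bsub>A.Q\<^esub>) \<in> carrier A.Q" for i j :: 3
    using A.Q.T.one_closed A.Q.T.zero_closed by presburger
  have if': "map_prod h h (if i = j then \<one>\<^bsub>A.Q\<^esub> else \<zero>\<^bsub>A.Q\<^esub>) = (if i = j then \<one>\<^bsub>B.Q\<^esub> else \<zero>\<^bsub>B.Q\<^esub>)" for i j :: 3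
    using Q.h.hom_one Q.h.hom_zero by presburger
  have "map_prod h h ` A.std_elems x = B.std_elems (h \<circ> x)"
    unfolding A.std_elems_def B.std_elems_def image_insert image_UN image_empty wm_comp
    using Q.hom_std_herm[OF v v] Q.h.hom_det3[OF m] Q.h.hom_one
      Q.h_minus[OF A.Q.T.det3_closed[OF m] A.Q.T.one_closed]
      Q.h_minus[OF A.Q.std_herm_closed[OF v v] c]
    by (simp only: Q.col_hom if')
  then have "B.Q.std_unitary (wm (h \<circ> x)) \<longleftrightarrow> (\<forall>p\<in>A.std_elems x. map_prod h h p = \<zero>\<^bsub>B.Q\<^esub>)"
    unfolding B.std_unitary_iff_elems[OF hx] by (simp only: image_subset_iff singleton_iff flip: \<open>map_prod h h ` A.std_elems x = B.std_elems (h \<circ> x)\<close>)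
  also have "\<dots> \<longleftrightarrow> (\<forall>p\<in>A.std_elems x. h (fst p) = \<zero>\<^bsub>B\<^esub> \<and> h (snd p) = \<zero>\<^bsub>B\<^esub>)"
    by (simp add: map_prod_def split_beta)
  also have "\<dots> \<longleftrightarrow> (\<forall>f\<in>A.std_eqs x. h f = \<zero>\<^bsub>B\<^esub>)"
    unfolding A.std_eqs_def by blast
  finally show ?thesis .
qed

section \<open>Elements of the extension as scalars\<close>

context ext_alg
begin

text \<open>The coordinates of the pure tensor of 1 and x, see \<open>el_emb\<close>: the image of
  an element of B in the quadratic algebra.\<close>

definition emb :: "'a \<Rightarrow> 'r \<times> 'r" where
  "emb x = (s (E.co0 x), s (E.co1 x))"

lemma emb_closed: "x \<in> B \<Longrightarrow> emb x \<in> carrier Q"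
  using E.coB by (simp add: emb_def)

lemma el_emb: "x \<in> B \<Longrightarrow> E.el (emb x) = tens S s R B \<one> x"
  using E.tens_el[of \<one> x] E.coB by (simp add: emb_def)

lemma emb_of: "c \<in> S \<Longrightarrow> emb c = (s c, \<zero>)"
  by (simp add: emb_def E.co_special s_hom)

lemma emb_one: "emb 1 = \<one>\<^bsub>Q\<^esub>"
  by (simp add: emb_def E.co_special s_hom)

lemma emb_mult:
  assumes "x \<in> B" "y \<in> B"
  shows "emb x \<otimes>\<^bsub>Q\<^esub> emb y = emb (x * y)"
proof -
  have B: "x * y \<in> B" using assms closed_ringD(5)[OF E.B] by blast
  have c: "emb x \<otimes>\<^bsub>Q\<^esub> emb y \<in> carrier Q" using emb_closed assms by (intro Q.T.m_closed)
  have "E.el (emb x \<otimes>\<^bsub>Q\<^esub> emb y) = E.el (emb (x * y))"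
    unfolding E.el.hom_mult[OF emb_closed[OF assms(1)] emb_closed[OF assms(2)]]
      el_emb[OF assms(1)] el_emb[OF assms(2)] el_emb[OF B]
    using E.tens_mult[of \<one> \<one> x y] assms by simp
  then show ?thesis using E.el_inj c emb_closed[OF B] by (simp only: quad_simps(1))
qed

lemma emb_conj: "x \<in> B \<Longrightarrow> emb (\<sigma> x) = qconj R (s \<tau>) (emb x)"
  using E.coB[of x] E.\<sigma>_B[of x] data closed_ringD(5)[OF S]
  by (simp add: emb_def qconj_def s_hom)

end

lemma (in quad_ext) el_minus:
  "p \<in> carrier R \<times> carrier R \<Longrightarrow> q \<in> carrier R \<times> carrier R \<Longrightarrow> el p \<ominus>\<^bsub>T\<^esub> el q = el (p \<ominus>\<^bsub>Q\<^esub> q)"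
  using el.hom_add[of p "\<ominus>\<^bsub>Q\<^esub> q"] el.hom_a_inv[of q] Q.a_inv_closed[of q] by (simp add: a_minus_def del: quad_simps(5))

section \<open>Universal property of the tensor product and extension of scalars\<close>

context base_alg
begin

text \<open>A formal sum is sent to the sum of the products f(r) g(x). Every generating relation
  preserves this value, the balanced one because f and g agree on S.\<close>

lemma tensor_hom:
  assumes C: "cring C" and f: "f \<in> ring_hom R C" and g: "g \<in> ring_hom (ring_of B) C"
    and fg: "\<And>c. c \<in> S \<Longrightarrow> f (s c) = g c"
  obtains H where "H \<in> ring_hom (tensor S s R B) C"
    "\<And>r x. r \<in> carrier R \<Longrightarrow> x \<in> B \<Longrightarrow> H (tens S s R B r x) = f r \<otimes>\<^bsub>C\<^esub> g x"
proof -
  interpret C: cring C by (rule C)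
  interpret f: ring_hom_cring R C f by (intro ring_hom_cringI' R.is_cring C f)
  interpret g: ring_hom_cring "ring_of B" C g by (intro ring_hom_cringI' cring_ring_of B C g)
  have gc [simp]: "x \<in> B \<Longrightarrow> g x \<in> carrier C" for x using g.hom_closed by simp
  have g_mult [simp]: "x \<in> B \<Longrightarrow> y \<in> B \<Longrightarrow> g (x * y) = g x \<otimes>\<^bsub>C\<^esub> g y" for x y using g.hom_mult[of x y] by simp
  have g_add [simp]: "x \<in> B \<Longrightarrow> y \<in> B \<Longrightarrow> g (x + y) = g x \<oplus>\<^bsub>C\<^esub> g y" for x y using g.hom_add[of x y] by simp
  have g_one [simp]: "g 1 = \<one>\<^bsub>C\<^esub>" using g.hom_one by simp
  define F where "F xs = foldr (\<lambda>p y. f (fst p) \<otimes>\<^bsub>C\<^esub> g (snd p) \<oplus>\<^bsub>C\<^esub> y) xs \<zero>\<^bsub>C\<^esub>" for xs :: "('r \<times> 'a) list"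
  have F_simps [simp]: "F [] = \<zero>\<^bsub>C\<^esub>" "F (p # xs) = f (fst p) \<otimes>\<^bsub>C\<^esub> g (snd p) \<oplus>\<^bsub>C\<^esub> F xs" for p xs
    by (simp_all add: F_def)
  have Fc: "F xs \<in> carrier C" if "xs \<in> lst" for xs
    using that by (induction xs) auto
  have F_append: "F (xs @ ys) = F xs \<oplus>\<^bsub>C\<^esub> F ys" if "xs \<in> lst" "ys \<in> lst" for xs ys
    using that(1)
  proof (induction xs)
    case (Cons p xs)
    then show ?case using Fc[OF Cons.hyps(2)] Fc[OF that(2)] by (auto simp: C.a_assoc)
  qed (use Fc[OF that(2)] in simp)
  have F_scale: "F (map (\<lambda>q. (fst p \<otimes> fst q, snd p * snd q)) ys) = f (fst p) \<otimes>\<^bsub>C\<^esub> g (snd p) \<otimes>\<^bsub>C\<^esub> F ys"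
    if "p \<in> carrier R \<times> B" "ys \<in> lst" for p ys
    using that(2)
  proof (induction ys)
    case (Cons q ys)
    then show ?case using that(1) Fc[OF Cons.hyps(2)] by (auto simp: C.r_distr C.m_ac)
  qed (use that(1) in auto)
  have F_mult: "F (prod_list2 R xs ys) = F xs \<otimes>\<^bsub>C\<^esub> F ys" if "xs \<in> lst" "ys \<in> lst" for xs ys
    using that(1)
  proof (induction xs)
    case (Cons p xs)
    have m: "map (\<lambda>q. (fst p \<otimes> fst q, snd p * snd q)) ys \<in> lst"
      using that(2) Cons.hyps(1) closed_ringD(5)[OF B] by (auto simp: in_lists_conv_set)
    have "prod_list2 R xs ys \<in> lst" using Cons.hyps(2) that(2) by (rule prod_list2_closed)
    then show ?case using Cons that(2) m F_scale[of p ys] Fc[OF Cons.hyps(2)] Fc[OF that(2)]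
      F_append[OF m, of "prod_list2 R xs ys"] by (auto simp: C.l_distr)
  qed (use Fc[OF that(2)] in simp)
  have F_rel: "F xs = F ys" if "(xs, ys) \<in> rel" for xs ys
    using that
  proof (induction rule: tensor_rel.induct)
    case (append xs xs' ys ys')
    then show ?case using rel_lists by (simp add: F_append)
  next
    case (commute xs ys)
    then show ?case by (simp add: F_append C.a_comm Fc)
  next
    case (balanced r c x)
    then have "c \<in> B" using SB by blast
    then show ?case using balanced by (simp add: C.m_assoc fg)
  qed (auto simp: C.l_distr C.r_distr)
  \<comment> \<open>A class is a set of lists; the value is picked from some representative and
    shown to be independent of it by \<open>F_rel\<close>.\<close>
  define H where "H X = (SOME y. \<exists>xs\<in>lst. X = cls xs \<and> y = F xs)" for X
  have H: "H (cls xs) = F xs" if xs: "xs \<in> lst" for xs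
    unfolding H_def
  proof (rule some_equality)
    show "\<exists>ys\<in>lst. cls xs = cls ys \<and> F xs = F ys" by (intro bexI[OF _ xs] conjI HOL.refl)
    show "y = F xs" if y: "\<exists>ys\<in>lst. cls xs = cls ys \<and> y = F ys" for y
    proof -
      from y obtain ys where ys: "ys \<in> lst" and e: "cls xs = cls ys \<and> y = F ys" by (rule bexE)
      have "(xs, ys) \<in> rel" using class_eq_iff[OF xs ys] e by simp
      then show ?thesis using F_rel e by metis
    qed
  qed
  have tens: "H (tens S s R B r x) = f r \<otimes>\<^bsub>C\<^esub> g x" if "r \<in> carrier R" "x \<in> B" for r x
    unfolding tens_def using H[of "[(r, x)]"] that by simp
  have "H \<in> ring_hom (tensor S s R B) C"
  proof (rule ring_hom_memI)
    fix X Y assume "X \<in> carrier (tensor S s R B)" "Y \<in> carrier (tensor S s R B)"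
    then obtain xs ys where X: "xs \<in> lst" "X = cls xs" and Y: "ys \<in> lst" "Y = cls ys"
      unfolding carrier_tensor by (elim imageE)
    have "xs @ ys \<in> lst" using X Y by simp
    then show "H (X \<oplus>\<^bsub>tensor S s R B\<^esub> Y) = H X \<oplus>\<^bsub>C\<^esub> H Y"
      unfolding X(2) Y(2) cls_add[OF X(1) Y(1)] using X(1) Y(1) by (simp only: H F_append)
    show "H (X \<otimes>\<^bsub>tensor S s R B\<^esub> Y) = H X \<otimes>\<^bsub>C\<^esub> H Y"
      unfolding X(2) Y(2) cls_mult[OF X(1) Y(1)] using X(1) Y(1) by (simp only: H F_mult prod_list2_closed)
  next
    fix X assume "X \<in> carrier (tensor S s R B)"
    then show "H X \<in> carrier C" unfolding carrier_tensor by (elim imageE) (simp only: H Fc)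
  next
    show "H \<one>\<^bsub>tensor S s R B\<^esub> = \<one>\<^bsub>C\<^esub>"
      using tens[of \<one> 1] closed_ringD(2)[OF B] by (simp add: tensor_def)
  qed
  then show thesis using tens by (rule that)
qed

lemma tens_one_hom: "(\<lambda>r. tens S s R B r 1) \<in> ring_hom R (tensor S s R B)"
proof (rule ring_hom_memI)
  have 1: "1 \<in> B" by (rule closed_ringD(2)[OF B])
  fix x y assume xy: "x \<in> carrier R" "y \<in> carrier R"
  show "tens S s R B x 1 \<in> carrier (tensor S s R B)" using xy 1 by simp
  show "tens S s R B (x \<otimes> y) 1 = tens S s R B x 1 \<otimes>\<^bsub>tensor S s R B\<^esub> tens S s R B y 1"
    using tens_mult[OF xy 1 1] by simp
  show "tens S s R B (x \<oplus> y) 1 = tens S s R B x 1 \<oplus>\<^bsub>tensor S s R B\<^esub> tens S s R B y 1"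
    using tens_add[OF xy 1] by simp
qed (simp add: tensor_def)

end

text \<open>As v inverts \<beta> in R, an element x with \<beta>^n x in O' must go to s(\<beta>^n x)
  v^n; the auxiliary fact \<open>shift\<close> makes this independent of n.\<close>

lemma (in cring) extend_scalars:
  fixes O' F :: "'k::comm_ring_1 set"
  assumes O': "closed_ring O'" and F: "closed_ring F" and sub: "O' \<subseteq> F" and s: "s \<in> ring_hom (ring_of O') R"
    and \<beta>: "\<beta> \<in> O'" and clear: "\<And>x. x \<in> F \<Longrightarrow> \<exists>n. \<beta> ^ n * x \<in> O'"
    and v: "v \<in> carrier R" "s \<beta> \<otimes> v = \<one>"
  obtains s' where "s' \<in> ring_hom (ring_of F) R" "\<And>c. c \<in> O' \<Longrightarrow> s' c = s c"
proof -
  interpret s: ring_hom_cring "ring_of O'" R s by (intro ring_hom_cringI' cring_ring_of O' is_cring s)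
  note c = closed_ringD[OF O']
  have sc [simp]: "x \<in> O' \<Longrightarrow> s x \<in> carrier R" for x using s.hom_closed by simp
  have s_mult: "x \<in> O' \<Longrightarrow> y \<in> O' \<Longrightarrow> s (x * y) = s x \<otimes> s y" for x y using s.hom_mult[of x y] by simp
  have s_add: "x \<in> O' \<Longrightarrow> y \<in> O' \<Longrightarrow> s (x + y) = s x \<oplus> s y" for x y using s.hom_add[of x y] by simp
  have \<beta>v: "s (\<beta> ^ n) \<otimes> v [^] n = \<one>" for n
  proof (induction n)
    case (Suc n)
    have "s (\<beta> ^ Suc n) \<otimes> v [^] Suc n = s \<beta> \<otimes> v \<otimes> (s (\<beta> ^ n) \<otimes> v [^] n)"
      using v(1) \<beta> c(7)[OF \<beta>] by (simp add: s_mult m_ac)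
    then show ?case using Suc v by simp
  qed (use s.hom_one in simp)
  have shift: "s (\<beta> ^ m * y) \<otimes> v [^] (m + n) = s y \<otimes> v [^] n" if y: "y \<in> O'" for y m n
  proof -
    have "s (\<beta> ^ m * y) \<otimes> v [^] (m + n) = s (\<beta> ^ m) \<otimes> v [^] m \<otimes> (s y \<otimes> v [^] n)"
      using y v(1) c(7)[OF \<beta>] by (simp add: s_mult m_ac flip: nat_pow_mult)
    then show ?thesis using \<beta>v y v(1) by simp
  qed
  define s' where "s' x = (let n = (SOME n. \<beta> ^ n * x \<in> O') in s (\<beta> ^ n * x) \<otimes> v [^] n)" for x
  have s': "s' x = s (\<beta> ^ n * x) \<otimes> v [^] n" if n: "\<beta> ^ n * x \<in> O'" for x n
  proof -
    define m where "m = (SOME n. \<beta> ^ n * x \<in> O')"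
    have m: "\<beta> ^ m * x \<in> O'" unfolding m_def by (rule someI[of "\<lambda>n. \<beta> ^ n * x \<in> O'", OF n])
    have "s' x = s (\<beta> ^ m * x) \<otimes> v [^] m" by (simp add: s'_def m_def Let_def)
    also have "\<dots> = s (\<beta> ^ n * (\<beta> ^ m * x)) \<otimes> v [^] (n + m)" using shift[OF m] by simp
    also have "\<dots> = s (\<beta> ^ m * (\<beta> ^ n * x)) \<otimes> v [^] (m + n)" by (simp add: ac_simps)
    also have "\<dots> = s (\<beta> ^ n * x) \<otimes> v [^] n" using shift[OF n] by simp
    finally show ?thesis .
  qed
  have "s' \<in> ring_hom (ring_of F) R"
  proof (rule ring_hom_memI)
    fix x y assume xy: "x \<in> carrier (ring_of F)" "y \<in> carrier (ring_of F)"
    then obtain m n where mn: "\<beta> ^ m * x \<in> O'" "\<beta> ^ n * y \<in> O'" using clear by fastforce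
    show "s' x \<in> carrier R" using s'[OF mn(1)] mn v by simp
    have 1: "\<beta> ^ (m + n) * (x * y) = (\<beta> ^ m * x) * (\<beta> ^ n * y)" by (simp add: power_add ac_simps)
    have "s' (x * y) = s ((\<beta> ^ m * x) * (\<beta> ^ n * y)) \<otimes> v [^] (m + n)"
      using s'[of "m + n" "x * y"] c(5)[OF mn] unfolding 1 by simp
    also have "\<dots> = s' x \<otimes> s' y"
      unfolding s'[OF mn(1)] s'[OF mn(2)] s_mult[OF mn] using mn v(1) by (simp add: m_ac flip: nat_pow_mult)
    finally show "s' (x \<otimes>\<^bsub>ring_of F\<^esub> y) = s' x \<otimes> s' y" by simp
    have 2: "\<beta> ^ (m + n) * (x + y) = \<beta> ^ n * (\<beta> ^ m * x) + \<beta> ^ m * (\<beta> ^ n * y)"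
      by (simp add: power_add algebra_simps)
    have xm: "\<beta> ^ n * (\<beta> ^ m * x) \<in> O'" "\<beta> ^ m * (\<beta> ^ n * y) \<in> O'" using mn c(5) c(7)[OF \<beta>] by blast+
    have "s' (x + y) = s (\<beta> ^ n * (\<beta> ^ m * x) + \<beta> ^ m * (\<beta> ^ n * y)) \<otimes> v [^] (m + n)"
      using s'[of "m + n" "x + y"] c(4)[OF xm] unfolding 2 by simp
    also have "\<dots> = s (\<beta> ^ n * (\<beta> ^ m * x)) \<otimes> v [^] (n + m) \<oplus> s (\<beta> ^ m * (\<beta> ^ n * y)) \<otimes> v [^] (m + n)"
      unfolding s_add[OF xm] using xm v(1) by (simp add: l_distr add.commute)
    also have "\<dots> = s' x \<oplus> s' y"
      unfolding s'[OF mn(1)] s'[OF mn(2)] shift[OF mn(1)] shift[OF mn(2)] ..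
    finally show "s' (x \<oplus>\<^bsub>ring_of F\<^esub> y) = s' x \<oplus> s' y" by simp
  next
    show "s' \<one>\<^bsub>ring_of F\<^esub> = \<one>" using s'[of 0 1] s.hom_one c(2) by simp
  qed
  moreover have "s' x = s x" if "x \<in> O'" for x using s'[of 0 x] that by simp
  ultimately show thesis by (rule that)
qed

section \<open>The constants of the ramified extension, fixed\<close>

locale ramified_data = scheme OK \<tau> \<beta> b \<tau>0 \<tau>1 e0 e1 c0 + KK: scheme K \<tau> \<beta> b \<tau>0 \<tau>1 e0 e1 c0
  for OK K :: "'l::field set" and \<tau> \<beta> b \<tau>0 \<tau>1 e0 e1 c0 :: 'l +
  fixes \<omega> :: "'l \<Rightarrow> ereal" and \<sigma> :: "'l \<Rightarrow> 'l" and t :: 'l and i0 :: nat and OL :: "'l set"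
  assumes OK_int: "OK = integers \<omega> K" and OL_int: "OL = integers \<omega> UNIV"
    and K_inverse: "x \<in> K \<Longrightarrow> inverse x \<in> K" and closed_OL: "closed_ring OL"
    and t_sq: "t * t = \<tau> * t - \<beta>"
    and OL_eq: "OL = {c + d * t | c d. c \<in> OK \<and> d \<in> OK}"
    and UNIV_eq: "UNIV = {c + d * t | c d. c \<in> K \<and> d \<in> K}"
    and indep: "c \<in> K \<Longrightarrow> d \<in> K \<Longrightarrow> c + d * t = 0 \<Longrightarrow> c = 0 \<and> d = 0"
    and \<sigma>_eq: "c \<in> K \<Longrightarrow> d \<in> K \<Longrightarrow> \<sigma> (c + d * t) = c + d * (\<tau> - t)"
    and \<sigma>_add: "\<sigma> (x + y) = \<sigma> x + \<sigma> y" and \<sigma>_mult: "\<sigma> (x * y) = \<sigma> x * \<sigma> y"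
    and \<sigma>_one: "\<sigma> 1 = 1" and \<sigma>_fix: "x \<in> K \<Longrightarrow> \<sigma> x = x"
    and clear: "x \<in> K \<Longrightarrow> \<exists>n. \<beta> ^ n * x \<in> OK"
    and t_nz: "t \<noteq> 0" and \<tau>_def: "\<tau> = t + \<sigma> t" and \<beta>_def: "\<beta> = t * \<sigma> t" and b_def: "b = \<beta> ^ i0"

text \<open>The constants of \<open>arithmetic\<close> are only known to exist. Fixing them in a
  locale allows the same equations to be instantiated over O_K and over K with common
  witnesses.\<close>

lemma (in ramified_setting) ramified_data_exists:
  "\<exists>\<tau>0 \<tau>1 e0 e1 c0. ramified_data OK K \<tau> \<beta> b \<tau>0 \<tau>1 e0 e1 c0 \<omega> \<sigma> t i0 OL"
proof -
  obtain \<tau>0 \<tau>1 e0 e1 where d: "\<tau>0 \<in> OK" "\<tau>1 \<in> OK" "e0 \<in> OK" "e1 \<in> OK"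
    "b * \<tau>0 = 2" "b * \<tau>1 = \<tau>" "\<tau>0 * e0 + \<tau>1 * e1 = 1" using \<tau>01 by blast
  obtain c0 where c: "c0 \<in> OK" "b = \<beta> * c0" using \<beta>_dvd_b by blast
  have b: "b \<in> OK" unfolding b_def by (rule closed_ringD(7)[OF closed_OK \<beta>_OK])
  have "OK \<subseteq> K" by (auto simp: integers_def)
  then have "\<tau> \<in> K" "\<beta> \<in> K" "b \<in> K" "\<tau>0 \<in> K" "\<tau>1 \<in> K" "e0 \<in> K" "e1 \<in> K" "c0 \<in> K"
    using \<tau>_OK \<beta>_OK b d(1-4) c(1) by blast+
  then have K: "scheme K \<tau> \<beta> b \<tau>0 \<tau>1 e0 e1 c0"
    by (intro scheme.intro K_closed(1) d(5-7) c(2) \<beta>_nz)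
  have O: "scheme OK \<tau> \<beta> b \<tau>0 \<tau>1 e0 e1 c0"
    by (intro scheme.intro closed_OK \<tau>_OK \<beta>_OK b d c \<beta>_nz)
  have "ramified_data_axioms OK K \<tau> \<beta> b \<omega> \<sigma> t i0 OL"
  proof (rule ramified_data_axioms.intro)
    show "inverse x \<in> K" if "x \<in> K" for x using that by (rule K_closed(2))
    show "c = 0 \<and> d = 0" if "c \<in> K" "d \<in> K" "c + d * t = 0" for c d using that by (rule indep)
    show "\<sigma> (c + d * t) = c + d * (\<tau> - t)" if "c \<in> K" "d \<in> K" for c d using that by (rule \<sigma>_eq)
    show "\<sigma> x = x" if "x \<in> K" for x using that by (rule \<sigma>_hom(4))
    show "\<exists>n. \<beta> ^ n * x \<in> OK" if "x \<in> K" for x using that by (rule clear)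
    show "t \<noteq> 0" using unif_t by (simp add: uniformiser_def)
  qed (fact closed_OL t_sq OL_eq UNIV_eq \<sigma>_hom \<tau>_def \<beta>_def b_def HOL.refl)+
  then show ?thesis using ramified_data.intro[OF O K] by blast
qed

context ramified_data
begin

lemma OK_sub: "OK \<subseteq> K" and OK_OL: "OK \<subseteq> OL"
  unfolding OK_int OL_int by (auto simp: integers_def)

lemma closed_OK: "closed_ring OK" and \<tau>_OK: "\<tau> \<in> OK" and \<beta>_OK: "\<beta> \<in> OK"
  by (fact S data)+

lemma K_closed: "closed_ring K" "x \<in> K \<Longrightarrow> inverse x \<in> K"
  by (fact KK.S) (rule K_inverse)

lemmas \<sigma>_hom = \<sigma>_add \<sigma>_mult \<sigma>_one \<sigma>_fix

lemma ext_O: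
  assumes R: "algebra_over OK s R"
  shows "ext_alg R OK OL s t \<tau> \<beta> b \<tau>0 \<tau>1 e0 e1 c0 \<sigma>"
proof (rule ext_alg.intro)
  show "scheme_alg R OK s \<tau> \<beta> b \<tau>0 \<tau>1 e0 e1 c0" by (rule alg[OF R])
  show "quad_ext R OK OL s t \<tau> \<beta> \<sigma>"
  proof (rule quad_ext.intro)
    have "cring R" "s \<in> ring_hom (ring_of OK) R" using R by (simp_all add: algebra_over_def)
    then show "base_alg R OK OL s"
      by (intro base_alg.intro base_alg_axioms.intro closed_OK closed_OL OK_OL)
    show "quad_ext_axioms OK OL t \<tau> \<beta> \<sigma>"
    proof (rule quad_ext_axioms.intro)
      fix c d assume "c \<in> OK" "d \<in> OK"
      then have cd: "c \<in> K" "d \<in> K" using OK_sub by blast+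
      show "\<sigma> (c + d * t) = c + d * (\<tau> - t)" by (rule \<sigma>_eq[OF cd])
      show "c = 0 \<and> d = 0" if "c + d * t = 0" by (rule indep[OF cd that])
    qed (rule \<tau>_OK \<beta>_OK t_sq OL_eq)+
  qed
qed

lemma ext_K:
  assumes R: "algebra_over K s R"
  shows "ext_alg R K UNIV s t \<tau> \<beta> b \<tau>0 \<tau>1 e0 e1 c0 \<sigma>"
proof (rule ext_alg.intro)
  show "scheme_alg R K s \<tau> \<beta> b \<tau>0 \<tau>1 e0 e1 c0" by (rule KK.alg[OF R])
  show "quad_ext R K UNIV s t \<tau> \<beta> \<sigma>"
  proof (rule quad_ext.intro)
    have "cring R" "s \<in> ring_hom (ring_of K) R" using R by (simp_all add: algebra_over_def)
    then show "base_alg R K UNIV s"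
      by (intro base_alg.intro base_alg_axioms.intro K_closed(1) closed_ring_UNIV subset_UNIV)
    show "quad_ext_axioms K UNIV t \<tau> \<beta> \<sigma>"
    proof (rule quad_ext_axioms.intro)
      fix c d assume "c \<in> K" "d \<in> K"
      then have cd: "c \<in> K" "d \<in> K" by simp_all
      show "\<sigma> (c + d * t) = c + d * (\<tau> - t)" by (rule \<sigma>_eq[OF cd])
      show "c = 0 \<and> d = 0" if "c + d * t = 0" by (rule indep[OF cd that])
    qed (rule KK.data t_sq UNIV_eq)+
  qed
qed

lemma alg_restrict:
  assumes "algebra_over K s R"
  shows "algebra_over OK s R"
proof -
  have R: "cring R" and s: "s \<in> ring_hom (ring_of K) R" using assms by (simp_all add: algebra_over_def)
  have k: "x \<in> carrier (ring_of K)" if "x \<in> OK" for x using that OK_sub by auto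
  have "s \<in> ring_hom (ring_of OK) R"
  proof (rule ring_hom_memI)
    fix x y assume "x \<in> carrier (ring_of OK)" "y \<in> carrier (ring_of OK)"
    then have xy: "x \<in> carrier (ring_of K)" "y \<in> carrier (ring_of K)" using k by simp_all
    show "s x \<in> carrier R" by (rule ring_hom_closed[OF s xy(1)])
    show "s (x \<otimes>\<^bsub>ring_of OK\<^esub> y) = s x \<otimes>\<^bsub>R\<^esub> s y" using ring_hom_mult[OF s xy] by simp
    show "s (x \<oplus>\<^bsub>ring_of OK\<^esub> y) = s x \<oplus>\<^bsub>R\<^esub> s y" using ring_hom_add[OF s xy] by simp
  next
    show "s \<one>\<^bsub>ring_of OK\<^esub> = \<one>\<^bsub>R\<^esub>" using ring_hom_one[OF s] by simp
  qed
  then show ?thesis using R by (simp add: algebra_over_def)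
qed

lemma \<sigma>_pow: "\<sigma> (x ^ n) = \<sigma> x ^ n"
  by (induction n) (simp_all add: \<sigma>_hom)

section \<open>The map \<phi> on points over K\<close>

context
  fixes R :: "'r ring" (structure) and s
  assumes R: "algebra_over K s R"
begin

interpretation X: ext_alg R K UNIV s t \<tau> \<beta> b \<tau>0 \<tau>1 e0 e1 c0 \<sigma> by (rule ext_K[OF R])

definition phi_pt :: "(weil_index \<Rightarrow> 'r) \<Rightarrow> weil_index \<Rightarrow> 'r" where
  "phi_pt x = unwm (X.Q.phi (X.emb (t ^ i0)) (X.emb (inverse t ^ i0)) (wm x))"

definition psi_pt :: "(weil_index \<Rightarrow> 'r) \<Rightarrow> weil_index \<Rightarrow> 'r" where
  "psi_pt x = unwm (X.Q.phi (X.emb (inverse t ^ i0)) (X.emb (t ^ i0)) (wm x))"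

definition std_pt :: "(weil_index \<Rightarrow> 'r) \<Rightarrow> bool" where
  "std_pt x \<longleftrightarrow> X.Q.std_unitary (wm x)"

text \<open>The exponent in \<phi> is such that t^i0 has norm \<beta>^i0 = b, which is the condition
  on \<theta> in \<open>herm_phi\<close>.\<close>

lemma \<theta>:
  "X.emb (t ^ i0) \<in> carrier X.Q" "X.emb (inverse t ^ i0) \<in> carrier X.Q"
  "X.emb (t ^ i0) \<otimes>\<^bsub>X.Q\<^esub> X.emb (inverse t ^ i0) = \<one>\<^bsub>X.Q\<^esub>"
  "X.emb (t ^ i0) \<otimes>\<^bsub>X.Q\<^esub> qconj R (s \<tau>) (X.emb (t ^ i0)) = (s b, \<zero>)"
proof -
  have "t ^ i0 * inverse t ^ i0 = 1" using t_nz by (simp flip: power_mult_distrib)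
  then show "X.emb (t ^ i0) \<otimes>\<^bsub>X.Q\<^esub> X.emb (inverse t ^ i0) = \<one>\<^bsub>X.Q\<^esub>"
    using X.emb_mult[of "t ^ i0" "inverse t ^ i0"] X.emb_one by (simp only: UNIV_I)
  have "t ^ i0 * \<sigma> (t ^ i0) = b" by (simp add: \<sigma>_pow b_def \<beta>_def flip: power_mult_distrib)
  then show "X.emb (t ^ i0) \<otimes>\<^bsub>X.Q\<^esub> qconj R (s \<tau>) (X.emb (t ^ i0)) = (s b, \<zero>)"
    using X.emb_mult[of "t ^ i0" "\<sigma> (t ^ i0)"] X.emb_conj[of "t ^ i0"] X.emb_of[of b] KK.data(3)
    by (simp only: UNIV_I)
qed (intro X.emb_closed UNIV_I)+

lemma mat_wm': "range x \<subseteq> carrier R \<longleftrightarrow> X.Q.T.mat (wm x)"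
  using X.mat_wm[of x] by blast

text \<open>In an algebra over K the element b becomes invertible, as \<open>unitary_phi\<close>
  demands.\<close>

lemma pt_phi: "std_pt x \<Longrightarrow> X.pt (phi_pt x)"
proof -
  assume x: "std_pt x"
  have ib: "inverse b \<in> K" using K_closed(2) KK.data(3) by blast
  have "b \<noteq> 0" using \<beta>_nz by (simp add: b_def)
  then have "(s (inverse b), \<zero>) \<otimes>\<^bsub>X.Q\<^esub> (s b, \<zero>) = \<one>\<^bsub>X.Q\<^esub>"
    using X.emb_mult[of "inverse b" b] X.emb_of[OF ib] X.emb_of[OF KK.data(3)] X.emb_one by (simp del: quad_simps)
  moreover have "(s (inverse b), \<zero>) \<in> carrier X.Q" using X.emb_closed[of "inverse b"] X.emb_of[OF ib] by (simp only: UNIV_I)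
  ultimately show ?thesis
    using X.Q.unitary_phi[OF \<theta>] x by (simp only: X.pt_def phi_pt_def wm_unwm std_pt_def)
qed

lemma std_psi: "X.pt x \<Longrightarrow> std_pt (psi_pt x)"
  using X.Q.std_unitary_phi[OF \<theta>] by (simp only: X.pt_def psi_pt_def wm_unwm std_pt_def)

lemma std_pt_closed: "std_pt x \<Longrightarrow> range x \<subseteq> carrier R"
  unfolding mat_wm' std_pt_def X.Q.std_unitary_def by blast

lemma phi_pt_closed:
  assumes "range x \<subseteq> carrier R"
  shows "range (phi_pt x) \<subseteq> carrier R"
  using X.Q.phi_closed[OF \<theta>(1,2)] assms unfolding mat_wm' phi_pt_def wm_unwm by blast

lemma phi_psi:
  assumes "range x \<subseteq> carrier R"
  shows "phi_pt (psi_pt x) = x"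
  using X.Q.phi_phi[OF \<theta>(1-3)] assms unfolding mat_wm' phi_pt_def psi_pt_def wm_unwm by (metis unwm_wm)

lemma phi_matrix_pt:
  assumes x: "range x \<subseteq> carrier R"
  shows "phi_matrix K s R t i0 (weil_matrix K s R UNIV t x) = weil_matrix K s R UNIV t (phi_pt x)"
proof -
  have gc: "wm x i j \<in> carrier X.Q" for i j using x unfolding mat_wm' by blast
  have e: "tens K s R UNIV \<one> y \<otimes>\<^bsub>X.E.T\<^esub> X.E.el (wm x i j) = X.E.el (X.emb y \<otimes>\<^bsub>X.Q\<^esub> wm x i j)" for y i j
    using X.E.el.hom_mult[OF X.emb_closed[of y] gc] X.el_emb[of y] by (simp only: UNIV_I)
  show ?thesis
    unfolding X.E.weil_matrix_wm[OF x] X.E.weil_matrix_wm[OF phi_pt_closed[OF x]] phi_matrix_def e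
    unfolding phi_pt_def wm_unwm X.Q.phi_def by (simp add: fun_eq_iff del: quad_simps)
qed

end

lemma phi_pt_hom:
  assumes R: "algebra_over K s R" and R': "algebra_over K s' R'" and h: "h \<in> alg_hom K s R s' R'"
    and x: "range x \<subseteq> carrier R"
  shows "h \<circ> phi_pt R s x = phi_pt R' s' (h \<circ> x)"
proof -
  interpret X: ext_alg R K UNIV s t \<tau> \<beta> b \<tau>0 \<tau>1 e0 e1 c0 \<sigma> by (rule ext_K[OF R])
  interpret Y: ext_alg R' K UNIV s' t \<tau> \<beta> b \<tau>0 \<tau>1 e0 e1 c0 \<sigma> by (rule ext_K[OF R'])
  interpret h: scheme_hom R R' K s s' \<tau> \<beta> b \<tau>0 \<tau>1 e0 e1 c0 h by (rule KK.alg_homI[OF R R' h])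
  have e: "map_prod h h (X.emb y) = Y.emb y" for y
    using X.E.coB[of y] by (simp add: X.emb_def Y.emb_def h.h_s)
  have m: "X.Q.T.mat (wm x)" using mat_wm'[OF R] x by blast
  have "wm (h \<circ> phi_pt R s x) = wm (phi_pt R' s' (h \<circ> x))"
    unfolding phi_pt_def[OF R] phi_pt_def[OF R'] wm_comp wm_unwm
    using h.Q.hom_phi[OF m \<theta>(1,2)[OF R]] by (simp only: e)
  then show ?thesis by (metis unwm_wm)
qed

section \<open>The coordinate ring of the special unitary group\<close>

abbreviation "IU \<equiv> SU3_ideal K \<sigma> t"
abbreviation "UU \<equiv> SU3 K \<sigma> t"
abbreviation "uu \<equiv> SU3_struct K \<sigma> t"
abbreviation "yU \<equiv> coord_fun K IU"

lemma range_var: "range mp_var \<subseteq> carrier PR" "range mp_var \<subseteq> carrier KK.PR"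
proof -
  show "range mp_var \<subseteq> carrier PR" by (intro image_subsetI var_closed)
  show "range mp_var \<subseteq> carrier KK.PR" by (intro image_subsetI KK.var_closed)
qed

text \<open>The generators are coordinates of matrix entries in the tensor product; through
  \<open>el\<close> they become coordinates in the quadratic algebra, where homomorphisms can be
  applied to them.\<close>

lemma SU3_ideal_eq: "IU = genideal KK.PR (KK.P.std_eqs mp_var)"
proof -
  interpret X: ext_alg KK.PR K UNIV mp_const t \<tau> \<beta> b \<tau>0 \<tau>1 e0 e1 c0 \<sigma> by (rule ext_K[OF KK.alg_mpoly])
  let ?g = "wm mp_var :: 3 \<Rightarrow> 3 \<Rightarrow> _"
  have m: "KK.P.Q.T.mat ?g" using mat_wm'[OF KK.alg_mpoly] range_var(2) by blast
  note v = KK.P.Q.vec_col[OF m]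
  have c: "(if i = j then \<one>\<^bsub>KK.P.Q\<^esub> else \<zero>\<^bsub>KK.P.Q\<^esub>) \<in> carrier KK.P.Q" for i j :: 3
    using KK.P.Q.T.one_closed KK.P.Q.T.zero_closed by presburger
  have D: "mat_diag X.E.T (\<lambda>_. \<one>\<^bsub>X.E.T\<^esub>) i j = X.E.el (if i = j then \<one>\<^bsub>KK.P.Q\<^esub> else \<zero>\<^bsub>KK.P.Q\<^esub>)" for i j
    unfolding mat_diag_def using X.E.el.hom_one X.E.el.hom_zero by presburger
  have w: "weil_coords K mp_const KK.PR UNIV t (X.E.el p) = {fst p, snd p}" if "p \<in> carrier KK.P.Q" for p
    using X.E.weil_coords_el[of p] that by (simp only: quad_simps(1))
  have em: "X.E.el p \<ominus>\<^bsub>X.E.T\<^esub> X.E.el q = X.E.el (p \<ominus>\<^bsub>KK.P.Q\<^esub> q)"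
    if "p \<in> carrier KK.P.Q" "q \<in> carrier KK.P.Q" for p q
    using X.E.el_minus[of p q] that by (simp only: quad_simps(1))
  have 1: "mat_det X.E.T (\<lambda>i j. X.E.el (?g i j)) \<ominus>\<^bsub>X.E.T\<^esub> \<one>\<^bsub>X.E.T\<^esub> = X.E.el (det3 KK.P.Q ?g \<ominus>\<^bsub>KK.P.Q\<^esub> \<one>\<^bsub>KK.P.Q\<^esub>)"
    unfolding X.E.mat_det_el[OF m] em[OF KK.P.Q.T.det3_closed[OF m] KK.P.Q.T.one_closed, symmetric]
    by (simp only: X.E.el.hom_one)
  show ?thesis
    unfolding SU3_ideal_def Let_def X.E.weil_matrix_wm[OF range_var(2)] X.std_herm_T[OF m] D 1
      em[OF KK.P.Q.std_herm_closed[OF v v] c] w[OF KK.P.Q.T.minus_closed[OF KK.P.Q.T.det3_closed[OF m] KK.P.Q.T.one_closed]]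
      w[OF KK.P.Q.T.minus_closed[OF KK.P.Q.std_herm_closed[OF v v] c]]
      KK.P.std_eqs_def KK.P.std_elems_def
    by (intro arg_cong[where f = "genideal KK.PR"]) blast
qed

lemma std_eqs_var: "KK.P.std_eqs mp_var \<subseteq> carrier KK.PR"
  by (rule KK.P.std_eqs_closed[OF range_var(2)])

sublocale IU: ideal IU KK.PR
  unfolding SU3_ideal_eq using std_eqs_var by (rule KK.P.R.genideal_ideal)

lemma coset_IU_hom: "(+>\<^bsub>KK.PR\<^esub>) IU \<in> ring_hom KK.PR UU"
  unfolding SU3_def by (rule IU.rcos_ring_hom)

lemma uu_eq: "uu c = IU +>\<^bsub>KK.PR\<^esub> mp_const c"
  by (simp add: SU3_struct_def quot_struct_def)

lemma alg_UU: "algebra_over K uu UU"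
  using ring_hom_trans[OF mp_const_hom[OF K_closed(1)] coset_IU_hom] IU.quotient_is_cring[OF KK.P.R.is_cring]
  by (simp add: algebra_over_def uu_eq[abs_def] comp_def SU3_def)

sublocale UU: cring UU
  using alg_UU by (simp add: algebra_over_def)

lemma coset_IU_alg_hom: "(+>\<^bsub>KK.PR\<^esub>) IU \<in> alg_hom K mp_const KK.PR uu UU"
  using coset_IU_hom by (simp add: alg_hom_def uu_eq)

lemma std_pt_yU: "std_pt UU uu yU"
proof -
  interpret h: scheme_hom KK.PR UU K mp_const uu \<tau> \<beta> b \<tau>0 \<tau>1 e0 e1 c0 "(+>\<^bsub>KK.PR\<^esub>) IU"
    by (rule KK.alg_homI[OF KK.alg_mpoly alg_UU coset_IU_alg_hom])
  have y: "(+>\<^bsub>KK.PR\<^esub>) IU \<circ> mp_var = yU" by (simp add: coord_fun_def fun_eq_iff)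
  have "IU +>\<^bsub>KK.PR\<^esub> f = \<zero>\<^bsub>UU\<^esub>" if f: "f \<in> KK.P.std_eqs mp_var" for f
  proof -
    have "f \<in> IU" unfolding SU3_ideal_eq using KK.P.R.genideal_self[OF std_eqs_var] f by blast
    then show ?thesis unfolding SU3_def using IU.coset_zero_iff f std_eqs_var by blast
  qed
  then show ?thesis
    unfolding std_pt_def[OF alg_UU] using h.std_unitary_iff_eqs[OF range_var(2)] unfolding y by blast
qed

text \<open>Evaluation at y sends the generators of the ideal to the coordinates of the equations at
  y, which vanish, so it factors through the quotient.\<close>

lemma UU_universal:
  assumes R: "algebra_over K s R" and y: "std_pt R s y"
  obtains k where "k \<in> alg_hom K uu UU s R" "k \<circ> yU = y"
proof -
  have yc: "range y \<subseteq> carrier R" by (rule std_pt_closed[OF R y])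
  note E = KK.eval_hom[OF R yc]
  have Er: "mp_eval R s y \<in> ring_hom KK.PR R" using E(1) by (simp add: alg_hom_def)
  have Rc: "cring R" using R by (simp add: algebra_over_def)
  interpret E: ring_hom_cring KK.PR R "mp_eval R s y" by (rule ring_hom_cringI'[OF KK.P.R.is_cring Rc Er])
  interpret h: scheme_hom KK.PR R K mp_const s \<tau> \<beta> b \<tau>0 \<tau>1 e0 e1 c0 "mp_eval R s y"
    by (rule KK.alg_homI[OF KK.alg_mpoly R E(1)])
  have "mp_eval R s y \<circ> mp_var = y" by (rule KK.eval_comp_var[OF R yc])
  then have z: "mp_eval R s y f = \<zero>\<^bsub>R\<^esub>" if "f \<in> KK.P.std_eqs mp_var" for f
    using y h.std_unitary_iff_eqs[OF range_var(2)] that unfolding std_pt_def[OF R] by metis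
  obtain k where k: "k \<in> ring_hom UU R" "\<And>f. f \<in> carrier KK.PR \<Longrightarrow> k (IU +>\<^bsub>KK.PR\<^esub> f) = mp_eval R s y f"
  proof (rule ring_hom_factor[OF KK.P.R.is_cring UU.is_cring Rc coset_IU_hom _ Er])
    show "(+>\<^bsub>KK.PR\<^esub>) IU ` carrier KK.PR = carrier UU" unfolding SU3_def by (rule IU.coset_surj)
    show "mp_eval R s y f = \<zero>\<^bsub>R\<^esub>" if "f \<in> carrier KK.PR" "IU +>\<^bsub>KK.PR\<^esub> f = \<zero>\<^bsub>UU\<^esub>" for f
    proof (rule E.genideal_kernel[OF std_eqs_var z])
      show "f \<in> genideal KK.PR (KK.P.std_eqs mp_var)"
        using that IU.coset_zero_iff unfolding SU3_def SU3_ideal_eq by blast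
    qed
  qed blast
  have "k \<in> alg_hom K uu UU s R"
    using k E(1) by (simp add: alg_hom_def uu_eq)
  moreover have "k \<circ> yU = y"
    using k(2)[OF KK.var_closed] E(2) by (simp add: coord_fun_def fun_eq_iff)
  ultimately show thesis by (rule that)
qed

text \<open>The image under \<phi> of the universal point; evaluation at it describes the comorphism
  of \<phi> on polynomials over O_K.\<close>

definition xU :: "weil_index \<Rightarrow> (weil_index, 'l) mpoly set" where
  "xU = phi_pt UU uu yU"

lemma range_yU: "range yU \<subseteq> carrier UU"
  by (rule std_pt_closed[OF alg_UU std_pt_yU])

lemma range_xU: "range xU \<subseteq> carrier UU"
  unfolding xU_def by (rule phi_pt_closed[OF alg_UU range_yU])

lemma alg_UU': "algebra_over OK uu UU"
  by (rule alg_restrict[OF alg_UU])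

lemma pt_xU: "scheme_alg.pt UU uu \<tau> \<beta> b \<tau>0 \<tau>1 xU"
  unfolding xU_def by (rule pt_phi[OF alg_UU std_pt_yU])

text \<open>Over \<open>AJ[1 / \<beta>]\<close>, which is a \<open>K\<close>-algebra, the universal point of \<open>AJ\<close> comes from a point
  of \<open>SU\<^sub>3\<close>, so that the localisation map of \<open>AJ\<close> factors through \<open>SU3\<close>. Hence the kernel of the
  evaluation at \<open>xU\<close> is the \<open>\<beta>\<close>-saturation of \<open>J\<close>, which is \<open>J\<close> itself.\<close>

theorem eval_xU_zero_iff:
  assumes f: "f \<in> carrier PR"
  shows "mp_eval UU uu xU f = \<zero>\<^bsub>UU\<^esub> \<longleftrightarrow> f \<in> J"
proof
  assume "f \<in> J"
  then show "mp_eval UU uu xU f = \<zero>\<^bsub>UU\<^esub>" by (rule eval_J[OF alg_UU' pt_xU])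
next
  assume 0: "mp_eval UU uu xU f = \<zero>\<^bsub>UU\<^esub>"
  have a\<beta>: "aJ \<beta> \<in> carrier AJ"
    using ring_hom_closed[OF coset_hom const_closed[OF \<beta>_OK]] by (simp add: aJ_def)
  interpret lc: localisation AJ "aJ \<beta>" by unfold_locales (rule a\<beta>)
  let ?L = "loc AJ (aJ \<beta>)" and ?m = "loc_map AJ (aJ \<beta>)"
  have aJr: "aJ \<in> ring_hom (ring_of OK) AJ" using alg_AJ by (simp add: algebra_over_def)
  have mr: "?m \<in> ring_hom AJ ?L" by (rule lc.m.homh)
  have sr: "?m \<circ> aJ \<in> ring_hom (ring_of OK) ?L" by (rule ring_hom_trans[OF aJr mr])
  \<comment> \<open>Every element of K becomes integral after multiplication by a power of \<beta>,
    and \<beta> is invertible in this localisation.\<close>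
  obtain s' where s': "s' \<in> ring_hom (ring_of K) ?L" "\<And>c. c \<in> OK \<Longrightarrow> s' c = (?m \<circ> aJ) c"
  proof (rule lc.L.extend_scalars[OF closed_OK K_closed(1) OK_sub sr \<beta>_OK])
    show "loc_inv AJ (aJ \<beta>) \<in> carrier ?L" by (rule lc.loc_inv_closed)
    show "(?m \<circ> aJ) \<beta> \<otimes>\<^bsub>?L\<^esub> loc_inv AJ (aJ \<beta>) = \<one>\<^bsub>?L\<^esub>" using lc.loc_inv by simp
    show "\<exists>n. \<beta> ^ n * x \<in> OK" if "x \<in> K" for x using that by (rule clear)
  qed (rule that)
  have L: "algebra_over K s' ?L" using s'(1) lc.L.is_cring by (simp add: algebra_over_def)
  have L': "algebra_over OK s' ?L" by (rule alg_restrict[OF L])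
  have m: "?m \<in> alg_hom OK aJ AJ s' ?L" using mr s'(2) by (simp add: alg_hom_def)
  interpret h: scheme_hom AJ ?L OK aJ s' \<tau> \<beta> b \<tau>0 \<tau>1 e0 e1 c0 ?m by (rule alg_homI[OF alg_AJ L' m])
  have pt: "scheme_alg.pt ?L s' \<tau> \<beta> b \<tau>0 \<tau>1 (?m \<circ> xJ)" by (rule h.pt_hom[OF pt_xJ])
  obtain k where k: "k \<in> alg_hom K uu UU s' ?L" "k \<circ> yU = psi_pt ?L s' (?m \<circ> xJ)"
    by (rule UU_universal[OF L std_psi[OF L pt]])
  have r: "range (?m \<circ> xJ) \<subseteq> carrier ?L" using h.B.pt_closed[OF pt] by blast
  have kx: "k \<circ> xU = ?m \<circ> xJ"
    unfolding xU_def phi_pt_hom[OF alg_UU L k(1) range_yU] k(2) by (rule phi_psi[OF L r])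
  have kO: "k \<in> alg_hom OK uu UU s' ?L" using k(1) OK_sub by (auto simp: alg_hom_def)
  interpret k: ring_hom_cring UU ?L k
    using kO by (intro ring_hom_cringI' UU.is_cring lc.L.is_cring) (simp add: alg_hom_def)
  have "?m (J +>\<^bsub>PR\<^esub> f) = ?m (mp_eval AJ aJ xJ f)" using eval_xJ[OF f] by simp
  also have "\<dots> = mp_eval ?L s' (?m \<circ> xJ) f" by (rule mp_eval_comp[OF closed_OK alg_AJ L' m xJ_closed f])
  also have "\<dots> = k (mp_eval UU uu xU f)" 
    using mp_eval_comp[OF closed_OK alg_UU' L' kO range_xU f] unfolding kx by (rule HOL.sym)
  also have "\<dots> = \<zero>\<^bsub>?L\<^esub>" unfolding 0 by (rule k.hom_zero)
  finally have m0: "?m (J +>\<^bsub>PR\<^esub> f) = \<zero>\<^bsub>?L\<^esub>" .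
  have Jf: "J +>\<^bsub>PR\<^esub> f \<in> carrier AJ" by (rule ring_hom_closed[OF coset_hom f])
  obtain n where n: "aJ \<beta> [^]\<^bsub>AJ\<^esub> (n::nat) \<otimes>\<^bsub>AJ\<^esub> (J +>\<^bsub>PR\<^esub> f) = \<zero>\<^bsub>AJ\<^esub>"
    using lc.loc_map_zeroD[OF Jf m0] by blast
  have bn: "mp_const (\<beta> ^ n) \<in> carrier PR" by (rule const_closed[OF closed_ringD(7)[OF closed_OK \<beta>_OK]])
  have fn: "mp_const (\<beta> ^ n) * f \<in> carrier PR"
    using P.R.m_closed[OF bn f] by (simp add: mpoly_ring_eq)
  have "J +>\<^bsub>PR\<^esub> (mp_const (\<beta> ^ n) * f) = aJ (\<beta> ^ n) \<otimes>\<^bsub>AJ\<^esub> (J +>\<^bsub>PR\<^esub> f)"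
    using ring_hom_mult[OF coset_hom bn f] by (simp add: aJ_def mpoly_ring_eq)
  also have "\<dots> = \<zero>\<^bsub>AJ\<^esub>" unfolding h.A.s_pow[OF \<beta>_OK] by (rule n)
  finally have "mp_const (\<beta> ^ n) * f \<in> J" using J.coset_zero_iff[OF fn] unfolding AJ_def by blast
  then show "f \<in> J" by (rule J_saturated[OF f])
qed

end

section \<open>The schematic adherence\<close>

context ramified_data
begin

abbreviation "I0 \<equiv> weil_SL3_ideal OK OL t"
abbreviation "AA \<equiv> weil_SL3 OK OL t"
abbreviation "aa \<equiv> weil_SL3_struct OK OL t"
abbreviation "IZ \<equiv> uSU3_ideal \<omega> K \<sigma> t i0"
abbreviation "ZZ \<equiv> uSU3 \<omega> K \<sigma> t i0"

lemma I0_eq: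
  "I0 = genideal PR {fst (det3 P.Q (wm mp_var) \<ominus>\<^bsub>P.Q\<^esub> \<one>\<^bsub>P.Q\<^esub>), snd (det3 P.Q (wm mp_var) \<ominus>\<^bsub>P.Q\<^esub> \<one>\<^bsub>P.Q\<^esub>)}"
proof -
  interpret X: ext_alg PR OK OL mp_const t \<tau> \<beta> b \<tau>0 \<tau>1 e0 e1 c0 \<sigma> by (rule ext_O[OF alg_mpoly])
  let ?g = "wm mp_var :: 3 \<Rightarrow> 3 \<Rightarrow> _"
  have m: "P.Q.T.mat ?g" using P.mat_wm[of mp_var] range_var(1) by blast
  have dc: "det3 P.Q ?g \<in> carrier PR \<times> carrier PR" and oc: "\<one>\<^bsub>P.Q\<^esub> \<in> carrier PR \<times> carrier PR"
    and mc: "det3 P.Q ?g \<ominus>\<^bsub>P.Q\<^esub> \<one>\<^bsub>P.Q\<^esub> \<in> carrier PR \<times> carrier PR"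
    using P.Q.T.det3_closed[OF m] P.Q.T.one_closed P.Q.T.minus_closed[OF P.Q.T.det3_closed[OF m] P.Q.T.one_closed]
    by (simp_all only: quad_simps(1))
  have 1: "mat_det X.E.T (\<lambda>i j. X.E.el (?g i j)) \<ominus>\<^bsub>X.E.T\<^esub> \<one>\<^bsub>X.E.T\<^esub> = X.E.el (det3 P.Q ?g \<ominus>\<^bsub>P.Q\<^esub> \<one>\<^bsub>P.Q\<^esub>)"
    unfolding X.E.mat_det_el[OF m] X.E.el_minus[OF dc oc, symmetric] by (simp only: X.E.el.hom_one)
  show ?thesis
    unfolding weil_SL3_ideal_def Let_def X.E.weil_matrix_wm[OF range_var(1)] 1 X.E.weil_coords_el[OF mc] ..
qed

lemma det_eqs:
  "{fst (det3 P.Q (wm mp_var) \<ominus>\<^bsub>P.Q\<^esub> \<one>\<^bsub>P.Q\<^esub>), snd (det3 P.Q (wm mp_var) \<ominus>\<^bsub>P.Q\<^esub> \<one>\<^bsub>P.Q\<^esub>)} \<subseteq> P.eqs mp_var"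
  unfolding P.eqs_def P.eq_elems_def by blast

lemma ideal_I0: "ideal I0 PR"
  unfolding I0_eq using det_eqs eqs_var by (intro P.R.genideal_ideal) blast

text \<open>The determinant equations are among those generating J, so X is a closed subscheme of
  the Weil restriction.\<close>

lemma I0_J: "I0 \<subseteq> J"
  unfolding I0_eq
proof (rule P.R.genideal_minimal[OF J.ideal_axioms])
  show "{fst (det3 P.Q (wm mp_var) \<ominus>\<^bsub>P.Q\<^esub> \<one>\<^bsub>P.Q\<^esub>), snd (det3 P.Q (wm mp_var) \<ominus>\<^bsub>P.Q\<^esub> \<one>\<^bsub>P.Q\<^esub>)} \<subseteq> J"
    using det_eqs P.R.genideal_self[OF eqs_var] unfolding J_def by (rule subset_trans)
qed

lemma coset_I0_hom: "(+>\<^bsub>PR\<^esub>) I0 \<in> ring_hom PR AA"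
  unfolding weil_SL3_def by (rule ideal.rcos_ring_hom[OF ideal_I0])

lemma AA_surj: "(+>\<^bsub>PR\<^esub>) I0 ` carrier PR = carrier AA"
  unfolding weil_SL3_def by (rule ideal.coset_surj[OF ideal_I0])

lemma cring_AA: "cring AA"
  unfolding weil_SL3_def by (rule ideal.quotient_is_cring[OF ideal_I0 P.R.is_cring])

lemma aa_eq: "aa c = I0 +>\<^bsub>PR\<^esub> mp_const c"
  by (simp add: weil_SL3_struct_def quot_struct_def)

lemma aa_hom: "aa \<in> ring_hom (ring_of OK) AA"
  using ring_hom_trans[OF mp_const_hom[OF closed_OK] coset_I0_hom] by (simp add: aa_eq[abs_def] comp_def)

lemma h0_exists:
  obtains h0 where "h0 \<in> ring_hom AA UU" "\<And>f. f \<in> carrier PR \<Longrightarrow> h0 (I0 +>\<^bsub>PR\<^esub> f) = mp_eval UU uu xU f"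
proof (rule ring_hom_factor[OF P.R.is_cring cring_AA UU.is_cring coset_I0_hom AA_surj])
  show "mp_eval UU uu xU \<in> ring_hom PR UU" using eval_hom(1)[OF alg_UU' range_xU] by (simp add: alg_hom_def)
  show "mp_eval UU uu xU f = \<zero>\<^bsub>UU\<^esub>" if f: "f \<in> carrier PR" "I0 +>\<^bsub>PR\<^esub> f = \<zero>\<^bsub>AA\<^esub>" for f
  proof -
    have "f \<in> I0" using ideal.coset_zero_iff[OF ideal_I0 f(1)] f(2) unfolding weil_SL3_def by blast
    then show ?thesis using I0_J eval_xU_zero_iff[OF f(1)] by blast
  qed
qed (rule that)

lemma base_AA: "base_alg AA OK K aa"
  by (intro base_alg.intro base_alg_axioms.intro cring_AA closed_OK K_closed(1) OK_sub aa_hom)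

abbreviation "tA F c \<equiv> tens OK aa AA K F c"

lemma uu_hom: "uu \<in> ring_hom (ring_of K) UU"
  using alg_UU by (simp add: algebra_over_def)

text \<open>The ideal of the image is defined through a choice operator, which is meaningful only
  once a comorphism exists. It is assembled from h0 and the structure map of K by the universal
  property of the tensor product.\<close>

lemma comorphism_exists: "\<exists>h. phi_comorphism \<omega> K \<sigma> t i0 h"
proof -
  interpret X: ext_alg UU K UNIV uu t \<tau> \<beta> b \<tau>0 \<tau>1 e0 e1 c0 \<sigma> by (rule ext_K[OF alg_UU])
  interpret A: cring AA by (rule cring_AA)
  obtain h0 where h0: "h0 \<in> ring_hom AA UU" "\<And>f. f \<in> carrier PR \<Longrightarrow> h0 (I0 +>\<^bsub>PR\<^esub> f) = mp_eval UU uu xU f"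
  proof (rule h0_exists)
  qed (rule that)
  have e: "mp_eval UU uu xU (mp_const c) = uu c" if "c \<in> OK" for c
    using eval_hom(1)[OF alg_UU' range_xU] that by (simp add: alg_hom_def)
  obtain H where H: "H \<in> ring_hom (tensor OK aa AA K) UU"
    "\<And>r x. r \<in> carrier AA \<Longrightarrow> x \<in> K \<Longrightarrow> H (tA r x) = h0 r \<otimes>\<^bsub>UU\<^esub> uu x"
  proof (rule base_alg.tensor_hom[OF base_AA UU.is_cring h0(1) uu_hom])
    show "h0 (aa c) = uu c" if "c \<in> OK" for c
      unfolding aa_eq using h0(2)[OF const_closed[OF that]] e[OF that] by simp
  qed (rule that)
  have uc: "c \<in> K \<Longrightarrow> uu c \<in> carrier UU" for c using ring_hom_closed[OF uu_hom] by simp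
  have 1: "H \<in> alg_hom K (\<lambda>c. tA \<one>\<^bsub>AA\<^esub> c) (tensor OK aa AA K) uu UU"
    using H ring_hom_one[OF h0(1)] uc by (simp add: alg_hom_def)
  have u1: "uu 1 = \<one>\<^bsub>UU\<^esub>" using ring_hom_one[OF uu_hom] by simp
  have x: "(\<lambda>v. H (tA (coord_fun OK I0 v) 1)) = xU"
  proof
    fix v
    have c: "I0 +>\<^bsub>PR\<^esub> mp_var v \<in> carrier AA" by (rule ring_hom_closed[OF coset_I0_hom var_closed])
    have "xU v \<in> carrier UU" using range_xU by blast
    then show "H (tA (coord_fun OK I0 v) 1) = xU v"
      unfolding coord_fun_def H(2)[OF c closed_ringD(2)[OF K_closed(1)]] h0(2)[OF var_closed] u1
        eval_hom(2)[OF alg_UU' range_xU] by (rule UU.r_one)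
  qed
  have "phi_comorphism \<omega> K \<sigma> t i0 H"
    unfolding phi_comorphism_def Let_def OK_int[symmetric] OL_int[symmetric] x phi_matrix_pt[OF alg_UU range_yU] using 1 by (simp add: xU_def)
  then show ?thesis by blast
qed

text \<open>Constants move across the tensor product by balancing, and the values on coordinates are
  read off from the matrix by \<open>el_wm_inj\<close>; so every comorphism, in particular the
  chosen one, restricts to evaluation at \<open>xU\<close>.\<close>

lemma comorphism_eval:
  assumes h: "phi_comorphism \<omega> K \<sigma> t i0 h" and f: "f \<in> carrier PR"
  shows "h (tA (I0 +>\<^bsub>PR\<^esub> f) 1) = mp_eval UU uu xU f"
proof -
  interpret X: ext_alg UU K UNIV uu t \<tau> \<beta> b \<tau>0 \<tau>1 e0 e1 c0 \<sigma> by (rule ext_K[OF alg_UU])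
  interpret A: cring AA by (rule cring_AA)
  have h1: "h \<in> alg_hom K (\<lambda>c. tA \<one>\<^bsub>AA\<^esub> c) (tensor OK aa AA K) uu UU"
    and h2: "weil_matrix K uu UU UNIV t (\<lambda>v. h (tA (coord_fun OK I0 v) 1)) = weil_matrix K uu UU UNIV t xU"
    using h unfolding phi_comorphism_def Let_def OK_int[symmetric] OL_int[symmetric] phi_matrix_pt[OF alg_UU range_yU] xU_def by blast+
  have hr: "h \<in> ring_hom (tensor OK aa AA K) UU" using h1 by (simp add: alg_hom_def)
  have 1: "(\<lambda>f. h (tA (I0 +>\<^bsub>PR\<^esub> f) 1)) \<in> ring_hom PR UU"
    using ring_hom_trans[OF ring_hom_trans[OF coset_I0_hom base_alg.tens_one_hom[OF base_AA]] hr]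
    by (simp add: comp_def)
  have r: "range (\<lambda>v. h (tA (coord_fun OK I0 v) 1)) \<subseteq> carrier UU"
    using ring_hom_closed[OF 1 var_closed] unfolding coord_fun_def by blast
  have x: "(\<lambda>v. h (tA (coord_fun OK I0 v) 1)) = xU"
    using h2 unfolding X.E.weil_matrix_wm[OF r] X.E.weil_matrix_wm[OF range_xU] by (rule X.E.el_wm_inj[OF r range_xU])
  note E = eval_hom[OF alg_UU' range_xU]
  have "(\<lambda>f. h (tA (I0 +>\<^bsub>PR\<^esub> f) 1)) f = mp_eval UU uu xU f"
  proof (rule mpoly_hom_unique[OF closed_OK 1 _ UU.is_cring _ _ f])
    show "mp_eval UU uu xU \<in> ring_hom PR UU" using E(1) by (simp add: alg_hom_def)
    show "h (tA (I0 +>\<^bsub>PR\<^esub> mp_const c) 1) = mp_eval UU uu xU (mp_const c)" if c: "c \<in> OK" for c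
    proof -
      have ac: "aa c \<in> carrier AA" using ring_hom_closed[OF aa_hom] c by simp
      have "tA (aa c) 1 = tA \<one>\<^bsub>AA\<^esub> c"
        using base_alg.tens_balanced[OF base_AA A.one_closed c closed_ringD(2)[OF K_closed(1)]] A.l_one[OF ac] by simp
      moreover have "c \<in> K" using OK_sub c by blast
      ultimately show ?thesis using h1 E(1) c unfolding aa_eq by (simp add: alg_hom_def)
    qed
    show "h (tA (I0 +>\<^bsub>PR\<^esub> mp_var v) 1) = mp_eval UU uu xU (mp_var v)" for v
      unfolding E(2) using fun_cong[OF x, of v] by (simp add: coord_fun_def)
  qed
  then show ?thesis .
qed

lemma IZ_mem:
  assumes "f \<in> carrier PR"
  shows "I0 +>\<^bsub>PR\<^esub> f \<in> IZ \<longleftrightarrow> mp_eval UU uu xU f = \<zero>\<^bsub>UU\<^esub>"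
proof -
  have h: "phi_comorphism \<omega> K \<sigma> t i0 (SOME h. phi_comorphism \<omega> K \<sigma> t i0 h)"
    by (rule someI_ex[OF comorphism_exists])
  have c: "I0 +>\<^bsub>PR\<^esub> f \<in> carrier AA" by (rule ring_hom_closed[OF coset_I0_hom assms])
  have "tA (I0 +>\<^bsub>PR\<^esub> f) 1 \<in> carrier (tensor OK aa AA K)"
    by (rule base_alg.tens_closed[OF base_AA c closed_ringD(2)[OF K_closed(1)]])
  then show ?thesis
    using comorphism_eval[OF h assms] c
    unfolding uSU3_ideal_def adherence_ideal_def phi_image_ideal_def a_kernel_def' OK_int[symmetric] OL_int[symmetric] by simp
qed

text \<open>By \<open>IZ_mem\<close> the set is the kernel of h0, a map defined on the Weil
  restriction over O_K itself, so the tensor product with K need not be analysed as a ring.\<close>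

lemma ideal_IZ: "ideal IZ AA"
proof -
  obtain h0 where h0: "h0 \<in> ring_hom AA UU" "\<And>f. f \<in> carrier PR \<Longrightarrow> h0 (I0 +>\<^bsub>PR\<^esub> f) = mp_eval UU uu xU f"
  proof (rule h0_exists)
  qed (rule that)
  interpret h0: ring_hom_ring AA UU h0
    by (rule ring_hom_ringI2[OF cring.axioms(1)[OF cring_AA] cring.axioms(1)[OF UU.is_cring] h0(1)])
  have sub: "IZ \<subseteq> carrier AA"
    unfolding uSU3_ideal_def adherence_ideal_def OK_int[symmetric] OL_int[symmetric] by blast
  have "F \<in> IZ \<longleftrightarrow> F \<in> a_kernel AA UU h0" for F
  proof (cases "F \<in> carrier AA")
    case True
    then obtain f where f: "f \<in> carrier PR" "F = I0 +>\<^bsub>PR\<^esub> f" using AA_surj by blast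
    have c: "I0 +>\<^bsub>PR\<^esub> f \<in> carrier AA" by (rule ring_hom_closed[OF coset_I0_hom f(1)])
    show ?thesis
      unfolding f(2) IZ_mem[OF f(1)] a_kernel_def' mem_Collect_eq h0(2)[OF f(1)] by (metis c)
  next
    case False
    then show ?thesis unfolding a_kernel_def' using sub by blast
  qed
  then have "IZ = a_kernel AA UU h0" by blast
  then show ?thesis using h0.kernel_is_ideal by simp
qed

abbreviation "piZ f \<equiv> IZ +>\<^bsub>AA\<^esub> (I0 +>\<^bsub>PR\<^esub> f)"

text \<open>Membership in the adherence ideal is vanishing at \<open>xU\<close>, which is membership
  in J by \<open>eval_xU_zero_iff\<close>. All results on X now apply to the adherence.\<close>

lemma rep: "scheme_rep OK \<tau> \<beta> b \<tau>0 \<tau>1 e0 e1 c0 ZZ piZ"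
proof (intro scheme_rep.intro scheme_axioms scheme_rep_axioms.intro)
  show "cring ZZ" unfolding uSU3_def OK_int[symmetric] OL_int[symmetric] by (rule ideal.quotient_is_cring[OF ideal_IZ cring_AA])
  have h: "(+>\<^bsub>AA\<^esub>) IZ \<in> ring_hom AA ZZ" unfolding uSU3_def OK_int[symmetric] OL_int[symmetric] by (rule ideal.rcos_ring_hom[OF ideal_IZ])
  show "piZ \<in> ring_hom PR ZZ" using ring_hom_trans[OF coset_I0_hom h] by (simp add: comp_def)
  have "piZ ` carrier PR = (+>\<^bsub>AA\<^esub>) IZ ` ((+>\<^bsub>PR\<^esub>) I0 ` carrier PR)" by (simp only: image_image)
  then show "piZ ` carrier PR = carrier ZZ"
    unfolding AA_surj uSU3_def OK_int[symmetric] OL_int[symmetric] ideal.coset_surj[OF ideal_IZ] .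
  show "piZ f = \<zero>\<^bsub>ZZ\<^esub> \<longleftrightarrow> f \<in> J" if "f \<in> carrier PR" for f
    unfolding uSU3_def OK_int[symmetric] OL_int[symmetric] ideal.coset_zero_iff[OF ideal_IZ ring_hom_closed[OF coset_I0_hom that]]
      IZ_mem[OF that] by (rule eval_xU_zero_iff[OF that])
qed

lemma struct_eq: "uSU3_struct \<omega> K \<sigma> t i0 = (\<lambda>c. piZ (mp_const c))"
  unfolding uSU3_struct_def quot_struct_def OK_int[symmetric] OL_int[symmetric] by (simp add: weil_SL3_struct_def quot_struct_def)

lemma smooth_ZZ: "smooth_algebra TYPE('c) OK (uSU3_struct \<omega> K \<sigma> t i0) ZZ"
  unfolding struct_eq by (rule scheme_rep.smooth_Z[OF rep])

section \<open>Points of the adherence as matrices\<close>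

lemma points_eq:
  assumes R: "algebra_over OK s R"
  shows "uSU3_points \<omega> K \<sigma> t i0 s R =
    {weil_matrix OK s R OL t x | x. scheme_alg.pt R s \<tau> \<beta> b \<tau>0 \<tau>1 x}"
proof (intro equalityI subsetI)
  fix g assume "g \<in> uSU3_points \<omega> K \<sigma> t i0 s R"
  then obtain h where h: "h \<in> alg_hom OK (\<lambda>c. piZ (mp_const c)) ZZ s R"
    "g = weil_matrix OK s R OL t (\<lambda>v. h (piZ (mp_var v)))"
    unfolding uSU3_points_def OK_int[symmetric] OL_int[symmetric] struct_eq coord_fun_def by (elim imageE)
  then show "g \<in> {weil_matrix OK s R OL t x | x. scheme_alg.pt R s \<tau> \<beta> b \<tau>0 \<tau>1 x}"
    using scheme_rep.hom_pt[OF rep R h(1)] by blast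
next
  fix g assume "g \<in> {weil_matrix OK s R OL t x | x. scheme_alg.pt R s \<tau> \<beta> b \<tau>0 \<tau>1 x}"
  then obtain x where x: "scheme_alg.pt R s \<tau> \<beta> b \<tau>0 \<tau>1 x" "g = weil_matrix OK s R OL t x" by blast
  obtain h where h: "h \<in> alg_hom OK (\<lambda>c. piZ (mp_const c)) ZZ s R" "\<And>v. h (piZ (mp_var v)) = x v"
  proof (rule scheme_rep.pt_hom[OF rep R x(1)])
  qed (rule that)
  show "g \<in> uSU3_points \<omega> K \<sigma> t i0 s R"
    unfolding uSU3_points_def OK_int[symmetric] OL_int[symmetric] struct_eq coord_fun_def x(2)
    by (rule image_eqI[OF _ h(1)]) (simp only: h(2))
qed

text \<open>The quotient (x + \<sigma> x) / b is taken in the field; it is integral on O_L because 1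
  and t have traces b \<tau>0 and b \<tau>1.\<close>

lemma trace_map:
  shows "x \<in> OL \<Longrightarrow> (x + \<sigma> x) / b \<in> OK" "(x + y + \<sigma> (x + y)) / b = (x + \<sigma> x) / b + (y + \<sigma> y) / b"
    "c \<in> OK \<Longrightarrow> (c * x + \<sigma> (c * x)) / b = c * ((x + \<sigma> x) / b)"
    "(1 + \<sigma> 1) / b = \<tau>0" "(t + \<sigma> t) / b = \<tau>1"
proof -
  have b0: "b \<noteq> 0" using \<beta>_nz by (simp add: b_def)
  have "1 + \<sigma> 1 = b * \<tau>0" using \<sigma>_one b\<tau>(1) by simp
  then show "(1 + \<sigma> 1) / b = \<tau>0" using b0 by simp
  have "t + \<sigma> t = b * \<tau>1" by (rule HOL.trans[OF \<tau>_def[symmetric] b\<tau>(2)[symmetric]])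
  then show "(t + \<sigma> t) / b = \<tau>1" using b0 by simp
  show "(x + y + \<sigma> (x + y)) / b = (x + \<sigma> x) / b + (y + \<sigma> y) / b"
    by (simp add: \<sigma>_hom add_divide_distrib)
  show "(c * x + \<sigma> (c * x)) / b = c * ((x + \<sigma> x) / b)" if "c \<in> OK"
  proof -
    have "\<sigma> (c * x) = c * \<sigma> x" using that OK_sub \<sigma>_hom(2,4) by auto
    then show ?thesis by (simp add: distrib_left)
  qed
  show "(x + \<sigma> x) / b \<in> OK" if x: "x \<in> OL"
  proof -
    obtain c d where cd: "c \<in> OK" "d \<in> OK" "x = c + d * t" using x OL_eq by blast
    have "c \<in> K" "d \<in> K" using cd OK_sub by blast+
    then have "x + \<sigma> x = c * 2 + d * \<tau>" using \<sigma>_eq cd(3) by (simp add: algebra_simps)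
    also have "\<dots> = c * (b * \<tau>0) + d * (b * \<tau>1)" by (simp only: b\<tau>)
    also have "\<dots> = b * (c * \<tau>0 + d * \<tau>1)" by (simp add: algebra_simps)
    finally have "(x + \<sigma> x) / b = c * \<tau>0 + d * \<tau>1" using b0 by simp
    then show ?thesis
      using closed_ringD(4)[OF closed_OK closed_ringD(5)[OF closed_OK cd(1) data(4)] closed_ringD(5)[OF closed_OK cd(2) data(5)]]
      by simp
  qed
qed

lemma points_equations:
  assumes R: "algebra_over OK s R"
  shows "uSU3_points \<omega> K \<sigma> t i0 s R =
    {g \<in> SL3 (tensor OK s R OL).
       mat_mul (tensor OK s R OL) (mat_mul (tensor OK s R OL) (anti_transpose (mat_conj OK s R OL \<sigma> g))
         (mat_diag (tensor OK s R OL) (\<lambda>i. if i = 2 then tens OK s R OL \<one>\<^bsub>R\<^esub> (\<beta> ^ i0) else \<one>\<^bsub>tensor OK s R OL\<^esub>))) g =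
       mat_diag (tensor OK s R OL) (\<lambda>i. if i = 2 then tens OK s R OL \<one>\<^bsub>R\<^esub> (\<beta> ^ i0) else \<one>\<^bsub>tensor OK s R OL\<^esub>) \<and>
       tensor_linear_ext s R (\<lambda>x. (x + \<sigma> x) / \<beta> ^ i0) (tensor_map OK s R OL \<sigma> (g 3 1) \<otimes>\<^bsub>tensor OK s R OL\<^esub> g 1 1) =
         \<ominus>\<^bsub>R\<^esub> tensor_norm OK s R OL \<sigma> (g 2 1) \<and>
       tensor_linear_ext s R (\<lambda>x. (x + \<sigma> x) / \<beta> ^ i0) (tensor_map OK s R OL \<sigma> (g 3 3) \<otimes>\<^bsub>tensor OK s R OL\<^esub> g 1 3) =
         \<ominus>\<^bsub>R\<^esub> tensor_norm OK s R OL \<sigma> (g 2 3)}"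
    (is "_ = {g \<in> _. ?H g \<and> ?t1 g \<and> ?t3 g}")
proof -
  interpret X: ext_alg R OK OL s t \<tau> \<beta> b \<tau>0 \<tau>1 e0 e1 c0 \<sigma> by (rule ext_O[OF R])
  have bO: "b \<in> OK" by (rule data(3))
  have tb: "tens OK s R OL \<one>\<^bsub>R\<^esub> (\<beta> ^ i0) = X.E.el (s b, \<zero>\<^bsub>R\<^esub>)"
    using X.el_emb[of b] X.emb_of[OF bO] OK_OL bO unfolding b_def[symmetric] by auto
  \<comment> \<open>Since \<open>el\<close> is injective, each equation over the tensor product
    becomes one over the quadratic algebra, and \<open>unitary_iff\<close> matches the collection
    with \<open>pt\<close>.\<close>
  have key: "(\<lambda>i j. X.E.el (wm x i j)) \<in> SL3 X.E.T \<and> ?H (\<lambda>i j. X.E.el (wm x i j)) \<and>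
      ?t1 (\<lambda>i j. X.E.el (wm x i j)) \<and> ?t3 (\<lambda>i j. X.E.el (wm x i j)) \<longleftrightarrow> X.pt x"
    if x: "range x \<subseteq> carrier R" for x
  proof -
    have m: "X.Q.T.mat (wm x)" using X.mat_wm[of x] x by blast
    have gT: "\<forall>i j. X.E.el (wm x i j) \<in> carrier X.E.T" using m X.E.el.hom_closed by blast
    have inj: "X.E.el p = X.E.el q \<longleftrightarrow> p = q" if "p \<in> carrier X.Q" "q \<in> carrier X.Q" for p q
      using X.E.el_inj that by (simp only: quad_simps(1))
    have 1: "(\<lambda>i j. X.E.el (wm x i j)) \<in> SL3 X.E.T \<longleftrightarrow> det3 X.Q (wm x) = \<one>\<^bsub>X.Q\<^esub>"
      unfolding SL3_def mem_Collect_eq X.E.mat_det_el[OF m] X.E.el.hom_one[symmetric]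
        inj[OF X.Q.T.det3_closed[OF m] X.Q.T.one_closed] using gT by blast
    have bc: "(s b, \<zero>\<^bsub>R\<^esub>) \<in> carrier X.Q" using bO by simp
    have ec: "(if i = j then if i = 2 then (s b, \<zero>\<^bsub>R\<^esub>) else \<one>\<^bsub>X.Q\<^esub> else \<zero>\<^bsub>X.Q\<^esub>) \<in> carrier X.Q" for i j :: 3
      using bc X.Q.T.one_closed X.Q.T.zero_closed by presburger
    have D: "mat_diag X.E.T (\<lambda>i. if i = 2 then X.E.el (s b, \<zero>\<^bsub>R\<^esub>) else \<one>\<^bsub>X.E.T\<^esub>) i j =
        X.E.el (if i = j then if i = 2 then (s b, \<zero>\<^bsub>R\<^esub>) else \<one>\<^bsub>X.Q\<^esub> else \<zero>\<^bsub>X.Q\<^esub>)" for i j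
      unfolding mat_diag_def using X.E.el.hom_one X.E.el.hom_zero by presburger
    have 2: "?H (\<lambda>i j. X.E.el (wm x i j)) \<longleftrightarrow> (\<forall>i j. X.Q.herm (col (wm x) (4 - i)) (col (wm x) j) =
        (if i = j then if i = 2 then (s b, \<zero>\<^bsub>R\<^esub>) else \<one>\<^bsub>X.Q\<^esub> else \<zero>\<^bsub>X.Q\<^esub>))"
      unfolding tb fun_eq_iff X.herm_T[OF m] D
        inj[OF X.Q.herm_closed[OF X.Q.vec_col[OF m] X.Q.vec_col[OF m]] ec] ..
    have tr: "tensor_linear_ext s R (\<lambda>x. (x + \<sigma> x) / b)
          (tensor_map OK s R OL \<sigma> (X.E.el (wm x 3 j)) \<otimes>\<^bsub>X.E.T\<^esub> X.E.el (wm x 1 j)) =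
        \<ominus>\<^bsub>R\<^esub> tensor_norm OK s R OL \<sigma> (X.E.el (wm x 2 j)) \<longleftrightarrow> X.Q.qf (col (wm x) j) = \<zero>\<^bsub>X.Q\<^esub>" for j
    proof (rule X.tr_T[where f = "\<lambda>x. (x + \<sigma> x) / b"])
      show "(y + \<sigma> y) / b \<in> OK" if "y \<in> OL" for y using that by (rule trace_map(1))
      show "(c * y + \<sigma> (c * y)) / b = c * ((y + \<sigma> y) / b)" if "c \<in> OK" for c y using that by (rule trace_map(3))
    qed (rule trace_map(2) trace_map(4) trace_map(5) m)+
    show ?thesis
      unfolding 1 2
      unfolding b_def[symmetric] tr X.pt_def X.Q.unitary_iff
      by (rule iffI; elim conjE; intro conjI m; assumption)
  qed
  show ?thesis (is "_ = ?RHS")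
    unfolding points_eq[OF R]
  proof (intro equalityI subsetI)
    fix g assume "g \<in> {weil_matrix OK s R OL t x | x. X.pt x}"
    then obtain x where x: "X.pt x" "g = weil_matrix OK s R OL t x" by blast
    have r: "range x \<subseteq> carrier R" using X.pt_closed[OF x(1)] by blast
    show "g \<in> ?RHS" unfolding x(2) X.E.weil_matrix_wm[OF r] using key[OF r] x(1) by simp
  next
    fix g assume g: "g \<in> ?RHS"
    then have "\<forall>i j. g i j \<in> carrier X.E.T" by (simp add: SL3_def)
    then obtain x where x: "range x \<subseteq> carrier R" "g = (\<lambda>i j. X.E.el (wm x i j))"
      unfolding X.E.mat_T_iff by blast
    have "X.pt x" using g key[OF x(1)] unfolding x(2) by simp
    then show "g \<in> {weil_matrix OK s R OL t x | x. X.pt x}"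
      unfolding x(2) X.E.weil_matrix_wm[OF x(1), symmetric] by blast
  qed
qed

end

theorem theorem7p29:
  fixes K :: "'l::field set" and \<omega> :: "'l \<Rightarrow> ereal" and \<sigma> :: "'l \<Rightarrow> 'l"
    and t \<beta> :: 'l and i0 :: nat
  assumes "local_field \<omega> K"
    and "residue_char_two \<omega> K"
    and "ramified_separable_quadratic \<omega> K \<sigma>"
    and "ramification_parameter \<omega> K i0"
    and "uniformiser \<omega> UNIV t"
    and "\<beta> = t * \<sigma> t"
  shows
    "(\<forall>(R::'r ring) s. algebra_over (integers \<omega> K) s R \<longrightarrow>
        uSU3_points \<omega> K \<sigma> t i0 s R =
        (let OK = integers \<omega> K; OL = integers \<omega> UNIV;
             T = tensor OK s R OL;
             cj = tensor_map OK s R OL \<sigma>;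
             Tr = tensor_linear_ext s R (\<lambda>x. (x + \<sigma> x) / \<beta> ^ i0);
             N = tensor_norm OK s R OL \<sigma>;
             D = mat_diag T (\<lambda>i. if i = 2 then tens OK s R OL \<one>\<^bsub>R\<^esub> (\<beta> ^ i0) else \<one>\<^bsub>T\<^esub>)
         in {g \<in> SL3 T.
               mat_mul T (mat_mul T (anti_transpose (mat_conj OK s R OL \<sigma> g)) D) g = D \<and>
               Tr (cj (g 3 1) \<otimes>\<^bsub>T\<^esub> g 1 1) = \<ominus>\<^bsub>R\<^esub> N (g 2 1) \<and>
               Tr (cj (g 3 3) \<otimes>\<^bsub>T\<^esub> g 1 3) = \<ominus>\<^bsub>R\<^esub> N (g 2 3)}))
     \<and> smooth_algebra TYPE('c) (integers \<omega> K) (uSU3_struct \<omega> K \<sigma> t i0) (uSU3 \<omega> K \<sigma> t i0)"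
proof -
  have "ramified_setting K \<omega> \<sigma> t \<beta> i0" by (rule ramified_setting.intro) (fact assms)+
  then obtain \<tau>0 \<tau>1 e0 e1 c0 where d: "ramified_data (integers \<omega> K) K
      (ramified_setting.\<tau> \<sigma> t) \<beta> (ramified_setting.b \<beta> i0) \<tau>0 \<tau>1 e0 e1 c0 \<omega> \<sigma> t i0 (integers \<omega> UNIV)"
    using ramified_setting.ramified_data_exists by blast
  show ?thesis
    unfolding Let_def
    by (intro conjI allI impI ramified_data.points_equations[OF d] ramified_data.smooth_ZZ[OF d])
qed

end
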